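(* Let $(T,G_\bullet)$ be a $\ast$-admissible tree of groups, and let $\iota\colon T\hookrightarrow\widetilde{\mathcal T}_{G_\bullet}\subseteq\mathcal T_K$ together with $\{G_v\hookrightarrow \mathrm{PGL}(2,K)\}_{v\in\mathrm{Vert}(T)}$ be an admissible embedding of it. Let $\Gamma$ be the subgroup of $\mathrm{PGL}(2,K)$ generated by all $G_v$, $v\in\mathrm{Vert}(T)$, and set $\mathcal T^\ast=\bigcup_{\gamma\in\Gamma}\gamma\cdot\iota(T)$ in $\mathcal T_K$. Then: (1) $\Gamma$ is a finitely generated discrete subgroup of $\mathrm{PGL}(2,K)$, isomorphic to $\varinjlim(T,G_\bullet)$. (2) The subset $\mathcal T^\ast$ of $\mathcal T_K$ is a tree, and $\Gamma\backslash\mathcal T^\ast\cong T$. (3) The embedding $\iota$ gives a section $T\hookrightarrow\mathcal T^\ast$ of the quotient map, and the tree of groups $(T,\Gamma_\bullet)$ induced by this section equals $(T,G_\bullet)$. Moreover, if $\mathcal T^\ast_\Gamma$ is the tree associated to $\Gamma$ and $T^\ast_\Gamma=\Gamma\backslash\mathcal T^\ast_\Gamma$, then $\mathcal T^\ast_\Gamma\subseteq\mathcal T^\ast$, and the induced inclusion $T^\ast_\Gamma\hookrightarrow T$ satisfies: (4) The induced inclusion $\mathrm{Ends}(T^\ast_\Gamma)\hookrightarrow\mathrm{Ends}(T)$ is a bijection. (5) The section $\iota$ restricts to a section $T^\ast_\Gamma\hookrightarrow\mathcal T^\ast_\Gamma$, and the tree of groups $(T^\ast_\Gamma,\Gamma_\bullet)$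 induced by it is the restriction of $(T,\Gamma_\bullet)=(T,G_\bullet)$ to $T^\ast_\Gamma$. (6) The tree of groups $(T^\ast_\Gamma,\Gamma_\bullet)$ is a contraction of $(T,\Gamma_\bullet)=(T,G_\bullet)$.
   Context: Notation. $K$ is a finite extension of $\mathbb Q_p$. $\mathcal T_K$ is the Bruhat–Tits tree of $\mathrm{PGL}(2,K)$: vertices are similarity classes of $\mathcal O_K$-lattices in $K^2$, two being adjacent when represented by lattices with quotient of length one. Its ends (equivalence classes of half-lines) are canonically and equivariantly identified with $\mathbb P^1(K)$; for a subtree, its set of ends is regarded as a subset of $\mathbb P^1(K)$. For a tree $T$: $\mathrm{Vert}(T)$, $\mathrm{Edge}(T)$, $\mathrm{Ends}(T)$ are the sets of vertices, unoriented edges and ends; $v\vdash\sigma$ means that the edge $\sigma$ emanates from the vertex $v$; $\mathrm{Star}_v(T)$ is the set of edges emanating from $v$; $]z,w[$ is the straight line joining two ends. Convention: $K$ is taken large enough that every element $\ne1$ of the discrete subgroups of $\mathrm{PGL}(2,K)$ considered has its fixed points of $\mathbb P^1$ in $\mathbb P^1(K)$; such groups act on $\mathcal T_K$ without inversion. Trees from groups. For a compact $\mathcal L\subseteq\mathbb P^1(K)$, $\mathcal T(\mathcal L)$ is the minimal subtree of $\mathcal T_K$ with set of ends $\mathcal L$ (the union of the lines $]z,w[$, $z\neq w\in\mathcal L$; empty if $\mathcal L$ has fewer than 2 points). For a finitely generated discrete $\Gamma\subset\mathrm{PGL}(2,K)$, let $\mathcal F_\Gamma$ be the set of fixed points of elements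 $\neq1$ of $\Gamma$, $\overline{\mathcal F}_\Gamma$ its closure, and $\mathcal T^\ast_\Gamma=\mathcal T(\overline{\mathcal F}_\Gamma)$, on which $\Gamma$ acts; $T^\ast_\Gamma=\Gamma\backslash\mathcal T^\ast_\Gamma$. An element of $\mathrm{PGL}(2,K)$ is elliptic if it has two distinct eigenvalues of equal valuation; if its fixed points are $z,w\in\mathbb P^1(K)$, its mirror is $M(\gamma)=\,]z,w[$. For $G$ finite, $\mathcal T^\ast_G$ is the minimal subtree containing all mirrors of elements $\neq1$ of $G$. $\Gamma_v$, $\Gamma_\sigma$ denote stabilizers of vertices and (oriented) edges. If $\Gamma$ acts on a subtree $\mathcal T$ and $\Gamma\backslash\mathcal T=T$ is a tree, a section $T\hookrightarrow\mathcal T$ of the quotient map induces a tree of groups $(T,\Gamma_\bullet)$ by attaching to vertices and edges of $T$ the stabilizers of their images. Trees of groups. An abstract tree of groups $(T,G_\bullet)$ is a tree $T$ with finite groups $G_v$ ($v\in\mathrm{Vert}(T)$), $G_\sigma$ ($\sigma\in\mathrm{Edge}(T)$) and injective homomorphisms $G_\sigma\hookrightarrow G_v$ for $v\vdash\sigma$; $\varinjlim(T,G_\bullet)$ is the associated amalgam (direct limit of this system of groups). Given embeddings $G_v\hookrightarrow\mathrm{PGL}(2,K)$ for all $v$, compatible with all $G_\sigma\hookrightarrow G_v$, let $\widetilde{\mathcal T}_{G_\bullet}$ be the minimal subtree of $\mathcal T_K$ containing all $\mathcal T^\ast_{G_v}$, $v\in\mathrm{Vert}(T)$. For $w\in\mathrm{Vert}(\widetilde{\mathcal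 T}_{G_\bullet})$, let $\widetilde G_w$ be the subgroup of $\mathrm{PGL}(2,K)$ generated by the stabilizers $(G_u)_w$ for all $u\in\mathrm{Vert}(T)$; for an edge $\sigma$, $\widetilde G_\sigma$ is defined similarly with the stabilizers $(G_u)_\sigma$ (for edges of $\iota(T)$ under condition (iii) below, it is just the intersection of the $\widetilde G_w$ at the two extremities of $\sigma$). Admissible embedding. It is an embedding of trees $\iota\colon T\hookrightarrow\mathcal T_K$ together with embeddings $G_v\hookrightarrow\mathrm{PGL}(2,K)$, $v\in\mathrm{Vert}(T)$, compatible with $G_\sigma\hookrightarrow G_v$ for all $v\vdash\sigma$, such that: (i) $\iota(T)\subset\widetilde{\mathcal T}_{G_\bullet}$; (ii) for any $v\in\mathrm{Vert}(T)$ and $1\ne\gamma\in G_v$ there is $\delta\in\Gamma$ such that $M(\delta\gamma\delta^{-1})\cap\iota(T)$ contains an edge, where $\Gamma$ is the subgroup generated by all $G_v$; (iii) $\widetilde G_{\iota(v)}=G_v$ for all $v\in\mathrm{Vert}(T)$; (iv) $\widetilde G_{\iota(\sigma)}=G_\sigma$ for all $\sigma\in\mathrm{Edge}(T)$; (v) for any $v\in\mathrm{Vert}(T)$, $\iota$ followed by projection gives a bijection $\mathrm{Star}_v(T)\cong G_v\backslash(G_v\cdot\mathrm{Star}_{\iota(v)}(\widetilde{\mathcal T}_{G_\bullet}))$. The tree of groups $(T,G_\bullet)$ is $\ast$-admissible if it has an admissible embedding and $\varinjlim(T,G_\bullet)$ is finitely generated. Contraction. For a subtree $T'\subseteq T$,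 the induced tree of groups $(T',G_\bullet)$ is a contraction of $(T,G_\bullet)$ if $\mathrm{Ends}(T')=\mathrm{Ends}(T)$ and, for every vertex $v$ of $T-T'$, the groups attached to the vertices on the path from $v$ to $v'$ are ordered increasingly with respect to inclusion upon approaching $T'$, where $v'$ is the vertex of $T'$ nearest to $v$. *)

theory Defs
  imports
    "HOL-Computational_Algebra.Primes"
    "HOL-Analysis.Determinants"
    "HOL-Analysis.Abstract_Metric_Spaces"
    "HOL-Algebra.Coset"
    "HOL-Algebra.Generated_Groups"
    "HOL-Algebra.Group_Action"
begin

section \<open>Graphs and trees\<close>

text \<open>
  Unoriented graphs in which an edge is an object of its own, so that quotients of trees by group
  actions make sense: \<open>extr G e\<close> is the set of the one (for a loop) or two extremities of \<open>e\<close>,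
  and \<open>v \<in> extr G e\<close> says that \<open>e\<close> emanates from \<open>v\<close>.
  Trees in the sense of digraph libraries do not fit: an unoriented edge, viewed as a symmetric
  pair of arcs, would already be a directed cycle.
\<close>

record ('v, 'e) ugraph =
  verts :: "'v set"
  edges :: "'e set"
  extr :: "'e \<Rightarrow> 'v set"

definition wf_graph :: "('v, 'e) ugraph \<Rightarrow> bool" where
  "wf_graph G \<longleftrightarrow> (\<forall>e\<in>edges G. extr G e \<subseteq> verts G \<and> card (extr G e) \<in> {1, 2})"

definition star :: "('v, 'e) ugraph \<Rightarrow> 'v \<Rightarrow> 'e set" where
  "star G v = {e \<in> edges G. v \<in> extr G e}"

definition adjacent :: "('v, 'e) ugraph \<Rightarrow> 'v \<Rightarrow> 'v \<Rightarrow> bool" where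
  "adjacent G x y \<longleftrightarrow> (\<exists>e\<in>edges G. extr G e = {x, y})"

definition connected_graph :: "('v, 'e) ugraph \<Rightarrow> bool" where
  "connected_graph G \<longleftrightarrow> (\<forall>x\<in>verts G. \<forall>y\<in>verts G. (adjacent G)\<^sup>*\<^sup>* x y)"

text \<open>Circuits of length \<open>n \<ge> 1\<close>; length 1 is a loop, length 2 a pair of parallel edges.\<close>

definition circuit :: "('v, 'e) ugraph \<Rightarrow> 'v list \<Rightarrow> 'e list \<Rightarrow> bool" where
  "circuit G vs es \<longleftrightarrow>
     vs \<noteq> [] \<and> length es = length vs \<and> distinct vs \<and> distinct es \<and>
     set vs \<subseteq> verts G \<and> set es \<subseteq> edges G \<and>
     (\<forall>i<length vs. extr G (es ! i) = {vs ! i, vs ! (Suc i mod length vs)})"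

definition tree :: "('v, 'e) ugraph \<Rightarrow> bool" where
  "tree G \<longleftrightarrow> wf_graph G \<and> verts G \<noteq> {} \<and> connected_graph G \<and> \<not> (\<exists>vs es. circuit G vs es)"

definition subgraph :: "('v, 'e) ugraph \<Rightarrow> ('v, 'e) ugraph \<Rightarrow> bool" where
  "subgraph H G \<longleftrightarrow>
     wf_graph H \<and> verts H \<subseteq> verts G \<and> edges H \<subseteq> edges G \<and> (\<forall>e\<in>edges H. extr H e = extr G e)"

definition subtree :: "('v, 'e) ugraph \<Rightarrow> ('v, 'e) ugraph \<Rightarrow> bool" where
  "subtree H G \<longleftrightarrow> subgraph H G \<and> tree H"

text \<open>Minimal subtree containing a family of subgraphs (the empty graph for an empty family).\<close>

definition tree_hull :: "('v, 'e) ugraph \<Rightarrow> ('v, 'e) ugraph set \<Rightarrow> ('v, 'e) ugraph" where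
  "tree_hull G F =
     \<lparr>verts = \<Inter> {verts H | H. subtree H G \<and> (\<forall>S\<in>F. subgraph S H)},
      edges = \<Inter> {edges H | H. subtree H G \<and> (\<forall>S\<in>F. subgraph S H)},
      extr = extr G\<rparr>"

definition graph_embedding ::
    "('v, 'e) ugraph \<Rightarrow> ('w, 'f) ugraph \<Rightarrow> ('v \<Rightarrow> 'w) \<Rightarrow> ('e \<Rightarrow> 'f) \<Rightarrow> bool" where
  "graph_embedding G H fV fE \<longleftrightarrow>
     fV ` verts G \<subseteq> verts H \<and> fE ` edges G \<subseteq> edges H \<and>
     inj_on fV (verts G) \<and> inj_on fE (edges G) \<and>
     (\<forall>e\<in>edges G. extr H (fE e) = fV ` extr G e)"

definition graph_iso ::
    "('v, 'e) ugraph \<Rightarrow> ('w, 'f) ugraph \<Rightarrow> ('v \<Rightarrow> 'w) \<Rightarrow> ('e \<Rightarrow> 'f) \<Rightarrow> bool" where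
  "graph_iso G H fV fE \<longleftrightarrow>
     bij_betw fV (verts G) (verts H) \<and> bij_betw fE (edges G) (edges H) \<and>
     (\<forall>e\<in>edges G. extr H (fE e) = fV ` extr G e)"

definition image_graph ::
    "('v, 'e) ugraph \<Rightarrow> ('w, 'f) ugraph \<Rightarrow> ('v \<Rightarrow> 'w) \<Rightarrow> ('e \<Rightarrow> 'f) \<Rightarrow> ('w, 'f) ugraph" where
  "image_graph G H fV fE = \<lparr>verts = fV ` verts G, edges = fE ` edges G, extr = extr H\<rparr>"

subsection \<open>Paths and ends\<close>

definition vpath :: "('v, 'e) ugraph \<Rightarrow> 'v list \<Rightarrow> bool" where
  "vpath G p \<longleftrightarrow> p \<noteq> [] \<and> distinct p \<and> set p \<subseteq> verts G \<and> successively (adjacent G) p"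

definition half_line :: "('v, 'e) ugraph \<Rightarrow> (nat \<Rightarrow> 'v) \<Rightarrow> bool" where
  "half_line G r \<longleftrightarrow> inj r \<and> range r \<subseteq> verts G \<and> (\<forall>n. adjacent G (r n) (r (Suc n)))"

definition end_rel :: "('v, 'e) ugraph \<Rightarrow> ((nat \<Rightarrow> 'v) \<times> (nat \<Rightarrow> 'v)) set" where
  "end_rel G = {(r, s). half_line G r \<and> half_line G s \<and> (\<exists>m n. \<forall>k. r (m + k) = s (n + k))}"

definition Ends :: "('v, 'e) ugraph \<Rightarrow> (nat \<Rightarrow> 'v) set set" where
  "Ends G = Collect (half_line G) // end_rel G"

text \<open>The map on ends (into those of \<open>H\<close>) induced by an embedding with vertex map \<open>f\<close>.\<close>

definition ends_map :: "('w, 'f) ugraph \<Rightarrow> ('v \<Rightarrow> 'w) \<Rightarrow> (nat \<Rightarrow> 'v) set \<Rightarrow> (nat \<Rightarrow> 'w) set" where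
  "ends_map H f E = end_rel H `` ((\<lambda>r. f \<circ> r) ` E)"

section \<open>Finite extensions of the p-adic numbers\<close>

definition abs_metric :: "('k::field \<Rightarrow> real) \<Rightarrow> 'k \<Rightarrow> 'k \<Rightarrow> real" where
  "abs_metric nrm x y = nrm (x - y)"

definition nonarch_abs :: "('k::field \<Rightarrow> real) \<Rightarrow> bool" where
  "nonarch_abs nrm \<longleftrightarrow>
     (\<forall>x. nrm x \<ge> 0) \<and> (\<forall>x. nrm x = 0 \<longleftrightarrow> x = 0) \<and> (\<forall>x y. nrm (x * y) = nrm x * nrm y) \<and>
     (\<forall>x y. nrm (x + y) \<le> max (nrm x) (nrm y))"

text \<open>\<open>nrm\<close> extends the \<open>p\<close>-adic absolute value of the rational numbers.\<close>

definition extends_padic_abs :: "nat \<Rightarrow> ('k::field_char_0 \<Rightarrow> real) \<Rightarrow> bool" where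
  "extends_padic_abs p nrm \<longleftrightarrow>
     (\<forall>n::int. n \<noteq> 0 \<longrightarrow> nrm (of_int n) = (1 / real p) ^ multiplicity (int p) n)"

text \<open>
  The closure of the rational numbers inside the field.  It is a copy of the field of \<open>p\<close>-adic
  numbers, i.e. a completion of the rational numbers, as soon as it is complete.
\<close>

definition rat_closure :: "('k::field_char_0 \<Rightarrow> real) \<Rightarrow> 'k set" where
  "rat_closure nrm = Metric_space.mtopology UNIV (abs_metric nrm) closure_of \<rat>"

text \<open>
  The type \<open>'k\<close> with the absolute value \<open>nrm\<close> is a finite extension of the field of \<open>p\<close>-adic
  numbers, with the unique absolute value extending the \<open>p\<close>-adic one.
\<close>

definition finite_extension_of_Qp :: "nat \<Rightarrow> ('k::field_char_0 \<Rightarrow> real) \<Rightarrow> bool" where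
  "finite_extension_of_Qp p nrm \<longleftrightarrow>
     prime p \<and> nonarch_abs nrm \<and> extends_padic_abs p nrm \<and>
     Metric_space.mcomplete (rat_closure nrm) (abs_metric nrm) \<and>
     (\<exists>B. finite B \<and>
        (\<forall>x. \<exists>c. (\<forall>b\<in>B. c b \<in> rat_closure nrm) \<and> x = (\<Sum>b\<in>B. c b * b)))"

definition ring_of_integers :: "('k::field \<Rightarrow> real) \<Rightarrow> 'k set" where
  "ring_of_integers nrm = {x. nrm x \<le> 1}"

section \<open>The group PGL(2,K)\<close>

type_synonym 'k pgl = "('k^2^2) set"

definition GL2 :: "('k::field^2^2) monoid" where
  "GL2 = \<lparr>carrier = {A. invertible A}, mult = (**), one = mat 1\<rparr>"

definition scalars :: "('k::field^2^2) set" where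
  "scalars = {mat c | c. c \<noteq> 0}"

definition PGL2 :: "'k::field pgl monoid" where
  "PGL2 = GL2 Mod scalars"

definition sub_PGL2 :: "'k::field pgl set \<Rightarrow> 'k pgl monoid" where
  "sub_PGL2 H = PGL2\<lparr>carrier := H\<rparr>"

definition finitely_generated :: "('a, 'b) monoid_scheme \<Rightarrow> bool" where
  "finitely_generated G \<longleftrightarrow> (\<exists>S. finite S \<and> S \<subseteq> carrier G \<and> generate G S = carrier G)"

text \<open>Elements of PGL(2,K) are cosets of scalar matrices; they act through any representative.\<close>

definition act_line :: "'k::field pgl \<Rightarrow> ('k^2) set \<Rightarrow> ('k^2) set" where
  "act_line g l = {A *v x | A x. A \<in> g \<and> x \<in> l}"

definition eigenvalue :: "'k::field^2^2 \<Rightarrow> 'k \<Rightarrow> bool" where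
  "eigenvalue A a \<longleftrightarrow> (\<exists>x. x \<noteq> 0 \<and> A *v x = a *s x)"

definition elliptic :: "('k::field \<Rightarrow> real) \<Rightarrow> 'k pgl \<Rightarrow> bool" where
  "elliptic nrm g \<longleftrightarrow>
     g \<in> carrier PGL2 \<and>
     (\<forall>A\<in>g. \<exists>a b. a \<noteq> b \<and> eigenvalue A a \<and> eigenvalue A b \<and> nrm a = nrm b)"

text \<open>
  The points of the projective line (over an algebraic closure) fixed by \<open>g\<close> are all
  \<open>K\<close>-rational: the characteristic polynomials of the representatives split over \<open>K\<close>.
\<close>

definition rational_fixed_points :: "'k::field pgl \<Rightarrow> bool" where
  "rational_fixed_points g \<longleftrightarrow> (\<forall>A\<in>g. \<exists>a b. \<forall>x. det (mat x - A) = (x - a) * (x - b))"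

subsection \<open>Topologies on the projective line and on PGL(2,K)\<close>

definition quotient_topology :: "'a topology \<Rightarrow> ('a \<Rightarrow> 'b) \<Rightarrow> 'b topology" where
  "quotient_topology X f =
     topology (\<lambda>U. U \<subseteq> f ` topspace X \<and> openin X {x \<in> topspace X. f x \<in> U})"

lemma openin_quotient_topology:
  "openin (quotient_topology X f) U \<longleftrightarrow>
     U \<subseteq> f ` topspace X \<and> openin X {x \<in> topspace X. f x \<in> U}"
proof -
  have "istopology (\<lambda>U. U \<subseteq> f ` topspace X \<and> openin X {x \<in> topspace X. f x \<in> U})"
  proof (unfold istopology_def, intro conjI allI impI)
    fix S T
    assume "S \<subseteq> f ` topspace X \<and> openin X {x \<in> topspace X. f x \<in> S}"
      and "T \<subseteq> f ` topspace X \<and> openin X {x \<in> topspace X. f x \<in> T}"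
    moreover have "{x \<in> topspace X. f x \<in> S \<inter> T} =
        {x \<in> topspace X. f x \<in> S} \<inter> {x \<in> topspace X. f x \<in> T}" by auto
    ultimately show "S \<inter> T \<subseteq> f ` topspace X" "openin X {x \<in> topspace X. f x \<in> S \<inter> T}"
      by auto
  next
    fix \<K>
    assume *: "\<forall>K\<in>\<K>. K \<subseteq> f ` topspace X \<and> openin X {x \<in> topspace X. f x \<in> K}"
    then show "\<Union> \<K> \<subseteq> f ` topspace X" by blast
    have "{x \<in> topspace X. f x \<in> \<Union> \<K>} = (\<Union>K\<in>\<K>. {x \<in> topspace X. f x \<in> K})" by auto
    with * show "openin X {x \<in> topspace X. f x \<in> \<Union> \<K>}" by auto
  qed
  then show ?thesis
    by (simp add: quotient_topology_def topology_inverse')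
qed

definition vec_topology :: "('k::field \<Rightarrow> real) \<Rightarrow> ('k^2) topology" where
  "vec_topology nrm = Metric_space.mtopology UNIV (\<lambda>x y. MAX i. nrm (x $ i - y $ i))"

definition mat_topology :: "('k::field \<Rightarrow> real) \<Rightarrow> ('k^2^2) topology" where
  "mat_topology nrm = Metric_space.mtopology UNIV (\<lambda>A B. MAX i. MAX j. nrm (A $ i $ j - B $ i $ j))"

text \<open>Points of the projective line are the lines through 0 in \<open>K\<^sup>2\<close>.\<close>

definition P1 :: "('k::field^2) set set" where
  "P1 = {vec.span {x} | x. x \<noteq> 0}"

definition P1_topology :: "('k::field \<Rightarrow> real) \<Rightarrow> ('k^2) set topology" where
  "P1_topology nrm = quotient_topology (subtopology (vec_topology nrm) (- {0})) (\<lambda>x. vec.span {x})"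

definition PGL2_topology :: "('k::field \<Rightarrow> real) \<Rightarrow> 'k pgl topology" where
  "PGL2_topology nrm =
     quotient_topology (subtopology (mat_topology nrm) (carrier GL2)) (\<lambda>A. scalars #>\<^bsub>GL2\<^esub> A)"

definition discrete_subgroup :: "('k::field \<Rightarrow> real) \<Rightarrow> 'k pgl set \<Rightarrow> bool" where
  "discrete_subgroup nrm H \<longleftrightarrow>
     subgroup H PGL2 \<and> subtopology (PGL2_topology nrm) H = discrete_topology H"

section \<open>The Bruhat--Tits tree\<close>

type_synonym 'k bt_vertex = "('k^2) set set"
type_synonym 'k bt_edge = "'k bt_vertex set"
type_synonym 'k bt_graph = "('k bt_vertex, 'k bt_edge) ugraph"

text \<open>Lattices: free submodules of rank 2 over the ring of integers.\<close>

definition OK_lattice :: "('k::field \<Rightarrow> real) \<Rightarrow> ('k^2) set \<Rightarrow> bool" where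
  "OK_lattice nrm L \<longleftrightarrow>
     (\<exists>A::'k^2^2. invertible A \<and> L = (\<lambda>x. A *v x) ` {x. \<forall>i. x $ i \<in> ring_of_integers nrm})"

definition similarity_class :: "('k::field^2) set \<Rightarrow> 'k bt_vertex" where
  "similarity_class L = {(\<lambda>x. c *s x) ` L | c. c \<noteq> 0}"

definition OK_submodule :: "('k::field \<Rightarrow> real) \<Rightarrow> ('k^2) set \<Rightarrow> bool" where
  "OK_submodule nrm N \<longleftrightarrow>
     0 \<in> N \<and> (\<forall>x\<in>N. \<forall>y\<in>N. x + y \<in> N) \<and> (\<forall>a\<in>ring_of_integers nrm. \<forall>x\<in>N. a *s x \<in> N)"

text \<open>\<open>M\<close> is contained in \<open>L\<close> and the quotient \<open>L/M\<close> has length one, i.e. is a simple module.\<close>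

definition colength_one :: "('k::field \<Rightarrow> real) \<Rightarrow> ('k^2) set \<Rightarrow> ('k^2) set \<Rightarrow> bool" where
  "colength_one nrm M L \<longleftrightarrow>
     M \<subset> L \<and> (\<forall>N. OK_submodule nrm N \<and> M \<subseteq> N \<and> N \<subseteq> L \<longrightarrow> N = M \<or> N = L)"

definition BT_tree :: "('k::field \<Rightarrow> real) \<Rightarrow> 'k bt_graph" where
  "BT_tree nrm =
     \<lparr>verts = {similarity_class L | L. OK_lattice nrm L},
      edges = {{similarity_class L, similarity_class M} | L M.
                 OK_lattice nrm L \<and> OK_lattice nrm M \<and> colength_one nrm M L},
      extr = id\<rparr>"

definition act_vert :: "'k::field pgl \<Rightarrow> 'k bt_vertex \<Rightarrow> 'k bt_vertex" where
  "act_vert g x = {(\<lambda>y. A *v y) ` L | A L. A \<in> g \<and> L \<in> x}"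

definition act_edge :: "'k::field pgl \<Rightarrow> 'k bt_edge \<Rightarrow> 'k bt_edge" where
  "act_edge g e = act_vert g ` e"

definition vert_stabilizer :: "'k::field pgl set \<Rightarrow> 'k bt_vertex \<Rightarrow> 'k pgl set" where
  "vert_stabilizer H x = stabilizer (sub_PGL2 H) act_vert x"

text \<open>Stabilizer of an oriented edge: both extremities are fixed.\<close>

definition edge_stabilizer :: "'k::field pgl set \<Rightarrow> 'k bt_edge \<Rightarrow> 'k pgl set" where
  "edge_stabilizer H e = {g \<in> H. \<forall>x\<in>e. act_vert g x = x}"

definition vert_orbit :: "'k::field pgl set \<Rightarrow> 'k bt_vertex \<Rightarrow> 'k bt_vertex set" where
  "vert_orbit H x = orbit (sub_PGL2 H) act_vert x"

definition edge_orbit :: "'k::field pgl set \<Rightarrow> 'k bt_edge \<Rightarrow> 'k bt_edge set" where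
  "edge_orbit H e = orbit (sub_PGL2 H) act_edge e"

definition quotient_graph ::
    "'k::field pgl set \<Rightarrow> 'k bt_graph \<Rightarrow> ('k bt_vertex set, 'k bt_edge set) ugraph" where
  "quotient_graph H S =
     \<lparr>verts = vert_orbit H ` verts S,
      edges = edge_orbit H ` edges S,
      extr = (\<lambda>E. \<Union>e\<in>E. vert_orbit H ` extr S e)\<rparr>"

subsection \<open>Ends as points of the projective line, lines, mirrors\<close>

text \<open>
  The canonical identification: a half-line is represented by a descending chain of lattices
  with successive quotients of length one; the intersection of the chain is a module of rank
  one, which spans the corresponding point of the projective line.
\<close>

definition half_line_to :: "('k::field \<Rightarrow> real) \<Rightarrow> (nat \<Rightarrow> 'k bt_vertex) \<Rightarrow> ('k^2) set \<Rightarrow> bool" where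
  "half_line_to nrm r z \<longleftrightarrow>
     half_line (BT_tree nrm) r \<and>
     (\<exists>L. (\<forall>n. L n \<in> r n \<and> colength_one nrm (L (Suc n)) (L n)) \<and> vec.span (\<Inter>n. L n) = z)"

text \<open>\<open>c\<close> parametrises the straight line from the end \<open>z\<close> to the end \<open>w\<close>.\<close>

definition straight_line ::
    "('k::field \<Rightarrow> real) \<Rightarrow> (int \<Rightarrow> 'k bt_vertex) \<Rightarrow> ('k^2) set \<Rightarrow> ('k^2) set \<Rightarrow> bool" where
  "straight_line nrm c z w \<longleftrightarrow>
     inj c \<and> half_line_to nrm (\<lambda>n. c (- int n)) z \<and> half_line_to nrm (\<lambda>n. c (int n)) w"

definition tree_of_ends :: "('k::field \<Rightarrow> real) \<Rightarrow> ('k^2) set set \<Rightarrow> 'k bt_graph" where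
  "tree_of_ends nrm X =
     \<lparr>verts = {c i | c i z w. z \<in> X \<and> w \<in> X \<and> z \<noteq> w \<and> straight_line nrm c z w},
      edges = {{c i, c (i + 1)} | c i z w. z \<in> X \<and> w \<in> X \<and> z \<noteq> w \<and> straight_line nrm c z w},
      extr = id\<rparr>"

definition fixed_points :: "'k::field pgl \<Rightarrow> ('k^2) set set" where
  "fixed_points g = {z \<in> P1. act_line g z = z}"

text \<open>
  An elliptic element has exactly two fixed points, so its mirror is the straight line joining
  them.  Other elements have no mirror.
\<close>

definition mirror :: "('k::field \<Rightarrow> real) \<Rightarrow> 'k pgl \<Rightarrow> 'k bt_graph" where
  "mirror nrm g = tree_of_ends nrm (if elliptic nrm g then fixed_points g else {})"

definition mirror_tree :: "('k::field \<Rightarrow> real) \<Rightarrow> 'k pgl set \<Rightarrow> 'k bt_graph" where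
  "mirror_tree nrm G = tree_hull (BT_tree nrm) (mirror nrm ` (G - {\<one>\<^bsub>PGL2\<^esub>}))"

definition limit_tree :: "('k::field \<Rightarrow> real) \<Rightarrow> 'k pgl set \<Rightarrow> 'k bt_graph" where
  "limit_tree nrm H =
     tree_of_ends nrm
       (P1_topology nrm closure_of (\<Union>g\<in>H - {\<one>\<^bsub>PGL2\<^esub>}. fixed_points g))"

section \<open>Trees of groups\<close>

text \<open>
  \<open>einj TG e v\<close> is the homomorphism from the group of the edge \<open>e\<close> to the group of its
  extremity \<open>v\<close>.
\<close>

record ('v, 'e, 'g, 'h) graph_of_groups =
  base :: "('v, 'e) ugraph"
  vgrp :: "'v \<Rightarrow> 'g monoid"
  egrp :: "'e \<Rightarrow> 'h monoid"
  einj :: "'e \<Rightarrow> 'v \<Rightarrow> 'h \<Rightarrow> 'g"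

definition tree_of_groups :: "('v, 'e, 'g, 'h) graph_of_groups \<Rightarrow> bool" where
  "tree_of_groups TG \<longleftrightarrow>
     tree (base TG) \<and>
     (\<forall>v\<in>verts (base TG). group (vgrp TG v) \<and> finite (carrier (vgrp TG v))) \<and>
     (\<forall>e\<in>edges (base TG). group (egrp TG e) \<and> finite (carrier (egrp TG e))) \<and>
     (\<forall>e\<in>edges (base TG). \<forall>v\<in>extr (base TG) e. einj TG e v \<in> mon (egrp TG e) (vgrp TG v))"

subsection \<open>The amalgam (direct limit)\<close>

text \<open>
  The direct limit is presented by the elements of all vertex groups as generators, with the
  multiplication tables of the vertex groups and the identifications along the edges as relations.
  Its elements are words modulo the congruence generated by these relations.
\<close>

definition letters :: "('v, 'e, 'g, 'h) graph_of_groups \<Rightarrow> ('v \<times> 'g) set" where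
  "letters TG = (SIGMA v:verts (base TG). carrier (vgrp TG v))"

inductive amalgam_eq ::
    "('v, 'e, 'g, 'h) graph_of_groups \<Rightarrow> ('v \<times> 'g) list \<Rightarrow> ('v \<times> 'g) list \<Rightarrow> bool"
  for TG where
  refl: "xs \<in> lists (letters TG) \<Longrightarrow> amalgam_eq TG xs xs"
| sym: "amalgam_eq TG xs ys \<Longrightarrow> amalgam_eq TG ys xs"
| trans: "amalgam_eq TG xs ys \<Longrightarrow> amalgam_eq TG ys zs \<Longrightarrow> amalgam_eq TG xs zs"
| one: "\<lbrakk>xs \<in> lists (letters TG); ys \<in> lists (letters TG); v \<in> verts (base TG)\<rbrakk> \<Longrightarrow>
    amalgam_eq TG (xs @ [(v, \<one>\<^bsub>vgrp TG v\<^esub>)] @ ys) (xs @ ys)"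
| mult: "\<lbrakk>xs \<in> lists (letters TG); ys \<in> lists (letters TG); v \<in> verts (base TG);
      g \<in> carrier (vgrp TG v); h \<in> carrier (vgrp TG v)\<rbrakk> \<Longrightarrow>
    amalgam_eq TG (xs @ [(v, g), (v, h)] @ ys) (xs @ [(v, g \<otimes>\<^bsub>vgrp TG v\<^esub> h)] @ ys)"
| edge: "\<lbrakk>xs \<in> lists (letters TG); ys \<in> lists (letters TG); e \<in> edges (base TG);
      v \<in> extr (base TG) e; w \<in> extr (base TG) e; h \<in> carrier (egrp TG e)\<rbrakk> \<Longrightarrow>
    amalgam_eq TG (xs @ [(v, einj TG e v h)] @ ys) (xs @ [(w, einj TG e w h)] @ ys)"

definition amalgam_class ::
    "('v, 'e, 'g, 'h) graph_of_groups \<Rightarrow> ('v \<times> 'g) list \<Rightarrow> ('v \<times> 'g) list set" where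
  "amalgam_class TG xs = {ys. amalgam_eq TG xs ys}"

definition amalgam :: "('v, 'e, 'g, 'h) graph_of_groups \<Rightarrow> ('v \<times> 'g) list set monoid" where
  "amalgam TG =
     \<lparr>carrier = amalgam_class TG ` lists (letters TG),
      mult = (\<lambda>X Y. \<Union>xs\<in>X. \<Union>ys\<in>Y. amalgam_class TG (xs @ ys)),
      one = amalgam_class TG []\<rparr>"

definition amalgam_vgrp ::
    "('v, 'e, 'g, 'h) graph_of_groups \<Rightarrow> 'v \<Rightarrow> ('v \<times> 'g) list set set" where
  "amalgam_vgrp TG v = (\<lambda>g. amalgam_class TG [(v, g)]) ` carrier (vgrp TG v)"

subsection \<open>Admissible embeddings\<close>

text \<open>
  In the following \<open>\<theta> v\<close> is the embedding into PGL(2,K) of the group of \<open>v\<close>, and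
  \<open>\<iota>V\<close>, \<open>\<iota>E\<close> are the maps on vertices and edges of an embedding of the tree.
\<close>

definition vimg :: "('v, 'e, 'g, 'h) graph_of_groups \<Rightarrow> ('v \<Rightarrow> 'g \<Rightarrow> 'k::field pgl) \<Rightarrow> 'v \<Rightarrow> 'k pgl set" where
  "vimg TG \<theta> v = \<theta> v ` carrier (vgrp TG v)"

definition compatible_embeddings ::
    "('v, 'e, 'g, 'h) graph_of_groups \<Rightarrow> ('v \<Rightarrow> 'g \<Rightarrow> 'k::field pgl) \<Rightarrow> bool" where
  "compatible_embeddings TG \<theta> \<longleftrightarrow>
     (\<forall>v\<in>verts (base TG). \<theta> v \<in> mon (vgrp TG v) PGL2) \<and>
     (\<forall>e\<in>edges (base TG). \<forall>v\<in>extr (base TG) e. \<forall>w\<in>extr (base TG) e. \<forall>h\<in>carrier (egrp TG e).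
        \<theta> v (einj TG e v h) = \<theta> w (einj TG e w h))"

definition generated_group ::
    "('v, 'e, 'g, 'h) graph_of_groups \<Rightarrow> ('v \<Rightarrow> 'g \<Rightarrow> 'k::field pgl) \<Rightarrow> 'k pgl set" where
  "generated_group TG \<theta> = generate PGL2 (\<Union>v\<in>verts (base TG). vimg TG \<theta> v)"

definition ambient_tree ::
    "('k::field \<Rightarrow> real) \<Rightarrow> ('v, 'e, 'g, 'h) graph_of_groups \<Rightarrow> ('v \<Rightarrow> 'g \<Rightarrow> 'k pgl) \<Rightarrow> 'k bt_graph" where
  "ambient_tree nrm TG \<theta> =
     tree_hull (BT_tree nrm) ((\<lambda>v. mirror_tree nrm (vimg TG \<theta> v)) ` verts (base TG))"

definition vert_tilde ::
    "('v, 'e, 'g, 'h) graph_of_groups \<Rightarrow> ('v \<Rightarrow> 'g \<Rightarrow> 'k::field pgl) \<Rightarrow> 'k bt_vertex \<Rightarrow> 'k pgl set" where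
  "vert_tilde TG \<theta> x =
     generate PGL2 (\<Union>u\<in>verts (base TG). vert_stabilizer (vimg TG \<theta> u) x)"

definition edge_tilde ::
    "('v, 'e, 'g, 'h) graph_of_groups \<Rightarrow> ('v \<Rightarrow> 'g \<Rightarrow> 'k::field pgl) \<Rightarrow> 'k bt_edge \<Rightarrow> 'k pgl set" where
  "edge_tilde TG \<theta> e =
     generate PGL2 (\<Union>u\<in>verts (base TG). edge_stabilizer (vimg TG \<theta> u) e)"

definition admissible_embedding ::
    "('k::field \<Rightarrow> real) \<Rightarrow> ('v, 'e, 'g, 'h) graph_of_groups \<Rightarrow>
     ('v \<Rightarrow> 'k bt_vertex) \<Rightarrow> ('e \<Rightarrow> 'k bt_edge) \<Rightarrow> ('v \<Rightarrow> 'g \<Rightarrow> 'k pgl) \<Rightarrow> bool" where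
  "admissible_embedding nrm TG \<iota>V \<iota>E \<theta> \<longleftrightarrow>
     graph_embedding (base TG) (BT_tree nrm) \<iota>V \<iota>E \<and>
     compatible_embeddings TG \<theta> \<and>
     subgraph (image_graph (base TG) (BT_tree nrm) \<iota>V \<iota>E) (ambient_tree nrm TG \<theta>) \<and>
     (\<forall>v\<in>verts (base TG). \<forall>g\<in>vimg TG \<theta> v - {\<one>\<^bsub>PGL2\<^esub>}. \<exists>d\<in>generated_group TG \<theta>.
        edges (mirror nrm (d \<otimes>\<^bsub>PGL2\<^esub> g \<otimes>\<^bsub>PGL2\<^esub> inv\<^bsub>PGL2\<^esub> d)) \<inter> \<iota>E ` edges (base TG) \<noteq> {}) \<and>
     (\<forall>v\<in>verts (base TG). vert_tilde TG \<theta> (\<iota>V v) = vimg TG \<theta> v) \<and>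
     (\<forall>e\<in>edges (base TG). \<forall>v\<in>extr (base TG) e.
        edge_tilde TG \<theta> (\<iota>E e) = \<theta> v ` einj TG e v ` carrier (egrp TG e)) \<and>
     (\<forall>v\<in>verts (base TG).
        bij_betw (\<lambda>e. edge_orbit (vimg TG \<theta> v) (\<iota>E e)) (star (base TG) v)
          (edge_orbit (vimg TG \<theta> v) ` star (ambient_tree nrm TG \<theta>) (\<iota>V v)))"

definition star_admissible ::
    "('k::field \<Rightarrow> real) \<Rightarrow> ('v, 'e, 'g, 'h) graph_of_groups \<Rightarrow> bool" where
  "star_admissible nrm TG \<longleftrightarrow>
     tree_of_groups TG \<and>
     (\<exists>\<iota>V \<iota>E \<theta>. admissible_embedding nrm TG \<iota>V \<iota>E \<theta>) \<and>
     finitely_generated (amalgam TG)"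

subsection \<open>Sections, induced trees of groups, contractions\<close>

definition translates_graph ::
    "('k::field \<Rightarrow> real) \<Rightarrow> 'k pgl set \<Rightarrow> ('v, 'e) ugraph \<Rightarrow>
     ('v \<Rightarrow> 'k bt_vertex) \<Rightarrow> ('e \<Rightarrow> 'k bt_edge) \<Rightarrow> 'k bt_graph" where
  "translates_graph nrm H T \<iota>V \<iota>E =
     \<lparr>verts = (\<Union>g\<in>H. (\<lambda>v. act_vert g (\<iota>V v)) ` verts T),
      edges = (\<Union>g\<in>H. (\<lambda>e. act_edge g (\<iota>E e)) ` edges T),
      extr = extr (BT_tree nrm)\<rparr>"

text \<open>
  \<open>\<iota>\<close> is a section of the quotient map from \<open>S\<close> to its quotient by \<open>H\<close>, the latter being
  identified with \<open>T\<close> by means of the isomorphism \<open>\<Phi>\<close>.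
\<close>

definition is_section ::
    "'k::field pgl set \<Rightarrow> 'k bt_graph \<Rightarrow> ('v, 'e) ugraph \<Rightarrow>
     ('k bt_vertex set \<Rightarrow> 'v) \<Rightarrow> ('k bt_edge set \<Rightarrow> 'e) \<Rightarrow>
     ('v \<Rightarrow> 'k bt_vertex) \<Rightarrow> ('e \<Rightarrow> 'k bt_edge) \<Rightarrow> bool" where
  "is_section H S T \<Phi>V \<Phi>E \<iota>V \<iota>E \<longleftrightarrow>
     graph_iso (quotient_graph H S) T \<Phi>V \<Phi>E \<and>
     graph_embedding T S \<iota>V \<iota>E \<and>
     (\<forall>v\<in>verts T. \<Phi>V (vert_orbit H (\<iota>V v)) = v) \<and>
     (\<forall>e\<in>edges T. \<Phi>E (edge_orbit H (\<iota>E e)) = e)"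

definition induced_groups ::
    "'k::field pgl set \<Rightarrow> ('v, 'e) ugraph \<Rightarrow> ('v \<Rightarrow> 'k bt_vertex) \<Rightarrow> ('e \<Rightarrow> 'k bt_edge) \<Rightarrow>
     ('v, 'e, 'k pgl, 'k pgl) graph_of_groups" where
  "induced_groups H T \<iota>V \<iota>E =
     \<lparr>base = T,
      vgrp = (\<lambda>v. sub_PGL2 (vert_stabilizer H (\<iota>V v))),
      egrp = (\<lambda>e. sub_PGL2 (edge_stabilizer H (\<iota>E e))),
      einj = (\<lambda>e v. id)\<rparr>"

text \<open>
  Two trees of groups on the same tree are equal, when their vertex groups are identified
  by means of the maps \<open>\<theta> v\<close> and their edge groups accordingly.
\<close>

definition equal_via ::
    "('v \<Rightarrow> 'g \<Rightarrow> 'g') \<Rightarrow> ('v, 'e, 'g, 'h) graph_of_groups \<Rightarrow>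
     ('v, 'e, 'g', 'h') graph_of_groups \<Rightarrow> bool" where
  "equal_via \<theta> TG TG' \<longleftrightarrow>
     base TG = base TG' \<and>
     (\<forall>v\<in>verts (base TG). \<theta> v \<in> iso (vgrp TG v) (vgrp TG' v)) \<and>
     (\<forall>e\<in>edges (base TG). \<exists>f\<in>iso (egrp TG e) (egrp TG' e).
        \<forall>v\<in>extr (base TG) e. \<forall>h\<in>carrier (egrp TG e).
          \<theta> v (einj TG e v h) = einj TG' e v (f h))"

definition restrict_groups ::
    "('v, 'e, 'g, 'h) graph_of_groups \<Rightarrow> ('v, 'e) ugraph \<Rightarrow> ('v, 'e, 'g, 'h) graph_of_groups" where
  "restrict_groups TG T' = TG\<lparr>base := T'\<rparr>"

text \<open>
  The vertex groups are compared as subgroups of the amalgam.  In the last clause, \<open>p\<close> is the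
  path from a vertex \<open>hd p\<close> outside the subtree to the vertex \<open>last p\<close> of the subtree nearest to it.
\<close>

definition contraction ::
    "('v, 'e, 'g, 'h) graph_of_groups \<Rightarrow> ('v, 'e, 'g, 'h) graph_of_groups \<Rightarrow> bool" where
  "contraction TG' TG \<longleftrightarrow>
     TG' = restrict_groups TG (base TG') \<and>
     subtree (base TG') (base TG) \<and>
     bij_betw (ends_map (base TG) id) (Ends (base TG')) (Ends (base TG)) \<and>
     (\<forall>p. vpath (base TG) p \<and> hd p \<notin> verts (base TG') \<and> last p \<in> verts (base TG') \<and>
        (\<forall>q. vpath (base TG) q \<and> hd q = hd p \<and> last q \<in> verts (base TG') \<longrightarrow>
           length p \<le> length q) \<longrightarrow>
        (\<forall>i. Suc i < length p \<longrightarrow> amalgam_vgrp TG (p ! i) \<subseteq> amalgam_vgrp TG (p ! Suc i)))"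

end

theory Submission
  imports Defs
begin

text \<open>
  Conditions (iii), (iv) and (v) are local injectivity statements: at a vertex \<open>\<iota> v\<close> the group
  \<open>G\<^sub>v\<close> identifies no two edges of \<open>\<iota>(T)\<close>, and the stabilizer of such an edge in \<open>G\<^sub>v\<close> is the edge
  group.  Hence a reduced word in the amalgam traces a path without backtracking in the tree of
  \<open>PGL(2,K)\<close>, that is a geodesic.  This computes all stabilizers of \<open>\<Gamma>\<close>, so \<open>\<Gamma>\<close> is the amalgam, it is
  discrete, the translates of \<open>\<iota>(T)\<close> form a tree and \<open>\<iota>\<close> is a section of the quotient.

  By (ii) a conjugate of any elliptic element has an edge of its mirror in \<open>\<iota>(T)\<close>, and by the
  surjectivity in (v) the mirror can be followed from there inside the translates of \<open>\<iota>(T)\<close>.  The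
  axis of a hyperbolic element lies there too, because the translates form an invariant subtree.  So
  the ends fixed by elements of \<open>\<Gamma>\<close>, and by a closure argument all limit points, are ends of that
  tree, whence the inclusion of the tree of \<open>\<Gamma>\<close>.

  Along a half-line of \<open>T\<close> the groups are finally constant, since the amalgam is finitely generated.
  If the constant group is nontrivial, its elements fix the half-line, which must then enter
  their mirrors.  If it is trivial, all mirrors lie on one side of an edge, contradicting (i).
  On a branch of \<open>T\<close> away from the tree of \<open>\<Gamma>\<close> an element of a vertex group fixes the geodesic to its
  mirror, so a conjugate of it lies in the next vertex group.  A finite group is not covered by the
  conjugates of a proper subgroup, so the groups increase towards the tree of \<open>\<Gamma>\<close>.
\<close>

section \<open>Trees as graphs without backtracking walks\<close>

text \<open>Walks without backtracking carry the combinatorics: \<open>simp_tree\<close> knows only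
  adjacency and that such walks are injective, and it serves for \<open>T\<close> and for the tree
  of lattices alike. On the arithmetic side a vertex is a disc in the field and matrices act by
  explicit formulas; this needs a cyclic value group, which is extracted from the definition of a
  finite extension by counting cosets of values. Two dependencies dictate the order. Rational fixed
  points are granted for discrete groups only, so stabilizers are computed before general elements
  are diagonalized. And the contraction rests on the comparison of ends: the inclusion of groups
  along an edge needs that geodesics leaving over farther edges stay away from the tree of
  \<open>\<Gamma>\<close>, and this confinement needs the inclusion. Both are proved together by
  induction on oriented edges, the far ones first. Distance is no measure for that; the descent
  stops because an infinite one would be a half-line of \<open>T\<close> that misses the tree of
  \<open>\<Gamma>\<close>.\<close>

fun nb :: "'a list \<Rightarrow> bool" where
  "nb (x # y # z # zs) \<longleftrightarrow> x \<noteq> z \<and> nb (y # z # zs)"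
| "nb _ \<longleftrightarrow> True"

lemma nb_Cons: "nb (x # xs) \<longleftrightarrow> nb xs \<and> (length xs \<ge> 2 \<longrightarrow> x \<noteq> xs ! 1)"
  by (cases "x # xs" rule: nb.cases) auto

text \<open>The only triple of consecutive entries that lies neither in \<open>xs @ [a]\<close> nor
  in \<open>a # ys\<close> is the one with \<open>a\<close> in the middle.\<close>

lemma nb_append:
  "nb (xs @ a # ys) \<longleftrightarrow> nb (xs @ [a]) \<and> nb (a # ys) \<and> (xs \<noteq> [] \<and> ys \<noteq> [] \<longrightarrow> last xs \<noteq> hd ys)"
proof (induction xs rule: nb.induct)
  case (1 x y z zs)
  then show ?case by simp
next
  case ("2_1")
  then show ?case by simp
next
  case ("2_2" v)
  then show ?case by (cases ys) auto
next
  case ("2_3" v w)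
  then show ?case by (cases ys) auto
qed

lemma nb_rev [simp]: "nb (rev xs) \<longleftrightarrow> nb xs"
proof (induction xs rule: nb.induct)
  case (1 x y z zs)
  have "nb (rev (x # y # z # zs)) \<longleftrightarrow> nb ((rev zs @ [z]) @ y # [x])" by simp
  also have "\<dots> \<longleftrightarrow> nb (rev (y # z # zs)) \<and> z \<noteq> x" by (subst nb_append) auto
  finally show ?case using 1 by auto
qed auto

lemma nb_map: "inj_on f (set xs) \<Longrightarrow> nb (map f xs) \<longleftrightarrow> nb xs"
  by (induction xs rule: nb.induct) (auto simp: inj_on_def)

lemma nb_distinct: "distinct xs \<Longrightarrow> nb xs"
  by (induction xs rule: nb.induct) auto

lemma nb_conv_nth: "nb xs \<longleftrightarrow> (\<forall>i. Suc (Suc i) < length xs \<longrightarrow> xs ! i \<noteq> xs ! Suc (Suc i))"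
proof (induction xs rule: nb.induct)
  case (1 x y z zs)
  show ?case
    apply (simp only: nb.simps 1)
    apply (rule iffI)
     apply (rule allI, case_tac i; simp)
    apply (rule conjI)
     apply (metis length_Cons nth_Cons_0 nth_Cons_Suc zero_less_Suc Suc_less_eq)
    apply (metis length_Cons nth_Cons_Suc Suc_less_eq)
    done
qed auto

text \<open>The last assumption is acyclicity in the form in which it is applied: a walk can return
  to a vertex only by backtracking. It excludes loops and makes geodesics unique. Recording
  adjacency instead of edges loses nothing, since a tree has no parallel edges.\<close>

locale simp_tree =
  fixes V :: "'x set" and adj :: "'x \<Rightarrow> 'x \<Rightarrow> bool"
  assumes adj_sym: "adj x y \<Longrightarrow> adj y x"
    and adj_V: "adj x y \<Longrightarrow> x \<in> V"
    and conn: "x \<in> V \<Longrightarrow> y \<in> V \<Longrightarrow> adj\<^sup>*\<^sup>* x y"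
    and nb_walk_distinct: "successively adj xs \<Longrightarrow> nb xs \<Longrightarrow> distinct xs"
begin

definition walk :: "'x list \<Rightarrow> 'x \<Rightarrow> 'x \<Rightarrow> bool" where
  "walk xs x y \<longleftrightarrow> xs \<noteq> [] \<and> set xs \<subseteq> V \<and> successively adj xs \<and> hd xs = x \<and> last xs = y"

definition geo :: "'x list \<Rightarrow> 'x \<Rightarrow> 'x \<Rightarrow> bool" where
  "geo xs x y \<longleftrightarrow> walk xs x y \<and> nb xs"

text \<open>Stated with arbitrary walks because these compose freely; by
  \<open>geo_subset_walk\<close> the set then contains the geodesics between its points.\<close>

definition convex :: "'x set \<Rightarrow> bool" where
  "convex S \<longleftrightarrow> S \<subseteq> V \<and> (\<forall>x\<in>S. \<forall>y\<in>S. \<exists>xs. walk xs x y \<and> set xs \<subseteq> S)"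

text \<open>\<open>p\<close> is the geodesic from \<open>x\<close> to its projection \<open>y\<close> on \<open>S\<close>.\<close>

definition gate :: "'x set \<Rightarrow> 'x list \<Rightarrow> 'x \<Rightarrow> 'x \<Rightarrow> bool" where
  "gate S p x y \<longleftrightarrow> geo p x y \<and> y \<in> S \<and> set (butlast p) \<inter> S = {}"

text \<open>The component of \<open>a\<close> in the complement of the vertex \<open>b\<close>.\<close>

definition branch :: "'x \<Rightarrow> 'x \<Rightarrow> 'x set" where
  "branch a b = {x. \<exists>xs. walk xs a x \<and> b \<notin> set xs}"

lemma adj_irrefl: "\<not> adj x x"
  using nb_walk_distinct[of "[x,x]"] by auto

lemma adj_V2: "adj x y \<Longrightarrow> y \<in> V"
  using adj_V adj_sym by blast

lemma walkD: "walk xs x y \<Longrightarrow> x \<in> V" "walk xs x y \<Longrightarrow> y \<in> V" "walk xs x y \<Longrightarrow> x \<in> set xs"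
   "walk xs x y \<Longrightarrow> y \<in> set xs" "walk xs x y \<Longrightarrow> set xs \<subseteq> V" "walk xs x y \<Longrightarrow> xs \<noteq> []"
  unfolding walk_def using hd_in_set last_in_set by blast+

lemma geo_walk: "geo xs x y \<Longrightarrow> walk xs x y"
  by (simp add: geo_def)

lemma geo_distinct: "geo xs x y \<Longrightarrow> distinct xs"
  unfolding geo_def walk_def using nb_walk_distinct by blast

lemma walk_single: "x \<in> V \<Longrightarrow> walk [x] x x"
  by (simp add: walk_def)

lemma walk_pair: "adj x y \<Longrightarrow> walk [x, y] x y"
  using adj_V adj_V2 by (simp add: walk_def)

lemma walk_Cons: "walk xs y z \<Longrightarrow> adj x y \<Longrightarrow> walk (x # xs) x z"
  using adj_V by (cases xs) (auto simp: walk_def)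

lemma walk_append: "walk xs x y \<Longrightarrow> walk ys y z \<Longrightarrow> walk (xs @ tl ys) x z"
  by (cases ys; cases "tl ys") (auto simp: walk_def successively_append_iff)

lemma walk_append_adj: "walk xs x y \<Longrightarrow> adj y y' \<Longrightarrow> walk ys y' z \<Longrightarrow> walk (xs @ ys) x z"
  by (auto simp: walk_def successively_append_iff)

lemma walk_rev: "walk xs x y \<Longrightarrow> walk (rev xs) y x"
  unfolding walk_def
  by (auto simp: hd_rev last_rev successively_rev intro: successively_mono adj_sym)

lemma walk_map:
  assumes "walk xs x y" "\<And>v. v \<in> V \<Longrightarrow> f v \<in> V" "\<And>v w. adj v w \<Longrightarrow> adj (f v) (f w)"
  shows "walk (map f xs) (f x) (f y)"
  using assms unfolding walk_def
  by (auto simp: hd_map last_map successively_map intro: successively_mono)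

lemma geo_map:
  assumes "geo xs x y" "\<And>v. v \<in> V \<Longrightarrow> f v \<in> V" "\<And>v w. adj v w \<Longrightarrow> adj (f v) (f w)" "inj_on f V"
  shows "geo (map f xs) (f x) (f y)"
  using assms walk_map nb_map[of f xs] inj_on_subset unfolding geo_def
  by (metis walkD(5))

lemma walk_exists:
  assumes "x \<in> V" "y \<in> V"
  shows "\<exists>xs. walk xs x y"
  using conn[OF assms] assms(2)
proof (induction rule: converse_rtranclp_induct)
  case base
  then show ?case using walk_single by blast
next
  case (step y z)
  then show ?case using walk_Cons by blast
qed

text \<open>Prepend the first vertex to the reduced tail. Either no backtracking arises, or the tail
  starts by returning to that vertex, and then the detour is cut off.\<close>

lemma walk_reduce:
  assumes "walk xs x y"
  shows "\<exists>ys. geo ys x y \<and> set ys \<subseteq> set xs \<and> length ys \<le> length xs"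
  using assms
proof (induction xs arbitrary: x)
  case Nil
  then show ?case by (simp add: walk_def)
next
  case (Cons a xs)
  show ?case
  proof (cases xs)
    case Nil
    with Cons.prems have "geo [a] x y" by (auto simp: walk_def geo_def)
    then show ?thesis by force
  next
    case [simp]: (Cons b zs)
    have ax: "a = x" "adj a b" "walk xs b y" using Cons.prems by (auto simp: walk_def)
    obtain ys where ys: "geo ys b y" "set ys \<subseteq> set xs" "length ys \<le> length xs"
      using Cons.IH[OF ax(3)] by blast
    show ?thesis
    proof (cases "length ys \<ge> 2 \<and> ys ! 1 = a")
      case True
      then obtain c zs' where c: "ys = b # a # zs'" using ys(1)
        by (cases ys; cases "tl ys") (auto simp: geo_def walk_def)
      have "geo (a # zs') x y" using ys(1) ax c by (auto simp: geo_def walk_def nb_Cons)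
      moreover have "set (a # zs') \<subseteq> set (a # xs)" "length (a # zs') \<le> length (a # xs)"
        using ys c by auto
      ultimately show ?thesis by blast
    next
      case False
      then have "geo (a # ys) x y" using ys(1) ax(1) walk_Cons[OF geo_walk[OF ys(1)] ax(2)]
        by (auto simp: geo_def nb_Cons)
      moreover have "set (a # ys) \<subseteq> set (a # xs)" "length (a # ys) \<le> length (a # xs)"
        using ys by auto
      ultimately show ?thesis by blast
    qed
  qed
qed

lemma geo_exists: "x \<in> V \<Longrightarrow> y \<in> V \<Longrightarrow> \<exists>xs. geo xs x y"
  using walk_exists walk_reduce by meson

lemma geo_closed: "geo xs x x \<Longrightarrow> xs = [x]"
  using geo_distinct[of xs x x] by (cases xs) (auto simp: geo_def walk_def split: if_splits)

text \<open>If the first steps differ, one geodesic reversed followed by the other is a closed walk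
  without backtracking, against \<open>geo_closed\<close>.\<close>

lemma geo_unique:
  assumes "geo p x y" "geo q x y"
  shows "p = q"
  using assms
proof (induction p arbitrary: x q)
  case Nil
  then show ?case by (simp add: geo_def walk_def)
next
  case (Cons a p)
  show ?case
  proof (cases "p = [] \<or> tl q = []")
    case True
    then have "x = y" using Cons.prems by (cases q) (auto simp: geo_def walk_def)
    then show ?thesis using Cons.prems geo_closed by blast
  next
    case False
    then obtain b p' where p: "p = b # p'" by (cases p) auto
    have "q \<noteq> []" "hd q = x" using Cons.prems(2) by (auto simp: geo_def walk_def)
    with False obtain c q' where q: "q = x # c # q'"
      by (metis list.exhaust_sel)
    have a: "a = x" using Cons.prems by (auto simp: geo_def walk_def)
    have b: "geo p b y" "adj x b" using Cons.prems(1) p a by (auto simp: geo_def walk_def nb_Cons)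
    have c: "geo (c # q') c y" "adj x c" using Cons.prems(2) q by (auto simp: geo_def walk_def nb_Cons)
    show ?thesis
    proof (cases "b = c")
      case True
      have "p = c # q'" by (rule Cons.IH[OF b(1)]) (simp only: True c(1))
      then show ?thesis using q a by simp
    next
      case False
      have "nb (rev p @ x # c # q')"
      proof (subst nb_append, intro conjI impI)
        have "nb (rev (x # p))" using Cons.prems(1) a by (simp add: geo_def del: rev.simps)
        then show "nb (rev p @ [x])" by simp
        show "nb (x # c # q')" using Cons.prems(2) q by (simp add: geo_def)
        show "last (rev p) \<noteq> hd (c # q')" using p False by simp
      qed
      moreover have "walk (rev p @ x # c # q') y y"
        using Cons.prems(2) b walk_append_adj[OF walk_rev[OF geo_walk[OF b(1)]] adj_sym[OF b(2)]] q
        by (auto simp: geo_def)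
      ultimately have "geo (rev p @ x # c # q') y y" by (simp add: geo_def)
      from geo_closed[OF this] p show ?thesis by simp
    qed
  qed
qed

lemma geo_subset_walk: "geo p x y \<Longrightarrow> walk w x y \<Longrightarrow> set p \<subseteq> set w"
  using walk_reduce geo_unique by metis

lemma geo_length_walk: "geo p x y \<Longrightarrow> walk w x y \<Longrightarrow> length p \<le> length w"
  using walk_reduce geo_unique by metis

lemma convex_geo: "convex S \<Longrightarrow> x \<in> S \<Longrightarrow> y \<in> S \<Longrightarrow> geo p x y \<Longrightarrow> set p \<subseteq> S"
  unfolding convex_def using geo_subset_walk by (meson order_trans)

lemma convexI:
  assumes "S \<subseteq> V" "c \<in> S" "\<And>x. x \<in> S \<Longrightarrow> \<exists>xs. walk xs c x \<and> set xs \<subseteq> S"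
  shows "convex S"
  unfolding convex_def
proof (intro conjI ballI)
  fix x y assume "x \<in> S" "y \<in> S"
  with assms(3) obtain p q where "walk p c x" "set p \<subseteq> S" "walk q c y" "set q \<subseteq> S" by metis
  then have "walk (rev p @ tl q) x y \<and> set (rev p @ tl q) \<subseteq> S"
    using walk_append[OF walk_rev, of p c x q y] list.set_sel(2)[of q] walkD(6) by (cases "q = []") auto
  then show "\<exists>xs. walk xs x y \<and> set xs \<subseteq> S" by blast
qed fact

section \<open>Projections onto convex sets, and maps that preserve them\<close>

lemma gate_exists:
  assumes "x \<in> V" "S \<subseteq> V" "S \<noteq> {}"
  shows "\<exists>p y. gate S p x y"
proof -
  from assms obtain s where s: "s \<in> S" by blast
  with assms obtain q where q: "geo q x s" using geo_exists by blast
  from s q have "\<exists>z\<in>set q. z \<in> S" using walkD(4) geo_walk by blast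
  then obtain q1 z q2 where z: "q = q1 @ z # q2" "z \<in> S" "\<forall>y\<in>set q1. y \<notin> S"
    using split_list_first_prop[of q "\<lambda>z. z \<in> S"] by blast
  have "geo (q1 @ [z]) x z" using q z(1) nb_append[of q1 z q2]
    by (auto simp: geo_def walk_def successively_append_iff hd_append)
  then show ?thesis using z unfolding gate_def by (intro exI[of _ "q1 @ [z]"] exI[of _ z]) auto
qed

text \<open>There is no backtracking at \<open>y\<close>: the vertex before it lies outside
  \<open>S\<close> and the vertex after it inside.\<close>

lemma gate_extend:
  assumes g: "gate S p x y" and S: "convex S" and s: "s \<in> S" and q: "geo q y s"
  shows "geo (p @ tl q) x s"
proof -
  have g': "geo p x y" "y \<in> S" "set (butlast p) \<inter> S = {}" using g by (auto simp: gate_def)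
  have "set q \<subseteq> S" using convex_geo S g'(2) s q by blast
  have pe: "p = butlast p @ [y]" using g'(1) by (auto simp: geo_def walk_def)
  have qe: "q = y # tl q" using q by (cases q) (auto simp: geo_def walk_def)
  have "nb (butlast p @ y # tl q)"
  proof (subst nb_append, intro conjI impI)
    show "nb (butlast p @ [y])" using g'(1) pe by (simp add: geo_def)
    show "nb (y # tl q)" using q qe by (simp add: geo_def)
    assume ne: "butlast p \<noteq> [] \<and> tl q \<noteq> []"
    then have "last (butlast p) \<in> set (butlast p)" by simp
    moreover have "hd (tl q) \<in> set q" using ne by (metis hd_in_set list.set_sel(2) tl_Nil)
    ultimately show "last (butlast p) \<noteq> hd (tl q)" using g'(3) \<open>set q \<subseteq> S\<close> by auto
  qed
  then have "nb (p @ tl q)" using pe by (metis append.assoc append_Cons append_Nil)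
  then show ?thesis using walk_append[of p x y q s] g'(1) q by (simp add: geo_def)
qed

text \<open>Extending \<open>p\<close> inside \<open>S\<close> up to \<open>y'\<close> gives
  \<open>p'\<close>. Were the extension nontrivial, \<open>p'\<close> would meet \<open>S\<close> in
  \<open>y\<close> before its end.\<close>

lemma gate_unique:
  assumes "gate S p x y" "gate S p' x y'" "convex S"
  shows "p = p' \<and> y = y'"
proof -
  have y: "y \<in> S" "y' \<in> S" using assms by (auto simp: gate_def)
  then obtain q where q: "geo q y y'" using geo_exists assms(3) by (meson convex_def subsetD)
  have "geo (p @ tl q) x y'" using gate_extend[OF assms(1,3) y(2) q] .
  moreover have "geo p' x y'" using assms(2) by (simp add: gate_def)
  ultimately have eq: "p' = p @ tl q" using geo_unique by blast
  have "tl q = []"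
  proof (rule ccontr)
    assume "tl q \<noteq> []"
    then have "y \<in> set (butlast p')" using eq assms(1)
      by (auto simp: butlast_append gate_def dest: geo_walk walkD(4))
    then show False using assms(2) y by (auto simp: gate_def)
  qed
  then show ?thesis using eq q
    by (metis \<open>geo p' x y'\<close> append_Nil2 assms(1) gate_def geo_def walk_def)
qed

lemma gate_prefix:
  assumes "gate S p x y" "convex S" "s \<in> S" "geo q x s"
  shows "\<exists>r. q = p @ r"
proof -
  have "y \<in> S" using assms by (auto simp: gate_def)
  then obtain q' where q: "geo q' y s" using geo_exists assms by (meson convex_def subsetD)
  from gate_extend[OF assms(1,2,3) this] assms(4) geo_unique show ?thesis by blast
qed

text \<open>An edge into \<open>Y\<close> is already the gate of \<open>x\<close>. This is how group
  elements are shown to fix an edge: they carry it to another edge from the same vertex into an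
  invariant subtree.\<close>

lemma neighbour_unique:
  assumes "convex Y" "x \<notin> Y" "a \<in> Y" "b \<in> Y" "adj x a" "adj x b"
  shows "a = b"
proof -
  have "gate Y [x, a] x a" "gate Y [x, b] x b"
    using assms walk_pair by (auto simp: gate_def geo_def)
  with gate_unique assms(1) show ?thesis by blast
qed

text \<open>By uniqueness the geodesic equals its image, and equality of the two lists is
  pointwise.\<close>

lemma geo_fixed:
  assumes "geo p x y" "f x = x" "f y = y" "\<And>v. v \<in> V \<Longrightarrow> f v \<in> V"
    "\<And>v w. adj v w \<Longrightarrow> adj (f v) (f w)" "inj_on f V" "z \<in> set p"
  shows "f z = z"
proof -
  have "geo (map f p) x y" using geo_map[of p x y f] assms by metis
  then have "map f p = p" using geo_unique assms by blast
  then show ?thesis using assms(7) by (metis map_eq_conv list.map_id id_apply)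
qed

lemma gate_map:
  assumes "gate S p x y" "\<And>v. v \<in> V \<Longrightarrow> f v \<in> V" "\<And>v w. adj v w \<Longrightarrow> adj (f v) (f w)"
    "inj_on f V" "\<And>v. v \<in> V \<Longrightarrow> f v \<in> S \<longleftrightarrow> v \<in> S"
  shows "gate S (map f p) (f x) (f y)"
proof -
  have g: "geo p x y" "y \<in> S" "set (butlast p) \<inter> S = {}" using assms(1) by (auto simp: gate_def)
  have "set p \<subseteq> V" using g(1) geo_walk walkD(5) by blast
  then have "set (butlast p) \<subseteq> V" "y \<in> V" using g(1) by (auto dest: in_set_butlastD geo_walk walkD)
  have "set (butlast (map f p)) \<inter> S = {}"
    using assms(5) g(3) \<open>set (butlast p) \<subseteq> V\<close> by (force simp: map_butlast[symmetric])
  then show ?thesis unfolding gate_def using geo_map[OF g(1), of f] assms(2-5) g(2) \<open>y \<in> V\<close>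
    by blast
qed

text \<open>As \<open>f\<close> preserves \<open>S\<close>, it maps the gate of the fixed point
  \<open>x\<close> to the gate of \<open>x\<close>; uniqueness makes the whole gate fixed.\<close>

lemma fixed_gate:
  assumes "x \<in> V" "f x = x" "convex S" "S \<noteq> {}" "\<And>v. v \<in> V \<Longrightarrow> f v \<in> V"
    "\<And>v w. adj v w \<Longrightarrow> adj (f v) (f w)" "inj_on f V" "\<And>v. v \<in> V \<Longrightarrow> f v \<in> S \<longleftrightarrow> v \<in> S"
  shows "\<exists>p y. gate S p x y \<and> f y = y \<and> (\<forall>z\<in>set p. f z = z)"
proof -
  obtain p y where g: "gate S p x y" using gate_exists assms by (meson convex_def)
  have "gate S (map f p) x (f y)" using gate_map[OF g] assms by metis
  then have fy: "f y = y" using gate_unique g assms(3) by metis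
  have "\<forall>z\<in>set p. f z = z"
    using geo_fixed[of p x y f] g assms fy by (auto simp: gate_def)
  with g fy show ?thesis by blast
qed

text \<open>Since \<open>f\<close> moves \<open>c\<close> inside \<open>C\<close>, the geodesic from
  \<open>f x\<close> to \<open>x\<close> enters \<open>C\<close> at \<open>f c\<close> and leaves it
  at \<open>c\<close>. Both its ends lie in \<open>S\<close>, hence so does \<open>c\<close>. In the
  application \<open>f\<close> is hyperbolic, \<open>C\<close> is its axis and \<open>S\<close> an
  invariant subtree.\<close>

lemma axis_gate:
  assumes S: "convex S" and C: "convex C" and x: "x \<in> S" and g: "gate C p x c"
    and f: "\<And>v. v \<in> V \<Longrightarrow> f v \<in> V" "\<And>v w. adj v w \<Longrightarrow> adj (f v) (f w)" "inj_on f V"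
    and fC: "\<And>v. v \<in> V \<Longrightarrow> f v \<in> C \<longleftrightarrow> v \<in> C" and fS: "f x \<in> S" and ne: "f c \<noteq> c"
  shows "c \<in> S"
proof -
  have g2: "gate C (map f p) (f x) (f c)" using gate_map[OF g] f fC by metis
  have cV: "c \<in> C" "f c \<in> C" using g g2 by (auto simp: gate_def)
  then obtain q where q: "geo q (f c) c" using geo_exists C by (meson convex_def subsetD)
  define s where "s = map f p @ tl q"
  have s: "geo s (f x) c" using gate_extend[OF g2 C cV(1) q] by (simp add: s_def)
  have "tl q \<noteq> []" using q ne by (cases q) (auto simp: geo_def walk_def)
  have sl: "s = butlast s @ [c]" using s by (auto simp: geo_def walk_def)
  have "set q \<subseteq> C" using convex_geo[OF C cV(2,1) q] .
  \<comment> \<open>The vertex visited just before \<open>c\<close> lies in \<open>C\<close>, while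
    the one after \<open>c\<close> on the way back to \<open>x\<close> does not; this excludes
    backtracking at \<open>c\<close>.\<close>
  have lb: "last (butlast s) \<in> C \<and> butlast s \<noteq> []"
  proof (cases "butlast (tl q) = []")
    case True
    then have "butlast s = map f p" using \<open>tl q \<noteq> []\<close> by (simp add: s_def butlast_append)
    then show ?thesis using g2 by (metis cV(2) gate_def geo_def walk_def)
  next
    case False
    then have "last (butlast s) = last (butlast (tl q))" "butlast s \<noteq> []"
      using \<open>tl q \<noteq> []\<close> by (auto simp: s_def butlast_append)
    moreover have "last (butlast (tl q)) \<in> set q" using False
      by (metis in_set_butlastD last_in_set list.set_sel(2) tl_Nil)
    ultimately show ?thesis using \<open>set q \<subseteq> C\<close> by auto
  qed
  have pg: "geo p x c" "set (butlast p) \<inter> C = {}" using g by (auto simp: gate_def)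
  then have pl: "p = butlast p @ [c]" by (auto simp: geo_def walk_def)
  have rp: "rev p = c # rev (butlast p)" by (subst pl) simp
  have "nb (butlast s @ c # rev (butlast p))"
  proof (subst nb_append, intro conjI impI)
    show "nb (butlast s @ [c])" using s sl by (simp add: geo_def)
    show "nb (c # rev (butlast p))" using pg(1) rp by (metis geo_def nb_rev)
    assume "butlast s \<noteq> [] \<and> rev (butlast p) \<noteq> []"
    then have "hd (rev (butlast p)) \<in> set (butlast p)" by (metis hd_in_set set_rev)
    then show "last (butlast s) \<noteq> hd (rev (butlast p))" using pg(2) lb by auto
  qed
  then have "nb (s @ tl (rev p))" using sl rp by (metis append.assoc append_Cons append_Nil list.sel(3))
  moreover have "walk (s @ tl (rev p)) (f x) x"
    using walk_append[OF geo_walk[OF s] walk_rev[OF geo_walk[OF pg(1)]]] .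
  ultimately have "geo (s @ tl (rev p)) (f x) x" by (simp add: geo_def)
  then have "set (s @ tl (rev p)) \<subseteq> S" using convex_geo[OF S fS x] by blast
  then show ?thesis using s geo_walk walkD(4) by (metis Un_iff set_append subsetD)
qed

section \<open>Half-lines and branches\<close>

lemma geo_ray:
  assumes "inj r" "\<And>n. adj (r n) (r (Suc n))" "i \<le> j"
  shows "geo (map r [i..<Suc j]) (r i) (r j)"
proof -
  have "successively adj (map r [i..<Suc j])"
    using assms(2) by (auto simp: successively_conv_nth simp del: upt_Suc)
  moreover have "distinct (map r [i..<Suc j])" using assms(1)
    by (simp add: distinct_map inj_on_def del: upt_Suc)
  moreover have "set (map r [i..<Suc j]) \<subseteq> V" using assms(2) adj_V by auto
  ultimately show ?thesis using assms(3) nb_distinct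
    by (auto simp: geo_def walk_def hd_map last_map simp del: upt_Suc)
qed

text \<open>An edge that stays outside \<open>C\<close> does not change the projection: the new gate
  arises from \<open>p\<close> by dropping its first vertex or by adding one in front.\<close>

lemma gate_step:
  assumes "gate C p a c" "adj a b" "a \<notin> C" "b \<notin> C"
  shows "\<exists>p'. gate C p' b c"
proof -
  have g: "geo p a c" "c \<in> C" "set (butlast p) \<inter> C = {}" using assms(1) by (auto simp: gate_def)
  then obtain d p' where p: "p = a # d # p'" using assms(3)
    by (cases p; cases "tl p") (auto simp: geo_def walk_def)
  show ?thesis
  proof (cases "d = b")
    case True
    then have "gate C (b # p') b c" using g p
      by (auto simp: gate_def geo_def walk_def nb_Cons split: if_splits)
    then show ?thesis by blast
  next
    case False
    then have "geo (b # p) b c" using g(1) p assms(2) adj_sym walk_Cons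
      by (auto simp: geo_def nb_Cons)
    then have "gate C (b # p) b c" using g p assms(4) by (auto simp: gate_def)
    then show ?thesis by blast
  qed
qed

text \<open>If the half-line were outside \<open>C\<close> from some index on, all its further
  points would have the same projection at bounded distance, but a half-line leaves every ball. So
  it meets \<open>C\<close> arbitrarily late, and convexity fills the gaps.\<close>

lemma ray_eventually_in:
  assumes r: "inj r" "\<And>n. adj (r n) (r (Suc n))" and C: "convex C"
    and k: "\<And>n. \<exists>p y. geo p (r n) y \<and> y \<in> C \<and> length p \<le> k"
  shows "\<exists>N. \<forall>n\<ge>N. r n \<in> C"
proof -
  have often: "\<exists>n\<ge>m. r n \<in> C" for m
  proof (rule ccontr)
    assume "\<not> ?thesis"
    then have nC: "r n \<notin> C" if "n \<ge> m" for n using that by blast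
    have V: "r n \<in> V" for n using r adj_V by blast
    have "C \<noteq> {}" "C \<subseteq> V" using k C by (auto simp: convex_def)
    then obtain p c where g: "gate C p (r m) c" using gate_exists V by blast
    have gn: "\<exists>p'. gate C p' (r n) c" if "n \<ge> m" for n
      using that
    proof (induction n rule: dec_induct)
      case base
      then show ?case using g by blast
    next
      case (step n)
      then show ?case using gate_step r(2) nC by (metis le_Suc_eq)
    qed
    have short: "\<exists>p'. geo p' (r n) c \<and> length p' \<le> k" if nm: "n \<ge> m" for n
    proof -
      obtain p' where p': "gate C p' (r n) c" using gn[OF nm] by blast
      obtain q y where q: "geo q (r n) y" "y \<in> C" "length q \<le> k" using k by blast
      have "length p' \<le> length q" using gate_prefix[OF p' C q(2,1)] by auto
      then show ?thesis using p' q by (auto simp: gate_def)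
    qed
    obtain p1 where p1: "geo p1 (r m) c" "length p1 \<le> k" using short by blast
    \<comment> \<open>Index \<open>m + 2 * k\<close> is far enough: two paths with at most
      \<open>k\<close> vertices each cannot be joined to a path of \<open>2 * k + 1\<close>
      vertices.\<close>
    obtain p2 where p2: "geo p2 (r (m + 2 * k)) c" "length p2 \<le> k" using short by (metis le_add1)
    have "walk (p1 @ tl (rev p2)) (r m) (r (m + 2 * k))"
      using walk_append walk_rev p1 p2 geo_walk by blast
    moreover have "geo (map r [m..<Suc (m + 2 * k)]) (r m) (r (m + 2 * k))"
      using geo_ray r by simp
    ultimately have "length (map r [m..<Suc (m + 2 * k)]) \<le> length (p1 @ tl (rev p2))"
      using geo_length_walk by blast
    then show False using p1 p2 by simp
  qed
  obtain N where N: "r N \<in> C" using often by blast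
  have "r n \<in> C" if "n \<ge> N" for n
  proof -
    obtain m where m: "m \<ge> n" "r m \<in> C" using often by blast
    have "set (map r [N..<Suc m]) \<subseteq> C"
      using convex_geo[OF C N m(2) geo_ray[OF r]] that m by simp
    then have "r ` {N..<Suc m} \<subseteq> C" by (simp del: upt_Suc)
    then show ?thesis using that m(1) by auto
  qed
  then show ?thesis by blast
qed

lemma branchI: "walk xs a x \<Longrightarrow> b \<notin> set xs \<Longrightarrow> x \<in> branch a b"
  by (auto simp: branch_def)

lemma branch_self: "a \<in> V \<Longrightarrow> a \<noteq> b \<Longrightarrow> a \<in> branch a b"
  using walk_single[of a] by (intro branchI[of "[a]"]) auto

lemma branch_not: "b \<notin> branch a b"
  by (auto simp: branch_def dest: walkD(4))

lemma branch_walk_subset: "walk xs a x \<Longrightarrow> b \<notin> set xs \<Longrightarrow> set xs \<subseteq> branch a b"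
proof
  fix z assume w: "walk xs a x" "b \<notin> set xs" "z \<in> set xs"
  then obtain p q where "xs = p @ z # q" by (meson split_list)
  then have "walk (p @ [z]) a z" "b \<notin> set (p @ [z])"
    using w by (auto simp: walk_def successively_append_iff hd_append)
  then show "z \<in> branch a b" by (rule branchI)
qed

lemma branch_convex: "a \<in> V \<Longrightarrow> a \<noteq> b \<Longrightarrow> convex (branch a b)"
proof (rule convexI[of _ a])
  show "branch a b \<subseteq> V" by (auto simp: branch_def dest: walkD(2))
  show "\<exists>xs. walk xs a x \<and> set xs \<subseteq> branch a b" if "x \<in> branch a b" for x
    using that branch_walk_subset unfolding branch_def[of a b] mem_Collect_eq
    by (metis branch_def)
qed (auto intro: branch_self)

text \<open>A walk from \<open>c\<close> that avoids \<open>v\<close> also avoids \<open>w\<close>,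
  because \<open>c\<close> is the only neighbour of \<open>v\<close> in the branch of
  \<open>c\<close>. Prepending \<open>v\<close> to it gives a walk from \<open>v\<close> that avoids
  \<open>w\<close>.\<close>

lemma branch_mono:
  assumes "adj c v" "adj v w" "c \<noteq> w"
  shows "branch c v \<subseteq> branch v w"
proof
  fix x assume "x \<in> branch c v"
  then obtain xs where xs: "walk xs c x" "v \<notin> set xs" by (auto simp: branch_def)
  have "w \<notin> set xs"
  proof
    assume "w \<in> set xs"
    then have "w \<in> branch c v" using branch_walk_subset xs by blast
    moreover have "c \<in> branch c v" using assms adj_V adj_irrefl by (metis branch_self)
    moreover have "convex (branch c v)" using assms adj_V adj_irrefl by (metis branch_convex)
    ultimately show False using neighbour_unique[of "branch c v" v c w] assms adj_sym branch_not by blast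
  qed
  moreover have "v \<noteq> w" using assms adj_irrefl by blast
  moreover have "walk (v # xs) v x" using walk_Cons[OF xs(1) adj_sym[OF assms(1)]] .
  ultimately show "x \<in> branch v w" by (intro branchI[of "v # xs"]) auto
qed

end

section \<open>From graphs without circuits to walks without backtracking\<close>

lemma adjacent_commute: "adjacent G x y \<longleftrightarrow> adjacent G y x"
  by (auto simp: adjacent_def insert_commute)

lemma adjacent_verts: "wf_graph G \<Longrightarrow> adjacent G x y \<Longrightarrow> x \<in> verts G \<and> y \<in> verts G"
  by (force simp: adjacent_def wf_graph_def)

text \<open>A repetition with minimal gap \<open>n\<close> bounds a circuit. Its vertices are
  distinct by minimality, and two of its edges can only coincide if \<open>n = 2\<close>, which is a
  backtracking. The cases \<open>n = 1\<close> and parallel edges are covered because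
  \<open>circuit\<close> admits lengths 1 and 2.\<close>

lemma tree_nb_distinct:
  assumes T: "tree G" and xs: "successively (adjacent G) xs" "nb xs"
  shows "distinct xs"
proof (rule ccontr)
  assume "\<not> distinct xs"
  then have ex: "\<exists>n i. n > 0 \<and> i + n < length xs \<and> xs ! i = xs ! (i + n)"
  proof -
    obtain i j where "i < j" "j < length xs" "xs ! i = xs ! j"
      using \<open>\<not> distinct xs\<close> unfolding distinct_conv_nth by (metis linorder_neqE_nat)
    then show ?thesis by (intro exI[of _ "j - i"] exI[of _ i]) auto
  qed
  define n where "n = (LEAST n. \<exists>i. n > 0 \<and> i + n < length xs \<and> xs ! i = xs ! (i + n))"
  have "\<exists>i. n > 0 \<and> i + n < length xs \<and> xs ! i = xs ! (i + n)"
    unfolding n_def by (rule LeastI_ex) (use ex in blast)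
  then obtain i where i: "n > 0" "i + n < length xs" "xs ! i = xs ! (i + n)" by blast
  have min: "\<not> (\<exists>i. m > 0 \<and> i + m < length xs \<and> xs ! i = xs ! (i + m))" if "m < n" for m
    using that not_less_Least unfolding n_def by blast
  define x where "x k = xs ! (i + k)" for k
  have xinj: "x k \<noteq> x l" if "k < l" "l \<le> n" "l - k < n" for k l
  proof -
    have "i + k + (l - k) = i + l" using that by simp
    then show ?thesis using min[OF that(3)] that i unfolding x_def
      by (metis add_le_cancel_left le_less_trans zero_less_diff)
  qed
  have adj: "adjacent G (x k) (x (Suc k))" if "k < n" for k
    using xs(1) i that unfolding x_def successively_conv_nth by auto
  then have "\<forall>k. \<exists>e. k < n \<longrightarrow> e \<in> edges G \<and> extr G e = {x k, x (Suc k)}"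
    by (auto simp: adjacent_def)
  then obtain e where e: "e k \<in> edges G" "extr G (e k) = {x k, x (Suc k)}" if "k < n" for k
    by metis
  have wf: "wf_graph G" using T by (simp add: tree_def)
  have x0n: "x 0 = x n" using i by (simp add: x_def)
  have edist: "e k \<noteq> e l" if kl: "k < l" "l < n" for k l
  proof
    assume "e k = e l"
    then have eq: "{x k, x (Suc k)} = {x l, x (Suc l)}" using e kl by (metis order_less_trans)
    have "x k \<noteq> x l" using xinj kl by auto
    with eq have 1: "x k = x (Suc l)" "x (Suc k) = x l" by (auto simp: doubleton_eq_iff)
    have "\<not> Suc l - k < n" using 1(1) xinj[of k "Suc l"] kl by auto
    then have "Suc l = n \<and> k = 0" using kl by linarith
    moreover have "Suc k = l"
    proof (rule ccontr)
      assume "Suc k \<noteq> l"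
      with kl have "Suc k < l" "l \<le> n" "l - Suc k < n" by auto
      from xinj[OF this] 1(2) show False by simp
    qed
    ultimately have "n = 2" by simp
    then show False using xs(2) i unfolding nb_conv_nth by auto
  qed
  have "circuit G (map x [0..<n]) (map e [0..<n])"
    unfolding circuit_def
  proof (intro conjI)
    show "map x [0..<n] \<noteq> []" using i by simp
    show "distinct (map x [0..<n])"
      unfolding distinct_map by (auto intro!: linorder_inj_onI dest: xinj)
    show "distinct (map e [0..<n])"
      unfolding distinct_map by (auto intro!: linorder_inj_onI dest: edist)
    show "set (map x [0..<n]) \<subseteq> verts G" using adj adjacent_verts[OF wf] by fastforce
    show "set (map e [0..<n]) \<subseteq> edges G" using e by auto
    show "\<forall>j<length (map x [0..<n]). extr G (map e [0..<n] ! j) =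
        {map x [0..<n] ! j, map x [0..<n] ! (Suc j mod length (map x [0..<n]))}"
    proof (intro allI impI)
      fix j assume "j < length (map x [0..<n])"
      then have j: "j < n" by simp
      then have "x (Suc j) = x (Suc j mod n)" using x0n by (cases "Suc j = n") auto
      then show "extr G (map e [0..<n] ! j) =
        {map x [0..<n] ! j, map x [0..<n] ! (Suc j mod length (map x [0..<n]))}"
        using j e i by simp
    qed
  qed simp
  then show False using T by (auto simp: tree_def)
qed

lemma tree_simp_tree: "tree G \<Longrightarrow> simp_tree (verts G) (adjacent G)"
proof
  assume T: "tree G"
  show "adjacent G x y \<Longrightarrow> adjacent G y x" for x y by (rule adjacent_commute[THEN iffD1])
  show "adjacent G x y \<Longrightarrow> x \<in> verts G" for x y using T adjacent_verts[of G x y] unfolding tree_def by blast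
  show "x \<in> verts G \<Longrightarrow> y \<in> verts G \<Longrightarrow> (adjacent G)\<^sup>*\<^sup>* x y" for x y
    using T unfolding tree_def connected_graph_def by blast
  show "successively (adjacent G) xs \<Longrightarrow> nb xs \<Longrightarrow> distinct xs" for xs
    using T tree_nb_distinct by blast
qed

section \<open>The Bruhat--Tits tree in coordinates\<close>

lemma vec2_eq_iff: "(x :: 'a^2) = y \<longleftrightarrow> x $ 1 = y $ 1 \<and> x $ 2 = y $ 2"
  by (simp add: vec_eq_iff forall_2)

definition M2 :: "'a \<Rightarrow> 'a \<Rightarrow> 'a \<Rightarrow> 'a \<Rightarrow> 'a::zero^2^2" where
  "M2 a b c d = vector [vector [a, b], vector [c, d]]"

lemma M2_nth [simp]: "M2 a b c d $ 1 $ 1 = a" "M2 a b c d $ 1 $ 2 = b" "M2 a b c d $ 2 $ 1 = c"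
  "M2 a b c d $ 2 $ 2 = d"
  by (simp_all add: M2_def)

lemma mat2_eq_iff: "(A :: 'a^2^2) = B \<longleftrightarrow>
    A $ 1 $ 1 = B $ 1 $ 1 \<and> A $ 1 $ 2 = B $ 1 $ 2 \<and> A $ 2 $ 1 = B $ 2 $ 1 \<and> A $ 2 $ 2 = B $ 2 $ 2"
  by (auto simp: vec2_eq_iff)

lemma matvec_nth: "((A :: 'a::semiring_1^2^2) *v x) $ i = A $ i $ 1 * x $ 1 + A $ i $ 2 * x $ 2"
  by (simp add: matrix_vector_mult_def sum_2)

lemma matmat_nth: "((A :: 'a::semiring_1^2^2) ** B) $ i $ j = A $ i $ 1 * B $ 1 $ j + A $ i $ 2 * B $ 2 $ j"
  by (simp add: matrix_matrix_mult_def sum_2)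

lemma one_neq_two: "(1::2) \<noteq> 2"
proof
  assume "(1::2) = 2"
  then have "(vector [0, 1] :: nat^2) $ 1 = (vector [0, 1] :: nat^2) $ 2" by (rule arg_cong)
  then show False by simp
qed

lemma mat_nth2: "(mat c :: 'a::zero^2^2) $ 1 $ 1 = c" "(mat c :: 'a^2^2) $ 1 $ 2 = 0"
    "(mat c :: 'a^2^2) $ 2 $ 1 = 0" "(mat c :: 'a^2^2) $ 2 $ 2 = c"
  using one_neq_two by (auto simp: mat_def)

lemmas mat2_simps = vec2_eq_iff matvec_nth matmat_nth mat_nth2

lemma invertible_mult2: "invertible A \<Longrightarrow> invertible B \<Longrightarrow> invertible (A ** B :: 'k::field^2^2)"
  by (rule invertible_mult)

lemma invertible_M2 [simp]: "invertible (M2 a b c d :: 'k::field^2^2) \<longleftrightarrow> a * d - b * c \<noteq> 0"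
  by (simp add: invertible_det_nz det_2)

lemma invertible_obtain:
  assumes "invertible (A :: 'k::field^2^2)"
  obtains B where "A ** B = mat 1" "B ** A = mat 1" "invertible B"
  using assms unfolding invertible_def by metis

lemma invertible_inj: "invertible (A :: 'k::field^2^2) \<Longrightarrow> inj ((*v) A)"
proof (rule injI)
  fix x y assume A: "invertible A" and "A *v x = A *v y"
  from A obtain B where "B ** A = mat 1" by (rule invertible_obtain)
  moreover have "(B ** A) *v x = (B ** A) *v y"
    using \<open>A *v x = A *v y\<close> by (simp flip: matrix_vector_mul_assoc)
  ultimately show "x = y" by simp
qed

section \<open>Nonarchimedean absolute values with a uniformizer\<close>

locale nonarch_field =
  fixes nrm :: "'k::field \<Rightarrow> real"
  assumes nonarch: "nonarch_abs nrm"
begin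

lemma nrm_ge0 [simp]: "nrm x \<ge> 0" and nrm_eq0 [simp]: "nrm x = 0 \<longleftrightarrow> x = 0"
  and nrm_mult: "nrm (x * y) = nrm x * nrm y" and nrm_add: "nrm (x + y) \<le> max (nrm x) (nrm y)"
  using nonarch by (auto simp: nonarch_abs_def)

lemma nrm_0 [simp]: "nrm 0 = 0"
  by simp

lemma nrm_pos [simp]: "nrm x > 0 \<longleftrightarrow> x \<noteq> 0"
  using nrm_ge0[of x] nrm_eq0[of x] by linarith

lemma nrm_1 [simp]: "nrm 1 = 1"
  using nrm_mult[of 1 1] by simp

lemma nrm_uminus [simp]: "nrm (- x) = nrm x"
proof -
  have "nrm (- 1) * nrm (- 1) = 1" using nrm_mult[of "-1" "-1"] by simp
  then have "nrm (- 1) = 1"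
    using nrm_ge0[of "-1"] by (metis abs_of_nonneg power2_eq_square real_sqrt_abs real_sqrt_one)
  then show ?thesis using nrm_mult[of "-1" x] by simp
qed

lemma nrm_minus_commute: "nrm (x - y) = nrm (y - x)"
  using nrm_uminus[of "x - y"] by simp

lemma nrm_diff: "nrm (x - y) \<le> max (nrm x) (nrm y)"
  using nrm_add[of x "- y"] by simp

lemma nrm_add_le: "nrm x \<le> r \<Longrightarrow> nrm y \<le> r \<Longrightarrow> nrm (x + y) \<le> r"
  using nrm_add[of x y] by linarith

lemma nrm_diff_le: "nrm x \<le> r \<Longrightarrow> nrm y \<le> r \<Longrightarrow> nrm (x - y) \<le> r"
  using nrm_diff[of x y] by linarith

lemma nrm_inverse: "nrm (inverse x) = inverse (nrm x)"
proof (cases "x = 0")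
  case False
  then have "nrm (inverse x) * nrm x = 1" by (simp flip: nrm_mult)
  then show ?thesis by (metis inverse_unique mult.commute)
qed simp

lemma nrm_divide: "nrm (x / y) = nrm x / nrm y"
  by (simp add: divide_inverse nrm_mult nrm_inverse)

lemma nrm_power: "nrm (x ^ n) = nrm x ^ n"
  by (induction n) (auto simp: nrm_mult)

lemma nrm_powi: "nrm (x powi n) = nrm x powi n"
  by (cases n rule: int_cases2) (auto simp: nrm_power power_int_minus nrm_inverse)

end

text \<open>Assumption \<open>disc\<close> makes \<open>\<pi>\<close> a uniformizer: its value is
  the largest one below 1. That the value group consists of the powers of \<open>nrm \<pi>\<close>
  follows in \<open>nrm_value\<close>.\<close>

locale dvf = nonarch_field nrm for nrm :: "'k::field \<Rightarrow> real" +
  fixes \<pi> :: 'k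
  assumes pi_nz [simp]: "\<pi> \<noteq> 0" and pi_lt: "nrm \<pi> < 1"
    and disc: "nrm x < 1 \<Longrightarrow> nrm x \<le> nrm \<pi>"
begin

abbreviation "q \<equiv> nrm \<pi>"

lemma q_pos: "q > 0" and q_lt: "q < 1" and q_nz [simp]: "q \<noteq> 0"
  using pi_nz pi_lt by auto

lemma powi_le [simp]: "q powi m \<le> q powi n \<longleftrightarrow> n \<le> m"
  using power_int_strict_decreasing[of m n q] power_int_decreasing[of n m q] q_pos q_lt
  by (smt (verit))

lemma powi_eq [simp]: "q powi m = q powi n \<longleftrightarrow> m = n"
  by (metis powi_le order_antisym order_refl)

lemma powi_gt0 [simp]: "q powi n > 0"
  using q_pos by simp

lemma powi_ge0 [simp]: "q powi n \<ge> 0"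
  using powi_gt0[of n] by linarith

lemma q_powi_add: "q powi (m + n) = q powi m * q powi n"
  by (simp add: power_int_add)

lemma powi_small:
  assumes "r > 0"
  shows "\<exists>N::nat. \<forall>n. n \<ge> int N \<longrightarrow> q powi n < r"
proof -
  obtain N where "q ^ N < r" using real_arch_pow_inv[OF assms] q_lt by blast
  then have "q powi n < r" if "n \<ge> int N" for n
    using powi_le[of n "int N"] that by (metis order_le_less_trans power_int_of_nat)
  then show ?thesis by blast
qed

text \<open>For a value of at most 1 take the first power of \<open>q\<close> below it. Dividing by
  the preceding power of \<open>\<pi>\<close> leaves a value greater than \<open>q\<close> and at
  most 1, which by \<open>disc\<close> must be 1. Larger values are inverted first.\<close>

lemma nrm_value:
  assumes "x \<noteq> 0"
  shows "\<exists>n::int. nrm x = q powi n"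
proof -
  have x: "nrm x > 0" using assms by simp
  have *: "\<exists>n. nrm y = q powi n" if y: "nrm y \<le> 1" "y \<noteq> 0" for y
  proof -
    obtain N where N: "q ^ N < nrm y" using real_arch_pow_inv[of "nrm y" q] q_lt y by auto
    define k where "k = (LEAST k. q ^ k < nrm y)"
    have k: "q ^ k < nrm y" unfolding k_def using N by (rule LeastI)
    then have "k \<noteq> 0" using y by (metis power_0 not_less)
    then obtain j where j: "k = Suc j" by (metis not0_implies_Suc)
    have j2: "nrm y \<le> q ^ j" using not_less_Least[of j "\<lambda>k. q ^ k < nrm y"] j
      unfolding k_def by (metis lessI not_less)
    have "nrm (y / \<pi> ^ j) = nrm y / q ^ j" by (simp add: nrm_divide nrm_power)
    moreover have "\<not> nrm (y / \<pi> ^ j) < 1"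
    proof
      assume "nrm (y / \<pi> ^ j) < 1"
      then have "nrm y / q ^ j \<le> q" using disc calculation by metis
      then have "nrm y \<le> q ^ k" using j q_pos by (simp add: field_simps)
      then show False using k by simp
    qed
    moreover have "nrm y / q ^ j \<le> 1" using j2 q_pos by (simp add: divide_le_eq)
    ultimately have "nrm y / q ^ j = 1" by linarith
    then have "nrm y = q ^ j" by simp
    then show ?thesis by (metis power_int_of_nat)
  qed
  show ?thesis
  proof (cases "nrm x \<le> 1")
    case False
    then have "nrm (inverse x) \<le> 1" "inverse x \<noteq> 0" using x assms by (auto simp: nrm_inverse inverse_le_1_iff)
    from *[OF this] obtain n where "inverse (nrm x) = q powi n" by (auto simp: nrm_inverse)
    then have "nrm x = q powi (- n)" by (metis inverse_inverse_eq power_int_minus)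
    then show ?thesis by blast
  qed (use * assms in blast)
qed

text \<open>
  \<open>BL m y n\<close> is the lattice spanned by the columns of an upper triangular matrix.  Every lattice has
  such a basis (Hermite normal form), so the vertex \<open>bv y n\<close> amounts to the disc of centre \<open>y\<close> and
  radius \<open>q powi n\<close> in the field.
\<close>

definition BL :: "int \<Rightarrow> 'k \<Rightarrow> int \<Rightarrow> ('k^2) set" where
  "BL m y n = {w. nrm (w $ 2) \<le> q powi m \<and> nrm (w $ 1 - w $ 2 * y) \<le> q powi (m + n)}"

definition bv :: "'k \<Rightarrow> int \<Rightarrow> 'k bt_vertex" where
  "bv y n = range (\<lambda>m. BL m y n)"

abbreviation "O2 \<equiv> {x. \<forall>i. x $ i \<in> ring_of_integers nrm} :: ('k^2) set"

lemma O2_eq: "O2 = {x. nrm (x $ 1) \<le> 1 \<and> nrm (x $ 2) \<le> 1}"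
  by (auto simp: forall_2 ring_of_integers_def)

lemma BL_matrix: "BL m y n = (*v) (M2 (\<pi> powi (m + n)) (\<pi> powi m * y) 0 (\<pi> powi m)) ` O2"
proof (intro equalityI subsetI)
  fix w assume w: "w \<in> BL m y n"
  define x :: "'k^2" where
    "x = vector [(w $ 1 - w $ 2 * y) / \<pi> powi (m + n), w $ 2 / \<pi> powi m]"
  have "w = M2 (\<pi> powi (m + n)) (\<pi> powi m * y) 0 (\<pi> powi m) *v x"
    using pi_nz by (simp add: x_def mat2_simps)
  moreover have "x \<in> O2"
    using w unfolding O2_eq by (auto simp: x_def BL_def nrm_divide nrm_powi divide_le_eq)
  ultimately show "w \<in> (*v) (M2 (\<pi> powi (m + n)) (\<pi> powi m * y) 0 (\<pi> powi m)) ` O2" by blast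
next
  fix w assume "w \<in> (*v) (M2 (\<pi> powi (m + n)) (\<pi> powi m * y) 0 (\<pi> powi m)) ` O2"
  then obtain x where x: "x \<in> O2" "w = M2 (\<pi> powi (m + n)) (\<pi> powi m * y) 0 (\<pi> powi m) *v x" by blast
  have w: "w $ 1 - w $ 2 * y = \<pi> powi (m + n) * x $ 1" "w $ 2 = \<pi> powi m * x $ 2"
    by (simp_all add: x(2) mat2_simps algebra_simps)
  show "w \<in> BL m y n"
    using x(1)[unfolded O2_eq] unfolding BL_def mem_Collect_eq w(1) unfolding w(2)
    by (simp add: nrm_mult nrm_powi mult_left_le)
qed

lemma BL_lattice: "OK_lattice nrm (BL m y n)"
  unfolding OK_lattice_def BL_matrix
  by (intro exI[of _ "M2 (\<pi> powi (m + n)) (\<pi> powi m * y) 0 (\<pi> powi m)"]) (simp add: pi_nz)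

text \<open>The inverse is the adjugate divided by a unit, so it has integral entries as well and
  maps \<open>O2\<close> into itself.\<close>

lemma unit_image:
  assumes "a * d - b * c \<noteq> 0" "nrm (a * d - b * c) = 1"
    "nrm a \<le> 1" "nrm b \<le> 1" "nrm c \<le> 1" "nrm d \<le> 1"
  shows "(*v) (M2 a b c d) ` O2 = O2"
proof -
  have sub: "(*v) (M2 a b c d) ` O2 \<subseteq> O2"
    if "nrm a \<le> 1" "nrm b \<le> 1" "nrm c \<le> 1" "nrm d \<le> 1" for a b c d
    using that unfolding O2_eq by (auto simp: matvec_nth nrm_mult intro!: nrm_add_le mult_le_one)
  let ?D = "a * d - b * c"
  have "x \<in> (*v) (M2 a b c d) ` O2" if x: "x \<in> O2" for x
  proof -
    have "(*v) (M2 (d / ?D) (- b / ?D) (- c / ?D) (a / ?D)) ` O2 \<subseteq> O2"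
      using assms by (intro sub) (auto simp: nrm_divide)
    then have "M2 (d / ?D) (- b / ?D) (- c / ?D) (a / ?D) *v x \<in> O2" using x by blast
    moreover have "x = M2 a b c d *v (M2 (d / ?D) (- b / ?D) (- c / ?D) (a / ?D) *v x)"
    proof -
      have "a * (d / ?D) + b * (- c / ?D) = 1" "c * (- b / ?D) + d * (a / ?D) = 1"
        using assms(1) by (simp_all add: add_divide_distrib[symmetric] diff_divide_distrib[symmetric] mult.commute)
      moreover have "a * (- b / ?D) + b * (a / ?D) = 0" "c * (d / ?D) + d * (- c / ?D) = 0"
        by (simp_all add: field_simps)
      ultimately have "M2 a b c d ** M2 (d / ?D) (- b / ?D) (- c / ?D) (a / ?D) = mat 1"
        by (simp add: mat2_eq_iff matmat_nth mat_nth2)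
      then show ?thesis by (simp add: matrix_vector_mul_assoc)
    qed
    ultimately show ?thesis by (rule rev_image_eqI)
  qed
  then show ?thesis using sub[OF assms(3-6)] by blast
qed

lemma lattice_mult_unit:
  "(*v) U ` O2 = O2 \<Longrightarrow> (*v) (A ** U) ` O2 = (*v) A ` O2"
  by (simp add: image_image flip: matrix_vector_mul_assoc) (metis image_image)

lemma upper_lattice:
  assumes "a \<noteq> 0" "d \<noteq> 0"
  shows "\<exists>m y n. (*v) (M2 a b 0 d) ` O2 = BL m y n"
proof -
  obtain i j where ij: "nrm a = q powi i" "nrm d = q powi j" using nrm_value assms by metis
  define U where "U = M2 (a / \<pi> powi i) 0 0 (d / \<pi> powi j)"
  have "(*v) U ` O2 = O2"
    unfolding U_def using assms pi_nz ij by (intro unit_image) (auto simp: nrm_divide nrm_powi nrm_mult)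
  moreover have "M2 a b 0 d = M2 (\<pi> powi i) (\<pi> powi j * (b / d)) 0 (\<pi> powi j) ** U"
    using assms pi_nz by (simp add: U_def mat2_eq_iff matmat_nth)
  ultimately have "(*v) (M2 a b 0 d) ` O2 = BL j (b / d) (i - j)"
    using lattice_mult_unit unfolding BL_matrix by simp
  then show ?thesis by blast
qed

text \<open>Hermite normal form: of the two entries in the lower row the larger one divides the
  other, so an integral column operation clears the smaller one and leaves an upper triangular
  matrix.\<close>

lemma lattice_BL:
  assumes "OK_lattice nrm L"
  shows "\<exists>m y n. L = BL m y n"
proof -
  obtain A :: "'k^2^2" where A: "invertible A" "L = (*v) A ` O2"
    using assms by (auto simp: OK_lattice_def)
  define a b c d where abcd: "a = A $ 1 $ 1" "b = A $ 1 $ 2" "c = A $ 2 $ 1" "d = A $ 2 $ 2"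
  have AM: "A = M2 a b c d" by (simp add: mat2_eq_iff abcd)
  have det: "a * d - b * c \<noteq> 0" using A(1) AM by simp
  show ?thesis
  proof (cases "nrm c \<le> nrm d")
    case True
    then have d: "d \<noteq> 0" using det nrm_ge0[of c] by (metis diff_0_right mult_zero_left mult_zero_right nrm_0 nrm_eq0 order_antisym)
    define U where "U = M2 1 0 (- c / d) 1"
    have "(*v) U ` O2 = O2"
      unfolding U_def using True d by (intro unit_image) (auto simp: nrm_divide divide_le_eq)
    moreover have "A ** U = M2 (a - b * c / d) b 0 d"
      using d by (simp add: AM U_def mat2_eq_iff matmat_nth)
    ultimately have "L = (*v) (M2 (a - b * c / d) b 0 d) ` O2" using A(2) lattice_mult_unit[of U A] by simp
    moreover have "a - b * c / d \<noteq> 0" using det d by (auto simp: field_simps)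
    ultimately show ?thesis using upper_lattice[OF _ d, of "a - b * c / d" b] by simp
  next
    case False
    then have c: "c \<noteq> 0" by (metis nrm_0 nrm_ge0)
    \<comment> \<open>Besides clearing \<open>d\<close>, this matrix swaps the columns, so that the
      pivot \<open>c\<close> ends up at the lower right.\<close>
    define U where "U = M2 (- d / c) 1 1 0"
    have "(*v) U ` O2 = O2"
      unfolding U_def using False c by (intro unit_image) (auto simp: nrm_divide divide_le_eq)
    moreover have "A ** U = M2 (b - a * d / c) a 0 c"
      using c by (simp add: AM U_def mat2_eq_iff matmat_nth)
    ultimately have "L = (*v) (M2 (b - a * d / c) a 0 c) ` O2" using A(2) lattice_mult_unit[of U A] by simp
    moreover have "b - a * d / c \<noteq> 0" using det c by (auto simp: field_simps)
    ultimately show ?thesis using upper_lattice[OF _ c, of "b - a * d / c" a] by simp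
  qed
qed

text \<open>The inclusion is tested on the two columns of the basis matrix; the third condition says
  that the second column of the smaller lattice satisfies the congruence of the larger one.\<close>

lemma BL_subset:
  "BL m' y' n' \<subseteq> BL m y n \<longleftrightarrow> m \<le> m' \<and> m + n \<le> m' + n' \<and> q powi m' * nrm (y' - y) \<le> q powi (m + n)"
proof
  assume L: "BL m' y' n' \<subseteq> BL m y n"
  have "vector [\<pi> powi (m' + n'), 0] \<in> BL m' y' n'" by (simp add: BL_def nrm_powi)
  with L have 1: "vector [\<pi> powi (m' + n'), 0] \<in> BL m y n" by blast
  have "vector [\<pi> powi m' * y', \<pi> powi m'] \<in> BL m' y' n'" by (simp add: BL_def nrm_powi)
  with L have 2: "vector [\<pi> powi m' * y', \<pi> powi m'] \<in> BL m y n" by blast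
  then have "nrm (\<pi> powi m' * (y' - y)) \<le> q powi (m + n)" by (simp add: BL_def algebra_simps)
  with 1 2 show "m \<le> m' \<and> m + n \<le> m' + n' \<and> q powi m' * nrm (y' - y) \<le> q powi (m + n)"
    by (simp add: BL_def nrm_powi nrm_mult)
next
  assume H: "m \<le> m' \<and> m + n \<le> m' + n' \<and> q powi m' * nrm (y' - y) \<le> q powi (m + n)"
  show "BL m' y' n' \<subseteq> BL m y n"
  proof
    fix w assume w: "w \<in> BL m' y' n'"
    then have w2: "nrm (w $ 2) \<le> q powi m'" and w1: "nrm (w $ 1 - w $ 2 * y') \<le> q powi (m' + n')"
      by (auto simp: BL_def)
    have "nrm (w $ 2 * (y' - y)) \<le> q powi m' * nrm (y' - y)"
      using w2 by (simp add: nrm_mult mult_right_mono)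
    then have "nrm (w $ 2 * (y' - y)) \<le> q powi (m + n)" using H by linarith
    moreover have "nrm (w $ 1 - w $ 2 * y') \<le> q powi (m + n)" using w1 H by (meson order_trans powi_le)
    ultimately have "nrm ((w $ 1 - w $ 2 * y') + w $ 2 * (y' - y)) \<le> q powi (m + n)"
      by (intro nrm_add_le)
    moreover have "nrm (w $ 2) \<le> q powi m" using w2 H by (meson order_trans powi_le)
    ultimately show "w \<in> BL m y n" by (simp add: BL_def algebra_simps)
  qed
qed

lemma nrm_le_shift: "q powi m * r \<le> q powi (m + n) \<longleftrightarrow> r \<le> q powi n"
  by (simp add: q_powi_add)

lemma BL_eq: "BL m y n = BL m' y' n' \<longleftrightarrow> m = m' \<and> n = n' \<and> nrm (y - y') \<le> q powi n"
  unfolding set_eq_subset BL_subset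
  by (auto simp: nrm_le_shift nrm_minus_commute[of y])

lemma BL_scale:
  assumes "nrm c = q powi k"
  shows "(*s) c ` BL m y n = BL (m + k) y n"
proof -
  have c: "c \<noteq> 0" using assms by (metis nrm_0 power_int_eq_0_iff q_nz)
  have *: "c *s w \<in> BL (m + k) y n \<longleftrightarrow> w \<in> BL m y n" for w
  proof -
    have "(c *s w) $ 1 - (c *s w) $ 2 * y = c * (w $ 1 - w $ 2 * y)" by (simp add: algebra_simps)
    then show ?thesis
      using assms by (simp add: BL_def nrm_mult q_powi_add mult.commute[of "q powi k"] mult.assoc)
  qed
  show ?thesis
  proof (intro equalityI subsetI)
    fix w assume "w \<in> BL (m + k) y n"
    moreover have "w = c *s (inverse c *s w)" using c by (simp add: vec2_eq_iff)
    ultimately show "w \<in> (*s) c ` BL m y n" using * by (metis image_eqI)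
  qed (use * in auto)
qed

lemma similarity_class_BL: "similarity_class (BL m y n) = bv y n"
proof -
  have "\<exists>k. (*s) c ` BL m y n = BL k y n" if "c \<noteq> 0" for c
    using nrm_value[OF that] BL_scale by blast
  moreover have "\<exists>c. BL k y n = (*s) c ` BL m y n \<and> c \<noteq> 0" for k
    using BL_scale[of "\<pi> powi (k - m)" "k - m"] pi_nz by (intro exI[of _ "\<pi> powi (k - m)"]) (auto simp: nrm_powi)
  ultimately show ?thesis unfolding similarity_class_def bv_def by (auto simp: image_iff)
qed

lemma bv_eq: "bv y n = bv y' n' \<longleftrightarrow> n = n' \<and> nrm (y - y') \<le> q powi n"
proof
  assume "bv y n = bv y' n'"
  then have "BL 0 y n \<in> bv y' n'" by (auto simp: bv_def)
  then show "n = n' \<and> nrm (y - y') \<le> q powi n" by (auto simp: bv_def BL_eq)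
next
  assume "n = n' \<and> nrm (y - y') \<le> q powi n"
  then have "BL m y n = BL m y' n'" for m by (auto simp: BL_eq)
  then show "bv y n = bv y' n'" by (simp add: bv_def)
qed

lemma bv_cong: "nrm (y - y') \<le> q powi n \<Longrightarrow> bv y n = bv y' n"
  by (simp add: bv_eq)

section \<open>Vertices and edges of the tree as discs\<close>

lemma verts_BT: "verts (BT_tree nrm) = {bv y n | y n. True}"
proof (intro equalityI subsetI)
  fix x assume "x \<in> verts (BT_tree nrm)"
  then obtain L where "OK_lattice nrm L" "x = similarity_class L" by (auto simp: BT_tree_def)
  moreover from this obtain m y n where "L = BL m y n" using lattice_BL by blast
  ultimately have "x = bv y n" using similarity_class_BL by blast
  then show "x \<in> {bv y n | y n. True}" by blast
next
  fix x assume "x \<in> {bv y n | y n. True}"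
  then obtain y n where "x = similarity_class (BL 0 y n)" using similarity_class_BL by blast
  then show "x \<in> verts (BT_tree nrm)" using BL_lattice by (auto simp: BT_tree_def)
qed

lemma BL_submodule: "OK_submodule nrm (BL m y n)"
  unfolding OK_submodule_def
proof (intro conjI ballI)
  show "0 \<in> BL m y n" by (simp add: BL_def)
  fix v w assume vw: "v \<in> BL m y n" "w \<in> BL m y n"
  have "nrm ((v $ 1 - v $ 2 * y) + (w $ 1 - w $ 2 * y)) \<le> q powi (m + n)"
    using vw by (intro nrm_add_le) (auto simp: BL_def)
  moreover have "nrm (v $ 2 + w $ 2) \<le> q powi m" using vw by (intro nrm_add_le) (auto simp: BL_def)
  ultimately show "v + w \<in> BL m y n" by (simp add: BL_def algebra_simps)
next
  fix a w assume aw: "a \<in> ring_of_integers nrm" "w \<in> BL m y n"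
  have "nrm (a * (w $ 1 - w $ 2 * y)) \<le> q powi (m + n)" "nrm (a * w $ 2) \<le> q powi m"
    using aw mult_mono[of "nrm a" 1] by (force simp: BL_def nrm_mult ring_of_integers_def)+
  then show "a *s w \<in> BL m y n" by (simp add: BL_def algebra_simps)
qed

text \<open>The smaller lattice is the part of \<open>BL m y n\<close> on which the linear form
  \<open>w $ 1 - w $ 2 * y\<close> is smaller by one step. Outside it the form attains its full
  value, so every \<open>x\<close> is an integral multiple of such a \<open>w\<close> modulo the
  smaller lattice.\<close>

lemma colength_child: "colength_one nrm (BL m y (n + 1)) (BL m y n)"
  unfolding colength_one_def
proof (intro conjI allI impI)
  show "BL m y (n + 1) \<subset> BL m y n" unfolding psubset_eq by (simp add: BL_subset BL_eq)
  fix N assume N: "OK_submodule nrm N \<and> BL m y (n + 1) \<subseteq> N \<and> N \<subseteq> BL m y n"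
  show "N = BL m y (n + 1) \<or> N = BL m y n"
  proof (rule disjCI)
    assume "N \<noteq> BL m y n"
    show "N = BL m y (n + 1)"
    proof (rule ccontr)
      assume "N \<noteq> BL m y (n + 1)"
      then obtain w where w: "w \<in> N" "w \<notin> BL m y (n + 1)" using N by blast
      then have wL: "w \<in> BL m y n" using N by blast
      define e where "e = w $ 1 - w $ 2 * y"
      have e: "nrm e \<le> q powi (m + n)" "\<not> nrm e \<le> q powi (m + n + 1)"
        using wL w(2) by (auto simp: BL_def e_def algebra_simps)
      have e0: "e \<noteq> 0" using e(2) by auto
      obtain k where "nrm e = q powi k" using nrm_value[OF e0] by blast
      moreover from this e have "m + n = k" by simp
      ultimately have k: "nrm e = q powi (m + n)" by simp
      have "BL m y n \<subseteq> N"
      proof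
        fix x assume x: "x \<in> BL m y n"
        define f where "f = (x $ 1 - x $ 2 * y) / e"
        have f: "f \<in> ring_of_integers nrm"
          using x k by (simp add: f_def ring_of_integers_def nrm_divide BL_def)
        \<comment> \<open>This is \<open>x - f *s w\<close> with the cancelling terms removed; its
          linear form is 0.\<close>
        define z :: "'k^2" where "z = vector [x $ 2 * y - f * w $ 2 * y, x $ 2 - f * w $ 2]"
        have "nrm (f * w $ 2) \<le> q powi m"
          using f wL mult_mono[of "nrm f" 1] by (force simp: BL_def nrm_mult ring_of_integers_def)
        then have "nrm (x $ 2 - f * w $ 2) \<le> q powi m" using x by (intro nrm_diff_le) (auto simp: BL_def)
        then have "z \<in> BL m y (n + 1)" by (simp add: z_def BL_def algebra_simps)
        then have "z \<in> N" using N by blast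
        moreover have "f *s w \<in> N" using N f w by (auto simp: OK_submodule_def)
        ultimately have "z + f *s w \<in> N" using N by (auto simp: OK_submodule_def)
        moreover have "f * e = x $ 1 - x $ 2 * y" using e0 by (simp add: f_def)
        then have "z + f *s w = x" by (simp add: vec2_eq_iff z_def e_def algebra_simps)
        ultimately show "x \<in> N" by simp
      qed
      then show False using N \<open>N \<noteq> BL m y n\<close> by blast
    qed
  qed
qed

text \<open>The argument of \<open>colength_child\<close> with the second coordinate as linear
  form.\<close>

lemma colength_parent: "colength_one nrm (BL (m + 1) y (n - 1)) (BL m y n)"
  unfolding colength_one_def
proof (intro conjI allI impI)
  show "BL (m + 1) y (n - 1) \<subset> BL m y n" unfolding psubset_eq by (simp add: BL_subset BL_eq)
  fix N assume N: "OK_submodule nrm N \<and> BL (m + 1) y (n - 1) \<subseteq> N \<and> N \<subseteq> BL m y n"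
  show "N = BL (m + 1) y (n - 1) \<or> N = BL m y n"
  proof (rule disjCI)
    assume "N \<noteq> BL m y n"
    show "N = BL (m + 1) y (n - 1)"
    proof (rule ccontr)
      assume "N \<noteq> BL (m + 1) y (n - 1)"
      then obtain w where w: "w \<in> N" "w \<notin> BL (m + 1) y (n - 1)" using N by blast
      then have wL: "w \<in> BL m y n" using N by blast
      have e: "nrm (w $ 2) \<le> q powi m" "\<not> nrm (w $ 2) \<le> q powi (m + 1)"
        using wL w(2) by (auto simp: BL_def)
      have e0: "w $ 2 \<noteq> 0" using e(2) by auto
      obtain k where "nrm (w $ 2) = q powi k" using nrm_value[OF e0] by blast
      with e have k: "nrm (w $ 2) = q powi m" by simp
      have "BL m y n \<subseteq> N"
      proof
        fix x assume x: "x \<in> BL m y n"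
        define f where "f = x $ 2 / w $ 2"
        have f: "f \<in> ring_of_integers nrm"
          using x k by (simp add: f_def ring_of_integers_def nrm_divide BL_def)
        define z :: "'k^2" where "z = vector [(x $ 1 - x $ 2 * y) - f * (w $ 1 - w $ 2 * y), 0]"
        have "nrm (f * (w $ 1 - w $ 2 * y)) \<le> q powi (m + n)"
          using f wL mult_mono[of "nrm f" 1] by (force simp: BL_def nrm_mult ring_of_integers_def)
        then have "nrm ((x $ 1 - x $ 2 * y) - f * (w $ 1 - w $ 2 * y)) \<le> q powi (m + n)"
          using x by (intro nrm_diff_le[of "x $ 1 - x $ 2 * y"]) (auto simp: BL_def)
        then have "z \<in> BL (m + 1) y (n - 1)" by (simp add: z_def BL_def)
        then have "z \<in> N" using N by blast
        moreover have "f *s w \<in> N" using N f w by (auto simp: OK_submodule_def)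
        ultimately have "z + f *s w \<in> N" using N by (auto simp: OK_submodule_def)
        moreover have "f * w $ 2 = x $ 2" using e0 by (simp add: f_def)
        then have "z + f *s w = x" by (simp add: vec2_eq_iff z_def algebra_simps flip: mult.assoc)
        ultimately show "x \<in> N" by simp
      qed
      then show False using N \<open>N \<noteq> BL m y n\<close> by blast
    qed
  qed
qed

text \<open>A proper sublattice is contained in a lattice with smaller disc at the same scale, if
  \<open>m' = m\<close>, and otherwise in the lattice of the next larger disc. As both are
  submodules, simplicity of the quotient turns containment into equality. So the neighbours of a
  disc are its maximal proper subdiscs and the smallest disc properly containing it.\<close>

lemma colength_cases:
  assumes "colength_one nrm (BL m' y' n') (BL m y n)"
  shows "nrm (y' - y) \<le> q powi n \<and> m' = m \<and> n' = n + 1 \<or> BL m' y' n' = BL (m + 1) y (n - 1)"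
proof -
  have sub: "BL m' y' n' \<subseteq> BL m y n" "BL m' y' n' \<noteq> BL m y n"
    and max: "\<And>N. OK_submodule nrm N \<Longrightarrow> BL m' y' n' \<subseteq> N \<Longrightarrow> N \<subseteq> BL m y n \<Longrightarrow> N = BL m' y' n' \<or> N = BL m y n"
    using assms by (auto simp: colength_one_def)
  have s: "m \<le> m'" "m + n \<le> m' + n'" "q powi m' * nrm (y' - y) \<le> q powi (m + n)"
    using sub(1) by (auto simp: BL_subset)
  show ?thesis
  proof (cases "m' = m")
    case True
    then have y: "nrm (y' - y) \<le> q powi n" using s(3) by (simp add: nrm_le_shift)
    then have eq: "BL m y n = BL m y' n" by (simp add: BL_eq nrm_minus_commute)
    then have "n' \<noteq> n" using sub(2) True by auto
    then have "n' \<ge> n + 1" using s(2) True by simp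
    then have "BL m y' (n + 1) = BL m' y' n' \<or> BL m y' (n + 1) = BL m y n"
      using eq True by (intro max BL_submodule) (auto simp: BL_subset)
    then show ?thesis using y True unfolding eq by (auto simp: BL_eq)
  next
    case False
    have "BL (m + 1) y (n - 1) = BL m' y' n' \<or> BL (m + 1) y (n - 1) = BL m y n"
      using s False by (intro max BL_submodule) (auto simp: BL_subset)
    then show ?thesis by (auto simp: BL_eq nrm_minus_commute)
  qed
qed

lemma edges_BT: "edges (BT_tree nrm) = {{bv y n, bv y (n + 1)} | y n. True}"
proof (intro equalityI subsetI)
  fix e assume "e \<in> edges (BT_tree nrm)"
  then obtain L M where LM: "OK_lattice nrm L" "OK_lattice nrm M" "colength_one nrm M L"
      "e = {similarity_class L, similarity_class M}"
    by (auto simp: BT_tree_def)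
  then obtain m y n m' y' n' where L: "L = BL m y n" "M = BL m' y' n'" using lattice_BL by metis
  have e: "e = {bv y n, bv y' n'}" using LM(4) L similarity_class_BL by simp
  have "nrm (y' - y) \<le> q powi n \<and> m' = m \<and> n' = n + 1 \<or> BL m' y' n' = BL (m + 1) y (n - 1)"
    using colength_cases LM(3) L by blast
  then show "e \<in> {{bv y n, bv y (n + 1)} | y n. True}"
  proof
    assume "nrm (y' - y) \<le> q powi n \<and> m' = m \<and> n' = n + 1"
    then have "e = {bv y' n, bv y' (n + 1)}" using e bv_cong[of y y'] nrm_minus_commute by metis
    then show ?thesis by blast
  next
    assume "BL m' y' n' = BL (m + 1) y (n - 1)"
    then have "bv y' n' = bv y (n - 1)" by (auto simp: BL_eq bv_eq)
    then have "e = {bv y (n - 1), bv y (n - 1 + 1)}" using e by auto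
    then show ?thesis by blast
  qed
next
  fix e assume "e \<in> {{bv y n, bv y (n + 1)} | y n. True}"
  then obtain y n where e: "e = {bv y n, bv y (n + 1)}" by blast
  then have "e = {similarity_class (BL 0 y n), similarity_class (BL 0 y (n + 1))}"
    by (simp only: similarity_class_BL)
  then show "e \<in> edges (BT_tree nrm)"
    using colength_child BL_lattice by (simp add: BT_tree_def) blast
qed

lemma extr_BT [simp]: "extr (BT_tree nrm) e = e"
  by (simp add: BT_tree_def)

lemma adjacent_BT: "adjacent (BT_tree nrm) x z \<longleftrightarrow> (\<exists>y n. {x, z} = {bv y n, bv y (n + 1)})"
  unfolding adjacent_def edges_BT by auto

lemma bv_neq_Suc: "bv y n \<noteq> bv y' (n + 1)"
  by (simp add: bv_eq)

text \<open>The exponent of the radius, a height function: large level means small disc.\<close>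

definition level :: "'k bt_vertex \<Rightarrow> int" where
  "level x = (THE n. \<exists>y. x = bv y n)"

lemma level_bv [simp]: "level (bv y n) = n"
  unfolding level_def by (rule the_equality) (auto simp: bv_eq intro!: exI[of _ y])

section \<open>The graph of lattice classes is a tree\<close>

lemma wf_BT: "wf_graph (BT_tree nrm)"
  unfolding wf_graph_def edges_BT verts_BT using bv_neq_Suc by auto

text \<open>Any two discs lie in a common one, and enlarging a disc step by step is a walk.\<close>

lemma connected_BT: "connected_graph (BT_tree nrm)"
proof -
  let ?A = "adjacent (BT_tree nrm)"
  have up: "?A\<^sup>*\<^sup>* (bv y n) (bv y (n - int k))" for y n k
  proof (induction k)
    case (Suc k)
    have "?A (bv y (n - int k)) (bv y (n - int (Suc k)))"
      unfolding adjacent_BT by (intro exI[of _ y] exI[of _ "n - int (Suc k)"]) (auto simp: insert_commute)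
    with Suc show ?case by (rule rtranclp.rtrancl_into_rtrancl)
  qed simp
  have symA: "?A\<^sup>*\<^sup>* x y \<Longrightarrow> ?A\<^sup>*\<^sup>* y x" for x y
    by (induction rule: rtranclp_induct)
       (auto intro: converse_rtranclp_into_rtranclp adjacent_commute[THEN iffD1])
  have "?A\<^sup>*\<^sup>* (bv y n) (bv y' n')" for y n y' n'
  proof -
    obtain k :: int where k: "nrm (y - y') \<le> q powi k" "k \<le> n" "k \<le> n'"
    proof (cases "y = y'")
      case True
      then show ?thesis using that[of "min n n'"] by auto
    next
      case False
      then obtain j where "nrm (y - y') = q powi j" using nrm_value[of "y - y'"] by auto
      then show ?thesis using that[of "min j (min n n')"] by auto
    qed
    have "?A\<^sup>*\<^sup>* (bv y n) (bv y k)" using up[of y n "nat (n - k)"] k by simp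
    moreover have "?A\<^sup>*\<^sup>* (bv y' n') (bv y' k)" using up[of y' n' "nat (n' - k)"] k by simp
    moreover have "bv y k = bv y' k" using k bv_cong by blast
    ultimately show ?thesis using symA by (auto intro: rtranclp_trans)
  qed
  then show ?thesis unfolding connected_graph_def verts_BT by blast
qed

text \<open>At a smallest disc of a circuit both neighbours are larger discs, but a disc has only
  one parent. So the two edges at this vertex coincide, and the circuit would be a loop; a disc is
  not its own parent.\<close>

lemma no_circuit_BT: "\<not> circuit (BT_tree nrm) vs es"
proof
  assume c: "circuit (BT_tree nrm) vs es"
  define l where "l = length vs"
  have l: "l > 0" "length es = l" "distinct vs" "distinct es" "set vs \<subseteq> verts (BT_tree nrm)"
    and es: "set es \<subseteq> edges (BT_tree nrm)"
    and ex: "\<And>i. i < l \<Longrightarrow> es ! i = {vs ! i, vs ! (Suc i mod l)}"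
    using c by (auto simp: circuit_def l_def)
  have e: "es ! i \<in> edges (BT_tree nrm)" if "i < l" for i
    using es l(2) that by (metis nth_mem subsetD)
  obtain i where i: "i < l" "\<And>j. j < l \<Longrightarrow> level (vs ! j) \<le> level (vs ! i)"
  proof -
    have "Max ((\<lambda>j. level (vs ! j)) ` {..<l}) \<in> (\<lambda>j. level (vs ! j)) ` {..<l}"
      using l(1) by (intro Max_in) auto
    then obtain i where "i < l" "Max ((\<lambda>j. level (vs ! j)) ` {..<l}) = level (vs ! i)" by auto
    moreover have "level (vs ! j) \<le> Max ((\<lambda>j. level (vs ! j)) ` {..<l})" if "j < l" for j
      using that by (intro Max_ge) auto
    ultimately show thesis using that[of i] by simp
  qed
  define b where "b = Suc i mod l"
  \<comment> \<open>The cyclic predecessor of \<open>i\<close>; adding \<open>l - 1\<close> avoids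
    subtraction at 0.\<close>
  define a where "a = (i + (l - 1)) mod l"
  have ab: "a < l" "b < l" using l(1) by (auto simp: a_def b_def)
  have sa: "Suc a mod l = i" using i(1) l(1) by (simp add: a_def mod_Suc_eq)
  have E1: "{vs ! i, vs ! b} \<in> edges (BT_tree nrm)" using e[OF i(1)] ex[OF i(1)] b_def by simp
  have E2: "{vs ! a, vs ! i} \<in> edges (BT_tree nrm)" using e[OF ab(1)] ex[OF ab(1)] sa by simp
  obtain y n where yn: "vs ! i = bv y n" using l(5) i(1) l_def verts_BT by (auto dest!: nth_mem)
  have parent: "vs ! j = bv y (n - 1)" if j: "j < l" "{vs ! i, vs ! j} \<in> edges (BT_tree nrm)" for j
  proof -
    obtain z m where z: "{vs ! i, vs ! j} = {bv z m, bv z (m + 1)}" using j(2) edges_BT by auto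
    have "vs ! i \<noteq> bv z m"
    proof
      assume "vs ! i = bv z m"
      then have "vs ! j = bv z (m + 1)" using z by (auto simp: doubleton_eq_iff bv_eq)
      then show False using i(2)[OF j(1)] \<open>vs ! i = bv z m\<close> by simp
    qed
    then have "vs ! j = bv z m" "vs ! i = bv z (m + 1)" using z by (auto simp: doubleton_eq_iff)
    moreover from this have "n = m + 1" "nrm (z - y) \<le> q powi n" using yn by (auto simp: bv_eq nrm_minus_commute)
    ultimately show ?thesis using powi_le[of n m] by (simp add: bv_eq del: powi_le)
  qed
  have "vs ! a = vs ! b" using parent[OF ab(1)] parent[OF ab(2) E1] E2 by (simp add: insert_commute)
  then have "a = b" using l(3) ab l_def by (simp add: nth_eq_iff_index_eq)
  have "vs ! b \<noteq> vs ! i" using parent[OF ab(2) E1] yn by (simp add: bv_eq)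
  then have "b \<noteq> i" by auto
  have "es ! a = es ! i" using ex[OF ab(1)] ex[OF i(1)] sa \<open>a = b\<close> b_def by (simp add: insert_commute)
  then have "a = i" using l ab(1) i(1) by (simp add: nth_eq_iff_index_eq)
  then show False using \<open>a = b\<close> \<open>b \<noteq> i\<close> by simp
qed

lemma tree_BT: "tree (BT_tree nrm)"
  unfolding tree_def using wf_BT connected_BT no_circuit_BT verts_BT by auto

end

section \<open>The action of PGL(2,K)\<close>

lemma mat_mult_left: "mat c ** (A :: 'k::field^2^2) = M2 (c * A$1$1) (c * A$1$2) (c * A$2$1) (c * A$2$2)"
  by (simp add: mat2_eq_iff matmat_nth mat_nth2)

lemma mat_mult_right: "(A :: 'k::field^2^2) ** mat c = mat c ** A"
  by (simp add: mat2_eq_iff matmat_nth mat_nth2 mult.commute)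

lemma mat_mult_vec: "(mat c ** (A :: 'k::field^2^2)) *v x = c *s (A *v x)"
  by (simp add: mat2_simps algebra_simps)

lemma mat_mult_mat: "mat c ** mat d = (mat (c * d) :: 'k::field^2^2)"
  by (simp add: mat2_eq_iff matmat_nth mat_nth2)

lemma invertible_mat [simp]: "invertible (mat c :: 'k::field^2^2) \<longleftrightarrow> c \<noteq> 0"
  by (simp add: invertible_det_nz det_2 mat_nth2)

lemma GL2_simps [simp]: "carrier GL2 = {A. invertible A}" "A \<otimes>\<^bsub>GL2\<^esub> B = A ** B" "\<one>\<^bsub>GL2\<^esub> = mat 1"
  by (simp_all add: GL2_def)

lemma group_GL2: "group (GL2 :: ('k::field^2^2) monoid)"
proof (rule groupI)
  fix A :: "'k^2^2" assume "A \<in> carrier GL2"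
  then obtain B where "B ** A = mat 1" "invertible B" using invertible_obtain[of A] by auto
  then show "\<exists>B\<in>carrier GL2. B \<otimes>\<^bsub>GL2\<^esub> A = \<one>\<^bsub>GL2\<^esub>" by auto
qed (simp_all add: invertible_mult2 matrix_mul_assoc)

lemma scalars_normal: "scalars \<lhd> (GL2 :: ('k::field^2^2) monoid)"
proof -
  interpret group "GL2 :: ('k^2^2) monoid" by (rule group_GL2)
  have sub: "subgroup scalars (GL2 :: ('k^2^2) monoid)"
  proof (rule subgroupI)
    show "scalars \<subseteq> carrier (GL2 :: ('k^2^2) monoid)" by (auto simp: scalars_def)
    show "scalars \<noteq> ({} :: ('k^2^2) set)" by (auto simp: scalars_def intro: exI[of _ 1])
    show "inv\<^bsub>GL2\<^esub> A \<in> scalars" if A: "A \<in> scalars" for A :: "'k^2^2"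
    proof -
      obtain c where c: "c \<noteq> 0" "A = mat c" using A by (auto simp: scalars_def)
      have "inv\<^bsub>GL2\<^esub> A = mat (inverse c)"
        by (rule inv_equality) (use c in \<open>auto simp: mat_mult_mat\<close>)
      then show ?thesis using c by (auto simp: scalars_def)
    qed
    show "A \<otimes>\<^bsub>GL2\<^esub> B \<in> scalars" if "A \<in> scalars" "B \<in> scalars" for A B :: "'k^2^2"
      using that by (auto simp: scalars_def mat_mult_mat)
  qed
  show ?thesis
    unfolding normal_inv_iff
  proof (intro conjI ballI sub)
    fix A h :: "'k^2^2" assume A: "A \<in> carrier GL2" "h \<in> scalars"
    then obtain c where c: "c \<noteq> 0" "h = mat c" by (auto simp: scalars_def)
    have "A \<otimes>\<^bsub>GL2\<^esub> h \<otimes>\<^bsub>GL2\<^esub> inv\<^bsub>GL2\<^esub> A = h \<otimes>\<^bsub>GL2\<^esub> (A \<otimes>\<^bsub>GL2\<^esub> inv\<^bsub>GL2\<^esub> A)"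
      using c by (simp add: mat_mult_right matrix_mul_assoc)
    also have "\<dots> = h" using A c by (metis GL2_simps(2,3) matrix_mul_rid r_inv)
    finally show "A \<otimes>\<^bsub>GL2\<^esub> h \<otimes>\<^bsub>GL2\<^esub> inv\<^bsub>GL2\<^esub> A \<in> scalars" using A by simp
  qed
qed

definition cls :: "'k::field^2^2 \<Rightarrow> 'k pgl" where
  "cls A = scalars #>\<^bsub>GL2\<^esub> A"

lemma cls_altdef: "cls A = {mat c ** A | c. c \<noteq> 0}"
  by (auto simp: cls_def r_coset_def scalars_def)

lemma cls_self: "A \<in> cls A"
  unfolding cls_altdef by (auto intro!: exI[of _ 1])

lemma carrier_PGL2: "carrier PGL2 = cls ` {A. invertible A}"
  by (auto simp: PGL2_def FactGroup_def RCOSETS_def cls_def)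

lemma cls_carrier [simp]: "invertible A \<Longrightarrow> cls A \<in> carrier PGL2"
  by (auto simp: carrier_PGL2)

lemma cls_mult: "invertible A \<Longrightarrow> invertible B \<Longrightarrow> cls A \<otimes>\<^bsub>PGL2\<^esub> cls B = cls (A ** B)"
  using normal.rcos_sum[OF scalars_normal, of A B] by (simp add: PGL2_def FactGroup_def cls_def)

lemma group_PGL2: "group (PGL2 :: 'k::field pgl monoid)"
  unfolding PGL2_def by (rule normal.factorgroup_is_group[OF scalars_normal])

lemma one_PGL2: "\<one>\<^bsub>PGL2\<^esub> = cls (mat 1)"
  by (auto simp: PGL2_def FactGroup_def cls_altdef scalars_def)

lemma inv_cls: "invertible A \<Longrightarrow> A ** B = mat 1 \<Longrightarrow> inv\<^bsub>PGL2\<^esub> (cls A) = cls B"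
proof -
  assume A: "invertible A" "A ** B = mat 1"
  then have B: "B ** A = mat 1" by (simp add: matrix_left_right_inverse)
  then have "invertible B" using A unfolding invertible_def by blast
  then show "inv\<^bsub>PGL2\<^esub> (cls A) = cls B"
    using A B by (intro group.inv_equality[OF group_PGL2]) (simp_all add: cls_mult one_PGL2)
qed

lemma cls_eqD:
  assumes "cls A = cls B"
  shows "\<exists>c. c \<noteq> 0 \<and> B = mat c ** A"
  using cls_self[of B] assms by (auto simp: cls_altdef)

lemma cls_mat_mult: "c \<noteq> 0 \<Longrightarrow> cls (mat c ** A) = cls A"
  unfolding cls_altdef
proof (intro equalityI subsetI)
  fix B assume c: "c \<noteq> 0" "B \<in> {mat d ** (mat c ** A) | d. d \<noteq> 0}"
  then show "B \<in> {mat d ** A | d. d \<noteq> 0}" by (auto simp: matrix_mul_assoc mat_mult_mat)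
next
  fix B assume c: "c \<noteq> 0" "B \<in> {mat d ** A | d. d \<noteq> 0}"
  then obtain d where d: "d \<noteq> 0" "B = mat d ** A" by blast
  then have "B = mat (d / c) ** (mat c ** A)" using c by (simp add: matrix_mul_assoc mat_mult_mat)
  then show "B \<in> {mat d ** (mat c ** A) | d. d \<noteq> 0}" using c d by auto
qed

section \<open>Points of the projective line and frames\<close>

definition e1 :: "'k::field^2" where "e1 = vector [1, 0]"
definition e2 :: "'k::field^2" where "e2 = vector [0, 1]"

lemma e_simps [simp]: "e1 $ 1 = 1" "e1 $ 2 = 0" "e2 $ 1 = 0" "e2 $ 2 = 1"
  by (simp_all add: e1_def e2_def)

abbreviation line :: "'k::field^2 \<Rightarrow> ('k^2) set" where "line x \<equiv> vec.span {x}"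

lemma line_eq: "line x = range (\<lambda>c. c *s x)"
  by (rule vec.span_singleton)

lemma line_eqI:
  assumes "y \<in> line x" "y \<noteq> 0"
  shows "line y = line x"
proof -
  obtain c where c: "y = c *s x" using assms by (auto simp: line_eq)
  with assms have "c \<noteq> 0" by auto
  have "d *s x \<in> range (\<lambda>e. e *s y)" for d
    using \<open>c \<noteq> 0\<close> c by (auto simp: image_iff intro!: exI[of _ "d / c"])
  then show ?thesis unfolding line_eq using c by (auto simp: image_iff vector_smult_assoc)
qed

lemma P1_line: "x \<noteq> 0 \<Longrightarrow> line x \<in> P1"
  by (auto simp: P1_def)

lemma matvec_zero_iff: "invertible (A :: 'k::field^2^2) \<Longrightarrow> A *v x = 0 \<longleftrightarrow> x = 0"
  using invertible_inj[of A] by (metis inj_def matrix_vector_mult_0_right)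

lemma matvec_scale: "(A :: 'k::field^2^2) *v (c *s x) = c *s (A *v x)"
  by (simp add: vec2_eq_iff matvec_nth algebra_simps)

lemma image_line: "(*v) (A :: 'k::field^2^2) ` line x = line (A *v x)"
  by (auto simp: line_eq matvec_scale image_iff)

lemma act_line_cls: "act_line (cls A) (line x) = line (A *v x)"
proof -
  have "act_line (cls A) (line x) = (\<Union>c\<in>-{0}. (\<lambda>y. c *s (A *v y)) ` line x)"
    by (auto simp: act_line_def cls_altdef mat_mult_vec) (metis mat_mult_vec)
  also have "\<dots> = line (A *v x)"
  proof (intro equalityI subsetI)
    fix z assume "z \<in> (\<Union>c\<in>-{0}. (\<lambda>y. c *s (A *v y)) ` line x)"
    then show "z \<in> line (A *v x)" by (auto simp: line_eq matvec_scale vector_smult_assoc)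
  next
    fix z assume "z \<in> line (A *v x)"
    then have "z \<in> (\<lambda>y. 1 *s (A *v y)) ` line x" by (simp add: image_line[symmetric])
    then show "z \<in> (\<Union>c\<in>-{0}. (\<lambda>y. c *s (A *v y)) ` line x)" by (intro UN_I[of 1]) simp_all
  qed
  finally show ?thesis .
qed

text \<open>Any two points are the lines spanned by the columns of an invertible matrix. Questions
  about lines and ends are moved in this way to \<open>e1\<close> and \<open>e2\<close>, where discs
  can be computed.\<close>

lemma P1_frame:
  assumes "z \<in> P1" "w \<in> P1" "z \<noteq> (w :: ('k::field^2) set)"
  shows "\<exists>P. invertible P \<and> z = line (P *v e1) \<and> w = line (P *v e2)"
proof -
  obtain x y where xy: "x \<noteq> 0" "z = line x" "y \<noteq> 0" "w = line y" using assms by (auto simp: P1_def)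
  define P where "P = M2 (x$1) (y$1) (x$2) (y$2)"
  have P: "P *v e1 = x" "P *v e2 = y" by (simp_all add: P_def vec2_eq_iff matvec_nth)
  have "x$1 * y$2 - y$1 * x$2 \<noteq> 0"
  proof
    assume d: "x$1 * y$2 - y$1 * x$2 = 0"
    have "y \<in> line x"
    proof (cases "x $ 1 = 0")
      case True
      then have "x $ 2 \<noteq> 0" using xy by (auto simp: vec2_eq_iff)
      then have "y = (y$2 / x$2) *s x" using d True by (simp add: vec2_eq_iff)
      then show ?thesis unfolding line_eq by blast
    next
      case False
      then have "y = (y$1 / x$1) *s x" using d by (simp add: vec2_eq_iff field_simps)
      then show ?thesis unfolding line_eq by blast
    qed
    then show False using xy assms line_eqI by metis
  qed
  then have "invertible P" by (simp add: P_def)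
  then show ?thesis using P xy by blast
qed

lemma line_e1_neq_e2: "line (e1 :: 'k::field^2) \<noteq> line e2"
proof
  assume "line (e1 :: 'k::field^2) = line e2"
  then have "(e1 :: 'k^2) \<in> line e2" using vec.span_base by blast
  then show False by (auto simp: line_eq vec2_eq_iff)
qed

lemma P1_frame1:
  assumes "(z :: ('k::field^2) set) \<in> P1"
  shows "\<exists>P. invertible P \<and> z = line (P *v e1)"
proof -
  have "e1 \<noteq> (0 :: 'k^2)" "e2 \<noteq> (0 :: 'k^2)" by (simp_all add: vec2_eq_iff)
  then have "line (e1 :: 'k^2) \<in> P1" "line (e2 :: 'k^2) \<in> P1" by (simp_all add: P1_line)
  then obtain w where "w \<in> P1" "z \<noteq> w" using line_e1_neq_e2 by metis
  with assms P1_frame show ?thesis by blast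
qed

lemma line_frame_inj:
  assumes "invertible (P :: 'k::field^2^2)"
  shows "line (P *v x) = line (P *v y) \<longleftrightarrow> line x = line y"
  using assms unfolding image_line[symmetric] by (simp add: invertible_inj inj_image_eq_iff)

section \<open>Matrices acting on vertices, half-lines and lines\<close>

context dvf
begin

abbreviation "BT \<equiv> BT_tree nrm"

definition mv :: "'k^2^2 \<Rightarrow> 'k bt_vertex \<Rightarrow> 'k bt_vertex" where
  "mv A x = (\<lambda>L. (*v) A ` L) ` x"

lemma mv_mult: "mv (A ** B) x = mv A (mv B x)"
  by (auto simp: mv_def image_image matrix_vector_mul_assoc[symmetric])

lemma mv_one [simp]: "mv (mat 1) x = x"
  by (simp add: mv_def)

lemma mv_inverse: "A ** B = mat 1 \<Longrightarrow> mv A (mv B x) = x"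
  by (simp add: mv_mult[symmetric])

lemma lattice_image:
  assumes "invertible A" "OK_lattice nrm L"
  shows "OK_lattice nrm ((*v) A ` L)"
proof -
  obtain B where B: "invertible B" "L = (*v) B ` O2" using assms by (auto simp: OK_lattice_def)
  then have "(*v) A ` L = (*v) (A ** B) ` O2"
    by (simp add: image_image matrix_vector_mul_assoc)
  then show ?thesis unfolding OK_lattice_def using B assms invertible_mult2 by blast
qed

lemma mv_similarity_class: "mv A (similarity_class L) = similarity_class ((*v) A ` L)"
proof -
  have "(*v) A ` (*s) c ` L = (*s) c ` (*v) A ` L" for c by (simp add: image_image matvec_scale)
  then show ?thesis unfolding mv_def similarity_class_def setcompr_eq_image image_image by simp
qed

lemma BT_vertE:
  assumes "x \<in> verts BT"
  obtains L where "OK_lattice nrm L" "x = similarity_class L"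
  using assms by (auto simp: BT_tree_def)

lemma BT_vertI: "OK_lattice nrm L \<Longrightarrow> similarity_class L \<in> verts BT"
  by (auto simp: BT_tree_def)

lemma bv_in_verts [simp]: "bv y n \<in> verts BT"
  by (auto simp: verts_BT)

lemma mv_verts: "invertible A \<Longrightarrow> x \<in> verts BT \<Longrightarrow> mv A x \<in> verts BT"
  by (elim BT_vertE) (auto simp: mv_similarity_class intro!: BT_vertI lattice_image)

text \<open>A scalar multiple of \<open>A\<close> sends each lattice of the class to the image of
  another lattice of the class. So the action of an element of the group may be computed with any
  chosen representative, through \<open>mv\<close>.\<close>

lemma act_vert_cls:
  assumes "x \<in> verts BT"
  shows "act_vert (cls A) x = mv A x"
proof -
  obtain y n where x: "x = bv y n" using assms by (auto simp: verts_BT)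
  have *: "(*v) (mat c ** A) ` BL m y n \<in> mv A x" if c: "c \<noteq> 0" for c m
  proof -
    obtain k where "nrm c = q powi k" using nrm_value c by blast
    then have "(*s) c ` BL m y n = BL (m + k) y n" by (rule BL_scale)
    then have "(*v) (mat c ** A) ` BL m y n = (*v) A ` BL (m + k) y n"
      by (simp add: mat_mult_vec image_image matvec_scale flip: image_comp)
         (metis (no_types, lifting) image_cong image_image matvec_scale)
    then show ?thesis by (auto simp: mv_def x bv_def)
  qed
  have "act_vert (cls A) x \<subseteq> mv A x"
    unfolding act_vert_def cls_altdef using * by (auto simp: x bv_def)
  moreover have "mv A x \<subseteq> act_vert (cls A) x"
    using cls_self by (auto simp: mv_def act_vert_def)
  ultimately show ?thesis by blast
qed

lemma submodule_preimage: "OK_submodule nrm N \<Longrightarrow> OK_submodule nrm ((*v) A -` N)"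
  by (auto simp: OK_submodule_def matrix_vector_right_distrib matvec_scale)

lemma colength_image:
  assumes A: "invertible A" and c: "colength_one nrm M L"
  shows "colength_one nrm ((*v) A ` M) ((*v) A ` L)"
  unfolding colength_one_def
proof (intro conjI allI impI)
  note inj = invertible_inj[OF A]
  show "(*v) A ` M \<subset> (*v) A ` L" using c inj by (simp add: colength_one_def inj_image_subset_iff psubset_eq inj_image_eq_iff)
  fix N assume N: "OK_submodule nrm N \<and> (*v) A ` M \<subseteq> N \<and> N \<subseteq> (*v) A ` L"
  define N' where "N' = (*v) A -` N"
  have NN: "N = (*v) A ` N'" using N by (auto simp: N'_def)
  have "OK_submodule nrm N'" using N submodule_preimage by (simp add: N'_def)
  moreover have "M \<subseteq> N'" "N' \<subseteq> L" using N unfolding NN by (simp_all add: inj inj_image_subset_iff)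
  ultimately have "N' = M \<or> N' = L" using c by (auto simp: colength_one_def)
  then show "N = (*v) A ` M \<or> N = (*v) A ` L" using NN by blast
qed

lemma mv_edge:
  assumes A: "invertible A" and e: "e \<in> edges BT"
  shows "mv A ` e \<in> edges BT"
proof -
  obtain L M where "OK_lattice nrm L" "OK_lattice nrm M" "colength_one nrm M L"
      "e = {similarity_class L, similarity_class M}"
    using e by (auto simp: BT_tree_def)
  then have "mv A ` e = {similarity_class ((*v) A ` L), similarity_class ((*v) A ` M)}"
      "OK_lattice nrm ((*v) A ` L)" "OK_lattice nrm ((*v) A ` M)"
      "colength_one nrm ((*v) A ` M) ((*v) A ` L)"
    using A by (auto simp: mv_similarity_class lattice_image colength_image)
  then show ?thesis unfolding BT_tree_def by auto
qed

lemma adjacent_BT_edge: "adjacent BT x y \<longleftrightarrow> {x, y} \<in> edges BT"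
  by (auto simp: adjacent_def)

lemma mv_adj: "invertible A \<Longrightarrow> adjacent BT x y \<Longrightarrow> adjacent BT (mv A x) (mv A y)"
  using mv_edge[of A "{x, y}"] by (simp add: adjacent_BT_edge)

lemma inj_mv: "invertible A \<Longrightarrow> inj (mv A)"
proof (rule injI)
  fix x y assume A: "invertible A" and eq: "mv A x = mv A y"
  from A obtain B where "B ** A = mat 1" by (rule invertible_obtain)
  then show "x = y" using mv_inverse[of B A] eq by metis
qed

lemma half_line_mv: "invertible A \<Longrightarrow> half_line BT r \<Longrightarrow> half_line BT (mv A \<circ> r)"
  unfolding half_line_def using inj_mv[of A] mv_adj[of A] mv_verts[of A]
  by (auto simp: inj_compose)

lemma half_line_to_mv:
  assumes A: "invertible A" and r: "half_line_to nrm r z"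
  shows "half_line_to nrm (mv A \<circ> r) ((*v) A ` z)"
proof -
  obtain L where L: "\<And>n. L n \<in> r n" "\<And>n. colength_one nrm (L (Suc n)) (L n)" "vec.span (\<Inter>n. L n) = z"
    using r unfolding half_line_to_def by blast
  have "vec.span (\<Inter>n. (*v) A ` L n) = vec.span ((*v) A ` (\<Inter>n. L n))"
    using invertible_inj[OF A] by (simp add: image_INT[of _ UNIV])
  also have "\<dots> = (*v) A ` z"
    using L(3) matrix_vector_mul_linear_gen[of A] by (simp add: vec.linear_span_image)
  finally have "vec.span (\<Inter>n. (*v) A ` L n) = (*v) A ` z" .
  moreover have "(*v) A ` L n \<in> (mv A \<circ> r) n" for n using L(1) by (simp add: mv_def)
  ultimately show ?thesis
    unfolding half_line_to_def using half_line_mv[OF A] r L(2) colength_image[OF A]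
    by (auto simp: half_line_to_def intro!: exI[of _ "\<lambda>n. (*v) A ` L n"])
qed

lemma straight_line_mv:
  assumes A: "invertible A" and r: "straight_line nrm c z w"
  shows "straight_line nrm (mv A \<circ> c) ((*v) A ` z) ((*v) A ` w)"
  using half_line_to_mv[OF A, of _ z] half_line_to_mv[OF A, of _ w] r inj_mv[OF A]
  unfolding straight_line_def by (auto simp: o_def inj_compose[unfolded o_def])

text \<open>Only steps to larger discs can occur. After one step to a smaller disc, a later step up
  would backtrack, so all further steps go down; then the lattices shrink in the direction of
  \<open>e1\<close> and no nonzero vector of \<open>line e1\<close> lies in all of them.\<close>

lemma half_line_to_std:
  assumes r: "half_line_to nrm r (line e1)" and r0: "r 0 = bv y n"
  shows "r k = bv y (n - int k)"
proof -
  obtain L where L: "\<And>k. L k \<in> r k" "\<And>k. colength_one nrm (L (Suc k)) (L k)" "vec.span (\<Inter>k. L k) = line e1"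
    using r unfolding half_line_to_def by blast
  have hl: "inj r" "range r \<subseteq> verts BT" using r by (auto simp: half_line_to_def half_line_def)
  have "\<exists>m y n. L k = BL m y n \<and> r k = bv y n" for k
  proof -
    obtain y n where "r k = bv y n" using hl(2) verts_BT by blast
    with L(1)[of k] show ?thesis by (auto simp: bv_def)
  qed
  then obtain M Y N where LL: "\<And>k. L k = BL (M k) (Y k) (N k)" "\<And>k. r k = bv (Y k) (N k)" by metis
  have stp: "nrm (Y (Suc k) - Y k) \<le> q powi N k \<and> M (Suc k) = M k \<and> N (Suc k) = N k + 1
     \<or> BL (M (Suc k)) (Y (Suc k)) (N (Suc k)) = BL (M k + 1) (Y k) (N k - 1)" for k
    using L(2)[of k] unfolding LL(1) by (rule colength_cases)
  have parent: "N (Suc k) = N k + 1 \<or> r (Suc k) = bv (Y k) (N k - 1)" for k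
    using stp[of k] unfolding LL(2)[of "Suc k"] by (auto simp: BL_eq bv_eq)
  obtain w where w: "w \<in> (\<Inter>k. L k)" "w \<noteq> 0"
  proof -
    have "\<not> (\<Inter>k. L k) \<subseteq> {0}"
    proof
      assume "(\<Inter>k. L k) \<subseteq> {0}"
      then have "vec.span (\<Inter>k. L k) \<subseteq> {0}" using vec.span_mono[of _ "{0}"] vec.span_insert_0[of "{}"] by auto
      moreover have "e1 \<in> vec.span (\<Inter>k. L k)" unfolding L(3) by (rule vec.span_base) simp
      ultimately show False by (auto simp: vec2_eq_iff)
    qed
    then show ?thesis using that by blast
  qed
  have "w \<in> line e1" using w(1) L(3) vec.span_base by blast
  then have w2: "w $ 2 = 0" by (auto simp: line_eq)
  then have w1: "w $ 1 \<noteq> 0" using w(2) by (simp add: vec2_eq_iff)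
  \<comment> \<open>On \<open>line e1\<close> the lattice \<open>L k\<close> is the ball of exponent
    \<open>M k + N k\<close>. A step up leaves this sum unchanged and a step down raises it.\<close>
  have wk: "nrm (w $ 1) \<le> q powi (M k + N k)" for k
  proof -
    have "w \<in> BL (M k) (Y k) (N k)" using w(1) LL(1) by blast
    then show ?thesis using w2 by (simp add: BL_def)
  qed
  have nochild: "N (Suc k) \<noteq> N k + 1" for k
  proof
    assume k: "N (Suc k) = N k + 1"
    have child: "N (Suc j) = N j + 1" if "j \<ge> k" for j
      using that
    proof (induction j rule: dec_induct)
      case base
      then show ?case by (rule k)
    next
      case (step j)
      show ?case
      proof (rule ccontr)
        assume "N (Suc (Suc j)) \<noteq> N (Suc j) + 1"
        then have "r (Suc (Suc j)) = bv (Y (Suc j)) (N j)" using parent[of "Suc j"] step.IH by simp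
        also have "\<dots> = r j"
          using stp[of j] step.IH unfolding LL(2) by (auto simp: bv_eq BL_eq)
        finally show False using hl(1) by (simp add: inj_eq)
      qed
    qed
    \<comment> \<open>From the first step down on the exponent grows by one each time, which
      contradicts the bound \<open>wk\<close> on the fixed vector \<open>w\<close>.\<close>
    have "M (Suc j) + N (Suc j) = M j + N j + 1" if "j \<ge> k" for j
      using stp[of j] child[OF that] by (auto simp: BL_eq)
    then have sum: "M (k + i) + N (k + i) = M k + N k + int i" for i
      by (induction i) (auto simp: le_add1)
    obtain K where K: "\<And>n. n \<ge> int K \<Longrightarrow> q powi n < nrm (w $ 1)" using powi_small[of "nrm (w $ 1)"] w1 by auto
    have "q powi (M k + N k + int (nat (int K - M k - N k))) < nrm (w $ 1)" by (rule K) linarith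
    then show False using wk[of "k + nat (int K - M k - N k)"] unfolding sum by linarith
  qed
  show ?thesis
  proof (induction k)
    case 0
    then show ?case using r0 by simp
  next
    case (Suc k)
    have "r (Suc k) = bv (Y k) (N k - 1)" using parent nochild by blast
    moreover have "N k = n - int k" "nrm (Y k - y) \<le> q powi (N k)"
      using Suc LL(2)[of k] by (auto simp: bv_eq nrm_minus_commute)
    ultimately show ?case using powi_le[of "N k" "N k - 1"] by (auto simp: bv_eq simp del: powi_le)
  qed
qed

lemma adj_bv: "adjacent BT (bv y n) (bv y (n + 1))" "adjacent BT (bv y (n + 1)) (bv y n)"
  unfolding adjacent_BT by (auto simp: insert_commute)

lemma half_line_up: "half_line BT (\<lambda>k. bv y (n - int k))"
  unfolding half_line_def
proof (intro conjI allI)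
  show "inj (\<lambda>k. bv y (n - int k))" by (auto simp: inj_def bv_eq)
  show "adjacent BT (bv y (n - int k)) (bv y (n - int (Suc k)))" for k
    using adj_bv(2)[of y "n - int (Suc k)"] by simp
qed auto

lemma half_line_down: "half_line BT (\<lambda>k. bv y (n + int k))"
  unfolding half_line_def
proof (intro conjI allI)
  show "inj (\<lambda>k. bv y (n + int k))" by (auto simp: inj_def bv_eq)
  show "adjacent BT (bv y (n + int k)) (bv y (n + int (Suc k)))" for k
    using adj_bv(1)[of y "n + int k"] by (simp add: algebra_simps)
qed auto

text \<open>In the chain \<open>BL k y (n - k)\<close> the bound on the second coordinate tends to 0
  while the bound on \<open>w $ 1 - w $ 2 * y\<close> stays \<open>q powi n\<close>. The
  intersection is a ball in \<open>line e1\<close>, and it contains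
  \<open>\<pi> powi n *s e1\<close>.\<close>

lemma half_line_to_e1: "half_line_to nrm (\<lambda>k. bv y (n - int k)) (line e1)"
proof -
  have col: "colength_one nrm (BL (int (Suc k)) y (n - int (Suc k))) (BL (int k) y (n - int k))" for k
    using colength_parent[of "int k" y "n - int k"] by (simp add: algebra_simps)
  have I: "(\<Inter>k. BL (int k) y (n - int k)) = {w. w $ 2 = 0 \<and> nrm (w $ 1) \<le> q powi n}"
  proof (intro equalityI subsetI)
    fix w assume w: "w \<in> (\<Inter>k. BL (int k) y (n - int k))"
    have "w $ 2 = 0"
    proof (rule ccontr)
      assume "w $ 2 \<noteq> 0"
      then obtain K where "\<And>n. n \<ge> int K \<Longrightarrow> q powi n < nrm (w $ 2)" using powi_small[of "nrm (w $ 2)"] by auto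
      from this[of "int K"] w show False by (auto simp: BL_def not_le[symmetric])
    qed
    then show "w \<in> {w. w $ 2 = 0 \<and> nrm (w $ 1) \<le> q powi n}" using w by (auto simp: BL_def)
  qed (auto simp: BL_def)
  have "vec.span (\<Inter>k. BL (int k) y (n - int k)) = line e1"
  proof (intro equalityI)
    have "(\<Inter>k. BL (int k) y (n - int k)) \<subseteq> line e1"
      unfolding I line_eq by (auto simp: vec2_eq_iff image_iff)
    then show "vec.span (\<Inter>k. BL (int k) y (n - int k)) \<subseteq> line e1"
      by (rule vec.span_minimal) (rule vec.subspace_span)
    have "(\<pi> powi n) *s e1 \<in> (\<Inter>k. BL (int k) y (n - int k))" unfolding I by (simp add: nrm_powi)
    then have "inverse (\<pi> powi n) *s ((\<pi> powi n) *s e1) \<in> vec.span (\<Inter>k. BL (int k) y (n - int k))"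
      by (intro vec.span_scale vec.span_base)
    then have "e1 \<in> vec.span (\<Inter>k. BL (int k) y (n - int k))" by (simp add: vector_smult_assoc)
    then show "line e1 \<subseteq> vec.span (\<Inter>k. BL (int k) y (n - int k))"
      by (intro vec.span_minimal) (auto simp: vec.subspace_span)
  qed
  then show ?thesis unfolding half_line_to_def using half_line_up col
    by (intro conjI exI[of _ "\<lambda>k. BL (int k) y (n - int k)"]) (auto simp: bv_def)
qed

lemma half_line_to_e2: "half_line_to nrm (\<lambda>k. bv 0 (n + int k)) (line e2)"
proof -
  have col: "colength_one nrm (BL 0 0 (n + int (Suc k))) (BL 0 0 (n + int k))" for k
    using colength_child[of 0 0 "n + int k"] by (simp add: algebra_simps)
  have I: "(\<Inter>k. BL 0 0 (n + int k)) = {w. w $ 1 = 0 \<and> nrm (w $ 2) \<le> 1}"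
  proof (intro equalityI subsetI)
    fix w assume w: "w \<in> (\<Inter>k. BL 0 0 (n + int k))"
    have "w $ 1 = 0"
    proof (rule ccontr)
      assume "w $ 1 \<noteq> 0"
      then obtain K where "\<And>n. n \<ge> int K \<Longrightarrow> q powi n < nrm (w $ 1)" using powi_small[of "nrm (w $ 1)"] by auto
      then have "q powi (n + int (nat (int K - n))) < nrm (w $ 1)" by auto
      moreover have "w \<in> BL 0 0 (n + int (nat (int K - n)))" using w by blast
      ultimately show False by (auto simp: BL_def)
    qed
    then show "w \<in> {w. w $ 1 = 0 \<and> nrm (w $ 2) \<le> 1}" using w by (auto simp: BL_def)
  qed (auto simp: BL_def)
  have "vec.span (\<Inter>k. BL 0 0 (n + int k)) = line e2"
  proof (intro equalityI)
    have "(\<Inter>k. BL 0 0 (n + int k)) \<subseteq> line e2"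
      unfolding I line_eq by (auto simp: vec2_eq_iff image_iff)
    then show "vec.span (\<Inter>k. BL 0 0 (n + int k)) \<subseteq> line e2"
      by (rule vec.span_minimal) (rule vec.subspace_span)
    have "e2 \<in> (\<Inter>k. BL 0 0 (n + int k))" unfolding I by simp
    then have "e2 \<in> vec.span (\<Inter>k. BL 0 0 (n + int k))" by (rule vec.span_base)
    then show "line e2 \<subseteq> vec.span (\<Inter>k. BL 0 0 (n + int k))"
      by (intro vec.span_minimal) (auto simp: vec.subspace_span)
  qed
  then show ?thesis unfolding half_line_to_def using half_line_down col
    by (intro conjI exI[of _ "\<lambda>k. BL 0 0 (n + int k)"]) (auto simp: bv_def)
qed

lemma straight_line_std: "straight_line nrm (bv 0) (line e1) (line e2)"
  unfolding straight_line_def using half_line_to_e1[of 0 0] half_line_to_e2[of 0]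
  by (auto simp: inj_def bv_eq)

lemma half_line_to_frame:
  assumes P: "invertible P" and r: "half_line_to nrm r (line (P *v e1))"
  shows "\<exists>y n. \<forall>k. r k = mv P (bv y (n - int k))"
proof -
  obtain Q where Q: "P ** Q = mat 1" "Q ** P = mat 1" "invertible Q" using P by (rule invertible_obtain)
  have "half_line_to nrm (mv Q \<circ> r) ((*v) Q ` line (P *v e1))" using half_line_to_mv Q r by blast
  then have hl: "half_line_to nrm (mv Q \<circ> r) (line e1)"
    using Q by (simp add: image_line matrix_vector_mul_assoc)
  then have "(mv Q \<circ> r) 0 \<in> verts BT" by (auto simp: half_line_to_def half_line_def)
  then obtain y n where "(mv Q \<circ> r) 0 = bv y n" using verts_BT by blast
  then have "mv Q (r k) = bv y (n - int k)" for k using half_line_to_std[OF hl] by auto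
  then have "r k = mv P (bv y (n - int k))" for k using mv_inverse[OF Q(1)] by metis
  then show ?thesis by blast
qed

text \<open>In a frame where the end is \<open>line e1\<close> both half-lines are chains of growing
  discs, and they agree from the first level at which one disc contains both centres.\<close>

lemma half_line_to_tail:
  assumes z: "z \<in> P1" and rs: "half_line_to nrm r z" "half_line_to nrm s z"
  shows "\<exists>a b. \<forall>k. r (a + k) = s (b + k)"
proof -
  obtain P where P: "invertible P" "z = line (P *v e1)" using P1_frame1 z by blast
  obtain y n y' n' where yn: "\<And>k. r k = mv P (bv y (n - int k))" "\<And>k. s k = mv P (bv y' (n' - int k))"
    using half_line_to_frame[OF P(1)] rs P(2) by metis
  obtain m where m: "nrm (y - y') \<le> q powi m" "m \<le> n" "m \<le> n'"
  proof (cases "y = y'")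
    case True
    then show ?thesis using that[of "min n n'"] by auto
  next
    case False
    then obtain j where "nrm (y - y') = q powi j" using nrm_value[of "y - y'"] by auto
    then show ?thesis using that[of "min j (min n n')"] by auto
  qed
  have "bv y (m - int k) = bv y' (m - int k)" for k
    using m(1) powi_le[of m "m - int k"] by (intro bv_cong) linarith
  then have "r (nat (n - m) + k) = s (nat (n' - m) + k)" for k
    using m by (simp add: yn algebra_simps)
  then show ?thesis by blast
qed

lemma line_exists:
  assumes "z \<in> P1" "w \<in> P1" "z \<noteq> w"
  shows "\<exists>c. straight_line nrm c z w"
proof -
  obtain P where P: "invertible P" "z = line (P *v e1)" "w = line (P *v e2)" using P1_frame assms by blast
  then show ?thesis using straight_line_mv[OF P(1) straight_line_std] by (auto simp: image_line)
qed

end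

section \<open>Ends of the Bruhat--Tits tree\<close>

context dvf
begin

lemma nrm_not_neg [simp]: "\<not> nrm x < 0"
  by (simp add: not_less)

sublocale bt: simp_tree "verts (BT_tree nrm)" "adjacent (BT_tree nrm)"
  by (rule tree_simp_tree[OF tree_BT])

text \<open>One half-line suffices as a test: any other one to the same point of \<open>P1\<close>
  has a common tail with it, by \<open>half_line_to_tail\<close>.\<close>

definition end_of :: "'k bt_vertex set \<Rightarrow> ('k^2) set \<Rightarrow> bool" where
  "end_of S z \<longleftrightarrow> (\<exists>r. half_line_to nrm r z \<and> (\<forall>n. r n \<in> S))"

lemma half_line_toD:
  assumes "half_line_to nrm r z"
  shows "inj r" "r n \<in> verts BT" "adjacent BT (r n) (r (Suc n))"
  using assms by (auto simp: half_line_to_def half_line_def)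

lemma end_of_tail:
  assumes "z \<in> P1" "end_of S z" "half_line_to nrm r z"
  shows "\<exists>N. \<forall>n\<ge>N. r n \<in> S"
proof -
  obtain s where s: "half_line_to nrm s z" "\<And>n. s n \<in> S" using assms by (auto simp: end_of_def)
  obtain a b where "\<And>k. r (a + k) = s (b + k)" using half_line_to_tail assms s by metis
  then have "r n \<in> S" if "n \<ge> a" for n using s(2) that by (metis le_add_diff_inverse)
  then show ?thesis by blast
qed

lemma end_of_ray:
  assumes "z \<in> P1" "end_of S z" "half_line_to nrm r z" "bt.convex S" "r 0 \<in> S"
  shows "r n \<in> S"
proof -
  obtain N where N: "\<And>n. n \<ge> N \<Longrightarrow> r n \<in> S" using end_of_tail assms by meson
  have "bt.geo (map r [0..<Suc (max n N)]) (r 0) (r (max n N))"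
    using bt.geo_ray half_line_toD[OF assms(3)] by blast
  then have "set (map r [0..<Suc (max n N)]) \<subseteq> S"
    using bt.convex_geo[OF assms(4,5) N] by (meson max.cobounded2)
  then have "r ` {0..<Suc (max n N)} \<subseteq> S" by (simp del: upt_Suc)
  then show ?thesis by force
qed

lemma straight_line_adj:
  assumes "straight_line nrm c z w"
  shows "adjacent BT (c i) (c (i + 1))"
proof (cases "i \<ge> 0")
  case True
  have "adjacent BT (c (int (nat i))) (c (int (Suc (nat i))))"
    using assms half_line_toD(3) unfolding straight_line_def by blast
  then show ?thesis using True by (simp add: add.commute)
next
  case False
  have "adjacent BT (c (- int (nat (- i - 1)))) (c (- int (Suc (nat (- i - 1)))))"
    using assms half_line_toD(3)[of "\<lambda>n. c (- int n)"] unfolding straight_line_def by blast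
  then have "adjacent BT (c (i + 1)) (c i)" using False by (simp add: add.commute)
  then show ?thesis by (rule adjacent_commute[THEN iffD1])
qed

lemma line_between:
  assumes c: "inj c" "\<And>i. adjacent BT (c i) (c (i + 1))" and S: "bt.convex S"
    and ij: "c i \<in> S" "c j \<in> S" "i \<le> k" "k \<le> j"
  shows "c (k :: int) \<in> S"
proof -
  define r where "r n = c (i + int n)" for n
  have "inj r" using c(1) by (auto simp: r_def inj_eq intro!: injI)
  moreover have "adjacent BT (r n) (r (Suc n))" for n using c(2)[of "i + int n"] by (simp add: r_def algebra_simps)
  ultimately have "bt.geo (map r [0..<Suc (nat (j - i))]) (r 0) (r (nat (j - i)))"
    using bt.geo_ray by blast
  then have "set (map r [0..<Suc (nat (j - i))]) \<subseteq> S"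
    using ij by (intro bt.convex_geo[OF S]) (auto simp: r_def)
  then have "r (nat (k - i)) \<in> S" using ij by (auto simp del: upt_Suc)
  then show ?thesis using ij by (simp add: r_def)
qed

lemma line_in:
  assumes S: "bt.convex S" and zw: "z \<in> P1" "w \<in> P1" "end_of S z" "end_of S w"
    and c: "straight_line nrm c z w"
  shows "c i \<in> S"
proof -
  obtain N where N: "\<And>n. n \<ge> N \<Longrightarrow> c (- int n) \<in> S"
    using end_of_tail[OF zw(1,3)] c unfolding straight_line_def by blast
  obtain M where M: "\<And>n. n \<ge> M \<Longrightarrow> c (int n) \<in> S"
    using end_of_tail[OF zw(2,4)] c unfolding straight_line_def by blast
  have in_S: "c (- int (max N (nat \<bar>i\<bar>))) \<in> S" "c (int (max M (nat \<bar>i\<bar>))) \<in> S" using N M by auto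
  have "inj c" using c by (simp add: straight_line_def)
  then show ?thesis by (rule line_between[OF _ straight_line_adj[OF c] S in_S]) linarith+
qed

lemma straight_line_ends:
  assumes "straight_line nrm c z w" "range c \<subseteq> S"
  shows "end_of S z" "end_of S w"
  using assms unfolding straight_line_def end_of_def by (blast, blast)

text \<open>Vertex stabilizers contain a neighbourhood of the identity. For small \<open>E\<close>
  the matrix \<open>mat 1 + E\<close> maps a lattice into itself; its inverse is
  \<open>mat 1 + E'\<close> with \<open>E'\<close> equally small, so equality holds.\<close>

lemma bv_fixed_small:
  "\<exists>\<epsilon>>0. \<forall>E. (\<forall>i j. nrm (E $ i $ j) \<le> \<epsilon>) \<longrightarrow>
      invertible (mat 1 + E) \<and> mv (mat 1 + E) (bv y n) = bv y n"
proof -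
  \<comment> \<open>The second factor bounds the coordinates of vectors in \<open>BL 0 y n\<close>;
    the first accounts for the multiplication by \<open>y\<close> in the congruence that defines the
    lattice.\<close>
  define R where "R = max 1 (nrm y) * max 1 (max (nrm y) (q powi n))"
  have R: "R \<ge> 1" unfolding R_def using mult_mono[of 1 "max 1 (nrm y)" 1] by simp
  define \<epsilon> where "\<epsilon> = min (q powi n) (q) / R"
  have e0: "\<epsilon> > 0" using R q_pos by (simp add: \<epsilon>_def)
  have eq: "\<epsilon> \<le> q" "\<epsilon> < 1"
    using R q_pos q_lt unfolding \<epsilon>_def by (auto simp: divide_le_eq divide_less_eq min_def intro: order_trans)
  have eR: "\<epsilon> * R \<le> 1" "\<epsilon> * R \<le> q powi n" using R q_lt by (auto simp: \<epsilon>_def)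
  have sub: "(*v) (mat 1 + E) ` BL 0 y n \<subseteq> BL 0 y n" if E: "\<And>i j. nrm (E $ i $ j) \<le> \<epsilon>" for E :: "'k^2^2"
  proof
    fix w' assume "w' \<in> (*v) (mat 1 + E) ` BL 0 y n"
    then obtain w where w: "w \<in> BL 0 y n" "w' = (mat 1 + E) *v w" by blast
    define u v where "u = w $ 1" "v = w $ 2"
    have uv: "nrm v \<le> 1" "nrm (u - v * y) \<le> q powi n" using w(1) by (auto simp: BL_def u_v_def)
    define S where "S = max 1 (max (nrm y) (q powi n))"
    have "nrm (v * y) \<le> nrm y" using uv(1) by (simp add: nrm_mult mult_left_le_one_le)
    then have "nrm ((u - v * y) + v * y) \<le> max (nrm y) (q powi n)"
      using uv by (intro nrm_add_le) auto
    then have u: "nrm u \<le> S" and v: "nrm v \<le> S" using uv(1) by (auto simp: S_def)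
    have S0: "S \<ge> 0" by (simp add: S_def)
    have row: "nrm (E $ i $ 1 * u + E $ i $ 2 * v) \<le> \<epsilon> * S" for i
      using E u v e0 S0 by (intro nrm_add_le) (auto simp: nrm_mult intro!: mult_mono)
    have SR: "\<epsilon> * S \<le> \<epsilon> * R" "nrm y * (\<epsilon> * S) \<le> \<epsilon> * R"
    proof -
      have "1 * S \<le> R" "nrm y * S \<le> R" unfolding R_def S_def by (intro mult_right_mono; simp)+
      then show "\<epsilon> * S \<le> \<epsilon> * R" "nrm y * (\<epsilon> * S) \<le> \<epsilon> * R"
        using e0 by (simp_all add: mult.left_commute[of "nrm y"])
    qed
    have w': "w' $ 1 = u + (E $ 1 $ 1 * u + E $ 1 $ 2 * v)" "w' $ 2 = v + (E $ 2 $ 1 * u + E $ 2 $ 2 * v)"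
      by (simp_all add: w(2) matvec_nth mat_nth2 u_v_def algebra_simps)
    have row1: "nrm (E $ 1 $ 1 * u + E $ 1 $ 2 * v) \<le> q powi n" using row[of 1] SR eR by linarith
    have row2: "nrm (E $ 2 $ 1 * u + E $ 2 $ 2 * v) \<le> 1" using row[of 2] SR eR by linarith
    have "nrm (w' $ 2) \<le> 1" unfolding w' by (rule nrm_add_le[OF uv(1) row2])
    moreover have "w' $ 1 - w' $ 2 * y =
        (u - v * y) + ((E $ 1 $ 1 * u + E $ 1 $ 2 * v) - y * (E $ 2 $ 1 * u + E $ 2 $ 2 * v))"
      by (simp add: w' algebra_simps)
    moreover have "nrm (y * (E $ 2 $ 1 * u + E $ 2 $ 2 * v)) \<le> q powi n"
      using mult_left_mono[OF row[of 2], of "nrm y"] SR eR by (simp add: nrm_mult)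
    then have "nrm ((u - v * y) + ((E $ 1 $ 1 * u + E $ 1 $ 2 * v) - y * (E $ 2 $ 1 * u + E $ 2 $ 2 * v))) \<le> q powi n"
      by (rule nrm_add_le[OF uv(2) nrm_diff_le[OF row1]])
    ultimately show "w' \<in> BL 0 y n" by (simp add: BL_def)
  qed
  have main: "invertible (mat 1 + E) \<and> mv (mat 1 + E) (bv y n) = bv y n"
    if E: "\<And>i j. nrm (E $ i $ j) \<le> \<epsilon>" for E :: "'k^2^2"
  proof -
    define a b c d where abcd: "a = E $ 1 $ 1" "b = E $ 1 $ 2" "c = E $ 2 $ 1" "d = E $ 2 $ 2"
    have le: "nrm a \<le> \<epsilon>" "nrm b \<le> \<epsilon>" "nrm c \<le> \<epsilon>" "nrm d \<le> \<epsilon>" using E by (auto simp: abcd)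
    define s where "s = a * d - b * c"
    have prod: "nrm (x * z) \<le> \<epsilon>" if "nrm x \<le> \<epsilon>" "nrm z \<le> \<epsilon>" for x z
      using that mult_mono[of "nrm x" \<epsilon> "nrm z" 1] e0 eq by (simp add: nrm_mult)
    have s: "nrm s \<le> \<epsilon>" unfolding s_def using prod le by (intro nrm_diff_le) auto
    define D where "D = 1 + (a + d + s)"
    have D1: "nrm (a + d + s) \<le> \<epsilon>" using le s by (intro nrm_add_le)
    have D: "nrm D = 1"
    proof (rule antisym)
      show "nrm D \<le> 1" unfolding D_def using D1 eq by (auto intro: nrm_add_le[of 1])
      have "nrm (D - (a + d + s)) \<le> max (nrm D) (nrm (a + d + s))" by (rule nrm_diff)
      then show "1 \<le> nrm D" using D1 eq by (simp add: D_def)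
    qed
    then have D0: "D \<noteq> 0" by auto
    have EM: "mat 1 + E = M2 (1 + a) b c (1 + d)" by (simp add: mat2_eq_iff mat_nth2 abcd)
    have det: "(1 + a) * (1 + d) - b * c = D" by (simp add: D_def s_def algebra_simps)
    \<comment> \<open>The adjugate of \<open>mat 1 + E\<close> divided by its determinant
      \<open>D\<close>, minus the identity; for instance
      \<open>(1 + d) / D - 1 = - (a + s) / D\<close>.\<close>
    define E' where "E' = M2 (- (a + s) / D) (- b / D) (- c / D) (- (d + s) / D)"
    have E': "nrm (E' $ i $ j) \<le> \<epsilon>" for i j
      using le s D exhaust_2[of i] exhaust_2[of j]
      by (auto simp: E'_def nrm_divide intro!: nrm_add_le simp del: minus_add_distrib)
    have inv: "(mat 1 + E) ** (mat 1 + E') = mat 1"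
    proof -
      have *: "mat 1 + E' = M2 ((1 + d) / D) (- b / D) (- c / D) ((1 + a) / D)"
        using D0 by (simp add: mat2_eq_iff mat_nth2 E'_def field_simps) (simp add: D_def algebra_simps)
      show ?thesis unfolding * EM using D0 det
        by (simp add: mat2_eq_iff matmat_nth mat_nth2 add_divide_distrib[symmetric] diff_divide_distrib[symmetric] mult.commute)
    qed
    have i: "invertible (mat 1 + E)" using D0 det by (simp add: EM)
    have "BL 0 y n \<subseteq> (*v) (mat 1 + E) ` BL 0 y n"
    proof
      fix w assume "w \<in> BL 0 y n"
      then have "(mat 1 + E') *v w \<in> BL 0 y n" using sub[OF E'] by blast
      moreover have "w = (mat 1 + E) *v ((mat 1 + E') *v w)"
        unfolding matrix_vector_mul_assoc inv by simp
      ultimately show "w \<in> (*v) (mat 1 + E) ` BL 0 y n" by (rule rev_image_eqI)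
    qed
    then have "(*v) (mat 1 + E) ` BL 0 y n = BL 0 y n" using sub[OF E] by blast
    then have "mv (mat 1 + E) (bv y n) = bv y n"
      by (metis mv_similarity_class similarity_class_BL)
    with i show ?thesis by blast
  qed
  show ?thesis using e0 main by blast
qed

section \<open>Open sets of vectors, matrices and lines in coordinates\<close>

abbreviation dv :: "'k^2 \<Rightarrow> 'k^2 \<Rightarrow> real" where "dv \<equiv> \<lambda>x y. MAX i. nrm (x $ i - y $ i)"
abbreviation dm :: "'k^2^2 \<Rightarrow> 'k^2^2 \<Rightarrow> real" where "dm \<equiv> \<lambda>A B. MAX i. MAX j. nrm (A $ i $ j - B $ i $ j)"

lemma Max2: "(MAX i::2. f i) = max (f 1) (f 2 :: real)"
proof -
  have "range f = {f 1, f 2}" unfolding UNIV_2 by simp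
  then show ?thesis by simp
qed

lemma metric_vec: "Metric_space UNIV dv"
proof
  fix x y z
  show "0 \<le> dv x y" by (simp add: Max2 le_max_iff_disj)
  show "dv x y = dv y x" by (simp add: nrm_minus_commute)
  show "(dv x y = 0) = (x = y)"
  proof
    assume "dv x y = 0"
    then have "nrm (x $ 1 - y $ 1) \<le> 0" "nrm (x $ 2 - y $ 2) \<le> 0" by (simp_all add: Max2 max_def split: if_splits)
    then have "nrm (x $ 1 - y $ 1) = 0" "nrm (x $ 2 - y $ 2) = 0"
      using nrm_ge0[of "x $ 1 - y $ 1"] nrm_ge0[of "x $ 2 - y $ 2"] by linarith+
    then show "x = y" by (simp add: vec2_eq_iff)
  qed (simp add: Max2)
  have "nrm (x $ i - z $ i) \<le> nrm (x $ i - y $ i) + nrm (y $ i - z $ i)" for i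
  proof -
    have "x $ i - z $ i = (x $ i - y $ i) + (y $ i - z $ i)" by simp
    then have "nrm (x $ i - z $ i) \<le> max (nrm (x $ i - y $ i)) (nrm (y $ i - z $ i))" by (metis nrm_add)
    then show ?thesis using nrm_ge0[of "x $ i - y $ i"] nrm_ge0[of "y $ i - z $ i"] by linarith
  qed
  from this[of 1] this[of 2] show "dv x z \<le> dv x y + dv y z" by (simp add: Max2 max_def)
qed

lemma metric_mat: "Metric_space UNIV dm"
proof
  fix A B C :: "'k^2^2"
  have *: "dm A B = max (dv (A $ 1) (B $ 1)) (dv (A $ 2) (B $ 2))" for A B by (simp add: Max2)
  interpret V: Metric_space UNIV dv by (rule metric_vec)
  show "0 \<le> dm A B" unfolding * using V.nonneg by (simp add: le_max_iff_disj)
  show "dm A B = dm B A" by (simp add: nrm_minus_commute)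
  show "(dm A B = 0) = (A = B)"
  proof
    assume "dm A B = 0"
    then have "dv (A $ 1) (B $ 1) = 0" "dv (A $ 2) (B $ 2) = 0"
      unfolding * using V.nonneg[of "A $ 1" "B $ 1"] V.nonneg[of "A $ 2" "B $ 2"] by linarith+
    then have "A $ 1 = B $ 1" "A $ 2 = B $ 2" by (simp_all only: V.zero UNIV_I)
    then show "A = B" by (simp add: mat2_eq_iff)
  qed (simp add: Max2)
  have "dv (A $ i) (C $ i) \<le> dv (A $ i) (B $ i) + dv (B $ i) (C $ i)" for i
    by (rule V.triangle) auto
  from this[of 1] this[of 2] show "dm A C \<le> dm A B + dm B C" unfolding * by linarith
qed

lemma dv_less: "dv x y < e \<longleftrightarrow> (\<forall>i. nrm (x $ i - y $ i) < e)"
  by (simp add: Max2 forall_2)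

lemma dm_less: "dm A B < e \<longleftrightarrow> (\<forall>i j. nrm (A $ i $ j - B $ i $ j) < e)"
  by (simp add: Max2 forall_2)

lemma openin_vec: "openin (vec_topology nrm) U \<longleftrightarrow>
    (\<forall>x\<in>U. \<exists>r>0. \<forall>y. (\<forall>i. nrm (x $ i - y $ i) < r) \<longrightarrow> y \<in> U)"
proof -
  interpret V: Metric_space UNIV dv by (rule metric_vec)
  show ?thesis unfolding vec_topology_def V.openin_mtopology V.mball_def dv_less by (auto simp: subset_iff)
qed

lemma openin_mat: "openin (mat_topology nrm) U \<longleftrightarrow>
    (\<forall>A\<in>U. \<exists>r>0. \<forall>B. (\<forall>i j. nrm (A $ i $ j - B $ i $ j) < r) \<longrightarrow> B \<in> U)"
proof -
  interpret V: Metric_space UNIV dm by (rule metric_mat)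
  show ?thesis unfolding mat_topology_def V.openin_mtopology V.mball_def dm_less by (auto simp: subset_iff)
qed

lemma topspace_vec [simp]: "topspace (vec_topology nrm) = UNIV"
  unfolding vec_topology_def by (simp add: Metric_space.topspace_mtopology[OF metric_vec])

lemma topspace_mat [simp]: "topspace (mat_topology nrm) = UNIV"
  unfolding mat_topology_def by (simp add: Metric_space.topspace_mtopology[OF metric_mat])

lemma openin_P1:
  assumes "openin (vec_topology nrm) {x. x \<noteq> 0 \<and> line x \<in> U}" "U \<subseteq> P1"
  shows "openin (P1_topology nrm) U"
  unfolding P1_topology_def openin_quotient_topology
proof (intro conjI)
  show "U \<subseteq> (\<lambda>x. line x) ` topspace (subtopology (vec_topology nrm) (- {0}))"
    using assms(2) by (auto simp: P1_def)
  have "{x \<in> topspace (subtopology (vec_topology nrm) (- {0})). line x \<in> U} = {x. x \<noteq> 0 \<and> line x \<in> U}"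
    by auto
  then show "openin (subtopology (vec_topology nrm) (- {0}))
     {x \<in> topspace (subtopology (vec_topology nrm) (- {0})). line x \<in> U}"
    using assms(1) by (auto simp: openin_subtopology intro!: exI[of _ "{x. x \<noteq> 0 \<and> line x \<in> U}"])
qed

lemma openin_vec_nonzero: "openin (vec_topology nrm) (- {0})"
  unfolding openin_vec
proof (intro ballI)
  fix x :: "'k^2" assume "x \<in> - {0}"
  then obtain i where i: "x $ i \<noteq> 0" by (auto simp: vec_eq_iff)
  have "y \<in> - {0}" if "\<forall>i. nrm (x $ i - y $ i) < nrm (x $ i)" for y
    using that[rule_format, of i] by auto
  then have "\<forall>y. (\<forall>j. nrm (x $ j - y $ j) < nrm (x $ i)) \<longrightarrow> y \<in> - {0}"
    by (metis Compl_iff diff_zero less_irrefl singletonD zero_index)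
  then show "\<exists>r>0. \<forall>y. (\<forall>i. nrm (x $ i - y $ i) < r) \<longrightarrow> y \<in> - {0}" using i nrm_pos by blast
qed

lemma openin_P1D:
  assumes "openin (P1_topology nrm) U"
  shows "openin (vec_topology nrm) {x. x \<noteq> 0 \<and> line x \<in> U}" "U \<subseteq> P1"
proof -
  have U: "U \<subseteq> (\<lambda>x. line x) ` (- {0})"
    "openin (subtopology (vec_topology nrm) (- {0})) {x \<in> - {0}. line x \<in> U}"
    using assms unfolding P1_topology_def openin_quotient_topology by simp_all
  show "U \<subseteq> P1" using U(1) by (auto simp: P1_def)
  have "openin (vec_topology nrm) {x \<in> - {0}. line x \<in> U}"
    using U(2) openin_vec_nonzero openin_trans_full by blast
  then show "openin (vec_topology nrm) {x. x \<noteq> 0 \<and> line x \<in> U}" by simp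
qed

lemma topspace_P1: "topspace (P1_topology nrm) = P1"
proof
  show "topspace (P1_topology nrm) \<subseteq> P1" using openin_P1D(2) openin_topspace by blast
  have "{x :: 'k^2. x \<noteq> 0 \<and> line x \<in> P1} = - {0}" by (auto intro: P1_line)
  then have "openin (vec_topology nrm) {x. x \<noteq> 0 \<and> line x \<in> P1}"
    using openin_vec_nonzero by (simp only:)
  then have "openin (P1_topology nrm) P1" by (rule openin_P1) simp
  then show "P1 \<subseteq> topspace (P1_topology nrm)" by (rule openin_subset)
qed

lemma matvec_bound:
  fixes A :: "'k^2^2"
  assumes "\<And>i j. nrm (A $ i $ j) \<le> C" "\<And>i. nrm (x $ i) < r" "C > 0"
  shows "nrm ((A *v x) $ i) < C * r"
proof -
  have "nrm (A $ i $ j * x $ j) < C * r" for j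
  proof -
    have "nrm (A $ i $ j * x $ j) \<le> C * nrm (x $ j)"
      using assms(1)[of i j] by (simp add: nrm_mult mult_right_mono)
    also have "\<dots> < C * r" using assms(2)[of j] assms(3) by simp
    finally show ?thesis .
  qed
  from this[of 1] this[of 2]
  show ?thesis unfolding matvec_nth using nrm_add[of "A $ i $ 1 * x $ 1" "A $ i $ 2 * x $ 2"]
    by linarith
qed

lemma entry_bound: "\<exists>C>0. \<forall>i j. nrm ((A :: 'k^2^2) $ i $ j) \<le> C"
  by (rule exI[of _ "1 + nrm (A$1$1) + nrm (A$1$2) + nrm (A$2$1) + nrm (A$2$2)"])
     (auto simp: forall_2 add_nonneg_nonneg add_pos_nonneg)

lemma openin_preimage_linear:
  assumes "openin (vec_topology nrm) U"
  shows "openin (vec_topology nrm) ((*v) A -` U)"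
  unfolding openin_vec
proof
  fix x assume "x \<in> (*v) A -` U"
  then obtain r where r: "r > 0" "\<And>y. (\<forall>i. nrm ((A *v x) $ i - y $ i) < r) \<Longrightarrow> y \<in> U"
    using assms unfolding openin_vec by blast
  obtain C where C: "C > 0" "\<And>i j. nrm (A $ i $ j) \<le> C" using entry_bound by blast
  have "y \<in> (*v) A -` U" if y: "\<forall>i. nrm (x $ i - y $ i) < r / C" for y
  proof -
    have "nrm ((A *v (x - y)) $ i) < C * (r / C)" for i using C y by (intro matvec_bound) auto
    then have "nrm ((A *v x) $ i - (A *v y) $ i) < r" for i
      using C(1) by (simp add: matrix_vector_mult_diff_distrib)
    then show ?thesis using r(2) by auto
  qed
  then show "\<exists>r>0. \<forall>y. (\<forall>i. nrm (x $ i - y $ i) < r) \<longrightarrow> y \<in> (*v) A -` U"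
    using C r by (intro exI[of _ "r / C"]) auto
qed

text \<open>Continuity of the projective action. Openness is checked on representing vectors, where
  the map is linear and \<open>openin_preimage_linear\<close> applies.\<close>

lemma closure_act:
  assumes A: "invertible A" and F: "F \<subseteq> P1" and z: "z \<in> P1_topology nrm closure_of F"
  shows "(*v) A ` z \<in> P1_topology nrm closure_of ((`) ((*v) A) ` F)"
proof -
  have zP: "z \<in> P1" using z unfolding in_closure_of topspace_P1 by (rule conjunct1)
  then obtain x where x: "x \<noteq> 0" "z = line x" by (auto simp: P1_def)
  have img: "(*v) A ` line v = line (A *v v)" for v by (rule image_line)
  show ?thesis unfolding in_closure_of topspace_P1
  proof (intro conjI allI impI)
    show "(*v) A ` z \<in> P1" using x A by (simp add: img P1_line matvec_zero_iff)
    fix U assume U: "(*v) A ` z \<in> U \<and> openin (P1_topology nrm) U"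
    define W where "W = {w \<in> P1. (*v) A ` w \<in> U}"
    have "{v. v \<noteq> 0 \<and> line v \<in> W} = (*v) A -` {v. v \<noteq> 0 \<and> line v \<in> U}"
      using A by (auto simp: W_def img matvec_zero_iff intro: P1_line)
    moreover have "openin (vec_topology nrm) {v. v \<noteq> 0 \<and> line v \<in> U}" using openin_P1D(1) U by blast
    then have "openin (vec_topology nrm) ((*v) A -` {v. v \<noteq> 0 \<and> line v \<in> U})"
      by (rule openin_preimage_linear)
    ultimately have "openin (vec_topology nrm) {v. v \<noteq> 0 \<and> line v \<in> W}" by (simp only:)
    then have "openin (P1_topology nrm) W" by (rule openin_P1) (simp add: W_def)
    moreover have "z \<in> W" using U zP by (simp add: W_def)
    ultimately obtain f where "f \<in> F" "f \<in> W" using z unfolding in_closure_of by blast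
    then show "\<exists>y. y \<in> (`) ((*v) A) ` F \<and> y \<in> U" by (auto simp: W_def)
  qed
qed

text \<open>Let \<open>r\<close> be the half-line from a point \<open>x\<close> of \<open>S\<close>
  to \<open>z\<close>. For each \<open>k\<close>, the points near \<open>z\<close> are images of
  \<open>z\<close> under unipotent matrices so close to the identity that they fix \<open>x\<close>
  and \<open>r k\<close>. Hence the half-line from \<open>x\<close> to such a point of
  \<open>F\<close> passes through \<open>r k\<close>; it lies in \<open>S\<close> by
  convexity.\<close>

lemma closure_end:
  assumes S: "bt.convex S" "S \<noteq> {}" and F: "F \<subseteq> P1" "\<And>f. f \<in> F \<Longrightarrow> end_of S f"
    and z: "z \<in> P1_topology nrm closure_of F"
  shows "end_of S z"
proof -
  have "z \<in> P1" using z unfolding in_closure_of topspace_P1 by (rule conjunct1)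
  then obtain P where P: "invertible P" "z = line (P *v e1)" using P1_frame1 by blast
  obtain Q where Q: "P ** Q = mat 1" "Q ** P = mat 1" "invertible Q" using P(1) by (rule invertible_obtain)
  obtain x where x: "x \<in> S" "x \<in> verts BT" using S by (auto simp: bt.convex_def)
  then obtain y n where yn: "mv Q x = bv y n" using mv_verts[OF Q(3)] verts_BT by blast
  then have x0: "x = mv P (bv y n)" using mv_inverse[OF Q(1)] by metis
  define r where "r k = mv P (bv y (n - int k))" for k
  have hl: "half_line_to nrm r z"
    using half_line_to_mv[OF P(1) half_line_to_e1] unfolding r_def P(2) by (simp add: o_def image_line)
  have "r k \<in> S" for k
  proof -
    have "\<exists>\<epsilon>>0. \<forall>E. (\<forall>i j. nrm (E $ i $ j) \<le> \<epsilon>) \<longrightarrow>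
        invertible (mat 1 + E) \<and> mv (mat 1 + E) (bv y (n - int j)) = bv y (n - int j)" for j
      by (rule bv_fixed_small)
    then obtain \<epsilon> where \<epsilon>: "\<And>j. \<epsilon> j > 0" "\<And>j E. (\<forall>i l. nrm (E $ i $ l) \<le> \<epsilon> j) \<Longrightarrow>
        invertible (mat 1 + E) \<and> mv (mat 1 + E) (bv y (n - int j)) = bv y (n - int j)" by metis
    define e where "e = min (\<epsilon> 0) (\<epsilon> k)"
    have e0: "e > 0" using \<epsilon> by (simp add: e_def)
    \<comment> \<open>In the frame \<open>P\<close> the point \<open>z\<close> is
      \<open>line e1\<close>, and \<open>U\<close> is a ball around it in the affine chart. On
      representing vectors it becomes the cone where the second coordinate is small relative to the
      first, which is open.\<close>
    define U where "U = {line (P *v vector [1, b]) | b. nrm b < e}"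
    have U: "{v. v \<noteq> 0 \<and> line v \<in> U} = (*v) Q -` {w. nrm (w $ 2) < e * nrm (w $ 1)}"
    proof (intro equalityI subsetI)
      fix v assume "v \<in> {v. v \<noteq> 0 \<and> line v \<in> U}"
      then obtain b where b: "v \<noteq> 0" "line v = line (P *v vector [1, b])" "nrm b < e" by (auto simp: U_def)
      then obtain c where c: "v = c *s (P *v vector [1, b])" using vec.span_base[of v "{v}"] by (auto simp: line_eq)
      then have "c \<noteq> 0" using b by auto
      moreover have "Q *v v = c *s vector [1, b]" using Q by (simp add: c matvec_scale matrix_vector_mul_assoc)
      ultimately show "v \<in> (*v) Q -` {w. nrm (w $ 2) < e * nrm (w $ 1)}" using b by (simp add: nrm_mult mult.commute)
    next
      fix v assume v: "v \<in> (*v) Q -` {w. nrm (w $ 2) < e * nrm (w $ 1)}"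
      define w where "w = Q *v v"
      have w: "nrm (w $ 2) < e * nrm (w $ 1)" using v by (simp add: w_def)
      then have w1: "w $ 1 \<noteq> 0" using nrm_ge0[of "w $ 2"] by auto
      have vw: "v = P *v w" using Q by (simp add: w_def matrix_vector_mul_assoc)
      have v0: "v \<noteq> 0" using w1 unfolding w_def by auto
      have "w = (w $ 1) *s vector [1, w $ 2 / w $ 1]" using w1 by (simp add: vec2_eq_iff)
      then have "v = (w $ 1) *s (P *v vector [1, w $ 2 / w $ 1])" using vw by (metis matvec_scale)
      then have "line v = line (P *v vector [1, w $ 2 / w $ 1])" using v0 by (intro line_eqI) (auto simp: line_eq)
      moreover have "nrm (w $ 2 / w $ 1) < e" using w w1 by (simp add: nrm_divide divide_less_eq)
      ultimately show "v \<in> {v. v \<noteq> 0 \<and> line v \<in> U}" using v0 by (auto simp: U_def)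
    qed
    have "openin (vec_topology nrm) {w. nrm (w $ 2) < e * nrm (w $ 1)}"
      unfolding openin_vec
    proof (intro ballI)
      fix w :: "'k^2" assume "w \<in> {w. nrm (w $ 2) < e * nrm (w $ 1)}"
      then have w: "nrm (w $ 2) < e * nrm (w $ 1)" by simp
      then have w1: "w $ 1 \<noteq> 0" using nrm_ge0[of "w $ 2"] by auto
      define r where "r = min (nrm (w $ 1)) (e * nrm (w $ 1))"
      have r0: "r > 0" using w1 e0 by (simp add: r_def)
      have "nrm (v $ 2) < e * nrm (v $ 1)" if v: "\<forall>i. nrm (w $ i - v $ i) < r" for v
      proof -
        have "nrm (w $ 1 - v $ 1) < nrm (w $ 1)" "nrm (w $ 2 - v $ 2) < e * nrm (w $ 1)"
          using v by (auto simp: r_def)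
        moreover have "nrm (w $ 1) \<le> max (nrm (w $ 1 - v $ 1)) (nrm (v $ 1))"
          using nrm_add[of "w $ 1 - v $ 1" "v $ 1"] by simp
        ultimately have "nrm (w $ 1) \<le> nrm (v $ 1)" by linarith
        moreover have "nrm (v $ 2) \<le> max (nrm (w $ 2)) (nrm (w $ 2 - v $ 2))"
          using nrm_diff[of "w $ 2" "w $ 2 - v $ 2"] by simp
        then have "nrm (v $ 2) < e * nrm (w $ 1)" using w \<open>nrm (w $ 2 - v $ 2) < _\<close> by linarith
        ultimately show ?thesis using e0 by (smt (verit) mult_left_mono)
      qed
      then show "\<exists>r>0. \<forall>v. (\<forall>i. nrm (w $ i - v $ i) < r) \<longrightarrow> v \<in> {w. nrm (w $ 2) < e * nrm (w $ 1)}"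
        using r0 by blast
    qed
    then have "openin (vec_topology nrm) ((*v) Q -` {w. nrm (w $ 2) < e * nrm (w $ 1)})"
      by (rule openin_preimage_linear)
    then have oU: "openin (vec_topology nrm) {v. v \<noteq> 0 \<and> line v \<in> U}" unfolding U .
    have "vector [1, b] \<noteq> (0 :: 'k^2)" for b by (simp add: vec2_eq_iff)
    then have "P *v vector [1, b] \<noteq> 0" for b using matvec_zero_iff[OF P(1)] by blast
    then have "U \<subseteq> P1" unfolding U_def using P1_line by blast
    with oU have "openin (P1_topology nrm) U" by (rule openin_P1)
    moreover have "z \<in> U" unfolding U_def P(2) e1_def using e0 by (auto intro!: exI[of _ 0])
    ultimately obtain f where "f \<in> F" "f \<in> U" using z unfolding in_closure_of by blast
    then obtain b where b: "nrm b < e" "f = line (P *v vector [1, b])" by (auto simp: U_def)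
    \<comment> \<open>The unipotent matrix with first column \<open>vector [1, b]\<close>: in the
      frame \<open>P\<close> it moves the end \<open>z\<close> to \<open>f\<close>.\<close>
    define B where "B = mat 1 + M2 0 0 b 0"
    have BE: "nrm (M2 0 0 b 0 $ i $ j) \<le> \<epsilon> 0" "nrm (M2 0 0 b 0 $ i $ j) \<le> \<epsilon> k" for i j
      using b(1) \<epsilon>(1)[of 0] \<epsilon>(1)[of k] exhaust_2[of i] exhaust_2[of j] by (auto simp: e_def)
    have B: "invertible B" "mv B (bv y n) = bv y n" "mv B (bv y (n - int k)) = bv y (n - int k)"
      using \<epsilon>(2)[of "M2 0 0 b 0" 0] \<epsilon>(2)[of "M2 0 0 b 0" k] BE by (auto simp: B_def)
    have f: "f = line ((P ** B) *v e1)"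
      unfolding b(2) matrix_vector_mul_assoc[symmetric]
      by (rule arg_cong[of _ _ "\<lambda>v. line (P *v v)"]) (simp add: B_def vec2_eq_iff matvec_nth mat_nth2)
    define s where "s j = mv (P ** B) (bv y (n - int j))" for j
    have "half_line_to nrm s f"
      using half_line_to_mv[OF invertible_mult2[OF P(1) B(1)] half_line_to_e1]
      unfolding s_def f by (simp add: o_def image_line)
    moreover have "s 0 = x" using B x0 by (simp add: s_def mv_mult)
    ultimately have "s k \<in> S" using end_of_ray[OF _ F(2)[OF \<open>f \<in> F\<close>] _ S(1)] F(1) \<open>f \<in> F\<close> x(1) by blast
    then show ?thesis using B by (simp add: s_def r_def mv_mult)
  qed
  then show ?thesis using hl by (auto simp: end_of_def)
qed

end

section \<open>Discreteness, elliptic and hyperbolic elements\<close>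

lemma mat_mult_nth: "(mat c ** (A :: 'k::field^2^2)) $ i $ j = c * A $ i $ j"
proof -
  have "(\<forall>i j. (mat c ** A) $ i $ j = c * A $ i $ j)"
    by (simp add: mat_mult_left forall_2)
  then show ?thesis by blast
qed

context dvf
begin

lemma act_verts: "g \<in> carrier PGL2 \<Longrightarrow> x \<in> verts BT \<Longrightarrow> act_vert g x \<in> verts BT"
  by (auto simp: carrier_PGL2 act_vert_cls mv_verts)

lemma act_mult:
  "g \<in> carrier PGL2 \<Longrightarrow> h \<in> carrier PGL2 \<Longrightarrow> x \<in> verts BT \<Longrightarrow>
    act_vert (g \<otimes>\<^bsub>PGL2\<^esub> h) x = act_vert g (act_vert h x)"
  by (auto simp: carrier_PGL2 act_vert_cls mv_verts cls_mult mv_mult)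

lemma act_one: "x \<in> verts BT \<Longrightarrow> act_vert \<one>\<^bsub>PGL2\<^esub> x = x"
  by (simp add: one_PGL2 act_vert_cls)

lemma act_inv:
  assumes "g \<in> carrier PGL2" "x \<in> verts BT"
  shows "act_vert (inv\<^bsub>PGL2\<^esub> g) (act_vert g x) = x" "act_vert g (act_vert (inv\<^bsub>PGL2\<^esub> g) x) = x"
proof -
  interpret group "PGL2 :: 'k pgl monoid" by (rule group_PGL2)
  show "act_vert (inv\<^bsub>PGL2\<^esub> g) (act_vert g x) = x" "act_vert g (act_vert (inv\<^bsub>PGL2\<^esub> g) x) = x"
    using assms by (simp_all add: act_mult[symmetric] act_one)
qed

lemma act_inj: "g \<in> carrier PGL2 \<Longrightarrow> inj_on (act_vert g) (verts BT)"
  by (metis act_inv(1) inj_on_inverseI)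

lemma act_adj: "g \<in> carrier PGL2 \<Longrightarrow> adjacent BT x y \<Longrightarrow> adjacent BT (act_vert g x) (act_vert g y)"
proof -
  assume g: "g \<in> carrier PGL2" and xy: "adjacent BT x y"
  obtain A where A: "invertible A" "g = cls A" using g by (auto simp: carrier_PGL2)
  have "x \<in> verts BT" "y \<in> verts BT" using xy adjacent_verts[OF wf_BT] by blast+
  then show ?thesis using A mv_adj[OF A(1) xy] by (simp add: act_vert_cls)
qed

lemma openin_PGL2:
  assumes "openin (mat_topology nrm) {A. invertible A \<and> cls A \<in> U}" "U \<subseteq> carrier PGL2"
  shows "openin (PGL2_topology nrm) U"
  unfolding PGL2_topology_def openin_quotient_topology cls_def[symmetric]
proof (intro conjI)
  have ts: "topspace (subtopology (mat_topology nrm) (carrier GL2)) = {A. invertible A}" by simp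
  show "U \<subseteq> cls ` topspace (subtopology (mat_topology nrm) (carrier GL2))"
    using assms(2) unfolding ts carrier_PGL2 .
  show "openin (subtopology (mat_topology nrm) (carrier GL2))
     {A \<in> topspace (subtopology (mat_topology nrm) (carrier GL2)). cls A \<in> U}"
    unfolding ts mem_Collect_eq openin_subtopology
    using assms(1) by (intro exI[of _ "{A. invertible A \<and> cls A \<in> U}"]) auto
qed

text \<open>Writing \<open>B\<close> as \<open>A\<close> times \<open>mat 1 + E\<close> carries the
  neighbourhood of the identity from \<open>bv_fixed_small\<close> to \<open>A\<close>.\<close>

lemma near_fixed:
  assumes A: "invertible A" and x: "x \<in> verts BT"
  shows "\<exists>r>0. \<forall>B. (\<forall>i j. nrm (A $ i $ j - B $ i $ j) < r) \<longrightarrow> invertible B \<and> mv B x = mv A x"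
proof -
  obtain Q where Q: "A ** Q = mat 1" "Q ** A = mat 1" "invertible Q" using A by (rule invertible_obtain)
  obtain y n where yn: "x = bv y n" using x verts_BT by blast
  obtain \<epsilon> where \<epsilon>: "\<epsilon> > 0" "\<And>E. \<forall>i j. nrm (E $ i $ j) \<le> \<epsilon> \<Longrightarrow>
      invertible (mat 1 + E) \<and> mv (mat 1 + E) (bv y n) = bv y n" using bv_fixed_small by blast
  obtain C where C: "C > 0" "\<And>i j. nrm (Q $ i $ j) \<le> C" using entry_bound by blast
  have "invertible B \<and> mv B x = mv A x" if B: "\<forall>i j. nrm (A $ i $ j - B $ i $ j) < \<epsilon> / C" for B
  proof -
    define E where "E = Q ** (B - A)"
    have "nrm (E $ i $ j) < \<epsilon>" for i j
    proof -
      have "E $ i $ j = (Q *v (\<chi> l. (B - A) $ l $ j)) $ i"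
        by (simp add: E_def matmat_nth matvec_nth)
      moreover have "nrm ((Q *v (\<chi> l. (B - A) $ l $ j)) $ i) < C * (\<epsilon> / C)"
        using C B by (intro matvec_bound) (auto simp: nrm_minus_commute)
      ultimately show ?thesis using C by simp
    qed
    then have E: "invertible (mat 1 + E)" "mv (mat 1 + E) x = x"
      using \<epsilon>(2)[of E] less_imp_le yn by blast+
    have "A ** E = B - A" by (simp add: E_def matrix_mul_assoc Q)
    then have "A ** (mat 1 + E) = B" by (simp add: matrix_add_ldistrib)
    then show ?thesis using invertible_mult2[OF A E(1)] mv_mult[of A "mat 1 + E" x] E(2) by simp
  qed
  moreover have "\<epsilon> / C > 0" using C \<epsilon>(1) by simp
  ultimately show ?thesis by blast
qed

lemma openin_stab:
  assumes x: "x \<in> verts BT"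
  shows "openin (PGL2_topology nrm) {g \<in> carrier PGL2. act_vert g x = y}"
proof (rule openin_PGL2)
  have "{A. invertible A \<and> cls A \<in> {g \<in> carrier PGL2. act_vert g x = y}} = {A. invertible A \<and> mv A x = y}"
    using act_vert_cls[OF x] by auto
  moreover have "openin (mat_topology nrm) {A. invertible A \<and> mv A x = y}"
    unfolding openin_mat
  proof
    fix A assume "A \<in> {A. invertible A \<and> mv A x = y}"
    then have A: "invertible A" "mv A x = y" by auto
    obtain r where "r > 0" "\<forall>B. (\<forall>i j. nrm (A $ i $ j - B $ i $ j) < r) \<longrightarrow> invertible B \<and> mv B x = mv A x"
      using near_fixed[OF A(1) x] by blast
    then show "\<exists>r>0. \<forall>B. (\<forall>i j. nrm (A $ i $ j - B $ i $ j) < r) \<longrightarrow> B \<in> {A. invertible A \<and> mv A x = y}"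
      using A by auto
  qed
  ultimately show "openin (mat_topology nrm) {A. invertible A \<and> cls A \<in> {g \<in> carrier PGL2. act_vert g x = y}}"
    by (simp only:)
qed auto

text \<open>Two invertible matrices have the same class exactly if all the two-by-two minors
  \<open>\<phi>\<close> formed from pairs of corresponding entries vanish. A minor that is nonzero
  at \<open>A\<close> stays nonzero nearby.\<close>

lemma openin_remove_point:
  assumes g: "g \<in> carrier PGL2"
  shows "openin (PGL2_topology nrm) (carrier PGL2 - {g})"
proof (rule openin_PGL2)
  obtain G where G: "invertible G" "g = cls G" using g by (auto simp: carrier_PGL2)
  have "openin (mat_topology nrm) {A. invertible A \<and> cls A \<noteq> cls G}"
    unfolding openin_mat
  proof
    fix A assume "A \<in> {A. invertible A \<and> cls A \<noteq> cls G}"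
    then have A: "invertible A" "cls A \<noteq> cls G" by auto
    have "\<exists>i j k l. A $ i $ j * G $ k $ l \<noteq> A $ k $ l * G $ i $ j"
    proof (rule ccontr)
      assume "\<not> ?thesis"
      then have eq: "A $ i $ j * G $ k $ l = A $ k $ l * G $ i $ j" for i j k l by blast
      have "G \<noteq> 0" using G(1) by (auto simp: invertible_det_nz det_2)
      then obtain k l where kl: "G $ k $ l \<noteq> 0" by (auto simp: vec_eq_iff)
      define c where "c = A $ k $ l / G $ k $ l"
      have "A $ i $ j = c * G $ i $ j" for i j
        using kl eq[of i j k l] by (simp add: c_def field_simps)
      then have Ac: "A = mat c ** G" by (simp add: mat2_eq_iff mat_mult_nth)
      then have "c \<noteq> 0" using A(1) by (auto simp: invertible_det_nz det_2 mat_mult_left)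
      then show False using Ac A(2) cls_mat_mult by blast
    qed
    then obtain i j k l where ijkl: "A $ i $ j * G $ k $ l - A $ k $ l * G $ i $ j \<noteq> 0" by auto
    define \<phi> where "\<phi> B = B $ i $ j * G $ k $ l - B $ k $ l * G $ i $ j" for B :: "'k^2^2"
    obtain C where C: "C > 0" "\<And>i j. nrm (G $ i $ j) \<le> C" using entry_bound by blast
    obtain r where r: "r > 0" "\<And>B. (\<forall>i j. nrm (A $ i $ j - B $ i $ j) < r) \<Longrightarrow> invertible B"
      using near_fixed[OF A(1) bv_in_verts[of 0 0]] by blast
    define s where "s = min r (nrm (\<phi> A) / C)"
    have \<phi>A: "nrm (\<phi> A) > 0" using ijkl by (simp add: \<phi>_def)
    have "B \<in> {A. invertible A \<and> cls A \<noteq> cls G}" if B: "\<forall>i j. nrm (A $ i $ j - B $ i $ j) < s" for B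
    proof -
      have "invertible B" using r(2) B by (simp add: s_def)
      moreover have "cls B \<noteq> cls G"
      proof
        assume "cls B = cls G"
        then obtain c where "c \<noteq> 0" "G = mat c ** B" using cls_eqD by blast
        then have "\<phi> B = 0" by (simp add: \<phi>_def mat_mult_nth)
        then have \<phi>eq: "\<phi> A = (A $ i $ j - B $ i $ j) * G $ k $ l - (A $ k $ l - B $ k $ l) * G $ i $ j"
          by (simp add: \<phi>_def algebra_simps)
        have small: "nrm ((A $ a $ b - B $ a $ b) * G $ c $ d) < nrm (\<phi> A)" for a b c d
        proof -
          have "nrm ((A $ a $ b - B $ a $ b) * G $ c $ d) \<le> nrm (A $ a $ b - B $ a $ b) * C"
            using C by (simp add: nrm_mult mult_left_mono)
          also have "\<dots> < nrm (\<phi> A) / C * C" using B C(1) by (intro mult_strict_right_mono) (simp_all add: s_def)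
          finally show ?thesis using C(1) by simp
        qed
        have "nrm (\<phi> A) < nrm (\<phi> A)"
          using arg_cong[OF \<phi>eq, of nrm] nrm_diff[of "(A $ i $ j - B $ i $ j) * G $ k $ l" "(A $ k $ l - B $ k $ l) * G $ i $ j"]
            small[of i j k l] small[of k l i j] by linarith
        then show False by simp
      qed
      ultimately show ?thesis by simp
    qed
    moreover have "s > 0" using r C \<phi>A by (simp add: s_def)
    ultimately show "\<exists>r>0. \<forall>B. (\<forall>i j. nrm (A $ i $ j - B $ i $ j) < r) \<longrightarrow> B \<in> {A. invertible A \<and> cls A \<noteq> cls G}"
      by blast
  qed
  moreover have "{A. invertible A \<and> cls A \<in> carrier PGL2 - {g}} = {A. invertible A \<and> cls A \<noteq> cls G}"
    using G by auto
  ultimately show "openin (mat_topology nrm) {A. invertible A \<and> cls A \<in> carrier PGL2 - {g}}" by (simp only:)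
qed auto

text \<open>The elements that move \<open>x\<close> as \<open>h\<close> does form an open set, which
  meets \<open>H\<close> in a coset of the finite stabilizer. Removing the other finitely many
  points isolates \<open>h\<close>.\<close>

lemma discrete_subgroupI:
  assumes H: "subgroup H PGL2" and x: "x \<in> verts BT" and fin: "finite {g \<in> H. act_vert g x = x}"
  shows "discrete_subgroup nrm H"
proof -
  interpret group "PGL2 :: 'k pgl monoid" by (rule group_PGL2)
  have Hc: "H \<subseteq> carrier PGL2" using H by (rule subgroup.subset)
  have pt: "\<exists>U. openin (PGL2_topology nrm) U \<and> U \<inter> H = {h}" if h: "h \<in> H" for h
  proof -
    define F where "F = {g \<in> H. act_vert g x = act_vert h x}"
    have hc: "h \<in> carrier PGL2" using h Hc by blast
    have "F \<subseteq> (\<lambda>g. h \<otimes>\<^bsub>PGL2\<^esub> g) ` {g \<in> H. act_vert g x = x}"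
    proof
      fix g assume "g \<in> F"
      then have g: "g \<in> H" "g \<in> carrier PGL2" "act_vert g x = act_vert h x" using Hc by (auto simp: F_def)
      define k where "k = inv\<^bsub>PGL2\<^esub> h \<otimes>\<^bsub>PGL2\<^esub> g"
      have "k \<in> H" unfolding k_def using H h g(1) by (simp add: subgroup.m_closed subgroup.m_inv_closed)
      moreover have "act_vert k x = x" using g hc x by (simp add: k_def act_mult act_inv)
      moreover have "g = h \<otimes>\<^bsub>PGL2\<^esub> k" using g hc by (simp add: k_def m_assoc[symmetric])
      ultimately show "g \<in> (\<lambda>g. h \<otimes>\<^bsub>PGL2\<^esub> g) ` {g \<in> H. act_vert g x = x}" by blast
    qed
    then have finF: "finite F" using fin finite_subset by blast
    define U where "U = {g \<in> carrier PGL2. act_vert g x = act_vert h x} \<inter> (\<Inter>g\<in>F - {h}. carrier PGL2 - {g})"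
    have "openin (PGL2_topology nrm) U"
    \<comment> \<open>The intersection over the empty set is \<open>UNIV\<close>, which
      \<open>openin_INT2\<close> does not cover.\<close>
    proof (cases "F - {h} = {}")
      case True
      then show ?thesis unfolding U_def True using openin_stab[OF x] by simp
    next
      case False
      have "openin (PGL2_topology nrm) (\<Inter>g\<in>F - {h}. carrier PGL2 - {g})"
      proof (rule openin_INT2)
        show "finite (F - {h})" using finF by simp
        show "F - {h} \<noteq> {}" by (rule False)
        show "openin (PGL2_topology nrm) (carrier PGL2 - {g})" if "g \<in> F - {h}" for g
          using that Hc by (intro openin_remove_point) (auto simp: F_def)
      qed
      then show ?thesis unfolding U_def using openin_stab[OF x] by (intro openin_Int) auto
    qed
    moreover have "U \<inter> H = {h}" using h hc Hc by (auto simp: U_def F_def)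
    ultimately show ?thesis by blast
  qed
  have "discrete_topology H = subtopology (PGL2_topology nrm) H"
    unfolding discrete_topology_unique
  proof (intro conjI ballI)
    have "H \<subseteq> topspace (PGL2_topology nrm)" using pt openin_subset by fastforce
    then show "topspace (subtopology (PGL2_topology nrm) H) = H" by auto
    show "openin (subtopology (PGL2_topology nrm) H) {h}" if "h \<in> H" for h
      using pt[OF that] by (auto simp: openin_subtopology)
  qed
  then show ?thesis using H by (simp add: discrete_subgroup_def)
qed

section \<open>Triangular matrices as affine maps of discs; axes and diagonalization\<close>

lemma mv_upper:
  assumes ad: "a \<noteq> 0" "d \<noteq> 0" and k: "nrm a = nrm d * q powi k"
  shows "mv (M2 a b 0 d) (bv y n) = bv ((a * y + b) / d) (n + k)"
proof -
  obtain j where j: "nrm d = q powi j" using nrm_value ad by blast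
  define y' where "y' = (a * y + b) / d"
  have i: "invertible (M2 a b 0 d)" using ad by simp
  have mem: "M2 a b 0 d *v w \<in> BL j y' (n + k) \<longleftrightarrow> w \<in> BL 0 y n" for w
  proof -
    have 1: "(M2 a b 0 d *v w) $ 1 - (M2 a b 0 d *v w) $ 2 * y' = a * (w $ 1 - w $ 2 * y)"
      using ad by (simp add: matvec_nth y'_def field_simps)
    have 2: "(M2 a b 0 d *v w) $ 2 = d * w $ 2" by (simp add: matvec_nth)
    have 3: "nrm a = q powi (j + k)" using k j by (simp add: q_powi_add)
    have "nrm a * r \<le> q powi (j + (n + k)) \<longleftrightarrow> r \<le> q powi n" for r
      unfolding 3 using nrm_le_shift[of "j + k" r n] by (simp add: algebra_simps)
    moreover have "nrm d * r \<le> q powi j \<longleftrightarrow> r \<le> 1" for r unfolding j by simp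
    ultimately show ?thesis unfolding BL_def mem_Collect_eq 1 unfolding 2 by (simp add: nrm_mult)
  qed
  have "(*v) (M2 a b 0 d) ` BL 0 y n = BL j y' (n + k)"
  proof (intro equalityI subsetI)
    fix w assume w: "w \<in> BL j y' (n + k)"
    obtain B where "M2 a b 0 d ** B = mat 1" using i by (rule invertible_obtain)
    then have "w = M2 a b 0 d *v (B *v w)" by (simp add: matrix_vector_mul_assoc)
    then show "w \<in> (*v) (M2 a b 0 d) ` BL 0 y n" using mem w by (metis image_eqI)
  qed (use mem in auto)
  then show ?thesis by (metis mv_similarity_class similarity_class_BL y'_def)
qed

text \<open>The apartment of the frame \<open>P\<close>: the straight line whose ends are spanned by
  the two columns.\<close>

definition axis :: "'k^2^2 \<Rightarrow> 'k bt_vertex set" where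
  "axis P = range (\<lambda>n. mv P (bv 0 n))"

lemma straight_line_frame:
  assumes "invertible P"
  shows "straight_line nrm (\<lambda>n. mv P (bv 0 n)) (line (P *v e1)) (line (P *v e2))"
  using straight_line_mv[OF assms straight_line_std] by (simp add: o_def image_line)

lemma straight_line_convex:
  assumes "straight_line nrm c z w"
  shows "bt.convex (range c)"
proof (rule bt.convexI[of _ "c 0"])
  have adj: "adjacent BT (c i) (c (i + 1))" for i by (rule straight_line_adj[OF assms])
  show "range c \<subseteq> verts BT" using adj bt.adj_V by blast
  have up: "\<exists>xs. bt.walk xs (c 0) (c (int n)) \<and> set xs \<subseteq> range c" for n
  proof (induction n)
    case 0
    show ?case using bt.walk_single[OF bt.adj_V[OF adj[of 0]]] by (intro exI[of _ "[c 0]"]) simp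
  next
    case (Suc n)
    then obtain xs where w: "bt.walk xs (c 0) (c (int n))" "set xs \<subseteq> range c" by blast
    have a: "adjacent BT (c (int n)) (c (int (Suc n)))" using adj[of "int n"] by (simp add: add.commute)
    have "bt.walk (xs @ [c (int (Suc n))]) (c 0) (c (int (Suc n)))"
      by (rule bt.walk_append_adj[OF w(1) a bt.walk_single[OF bt.adj_V2[OF a]]])
    then show ?case using w(2) by (intro exI[of _ "xs @ [c (int (Suc n))]"]) auto
  qed
  have down: "\<exists>xs. bt.walk xs (c 0) (c (- int n)) \<and> set xs \<subseteq> range c" for n
  proof (induction n)
    case 0
    show ?case using bt.walk_single[OF bt.adj_V[OF adj[of 0]]] by (intro exI[of _ "[c 0]"]) simp
  next
    case (Suc n)
    then obtain xs where w: "bt.walk xs (c 0) (c (- int n))" "set xs \<subseteq> range c" by blast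
    have a: "adjacent BT (c (- int n)) (c (- int (Suc n)))"
      using bt.adj_sym[OF adj[of "- int (Suc n)"]] by (simp add: add.commute)
    have "bt.walk (xs @ [c (- int (Suc n))]) (c 0) (c (- int (Suc n)))"
      by (rule bt.walk_append_adj[OF w(1) a bt.walk_single[OF bt.adj_V2[OF a]]])
    then show ?case using w(2) by (intro exI[of _ "xs @ [c (- int (Suc n))]"]) auto
  qed
  show "\<exists>xs. bt.walk xs (c 0) x \<and> set xs \<subseteq> range c" if "x \<in> range c" for x
  proof -
    obtain i where "x = c i" using \<open>x \<in> range c\<close> by blast
    then show ?thesis using up down by (cases i rule: int_cases2) blast+
  qed
qed auto

lemma axis_convex: "invertible P \<Longrightarrow> bt.convex (axis P)"
  unfolding axis_def by (rule straight_line_convex[OF straight_line_frame])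

lemma frame_P1:
  assumes "invertible (P :: 'k^2^2)"
  shows "line (P *v e1) \<in> P1" "line (P *v e2) \<in> P1" "line (P *v e1) \<noteq> line (P *v e2)"
proof -
  have "e1 \<noteq> (0 :: 'k^2)" "e2 \<noteq> (0 :: 'k^2)" by (simp_all add: vec2_eq_iff)
  then show "line (P *v e1) \<in> P1" "line (P *v e2) \<in> P1" using matvec_zero_iff[OF assms] P1_line by blast+
  show "line (P *v e1) \<noteq> line (P *v e2)" using line_frame_inj[OF assms] line_e1_neq_e2 by blast
qed

lemma straight_line_commute: "straight_line nrm c z w \<Longrightarrow> straight_line nrm (\<lambda>i. c (- i)) w z"
  unfolding straight_line_def by (auto simp: inj_eq intro!: injI)

lemma straight_line_axis:
  assumes P: "invertible P" and c: "straight_line nrm c z w"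
    and zw: "{z, w} = {line (P *v e1), line (P *v e2)}"
  shows "c i \<in> axis P"
proof -
  have "end_of (axis P) (line (P *v e1))" "end_of (axis P) (line (P *v e2))"
    using straight_line_ends[OF straight_line_frame[OF P]] by (auto simp: axis_def)
  then have "end_of (axis P) z" "end_of (axis P) w" "z \<in> P1" "w \<in> P1"
    using zw frame_P1[OF P] by (auto simp: doubleton_eq_iff)
  then show ?thesis using line_in[OF axis_convex[OF P] _ _ _ _ c] by blast
qed

lemma mat_cols_eqI:
  assumes "(M :: 'k^2^2) *v e1 = N *v e1" "M *v e2 = N *v e2"
  shows "M = N"
  using assms by (simp add: vec2_eq_iff matvec_nth)

lemma diagonalize:
  assumes ab: "a \<noteq> b" and x: "x \<noteq> 0" "A *v x = a *s x" and y: "y \<noteq> 0" "A *v y = b *s (y :: 'k^2)"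
  shows "\<exists>P. invertible P \<and> A ** P = P ** M2 a 0 0 b"
proof -
  have "line x \<noteq> line y"
  proof
    assume "line x = line y"
    then have "x \<in> line y" using vec.span_base[of x "{x}"] by simp
    then obtain c where "x = c *s y" by (auto simp: line_eq)
    then have "a *s x = b *s x" using x y by (simp add: matvec_scale vector_smult_assoc mult.commute)
    then show False using ab x(1) by (auto simp: vec2_eq_iff)
  qed
  then obtain P where P: "invertible P" "line x = line (P *v e1)" "line y = line (P *v e2)"
    using P1_frame P1_line x y by blast
  have "P *v e1 \<in> line x" "P *v e2 \<in> line y" unfolding P(2,3) by (simp_all add: vec.span_base)
  then obtain c d where cd: "P *v e1 = c *s x" "P *v e2 = d *s y" by (auto simp: line_eq)
  have "M2 a 0 0 b *v e1 = a *s e1" "M2 a 0 0 b *v e2 = b *s e2" by (simp_all add: vec2_eq_iff matvec_nth)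
  then have "A ** P = P ** M2 a 0 0 b"
    by (intro mat_cols_eqI)
       (simp_all add: matrix_vector_mul_assoc[symmetric] matvec_scale cd x y vector_smult_assoc mult.commute)
  then show ?thesis using P by blast
qed

lemma diag_nonzero:
  assumes "invertible A" "invertible (P :: 'k^2^2)" "A ** P = P ** M2 a c 0 b"
  shows "a \<noteq> 0" "b \<noteq> 0"
proof -
  have "det (A ** P) = det (P ** M2 a c 0 b)" by (simp only: assms(3))
  then have "det A * det P = det P * (a * b)" by (simp add: det_mul det_2[of "M2 a c 0 b"])
  then have "det A = a * b" using assms(2) by (simp add: invertible_det_nz)
  then show "a \<noteq> 0" "b \<noteq> 0" using assms(1) by (auto simp: invertible_det_nz)
qed

lemma ellipticD:
  assumes "elliptic nrm (cls A)"
  obtains P a b where "invertible P" "A ** P = P ** M2 a 0 0 b" "a \<noteq> b" "nrm a = nrm b"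
proof -
  obtain a b where ab: "a \<noteq> b" "eigenvalue A a" "eigenvalue A b" "nrm a = nrm b"
    using assms cls_self[of A] unfolding elliptic_def by blast
  then obtain x y where "x \<noteq> 0" "A *v x = a *s x" "y \<noteq> 0" "A *v y = b *s y"
    unfolding eigenvalue_def by blast
  then show ?thesis using diagonalize[OF ab(1)] that ab by blast
qed

lemma ellipticI:
  assumes A: "invertible A" and P: "invertible P" "A ** P = P ** M2 a 0 0 b" "a \<noteq> b" "nrm a = nrm b"
  shows "elliptic nrm (cls A)"
  unfolding elliptic_def
proof (intro conjI ballI)
  fix B assume "B \<in> cls A"
  then obtain c where c: "c \<noteq> 0" "B = mat c ** A" by (auto simp: cls_altdef)
  have ev: "M2 a 0 0 b *v e1 = a *s e1" "M2 a 0 0 b *v e2 = b *s e2" by (simp_all add: vec2_eq_iff matvec_nth)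
  have "A *v (P *v e1) = a *s (P *v e1)" "A *v (P *v e2) = b *s (P *v e2)"
    unfolding matrix_vector_mul_assoc P(2) unfolding matrix_vector_mul_assoc[symmetric] ev matvec_scale by simp_all
  then have "B *v (P *v e1) = (c * a) *s (P *v e1)" "B *v (P *v e2) = (c * b) *s (P *v e2)"
    by (simp_all add: c mat_mult_vec vector_smult_assoc)
  moreover have "P *v e1 \<noteq> 0" "P *v e2 \<noteq> 0" using matvec_zero_iff[OF P(1)] by (simp_all add: vec2_eq_iff[of e1] vec2_eq_iff[of e2])
  ultimately have "eigenvalue B (c * a)" "eigenvalue B (c * b)" unfolding eigenvalue_def by blast+
  then show "\<exists>a b. a \<noteq> b \<and> eigenvalue B a \<and> eigenvalue B b \<and> nrm a = nrm b"
    using P(3,4) c by (intro exI[of _ "c * a"] exI[of _ "c * b"]) (simp add: nrm_mult)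
qed (use A in simp)

lemma fixed_points_diag:
  assumes P: "invertible P" "A ** P = P ** M2 a 0 0 b" "a \<noteq> b" "a \<noteq> 0" "b \<noteq> (0 :: 'k)"
  shows "fixed_points (cls A) = {line (P *v e1), line (P *v e2)}"
proof (intro equalityI subsetI)
  have ev: "M2 a 0 0 b *v e1 = a *s e1" "M2 a 0 0 b *v e2 = b *s e2" by (simp_all add: vec2_eq_iff matvec_nth)
  have Aev: "A *v (P *v w) = P *v (M2 a 0 0 b *v w)" for w
    unfolding matrix_vector_mul_assoc P(2) ..
  {
    fix z assume z: "z \<in> {line (P *v e1), line (P *v e2)}"
    have "line (c *s v) = line v" if "c \<noteq> 0" for c and v :: "'k^2"
    proof (cases "v = 0")
      case False
      then show ?thesis using that by (intro line_eqI) (simp_all add: line_eq)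
    qed simp
    then show "z \<in> fixed_points (cls A)"
      using z frame_P1[OF P(1)] P(4,5) by (auto simp: fixed_points_def act_line_cls Aev ev matvec_scale)
  next
    fix z assume "z \<in> fixed_points (cls A)"
    then obtain v where v: "v \<noteq> 0" "z = line v" "line (A *v v) = line v"
      by (auto simp: fixed_points_def P1_def act_line_cls)
    obtain Q where Q: "P ** Q = mat 1" using P(1) by (rule invertible_obtain)
    define w where "w = Q *v v"
    have vw: "v = P *v w" using Q by (simp add: w_def matrix_vector_mul_assoc)
    have "line (M2 a 0 0 b *v w) = line w" using v(3) line_frame_inj[OF P(1)] unfolding vw Aev by blast
    then have "M2 a 0 0 b *v w \<in> line w" using vec.span_base by blast
    then obtain c where "M2 a 0 0 b *v w = c *s w" by (auto simp: line_eq)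
    then have "a * w $ 1 = c * w $ 1" "b * w $ 2 = c * w $ 2" by (simp_all add: vec2_eq_iff matvec_nth)
    then have "w $ 1 = 0 \<or> w $ 2 = 0" using P(3) by auto
    then have "w = (w $ 2) *s e2 \<or> w = (w $ 1) *s e1" by (auto simp: vec2_eq_iff)
    then have "w \<in> line e2 \<or> w \<in> line e1" unfolding line_eq by blast
    moreover have "w \<noteq> 0" using v vw by auto
    ultimately have "line w = line e2 \<or> line w = line e1" using line_eqI by blast
    then show "z \<in> {line (P *v e1), line (P *v e2)}" using v(2) vw line_frame_inj[OF P(1)] by blast
  }
qed

lemma diag_axis:
  assumes P: "invertible P" "A ** P = P ** M2 a 0 0 b" and ab: "a \<noteq> 0" "b \<noteq> 0" "nrm a = nrm b * q powi k"
  shows "mv A (mv P (bv 0 n)) = mv P (bv 0 (n + k))"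
proof -
  have "mv A (mv P (bv 0 n)) = mv P (mv (M2 a 0 0 b) (bv 0 n))" by (simp add: P(2) flip: mv_mult)
  then show ?thesis using mv_upper[OF ab, of 0 0 n] by simp
qed

text \<open>In the frame \<open>P\<close> the element multiplies centres by \<open>a / b\<close>. If
  it fixes the disc with centre \<open>y\<close> and radius \<open>q powi n\<close>, then
  \<open>(a / b - 1) * y\<close> lies in the ball of that radius, so \<open>J\<close> steps up the
  disc contains 0 and belongs to the axis. The bound depends on \<open>a / b\<close> only; the path
  has \<open>Suc J\<close> vertices.\<close>

lemma elliptic_tube:
  assumes A: "A ** P = P ** M2 a 0 0 b" and P: "invertible P" and ab: "a \<noteq> 0" "b \<noteq> 0" "a \<noteq> b" "nrm a = nrm b"
  shows "\<exists>k. \<forall>x\<in>verts BT. mv A x = x \<longrightarrow> (\<exists>p y. bt.geo p x y \<and> y \<in> axis P \<and> length p \<le> k)"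
proof -
  obtain Q where Q: "P ** Q = mat 1" "Q ** P = mat 1" "invertible Q" using P by (rule invertible_obtain)
  obtain j where j: "nrm (a / b - 1) = q powi j" using nrm_value[of "a / b - 1"] ab by auto
  define J where "J = nat (max j 0)"
  have "\<exists>p y. bt.geo p x y \<and> y \<in> axis P \<and> length p \<le> Suc J" if x: "x \<in> verts BT" "mv A x = x" for x
  proof -
    obtain y n where yn: "mv Q x = bv y n" using mv_verts[OF Q(3) x(1)] verts_BT by blast
    then have xP: "x = mv P (bv y n)" using mv_inverse[OF Q(1)] by metis
    have "mv P (mv (M2 a 0 0 b) (bv y n)) = mv P (bv y n)"
      using x(2) unfolding xP by (simp add: A flip: mv_mult)
    then have "mv (M2 a 0 0 b) (bv y n) = bv y n" using inj_mv[OF P] by (simp add: inj_eq)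
    then have "bv (a * y / b) n = bv y n" using mv_upper[of a b 0 0 y n] ab by simp
    then have "nrm (a * y / b - y) \<le> q powi n" by (simp add: bv_eq)
    moreover have "a * y / b - y = (a / b - 1) * y" by (simp add: algebra_simps)
    ultimately have "q powi j * nrm y \<le> q powi n" using j by (simp add: nrm_mult)
    then have "nrm y \<le> q powi (n - j)" using nrm_le_shift[of j "nrm y" "n - j"] by simp
    then have y: "nrm (y - 0) \<le> q powi (n - int J)"
      using powi_le[of "n - j" "n - int J"] by (simp add: J_def del: powi_le)
    define r where "r i = mv P (bv y (n - int i))" for i
    have "half_line BT r" unfolding r_def using half_line_mv[OF P half_line_up] by (simp add: o_def)
    then have "bt.geo (map r [0..<Suc J]) (r 0) (r J)"
      by (intro bt.geo_ray) (auto simp: half_line_def)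
    moreover have "r J = mv P (bv 0 (n - int J))" unfolding r_def using bv_cong[OF y] by simp
    then have "r J \<in> axis P" by (auto simp: axis_def)
    moreover have "r 0 = x" by (simp add: r_def xP)
    ultimately show ?thesis by (intro exI[of _ "map r [0..<Suc J]"] exI[of _ "r J"]) simp
  qed
  then show ?thesis by blast
qed

text \<open>A root of the characteristic polynomial gives an eigenvector, which serves as first
  vector of the frame.\<close>

lemma triangularize:
  assumes A: "invertible (A :: 'k^2^2)" and r: "rational_fixed_points (cls A)"
  shows "\<exists>P a b c. invertible P \<and> A ** P = P ** M2 a c 0 b"
proof -
  obtain a b where "\<And>x. det (mat x - A) = (x - a) * (x - b)"
    using r cls_self[of A] unfolding rational_fixed_points_def by blast
  then have "\<not> invertible (mat a - A)" by (simp add: invertible_det_nz)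
  then obtain x where x: "x \<noteq> 0" "(mat a - A) *v x = 0"
    unfolding invertible_left_inverse matrix_left_invertible_ker by blast
  then have Ax: "A *v x = a *s x" by (simp add: vec2_eq_iff matvec_nth mat_nth2 algebra_simps)
  obtain P where P: "invertible P" "line x = line (P *v e1)" using P1_frame1[OF P1_line[OF x(1)]] by blast
  have "P *v e1 \<in> line x" unfolding P(2) by (simp add: vec.span_base)
  then obtain c where c: "P *v e1 = c *s x" by (auto simp: line_eq)
  obtain Q where Q: "P ** Q = mat 1" "Q ** P = mat 1" using P(1) by (rule invertible_obtain)
  define D where "D = Q ** A ** P"
  have AD: "A ** P = P ** D" by (simp add: D_def matrix_mul_assoc Q)
  have "P *v (D *v e1) = P *v (a *s e1)"
    by (simp add: matrix_vector_mul_assoc flip: AD) (simp add: matrix_vector_mul_assoc[symmetric] c Ax matvec_scale vector_smult_assoc mult.commute)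
  then have "D *v e1 = a *s e1" using invertible_inj[OF P(1)] by (simp add: inj_eq)
  then have "D $ 1 $ 1 = a" "D $ 2 $ 1 = 0" by (simp_all add: vec2_eq_iff matvec_nth)
  then have "D = M2 a (D $ 1 $ 2) 0 (D $ 2 $ 2)" by (simp add: mat2_eq_iff)
  then show ?thesis using AD P(1) by metis
qed

text \<open>If the diagonal entries of a triangular form have equal norm, the element acts on the
  field as an affine isometry and fixes a large disc; this includes unipotent elements. Otherwise
  the eigenvalues differ and the matrix is diagonalized: the hyperbolic case.\<close>

lemma rational_cases:
  assumes A: "invertible (A :: 'k^2^2)" and r: "rational_fixed_points (cls A)"
  shows "(\<exists>x\<in>verts BT. mv A x = x) \<or>
    (\<exists>P a b. invertible P \<and> A ** P = P ** M2 a 0 0 b \<and> nrm a \<noteq> nrm b \<and> a \<noteq> 0 \<and> b \<noteq> 0)"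
proof -
  obtain P a b c where P: "invertible P" "A ** P = P ** M2 a c 0 b" using triangularize assms by blast
  note ab = diag_nonzero[OF A P]
  show ?thesis
  proof (cases "nrm a = nrm b")
    case True
    \<comment> \<open>The image of 0 is \<open>c / b\<close>; the radius is chosen so that the disc
      around 0 contains it.\<close>
    obtain N where N: "nrm (c / b) \<le> q powi N"
    proof (cases "c = 0")
      case True
      then show ?thesis using that[of 0] by simp
    next
      case False
      then obtain k where "nrm (c / b) = q powi k" using nrm_value[of "c / b"] ab by auto
      then show ?thesis using that[of k] by simp
    qed
    have "mv A (mv P (bv 0 N)) = mv P (mv (M2 a c 0 b) (bv 0 N))" by (simp add: P(2) flip: mv_mult)
    also have "\<dots> = mv P (bv (c / b) N)" using mv_upper[of a b 0 c 0 N] True ab by simp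
    also have "bv (c / b) N = bv 0 N" using N by (intro bv_cong) simp
    finally have "mv A (mv P (bv 0 N)) = mv P (bv 0 N)" .
    moreover have "mv P (bv 0 N) \<in> verts BT" by (rule mv_verts[OF P(1) bv_in_verts])
    ultimately show ?thesis by blast
  next
    case False
    then have ne: "a \<noteq> b" by auto
    define d where "d = c / (b - a)"
    define S where "S = M2 1 d 0 1"
    have S: "invertible S" by (simp add: S_def)
    have "M2 a c 0 b ** S = S ** M2 a 0 0 b"
    proof -
      have "(b - a) * d = c" using ne by (simp add: d_def)
      then have "a * d + c = d * b" by (simp add: algebra_simps)
      then show ?thesis by (simp add: S_def mat2_eq_iff matmat_nth)
    qed
    then have "A ** P ** S = P ** (S ** M2 a 0 0 b)"
      unfolding P(2) by (simp flip: matrix_mul_assoc)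
    then have "A ** (P ** S) = (P ** S) ** M2 a 0 0 b" by (simp add: matrix_mul_assoc)
    then show ?thesis using invertible_mult2[OF P(1) S] False ab by blast
  qed
qed

end

section \<open>The absolute value of a p-adic field is discrete\<close>

locale padic_field = nonarch_field nrm for nrm :: "'k::field_char_0 \<Rightarrow> real" +
  fixes p :: nat
  assumes prime_p: "prime p" and ext: "extends_padic_abs p nrm"
begin

lemma p_gt1: "real p > 1"
  using prime_gt_1_nat[OF prime_p] by simp

definition F :: "'k set" where
  "F = {x. \<forall>e>0. \<exists>r\<in>\<rat>. nrm (x - r) < e}"

lemma rat_closure_F: "rat_closure nrm = F"
proof -
  interpret M: Metric_space UNIV "abs_metric nrm"
  proof
    fix x y z
    show "0 \<le> abs_metric nrm x y" by (simp add: abs_metric_def)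
    show "abs_metric nrm x y = abs_metric nrm y x" by (simp add: abs_metric_def nrm_minus_commute)
    show "(abs_metric nrm x y = 0) = (x = y)" by (simp add: abs_metric_def)
    have "nrm (x - z) \<le> max (nrm (x - y)) (nrm (y - z))" using nrm_add[of "x - y" "y - z"] by simp
    then show "abs_metric nrm x z \<le> abs_metric nrm x y + abs_metric nrm y z"
      using nrm_ge0[of "x - y"] nrm_ge0[of "y - z"] unfolding abs_metric_def by linarith
  qed
  show ?thesis
    unfolding rat_closure_def M.metric_closure_of F_def
    by (auto simp: M.in_mball abs_metric_def)
qed

lemma nrm_close:
  assumes "nrm (x - y) < nrm x"
  shows "nrm y = nrm x"
proof -
  have "nrm y \<le> nrm x"
    using nrm_diff[of x "x - y"] assms by simp
  moreover have "nrm x \<le> max (nrm (x - y)) (nrm y)" using nrm_add[of "x - y" y] by simp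
  ultimately show ?thesis using assms by linarith
qed

lemma nrm_distinct:
  assumes "nrm x \<noteq> nrm y"
  shows "nrm (x - y) = max (nrm x) (nrm y)"
proof (cases "nrm x < nrm y")
  case True
  then have "nrm (y - (y - x)) < nrm y" by simp
  from nrm_close[OF this] True show ?thesis by (simp add: nrm_minus_commute)
next
  case False
  with assms have "nrm (x - (x - y)) < nrm x" by simp
  from nrm_close[OF this] False show ?thesis by simp
qed

lemma nrm_int: "a \<noteq> 0 \<Longrightarrow> \<exists>n::int. nrm (of_int a) = real p powi n"
proof -
  assume "a \<noteq> 0"
  then have "nrm (of_int a) = (1 / real p) ^ multiplicity (int p) a"
    using ext by (simp add: extends_padic_abs_def)
  also have "\<dots> = real p powi (- int (multiplicity (int p) a))"
    by (simp add: power_int_minus power_divide inverse_eq_divide)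
  finally show ?thesis by blast
qed

lemma nrm_Rats:
  assumes "r \<in> \<rat>" "r \<noteq> 0"
  shows "\<exists>n::int. nrm r = real p powi n"
proof -
  obtain x where x: "r = of_rat x" using assms by (auto elim: Rats_cases)
  obtain a b where ab: "x = Fract a b" "b > 0" by (cases x) auto
  then have r: "r = of_int a / of_int b" by (simp add: x of_rat_rat)
  then have "a \<noteq> 0" using assms by auto
  then obtain m n where "nrm (of_int a) = real p powi m" "nrm (of_int b) = real p powi n"
    using nrm_int[of a] nrm_int[of b] ab by auto
  then have "nrm r = real p powi (m - n)" using p_gt1 by (simp add: r nrm_divide power_int_diff)
  then show ?thesis by blast
qed

text \<open>A rational number closer to \<open>x\<close> than \<open>nrm x\<close> has the same
  absolute value, so the closure acquires no new values.\<close>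

lemma nrm_F:
  assumes "x \<in> F" "x \<noteq> 0"
  shows "\<exists>n::int. nrm x = real p powi n"
proof -
  have "nrm x > 0" using assms(2) by simp
  then obtain r where r: "r \<in> \<rat>" "nrm (x - r) < nrm x" using assms(1) unfolding F_def by blast
  then have "nrm r = nrm x" by (intro nrm_close)
  moreover from this have "r \<noteq> 0" using assms(2) by auto
  ultimately show ?thesis using nrm_Rats r(1) by metis
qed

lemma F_diff:
  assumes "x \<in> F" "y \<in> F"
  shows "x - y \<in> F"
  unfolding F_def
proof (intro CollectI allI impI)
  fix e :: real assume "e > 0"
  then obtain r s where rs: "r \<in> \<rat>" "nrm (x - r) < e" "s \<in> \<rat>" "nrm (y - s) < e"
    using assms unfolding F_def by blast
  have "nrm ((x - r) - (y - s)) \<le> max (nrm (x - r)) (nrm (y - s))" by (rule nrm_diff)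
  then have "nrm ((x - y) - (r - s)) < e" using rs by (simp add: algebra_simps)
  then show "\<exists>r\<in>\<rat>. nrm (x - y - r) < e" using rs by (intro bexI[of _ "r - s"]) auto
qed

lemma F_mult:
  assumes "x \<in> F" "y \<in> F"
  shows "x * y \<in> F"
  unfolding F_def
proof (intro CollectI allI impI)
  fix e :: real assume e: "e > 0"
  define M where "M = max 1 (max (nrm x) (nrm y))"
  define d where "d = min 1 (e / M)"
  have M: "M \<ge> 1" "nrm x \<le> M" "nrm y \<le> M" by (auto simp: M_def)
  have "d > 0" using e M by (simp add: d_def)
  then obtain r s where rs: "r \<in> \<rat>" "nrm (x - r) < d" "s \<in> \<rat>" "nrm (y - s) < d"
    using assms unfolding F_def by blast
  have "d \<le> 1" by (simp add: d_def)
  moreover have "nrm s \<le> max (nrm y) (nrm (y - s))" using nrm_diff[of y "y - s"] by simp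
  ultimately have s: "nrm s \<le> M" using rs(4) M by linarith
  have small: "nrm (a * b) < e" if "nrm a \<le> M" "nrm b < d" for a b
  proof -
    have "nrm (a * b) \<le> M * nrm b" using that(1) by (simp add: nrm_mult mult_right_mono)
    also have "\<dots> < M * d" using that(2) M by simp
    also have "\<dots> \<le> M * (e / M)" using M by (intro mult_left_mono) (simp_all add: d_def)
    finally show ?thesis using M by simp
  qed
  have "x * y - r * s = x * (y - s) + s * (x - r)" by (simp add: algebra_simps)
  then have "nrm (x * y - r * s) \<le> max (nrm (x * (y - s))) (nrm (s * (x - r)))" using nrm_add by metis
  then have "nrm (x * y - r * s) < e" using small[OF M(2) rs(4)] small[OF s rs(2)] by linarith
  then show "\<exists>r\<in>\<rat>. nrm (x * y - r) < e" using rs by (intro bexI[of _ "r * s"]) auto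
qed

lemma F_inverse:
  assumes "y \<in> F" "y \<noteq> 0"
  shows "inverse y \<in> F"
  unfolding F_def
proof (intro CollectI allI impI)
  fix e :: real assume e: "e > 0"
  have "min (nrm y) (e * nrm y * nrm y) > 0" using assms e by simp
  then obtain r where r: "r \<in> \<rat>" "nrm (y - r) < min (nrm y) (e * nrm y * nrm y)"
    using assms unfolding F_def by blast
  then have nr: "nrm r = nrm y" by (intro nrm_close) simp
  then have "r \<noteq> 0" using assms by auto
  then have "inverse y - inverse r = - ((y - r) / (y * r))" using assms by (simp add: field_simps)
  then have "nrm (inverse y - inverse r) = nrm (y - r) / (nrm y * nrm y)"
    by (simp add: nrm_divide nrm_mult nr)
  also have "\<dots> < e" using r assms by (simp add: divide_less_eq mult.assoc)
  finally show "\<exists>r\<in>\<rat>. nrm (inverse y - r) < e" using r by (intro bexI[of _ "inverse r"]) auto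
qed

definition spanF :: "'k set \<Rightarrow> 'k set" where
  "spanF B = {\<Sum>b\<in>B. c b * b | c. \<forall>b\<in>B. c b \<in> F}"

lemma spanF_diff: "finite B \<Longrightarrow> x \<in> spanF B \<Longrightarrow> y \<in> spanF B \<Longrightarrow> x - y \<in> spanF B"
proof -
  assume B: "finite B" and "x \<in> spanF B" "y \<in> spanF B"
  then obtain c d where "\<forall>b\<in>B. c b \<in> F" "\<forall>b\<in>B. d b \<in> F" "x = (\<Sum>b\<in>B. c b * b)" "y = (\<Sum>b\<in>B. d b * b)"
    by (auto simp: spanF_def)
  then show ?thesis unfolding spanF_def
    by (intro CollectI exI[of _ "\<lambda>b. c b - d b"]) (auto simp: F_diff sum_subtractf left_diff_distrib)
qed

lemma spanF_scale: "finite B \<Longrightarrow> x \<in> spanF B \<Longrightarrow> a \<in> F \<Longrightarrow> a * x \<in> spanF B"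
proof -
  assume B: "finite B" and a: "a \<in> F" and "x \<in> spanF B"
  then obtain c where "\<forall>b\<in>B. c b \<in> F" "x = (\<Sum>b\<in>B. c b * b)" by (auto simp: spanF_def)
  then show ?thesis unfolding spanF_def using a
    by (intro CollectI exI[of _ "\<lambda>b. a * c b"]) (auto simp: F_mult sum_distrib_left mult.assoc)
qed

definition valued_in :: "real set \<Rightarrow> 'k \<Rightarrow> bool" where
  "valued_in T x \<longleftrightarrow> (\<exists>t\<in>T. \<exists>n::int. nrm x = t * real p powi n)"

lemma valued_in_scale: "valued_in T x \<Longrightarrow> a \<in> F \<Longrightarrow> a \<noteq> 0 \<Longrightarrow> valued_in T (a * x)"
proof -
  assume x: "valued_in T x" and a: "a \<in> F" "a \<noteq> 0"
  obtain m where "nrm a = real p powi m" using nrm_F[OF a] by blast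
  moreover obtain t n where "t \<in> T" "nrm x = t * real p powi n" using x by (auto simp: valued_in_def)
  ultimately have "nrm (a * x) = t * real p powi (n + m)"
    using p_gt1 by (simp add: nrm_mult power_int_add)
  then show ?thesis using \<open>t \<in> T\<close> by (auto simp: valued_in_def)
qed

text \<open>Adjoining one vector to the spanning set contributes at most one new coset of values.\<close>

lemma values_span:
  assumes "finite B"
  shows "\<exists>T. finite T \<and> (\<forall>x\<in>spanF B - {0}. valued_in T x)"
  using assms
proof (induction B rule: finite_induct)
  case empty
  then show ?case by (auto simp: spanF_def)
next
  case (insert b B)
  then obtain T where T: "finite T" "\<And>x. x \<in> spanF B \<Longrightarrow> x \<noteq> 0 \<Longrightarrow> valued_in T x" by auto
  show ?case
  proof (cases "\<forall>v\<in>spanF B. v + b = 0 \<or> valued_in T (v + b)")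
    case True
    show ?thesis
    proof (intro exI[of _ T] conjI ballI T(1))
      fix x assume x: "x \<in> spanF (insert b B) - {0}"
      then obtain c where c: "\<forall>d\<in>insert b B. c d \<in> F" "x = (\<Sum>d\<in>insert b B. c d * d)"
        by (auto simp: spanF_def)
      define v where "v = (\<Sum>d\<in>B. c d * d)"
      have v: "v \<in> spanF B" using c by (auto simp: spanF_def v_def)
      have xv: "x = c b * b + v" using c insert by (simp add: v_def)
      show "valued_in T x"
      proof (cases "c b = 0")
        case True
        then show ?thesis using T(2)[OF v] x xv by simp
      next
        case False
        have "inverse (c b) * v \<in> spanF B" using v c False insert by (intro spanF_scale F_inverse) auto
        moreover have e: "x = c b * (inverse (c b) * v + b)" using False by (simp add: xv algebra_simps)
        ultimately have "valued_in T (inverse (c b) * v + b)" using \<open>\<forall>v\<in>spanF B. _\<close> x by auto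
        then show ?thesis unfolding e using c False by (intro valued_in_scale) auto
      qed
    qed
  next
    case False
    then obtain v0 where v0: "v0 \<in> spanF B" "v0 + b \<noteq> 0" "\<not> valued_in T (v0 + b)" by blast
    \<comment> \<open>If two new values differed, the difference of the two elements, which lies in
      \<open>spanF B\<close>, would have the larger of them as its value, against the choice of
      \<open>T\<close>.\<close>
    have new: "nrm (w + b) = nrm (v0 + b)" if w: "w \<in> spanF B" "\<not> valued_in T (w + b)" for w
    proof (rule ccontr)
      assume ne: "nrm (w + b) \<noteq> nrm (v0 + b)"
      have d: "(w + b) - (v0 + b) \<in> spanF B" using spanF_diff[OF insert(1) w(1) v0(1)] by simp
      have m: "nrm ((w + b) - (v0 + b)) = max (nrm (w + b)) (nrm (v0 + b))" by (rule nrm_distinct[OF ne])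
      then have "(w + b) - (v0 + b) \<noteq> 0" using ne by auto
      then have "valued_in T ((w + b) - (v0 + b))" using T(2) d by blast
      then have "valued_in T (w + b) \<or> valued_in T (v0 + b)"
        unfolding valued_in_def m by (auto simp: max_def split: if_splits)
      then show False using w v0 by blast
    qed
    show ?thesis
    proof (intro exI[of _ "insert (nrm (v0 + b)) T"] conjI ballI)
      fix x assume x: "x \<in> spanF (insert b B) - {0}"
      have mono: "valued_in T y \<Longrightarrow> valued_in (insert (nrm (v0 + b)) T) y" for y by (auto simp: valued_in_def)
      obtain c where c: "\<forall>d\<in>insert b B. c d \<in> F" "x = (\<Sum>d\<in>insert b B. c d * d)"
        using x by (auto simp: spanF_def)
      define v where "v = (\<Sum>d\<in>B. c d * d)"
      have v: "v \<in> spanF B" using c by (auto simp: spanF_def v_def)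
      have xv: "x = c b * b + v" using c insert by (simp add: v_def)
      show "valued_in (insert (nrm (v0 + b)) T) x"
      proof (cases "c b = 0")
        case True
        then show ?thesis using T(2)[OF v] x xv mono by simp
      next
        case False
        have w: "inverse (c b) * v \<in> spanF B" using v c False insert by (intro spanF_scale F_inverse) auto
        have "valued_in (insert (nrm (v0 + b)) T) (inverse (c b) * v + b)"
          using new[OF w] mono[of "inverse (c b) * v + b"]
          by (auto simp: valued_in_def intro!: exI[of _ 0])
        moreover have e: "x = c b * (inverse (c b) * v + b)" using False by (simp add: xv algebra_simps)
        ultimately show ?thesis unfolding e using c False by (intro valued_in_scale) auto
      qed
    qed (use T in simp)
  qed
qed

end

text \<open>By \<open>values_span\<close> all values lie in finitely many cosets of the powers of
  \<open>p\<close>, and each coset has at most one element in the interval from \<open>1 / p\<close>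
  (included) to 1 (excluded). So there are finitely many values in it, among them that of
  \<open>p\<close>; an element with the largest one is a uniformizer.\<close>

lemma dvf_exists:
  assumes K: "finite_extension_of_Qp p nrm"
  shows "\<exists>\<pi>. dvf nrm \<pi>"
proof -
  interpret padic_field nrm p
    using K by unfold_locales (auto simp: finite_extension_of_Qp_def)
  have "\<exists>B. finite B \<and> (\<forall>x. \<exists>c. (\<forall>b\<in>B. c b \<in> F) \<and> x = (\<Sum>b\<in>B. c b * b))"
    using K unfolding finite_extension_of_Qp_def rat_closure_F by (elim conjE)
  then obtain B where B: "finite B" and c: "\<And>x. \<exists>c. (\<forall>b\<in>B. c b \<in> F) \<and> x = (\<Sum>b\<in>B. c b * b)"
    by blast
  have spB: "x \<in> spanF B" for x
    using c[of x] unfolding spanF_def by (elim exE conjE) (intro CollectI exI conjI)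
  obtain T where T: "finite T" "\<And>x. x \<noteq> 0 \<Longrightarrow> valued_in T x" using values_span[OF B] spB by auto
  define S where "S = {nrm x | x. 1 / real p \<le> nrm x \<and> nrm x < 1}"
  define St where "St t = {t * real p powi n | n. 1 / real p \<le> t * real p powi n \<and> t * real p powi n < 1}" for t
  have one: "n \<le> m" if "1 / real p \<le> t * real p powi m" "t * real p powi n < 1" for t and m n :: int
  proof (rule ccontr)
    assume "\<not> n \<le> m"
    have t: "t > 0" using that(1) p_gt1 by (smt (verit) divide_pos_pos zero_less_mult_pos2 zero_less_power_int)
    have "real p powi (m + 1) \<le> real p powi n" using \<open>\<not> n \<le> m\<close> p_gt1 by (intro power_int_increasing) auto
    then have "t * real p powi (m + 1) < 1" using t that(2) by (smt (verit) mult_left_mono)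
    then have "t * real p powi m * real p < 1" using p_gt1 by (simp add: power_int_add mult.assoc)
    then show False using that(1) p_gt1 by (simp add: divide_le_eq)
  qed
  have finSt: "finite (St t)" for t
  proof (cases "St t = {}")
    case False
    then obtain n where n: "1 / real p \<le> t * real p powi n" "t * real p powi n < 1" by (auto simp: St_def)
    have "St t \<subseteq> {t * real p powi n}"
    proof
      fix s assume "s \<in> St t"
      then obtain m where m: "s = t * real p powi m" "1 / real p \<le> t * real p powi m" "t * real p powi m < 1"
        by (auto simp: St_def)
      then have "m = n" using one[OF n(1) m(3)] one[OF m(2) n(2)] by simp
      then show "s \<in> {t * real p powi n}" using m by simp
    qed
    then show ?thesis using finite_subset by blast
  qed simp
  have "S \<subseteq> (\<Union>t\<in>T. St t)"
  proof
    fix s assume "s \<in> S"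
    then obtain x where x: "s = nrm x" "1 / real p \<le> nrm x" "nrm x < 1" by (auto simp: S_def)
    then have "x \<noteq> 0" using p_gt1 by auto
    then obtain t n where t: "t \<in> T" "nrm x = t * real p powi n" using T(2)[of x] by (auto simp: valued_in_def)
    then have "s \<in> St t" using x unfolding St_def by (intro CollectI exI[of _ n]) simp
    then show "s \<in> (\<Union>t\<in>T. St t)" using t(1) by blast
  qed
  then have finS: "finite S" using T(1) finSt finite_subset by blast
  have "nrm (of_int (int p)) = (1 / real p) ^ multiplicity (int p) (int p)"
    using ext[unfolded extends_padic_abs_def, rule_format, of "int p"] prime_gt_0_nat[OF prime_p] by linarith
  moreover have "multiplicity (int p) (int p) = 1" using prime_p by (intro multiplicity_self) auto
  ultimately have np: "nrm (of_int (int p)) = 1 / real p" by simp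
  have "1 / real p \<in> S" unfolding S_def using p_gt1 np by (intro CollectI exI[of _ "of_int (int p)"]) auto
  then have S0: "S \<noteq> {}" and mx: "1 / real p \<le> Max S" using finS by auto
  then have "Max S \<in> S" using finS by simp
  then obtain \<pi> where \<pi>: "nrm \<pi> = Max S" "nrm \<pi> < 1" by (auto simp: S_def)
  have "nrm x \<le> nrm \<pi>" if "nrm x < 1" for x
  proof (cases "1 / real p \<le> nrm x")
    case True
    then have "nrm x \<in> S" using that by (auto simp: S_def)
    then show ?thesis using finS \<pi> by simp
  next
    case False
    then show ?thesis using mx \<pi> by linarith
  qed
  moreover have "\<pi> \<noteq> 0" using \<pi> mx p_gt1 by auto
  ultimately have "dvf nrm \<pi>" using \<pi> by unfold_locales auto
  then show ?thesis by blast
qed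

section \<open>Trees of groups acting on a tree\<close>

lemma einj_closed:
  assumes "tree_of_groups TG" "e \<in> edges (base TG)" "v \<in> extr (base TG) e" "h \<in> carrier (egrp TG e)"
  shows "einj TG e v h \<in> carrier (vgrp TG v)"
proof -
  have "einj TG e v \<in> mon (egrp TG e) (vgrp TG v)" using assms by (simp add: tree_of_groups_def)
  then show ?thesis using assms(4) by (auto simp: mon_def hom_def)
qed

lemma amalgam_eq_letters:
  assumes "tree_of_groups TG" "amalgam_eq TG xs ys"
  shows "xs \<in> lists (letters TG) \<and> ys \<in> lists (letters TG)"
  using assms(2)
proof induction
  case (one xs ys v)
  then have "group (vgrp TG v)" using assms(1) by (simp add: tree_of_groups_def)
  then have "\<one>\<^bsub>vgrp TG v\<^esub> \<in> carrier (vgrp TG v)" by (simp add: group.is_monoid monoid.one_closed)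
  then show ?case using one by (auto simp: letters_def)
next
  case (mult xs ys v g h)
  then have "group (vgrp TG v)" using assms(1) by (simp add: tree_of_groups_def)
  then have "g \<otimes>\<^bsub>vgrp TG v\<^esub> h \<in> carrier (vgrp TG v)"
    using mult by (simp add: group.is_monoid monoid.m_closed)
  then show ?case using mult by (auto simp: letters_def)
next
  case (edge xs ys e v w h)
  have "wf_graph (base TG)" using assms(1) by (auto simp: tree_of_groups_def tree_def)
  then have vw: "v \<in> verts (base TG)" "w \<in> verts (base TG)" using edge by (auto simp: wf_graph_def)
  have "einj TG e u h \<in> carrier (vgrp TG u)" if "u \<in> extr (base TG) e" for u
    using einj_closed[OF assms(1) _ that] edge by blast
  then show ?case using edge vw by (auto simp: letters_def)
qed auto

lemma amalgam_eq_context: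
  assumes "amalgam_eq TG xs ys" "us \<in> lists (letters TG)" "vs \<in> lists (letters TG)"
  shows "amalgam_eq TG (us @ xs @ vs) (us @ ys @ vs)"
  using assms(1)
proof induction
  case (refl xs)
  then show ?case using assms by (intro amalgam_eq.refl) auto
next
  case (sym xs ys)
  show ?case by (rule amalgam_eq.sym[OF sym.IH])
next
  case (trans xs ys zs)
  show ?case by (rule amalgam_eq.trans[OF trans.IH])
next
  case (one xs ys v)
  then show ?case using amalgam_eq.one[of "us @ xs" TG "ys @ vs" v] assms by simp
next
  case (mult xs ys v g h)
  then show ?case using amalgam_eq.mult[of "us @ xs" TG "ys @ vs" v g h] assms by simp
next
  case (edge xs ys e v w h)
  then show ?case using amalgam_eq.edge[of "us @ xs" TG "ys @ vs" e v w h] assms by simp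
qed

text \<open>
  The last three assumptions are what conditions (iii), (v) and (iv) of an admissible embedding say
  about the action of the vertex group at a single vertex.
\<close>

locale tree_of_groups_action = simp_tree VX adj + group P
  for VX :: "'x set" and adj :: "'x \<Rightarrow> 'x \<Rightarrow> bool" and P :: "'a monoid" +
  fixes TG :: "('v, 'e, 'g, 'h) graph_of_groups" and \<theta> :: "'v \<Rightarrow> 'g \<Rightarrow> 'a"
    and act :: "'a \<Rightarrow> 'x \<Rightarrow> 'x" and \<iota> :: "'v \<Rightarrow> 'x"
  assumes TG: "tree_of_groups TG"
    and act_V: "g \<in> carrier P \<Longrightarrow> x \<in> VX \<Longrightarrow> act g x \<in> VX"
    and act_mult: "g \<in> carrier P \<Longrightarrow> h \<in> carrier P \<Longrightarrow> x \<in> VX \<Longrightarrow> act (g \<otimes>\<^bsub>P\<^esub> h) x = act g (act h x)"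
    and act_one: "x \<in> VX \<Longrightarrow> act \<one>\<^bsub>P\<^esub> x = x"
    and act_adj: "g \<in> carrier P \<Longrightarrow> adj x y \<Longrightarrow> adj (act g x) (act g y)"
    and \<theta>_mon: "v \<in> verts (base TG) \<Longrightarrow> \<theta> v \<in> mon (vgrp TG v) P"
    and compat: "\<lbrakk>e \<in> edges (base TG); v \<in> extr (base TG) e; w \<in> extr (base TG) e; k \<in> carrier (egrp TG e)\<rbrakk>
        \<Longrightarrow> \<theta> v (einj TG e v k) = \<theta> w (einj TG e w k)"
    and \<iota>_V: "v \<in> verts (base TG) \<Longrightarrow> \<iota> v \<in> VX"
    and \<iota>_adj: "adjacent (base TG) v w \<Longrightarrow> adj (\<iota> v) (\<iota> w)"
    and \<iota>_inj: "inj_on \<iota> (verts (base TG))"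
    and vertex_fixes: "v \<in> verts (base TG) \<Longrightarrow> g \<in> \<theta> v ` carrier (vgrp TG v) \<Longrightarrow> act g (\<iota> v) = \<iota> v"
    and star_inj: "\<lbrakk>adjacent (base TG) v w; adjacent (base TG) v u; g \<in> \<theta> v ` carrier (vgrp TG v); act g (\<iota> w) = \<iota> u\<rbrakk>
        \<Longrightarrow> w = u"
    and edge_group: "\<lbrakk>e \<in> edges (base TG); extr (base TG) e = {v, w}; g \<in> \<theta> v ` carrier (vgrp TG v); act g (\<iota> w) = \<iota> w\<rbrakk>
        \<Longrightarrow> g \<in> \<theta> v ` einj TG e v ` carrier (egrp TG e)"
begin

abbreviation "T \<equiv> base TG"
abbreviation "\<G> v \<equiv> \<theta> v ` carrier (vgrp TG v)"

definition \<Gamma> :: "'a set" where "\<Gamma> = generate P (\<Union>v\<in>verts T. \<G> v)"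

lemma tree_T: "tree T" and vgrp_group: "v \<in> verts T \<Longrightarrow> group (vgrp TG v)"
  and vgrp_finite: "v \<in> verts T \<Longrightarrow> finite (carrier (vgrp TG v))"
  using TG by (auto simp: tree_of_groups_def)

sublocale t: simp_tree "verts T" "adjacent T"
  by (rule tree_simp_tree[OF tree_T])

lemma wf_T: "wf_graph T"
  using tree_T by (simp add: tree_def)

lemma extr_verts: "e \<in> edges T \<Longrightarrow> v \<in> extr T e \<Longrightarrow> v \<in> verts T"
  using wf_T unfolding wf_graph_def by blast

lemma \<theta>_hom: "v \<in> verts T \<Longrightarrow> group_hom (vgrp TG v) P (\<theta> v)"
  using \<theta>_mon[of v] vgrp_group[of v] is_group
  by (auto simp: group_hom_def group_hom_axioms_def mon_def)

lemma \<theta>_inj: "v \<in> verts T \<Longrightarrow> inj_on (\<theta> v) (carrier (vgrp TG v))"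
  using \<theta>_mon[of v] by (simp add: mon_def)

lemma \<theta>_carrier: "v \<in> verts T \<Longrightarrow> g \<in> carrier (vgrp TG v) \<Longrightarrow> \<theta> v g \<in> carrier P"
  by (rule group_hom.hom_closed[OF \<theta>_hom])

lemma \<G>_subgroup: "v \<in> verts T \<Longrightarrow> subgroup (\<G> v) P"
  using group_hom.img_is_subgroup[OF \<theta>_hom] .

lemma \<G>_carrier: "v \<in> verts T \<Longrightarrow> \<G> v \<subseteq> carrier P"
  by (rule subgroup.subset[OF \<G>_subgroup])

lemma \<Gamma>_subgroup: "subgroup \<Gamma> P"
  unfolding \<Gamma>_def by (intro generate_is_subgroup UN_least \<G>_carrier)

lemma \<Gamma>_carrier: "\<Gamma> \<subseteq> carrier P"
  by (rule subgroup.subset[OF \<Gamma>_subgroup])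

lemma \<G>_\<Gamma>: "v \<in> verts T \<Longrightarrow> \<G> v \<subseteq> \<Gamma>"
  unfolding \<Gamma>_def by (intro subsetI generate.incl) blast

lemma act_inv: "g \<in> carrier P \<Longrightarrow> x \<in> VX \<Longrightarrow> act (inv\<^bsub>P\<^esub> g) (act g x) = x"
  by (simp add: act_mult[symmetric] act_one)

lemma act_inj: "g \<in> carrier P \<Longrightarrow> inj_on (act g) VX"
  by (metis act_inv inj_on_inverseI)

lemma act_eq_iff: "g \<in> carrier P \<Longrightarrow> x \<in> VX \<Longrightarrow> y \<in> VX \<Longrightarrow> act g x = act g y \<longleftrightarrow> x = y"
  using act_inj by (meson inj_on_eq_iff)

lemma walk_act: "g \<in> carrier P \<Longrightarrow> walk xs x y \<Longrightarrow> walk (map (act g) xs) (act g x) (act g y)"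
  using walk_map act_V act_adj by meson

lemma geo_act: "g \<in> carrier P \<Longrightarrow> geo xs x y \<Longrightarrow> geo (map (act g) xs) (act g x) (act g y)"
  using geo_map act_V act_adj act_inj by meson

definition wp :: "('v \<times> 'g) list \<Rightarrow> 'a" where
  "wp ws = foldr (\<lambda>(v, g) a. \<theta> v g \<otimes>\<^bsub>P\<^esub> a) ws \<one>\<^bsub>P\<^esub>"

lemma wp_simps [simp]: "wp [] = \<one>\<^bsub>P\<^esub>" "wp ((v, g) # ws) = \<theta> v g \<otimes>\<^bsub>P\<^esub> wp ws"
  by (simp_all add: wp_def)

lemma letters_carrier: "(v, g) \<in> letters TG \<Longrightarrow> v \<in> verts T \<and> g \<in> carrier (vgrp TG v) \<and> \<theta> v g \<in> carrier P"
  using \<theta>_carrier by (auto simp: letters_def)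

lemma wp_carrier [simp]: "ws \<in> lists (letters TG) \<Longrightarrow> wp ws \<in> carrier P"
  by (induction ws) (auto dest: letters_carrier)

lemma wp_append: "xs \<in> lists (letters TG) \<Longrightarrow> ys \<in> lists (letters TG) \<Longrightarrow> wp (xs @ ys) = wp xs \<otimes>\<^bsub>P\<^esub> wp ys"
proof (induction xs)
  case (Cons x xs)
  then have "wp xs \<in> carrier P" "wp ys \<in> carrier P" "wp (xs @ ys) = wp xs \<otimes>\<^bsub>P\<^esub> wp ys" "x \<in> letters TG"
    by (auto intro: wp_carrier)
  then show ?case using letters_carrier by (cases x) (auto simp: m_assoc)
qed simp

lemma wp_\<Gamma>: "ws \<in> lists (letters TG) \<Longrightarrow> wp ws \<in> \<Gamma>"
proof (induction ws)
  case Nil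
  then show ?case using \<Gamma>_subgroup by (simp add: subgroup.one_closed)
next
  case (Cons a ws)
  then show ?case using \<G>_\<Gamma> \<Gamma>_subgroup by (cases a) (auto simp: letters_def intro!: subgroup.m_closed)
qed

lemma word_exists:
  assumes "\<gamma> \<in> generate P (\<Union>v\<in>A. \<G> v)" "A \<subseteq> verts T"
  shows "\<exists>ws\<in>lists (letters TG). wp ws = \<gamma> \<and> fst ` set ws \<subseteq> A"
  using assms(1)
proof induction
  case one
  then show ?case by (intro bexI[of _ "[]"]) auto
next
  case (incl h)
  then obtain v g where vg: "v \<in> A" "g \<in> carrier (vgrp TG v)" "h = \<theta> v g" by blast
  then have "v \<in> verts T" using assms(2) by blast
  then show ?case using vg \<theta>_carrier by (intro bexI[of _ "[(v, g)]"]) (auto simp: letters_def)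
next
  case (inv h)
  then obtain v g where vg: "v \<in> A" "g \<in> carrier (vgrp TG v)" "h = \<theta> v g" by blast
  have v: "v \<in> verts T" using assms(2) vg by blast
  interpret group_hom "vgrp TG v" P "\<theta> v" by (rule \<theta>_hom[OF v])
  have "inv\<^bsub>P\<^esub> h = \<theta> v (inv\<^bsub>vgrp TG v\<^esub> g)" using vg by simp
  then show ?case using vg v by (intro bexI[of _ "[(v, inv\<^bsub>vgrp TG v\<^esub> g)]"]) (auto simp: letters_def)
next
  case (eng h1 h2)
  then obtain xs ys where "xs \<in> lists (letters TG)" "wp xs = h1" "fst ` set xs \<subseteq> A"
    "ys \<in> lists (letters TG)" "wp ys = h2" "fst ` set ys \<subseteq> A" by blast
  then show ?case by (intro bexI[of _ "xs @ ys"]) (auto simp: wp_append)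
qed

lemma amalgam_eq_wp: "amalgam_eq TG xs ys \<Longrightarrow> wp xs = wp ys"
proof (induction rule: amalgam_eq.induct)
  case (one xs ys v)
  interpret group_hom "vgrp TG v" P "\<theta> v" by (rule \<theta>_hom[OF one(3)])
  have "(v, \<one>\<^bsub>vgrp TG v\<^esub>) \<in> letters TG" using one by (simp add: letters_def)
  then show ?case using one by (simp add: wp_append)
next
  case (mult xs ys v g h)
  note P_assoc = m_assoc
  interpret group_hom "vgrp TG v" P "\<theta> v" by (rule \<theta>_hom[OF mult(3)])
  have "(v, g) \<in> letters TG" "(v, h) \<in> letters TG" "(v, g \<otimes>\<^bsub>vgrp TG v\<^esub> h) \<in> letters TG"
    using mult by (simp_all add: letters_def)
  moreover have "\<theta> v g \<in> carrier P" "\<theta> v h \<in> carrier P" using \<theta>_carrier mult by blast+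
  moreover have "wp xs \<in> carrier P" "wp ys \<in> carrier P" using mult wp_carrier by blast+
  ultimately show ?case using mult by (simp add: wp_append P_assoc)
next
  case (edge xs ys e v w h)
  have vw: "v \<in> verts T" "w \<in> verts T" using edge extr_verts by blast+
  have "einj TG e u h \<in> carrier (vgrp TG u)" if "u \<in> extr T e" for u
    using einj_closed[OF TG _ that] edge by blast
  then have "(v, einj TG e v h) \<in> letters TG" "(w, einj TG e w h) \<in> letters TG"
    using edge vw by (auto simp: letters_def)
  then show ?case using edge compat[OF edge(3,4,5,6)] by (simp add: wp_append letters_carrier)
qed auto

section \<open>Words as paths, and their reduction\<close>

definition wpath :: "('v \<times> 'g) list \<Rightarrow> bool" where
  "wpath ws \<longleftrightarrow> ws \<noteq> [] \<and> ws \<in> lists (letters TG) \<and>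
     successively (\<lambda>x y. fst x = fst y \<or> adjacent T (fst x) (fst y)) ws"

text \<open>These are the places where a word can be shortened: two letters at one vertex, or a
  middle letter that carries the edge towards the next vertex back onto the edge just travelled. The
  second pattern is where \<open>trace\<close> backtracks.\<close>

fun reducible :: "('v \<times> 'g) list \<Rightarrow> bool" where
  "reducible ((u, a) # (v, b) # ws) \<longleftrightarrow>
     u = v \<or> (ws \<noteq> [] \<and> act (\<theta> v b) (\<iota> (fst (hd ws))) = \<iota> u) \<or> reducible ((v, b) # ws)"
| "reducible _ \<longleftrightarrow> False"

lemma reducible_split:
  assumes "reducible ws"
  shows "(\<exists>xs u a b ys. ws = xs @ [(u, a), (u, b)] @ ys) \<or>
    (\<exists>xs u a v b w c ys. ws = xs @ [(u, a), (v, b), (w, c)] @ ys \<and> u \<noteq> v \<and> v \<noteq> w \<and> act (\<theta> v b) (\<iota> w) = \<iota> u)"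
  using assms
proof (induction ws rule: reducible.induct)
  case (1 u a v b ws)
  consider "u = v" | "u \<noteq> v" "ws \<noteq> []" "v = fst (hd ws)"
    | "u \<noteq> v" "ws \<noteq> []" "v \<noteq> fst (hd ws)" "act (\<theta> v b) (\<iota> (fst (hd ws))) = \<iota> u" | "reducible ((v, b) # ws)"
    using 1(2) by auto
  then show ?case
  proof cases
    case 1
    then have "(u, a) # (v, b) # ws = [] @ [(u, a), (u, b)] @ ws" by simp
    then show ?thesis by blast
  next
    case 2
    then have "(u, a) # (v, b) # ws = [(u, a)] @ [(v, b), (v, snd (hd ws))] @ tl ws" by (cases ws) auto
    then show ?thesis by blast
  next
    case 3
    then have "(u, a) # (v, b) # ws = [] @ [(u, a), (v, b), (fst (hd ws), snd (hd ws))] @ tl ws" by (cases ws) auto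
    then show ?thesis using 3 by blast
  next
    case 4
    from "1.IH"[OF this] show ?thesis
    proof
      assume "\<exists>xs u a b' ys. (v, b) # ws = xs @ [(u, a), (u, b')] @ ys"
      then obtain xs u' a' b' ys where "(v, b) # ws = xs @ [(u', a'), (u', b')] @ ys" by blast
      then have "(u, a) # (v, b) # ws = ((u, a) # xs) @ [(u', a'), (u', b')] @ ys" by simp
      then show ?thesis by blast
    next
      assume "\<exists>xs u a v' b' w c ys. (v, b) # ws = xs @ [(u, a), (v', b'), (w, c)] @ ys \<and> u \<noteq> v' \<and> v' \<noteq> w \<and> act (\<theta> v' b') (\<iota> w) = \<iota> u"
      then obtain xs u' a' v' b' w' c' ys where h: "(v, b) # ws = xs @ [(u', a'), (v', b'), (w', c')] @ ys"
        "u' \<noteq> v'" "v' \<noteq> w'" "act (\<theta> v' b') (\<iota> w') = \<iota> u'" by blast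
      then have "(u, a) # (v, b) # ws = ((u, a) # xs) @ [(u', a'), (v', b'), (w', c')] @ ys" by simp
      then show ?thesis using h by blast
    qed
  qed
qed auto

lemma merge_step:
  assumes "wpath (xs @ [(u, a), (u, b)] @ ys)"
  shows "wpath (xs @ [(u, a \<otimes>\<^bsub>vgrp TG u\<^esub> b)] @ ys) \<and>
    amalgam_eq TG (xs @ [(u, a), (u, b)] @ ys) (xs @ [(u, a \<otimes>\<^bsub>vgrp TG u\<^esub> b)] @ ys)"
proof -
  have l: "xs \<in> lists (letters TG)" "ys \<in> lists (letters TG)" "u \<in> verts T" "a \<in> carrier (vgrp TG u)" "b \<in> carrier (vgrp TG u)"
    using assms by (auto simp: wpath_def letters_def)
  interpret group "vgrp TG u" by (rule vgrp_group[OF l(3)])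
  have "wpath (xs @ [(u, a \<otimes>\<^bsub>vgrp TG u\<^esub> b)] @ ys)"
    using assms l by (cases ys) (auto simp: wpath_def letters_def successively_append_iff)
  then show ?thesis using amalgam_eq.mult[OF l] by simp
qed

text \<open>In the backtracking case \<open>star_inj\<close> gives \<open>w = u\<close>, and
  \<open>edge_group\<close> places \<open>b\<close> in the edge group. The edge relation moves it to
  \<open>u\<close>, where three letters merge into one.\<close>

lemma reduce_step:
  assumes ws: "wpath ws" and r: "reducible ws"
  shows "\<exists>ws'. wpath ws' \<and> amalgam_eq TG ws ws' \<and> length ws' < length ws \<and>
    fst (hd ws') = fst (hd ws) \<and> fst (last ws') = fst (last ws)"
  using reducible_split[OF r]
proof (elim disjE exE conjE)
  fix xs u a b ys assume e: "ws = xs @ [(u, a), (u, b)] @ ys"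
  show ?thesis
    using merge_step[of xs u a b ys] ws unfolding e
    by (intro exI[of _ "xs @ [(u, a \<otimes>\<^bsub>vgrp TG u\<^esub> b)] @ ys"]) (auto simp: hd_append)
next
  fix xs u a v b w c ys
  assume e: "ws = xs @ [(u, a), (v, b), (w, c)] @ ys" "u \<noteq> v" "v \<noteq> w" "act (\<theta> v b) (\<iota> w) = \<iota> u"
  have l: "xs \<in> lists (letters TG)" "ys \<in> lists (letters TG)" "u \<in> verts T" "a \<in> carrier (vgrp TG u)"
    "v \<in> verts T" "b \<in> carrier (vgrp TG v)" "w \<in> verts T" "c \<in> carrier (vgrp TG w)"
    using ws e(1) by (auto simp: wpath_def letters_def)
  have adj: "adjacent T v w" "adjacent T v u"
    using ws e by (auto simp: wpath_def successively_append_iff intro: t.adj_sym)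
  have wu: "w = u" using star_inj[OF adj _ e(4)] l by blast
  obtain ed where ed: "ed \<in> edges T" "extr T ed = {v, u}" using adj(2) by (auto simp: adjacent_def)
  have "\<theta> v b \<in> \<theta> v ` einj TG ed v ` carrier (egrp TG ed)"
    using edge_group[OF ed, of "\<theta> v b"] l e(4) wu by blast
  then obtain h where h: "h \<in> carrier (egrp TG ed)" "\<theta> v b = \<theta> v (einj TG ed v h)" by blast
  have einj: "einj TG ed x h \<in> carrier (vgrp TG x)" if "x \<in> extr T ed" for x
    using einj_closed[OF TG _ that] ed h by blast
  have b: "b = einj TG ed v h" using h \<theta>_inj[OF l(5)] einj[of v] ed l by (auto simp: inj_on_eq_iff)
  define b' where "b' = einj TG ed u h"
  have b': "b' \<in> carrier (vgrp TG u)" using einj[of u] ed by (simp add: b'_def)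
  have 1: "amalgam_eq TG ws (xs @ [(u, a), (u, b'), (u, c)] @ ys)"
    using amalgam_eq.edge[of "xs @ [(u, a)]" TG "(u, c) # ys" ed v u h] l ed h
    unfolding e(1) b b'_def wu by (simp add: letters_def wu)
  have w1: "wpath (xs @ [(u, a), (u, b')] @ ((u, c) # ys))"
    using ws l b' unfolding e(1) wpath_def wu
    by (auto simp: successively_append_iff letters_def wu)
  note m1 = merge_step[OF w1]
  then have w2: "wpath (xs @ [(u, a \<otimes>\<^bsub>vgrp TG u\<^esub> b'), (u, c)] @ ys)" by simp
  note m2 = merge_step[OF w2]
  have "amalgam_eq TG ws (xs @ [(u, a \<otimes>\<^bsub>vgrp TG u\<^esub> b' \<otimes>\<^bsub>vgrp TG u\<^esub> c)] @ ys)"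
    using amalgam_eq.trans[OF 1] m1 m2 amalgam_eq.trans by (metis append_Cons append_Nil)
  then show ?thesis using m2 unfolding e(1)
    by (intro exI[of _ "xs @ [(u, a \<otimes>\<^bsub>vgrp TG u\<^esub> b' \<otimes>\<^bsub>vgrp TG u\<^esub> c)] @ ys"]) (auto simp: hd_append wu)
qed

lemma reduce:
  assumes "wpath ws"
  shows "\<exists>ws'. wpath ws' \<and> amalgam_eq TG ws ws' \<and> \<not> reducible ws' \<and>
    fst (hd ws') = fst (hd ws) \<and> fst (last ws') = fst (last ws)"
  using assms
proof (induction "length ws" arbitrary: ws rule: less_induct)
  case less
  show ?case
  proof (cases "reducible ws")
    case True
    from reduce_step[OF less.prems this] obtain ws1 where ws1: "wpath ws1" "amalgam_eq TG ws ws1"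
      "length ws1 < length ws" "fst (hd ws1) = fst (hd ws)" "fst (last ws1) = fst (last ws)" by blast
    from less.hyps[OF ws1(3,1)] obtain ws2 where "wpath ws2" "amalgam_eq TG ws1 ws2" "\<not> reducible ws2"
      "fst (hd ws2) = fst (hd ws1)" "fst (last ws2) = fst (last ws1)" by blast
    then show ?thesis using ws1 amalgam_eq.trans[OF ws1(2)] by metis
  next
    case False
    then show ?thesis using less.prems by (auto simp: wpath_def intro: amalgam_eq.refl)
  qed
qed

text \<open>
  The path of \<open>(v\<^sub>1, g\<^sub>1), \<dots>, (v\<^sub>n, g\<^sub>n)\<close> has the vertices \<open>\<iota> v\<^sub>1\<close>, \<open>g\<^sub>1 (\<iota> v\<^sub>2)\<close>, \<open>g\<^sub>1 g\<^sub>2 (\<iota> v\<^sub>3)\<close> etc.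
\<close>

fun trace :: "('v \<times> 'g) list \<Rightarrow> 'x list" where
  "trace [] = []"
| "trace ((v, g) # ws) = \<iota> v # map (act (\<theta> v g)) (trace ws)"

lemma trace_length [simp]: "length (trace ws) = length ws"
  by (induction ws rule: trace.induct) auto

text \<open>The first letter fixes the first vertex, so it can be applied to the rest of the path
  without breaking the first edge; irreducibility says that the third vertex is not the first one
  again.\<close>

lemma trace_geo:
  assumes "wpath ws" "\<not> reducible ws"
  shows "geo (trace ws) (\<iota> (fst (hd ws))) (act (wp ws) (\<iota> (fst (last ws))))"
  using assms
proof (induction ws rule: reducible.induct)
  case (1 u a v b ws)
  let ?r = "(v, b) # ws"
  have l: "u \<in> verts T" "a \<in> carrier (vgrp TG u)" "v \<in> verts T" "b \<in> carrier (vgrp TG v)" "?r \<in> lists (letters TG)"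
    using 1(2) by (auto simp: wpath_def letters_def)
  have ca: "\<theta> u a \<in> carrier P" using \<theta>_carrier l by blast
  have r: "wpath ?r" "\<not> reducible ?r" using 1(2,3) by (auto simp: wpath_def)
  have IH: "geo (trace ?r) (\<iota> v) (act (wp ?r) (\<iota> (fst (last ?r))))" using "1.IH"[OF r] by simp
  define z where "z = act (wp ?r) (\<iota> (fst (last ?r)))"
  have adj: "adjacent T u v" using 1(2,3) by (auto simp: wpath_def)
  have fixu: "act (\<theta> u a) (\<iota> u) = \<iota> u" using vertex_fixes l by blast
  have adjx: "adj (\<iota> u) (act (\<theta> u a) (\<iota> v))" using act_adj[OF ca \<iota>_adj[OF adj]] fixu by simp
  have g: "geo (map (act (\<theta> u a)) (trace ?r)) (act (\<theta> u a) (\<iota> v)) (act (\<theta> u a) z)"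
    using geo_act[OF ca IH] by (simp add: z_def)
  have lastv: "fst (last ?r) \<in> verts T"
    using l(5) by (metis last_in_set list.distinct(1) lists_eq_set letters_carrier mem_Collect_eq prod.collapse subsetD)
  have "act (\<theta> u a) z = act (wp ((u, a) # ?r)) (\<iota> (fst (last ((u, a) # ?r))))"
    using act_mult[OF ca wp_carrier[OF l(5)] \<iota>_V[OF lastv]] by (simp add: z_def)
  moreover have "nb (\<iota> u # map (act (\<theta> u a)) (trace ?r))"
    unfolding nb_Cons
  proof (intro conjI impI)
    show "nb (map (act (\<theta> u a)) (trace ?r))" using g by (simp add: geo_def)
    assume "2 \<le> length (map (act (\<theta> u a)) (trace ?r))"
    then obtain w c ws' where ws: "ws = (w, c) # ws'" by (cases ws) auto
    have w: "w \<in> verts T" using l(5) ws by (auto simp: letters_def)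
    have "act (\<theta> v b) (\<iota> w) \<noteq> \<iota> u" using 1(3) ws by auto
    moreover have "act (\<theta> v b) (\<iota> w) \<in> VX" using act_V \<theta>_carrier l \<iota>_V w by blast
    ultimately have "act (\<theta> u a) (act (\<theta> v b) (\<iota> w)) \<noteq> act (\<theta> u a) (\<iota> u)"
      using act_eq_iff[OF ca] \<iota>_V l by blast
    then show "\<iota> u \<noteq> map (act (\<theta> u a)) (trace ?r) ! 1" using fixu ws by simp
  qed
  ultimately show ?case using walk_Cons[OF geo_walk[OF g] adjx] by (simp add: geo_def)
next
  case ("2_1")
  then show ?case by (simp add: wpath_def)
next
  case ("2_2" x)
  obtain v g where x: "x = (v, g)" by (cases x)
  have l: "v \<in> verts T" "g \<in> carrier (vgrp TG v)" using "2_2" x by (auto simp: wpath_def letters_def)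
  have "act (\<theta> v g) (\<iota> v) = \<iota> v" using vertex_fixes l by blast
  then show ?case using walk_single[OF \<iota>_V[OF l(1)]] \<theta>_carrier l x by (simp add: geo_def)
qed

text \<open>Identity letters along a walk of \<open>T\<close> do not change the class of a word.
  With them any word can be padded to a path with prescribed first and last vertex.\<close>

lemma ones_path:
  assumes "t.walk ps v w"
  shows "\<exists>ws. wpath ws \<and> amalgam_eq TG ws [] \<and> fst (hd ws) = v \<and> fst (last ws) = w"
proof -
  define o1 where "o1 v = (v, \<one>\<^bsub>vgrp TG v\<^esub>)" for v
  have o: "o1 x \<in> letters TG" if "x \<in> verts T" for x
    using vgrp_group[OF that] that by (simp add: o1_def letters_def group.is_monoid monoid.one_closed)
  have ps: "set ps \<subseteq> verts T" "ps \<noteq> []" "successively (adjacent T) ps" "hd ps = v" "last ps = w"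
    using assms by (auto simp: t.walk_def)
  have eq: "amalgam_eq TG (map o1 qs) []" if "set qs \<subseteq> verts T" for qs
    using that
  proof (induction qs)
    case Nil
    then show ?case by (auto intro: amalgam_eq.refl)
  next
    case (Cons x qs)
    then have "\<forall>x\<in>set qs. o1 x \<in> letters TG" using o by (simp add: subset_iff)
    then have "map o1 qs \<in> lists (letters TG)" by (simp add: in_lists_conv_set)
    then have "amalgam_eq TG (map o1 (x # qs)) (map o1 qs)"
      using amalgam_eq.one[of "[]" TG "map o1 qs" x] Cons by (simp add: o1_def)
    then show ?case using Cons amalgam_eq.trans by auto
  qed
  have "\<forall>x\<in>set ps. o1 x \<in> letters TG" using o ps(1) by (simp add: subset_iff)
  moreover have "successively (\<lambda>x y. fst (o1 x) = fst (o1 y) \<or> adjacent T (fst (o1 x)) (fst (o1 y))) ps"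
    using ps(3) by (rule successively_mono) (simp add: o1_def)
  ultimately have "wpath (map o1 ps)"
    using ps(2) by (simp add: wpath_def successively_map in_lists_conv_set)
  then show ?thesis using eq[OF ps(1)] ps
    by (intro exI[of _ "map o1 ps"]) (simp add: hd_map last_map o1_def)
qed

lemma word_to_path:
  assumes "ws \<in> lists (letters TG)" "v \<in> verts T" "w \<in> verts T"
  shows "\<exists>ws'. wpath ws' \<and> amalgam_eq TG ws ws' \<and> fst (hd ws') = v \<and> fst (last ws') = w"
  using assms(1,2)
proof (induction ws arbitrary: v)
  case Nil
  with assms(3) obtain ps where "t.walk ps v w" using t.walk_exists by blast
  from ones_path[OF this] show ?case using amalgam_eq.sym by blast
next
  case (Cons x ws)
  obtain u g where x: "x = (u, g)" by (cases x)
  have u: "u \<in> verts T" "x \<in> letters TG" "ws \<in> lists (letters TG)" using Cons.hyps x by (auto simp: letters_def)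
  obtain ps where "t.walk ps v u" using t.walk_exists Cons.prems u by blast
  then obtain os where os: "wpath os" "amalgam_eq TG os []" "fst (hd os) = v" "fst (last os) = u"
    using ones_path by blast
  obtain ws' where ws': "wpath ws'" "amalgam_eq TG ws ws'" "fst (hd ws') = u" "fst (last ws') = w"
    using Cons.IH[OF u(1)] by blast
  have osl: "os \<in> lists (letters TG)" "ws' \<in> lists (letters TG)" using os ws' by (auto simp: wpath_def)
  have "wpath (os @ x # ws')"
    using os ws' u(2) by (cases ws') (auto simp: wpath_def successively_append_iff x)
  moreover have "amalgam_eq TG (x # ws) (os @ x # ws')"
  proof -
    have "amalgam_eq TG (x # ws) (x # ws')"
      using amalgam_eq_context[OF ws'(2), of "[x]" "[]"] u by simp
    moreover have "amalgam_eq TG (x # ws') (os @ x # ws')"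
      using amalgam_eq_context[OF amalgam_eq.sym[OF os(2)], of "[]" "x # ws'"] u osl by simp
    ultimately show ?thesis by (rule amalgam_eq.trans)
  qed
  moreover have "os \<noteq> []" "ws' \<noteq> []" using os ws' by (auto simp: wpath_def)
  ultimately show ?case using os ws' by (intro exI[of _ "os @ x # ws'"]) simp
qed

text \<open>The word is equivalent to an irreducible path from \<open>v\<close> to \<open>w\<close>.
  Its trace is a geodesic from \<open>\<iota> v\<close> to itself, so a single letter is
  left.\<close>

lemma word_stabilizer:
  assumes ws: "ws \<in> lists (letters TG)" and vw: "v \<in> verts T" "w \<in> verts T"
    and e: "act (wp ws) (\<iota> w) = \<iota> v"
  shows "v = w \<and> (\<exists>g\<in>carrier (vgrp TG v). amalgam_eq TG ws [(v, g)])"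
proof -
  obtain ws1 where ws1: "wpath ws1" "amalgam_eq TG ws ws1" "fst (hd ws1) = v" "fst (last ws1) = w"
    using word_to_path[OF ws vw] by blast
  obtain ws2 where ws2: "wpath ws2" "amalgam_eq TG ws1 ws2" "\<not> reducible ws2"
    "fst (hd ws2) = v" "fst (last ws2) = w" using reduce[OF ws1(1)] ws1 by metis
  have eq: "amalgam_eq TG ws ws2" using ws1 ws2 amalgam_eq.trans by blast
  have "geo (trace ws2) (\<iota> v) (act (wp ws2) (\<iota> w))" using trace_geo[OF ws2(1,3)] ws2 by simp
  moreover have "wp ws2 = wp ws" using amalgam_eq_wp[OF eq] by simp
  ultimately have "geo (trace ws2) (\<iota> v) (\<iota> v)" using e by simp
  then have "length (trace ws2) = 1" using geo_closed by fastforce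
  then obtain y where y: "ws2 = [y]" by (auto simp: length_Suc_conv)
  then obtain g where "y = (v, g)" using ws2(4) by (cases y) auto
  then have "ws2 = [(v, g)]" "g \<in> carrier (vgrp TG v)" using ws2(1) y by (auto simp: wpath_def letters_def)
  then show ?thesis using ws2 eq by auto
qed

lemma stabilizer:
  assumes "\<gamma> \<in> \<Gamma>" "v \<in> verts T" "w \<in> verts T" "act \<gamma> (\<iota> w) = \<iota> v"
  shows "v = w" "\<gamma> \<in> \<G> v"
proof -
  obtain ws where ws: "ws \<in> lists (letters TG)" "wp ws = \<gamma>"
    using word_exists[of \<gamma> "verts T"] assms(1) by (auto simp: \<Gamma>_def)
  with word_stabilizer[OF ws(1) assms(2,3)] assms(4) obtain g where
    g: "v = w" "g \<in> carrier (vgrp TG v)" "amalgam_eq TG ws [(v, g)]" by auto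
  show "v = w" by fact
  have "\<gamma> = \<theta> v g" using amalgam_eq_wp[OF g(3)] ws \<theta>_carrier[OF assms(2) g(2)] by simp
  then show "\<gamma> \<in> \<G> v" using g by blast
qed

text \<open>Faithfulness of the amalgam: a word with trivial value fixes every vertex, hence is
  equivalent to one letter, and this letter is trivial as \<open>\<theta> v\<close> is
  injective.\<close>

lemma word_trivial:
  assumes "ws \<in> lists (letters TG)" "wp ws = \<one>\<^bsub>P\<^esub>"
  shows "amalgam_eq TG ws []"
proof -
  obtain v where v: "v \<in> verts T" using tree_T by (auto simp: tree_def)
  obtain g where g: "g \<in> carrier (vgrp TG v)" "amalgam_eq TG ws [(v, g)]"
    using word_stabilizer[OF assms(1) v v] assms(2) act_one[OF \<iota>_V[OF v]] by auto
  interpret gh: group_hom "vgrp TG v" P "\<theta> v" by (rule \<theta>_hom[OF v])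
  have "\<theta> v g = \<theta> v \<one>\<^bsub>vgrp TG v\<^esub>" using amalgam_eq_wp[OF g(2)] assms(2) g(1) by simp
  then have "g = \<one>\<^bsub>vgrp TG v\<^esub>" using inj_onD[OF \<theta>_inj[OF v] _ g(1)] gh.G.one_closed by blast
  then have "amalgam_eq TG [(v, g)] []" using amalgam_eq.one[of "[]" TG "[]" v] v by simp
  then show ?thesis using amalgam_eq.trans[OF g(2)] by blast
qed

lemma word_inverse:
  assumes "ws \<in> lists (letters TG)"
  shows "\<exists>ws'\<in>lists (letters TG). wp ws' = inv\<^bsub>P\<^esub> (wp ws)"
proof -
  have "inv\<^bsub>P\<^esub> (wp ws) \<in> \<Gamma>" using wp_\<Gamma>[OF assms] \<Gamma>_subgroup by (simp add: subgroup.m_inv_closed)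
  then show ?thesis unfolding \<Gamma>_def using word_exists[OF _ order_refl] by blast
qed

text \<open>With a word \<open>zs\<close> for the inverse of the common value,
  \<open>xs @ zs @ ys\<close> is equivalent to both sides by \<open>word_trivial\<close>.\<close>

lemma amalgam_eq_iff:
  assumes "xs \<in> lists (letters TG)" "ys \<in> lists (letters TG)"
  shows "amalgam_eq TG xs ys \<longleftrightarrow> wp xs = wp ys"
proof
  assume e: "wp xs = wp ys"
  obtain zs where zs: "zs \<in> lists (letters TG)" "wp zs = inv\<^bsub>P\<^esub> (wp ys)" using word_inverse[OF assms(2)] by blast
  have zl: "zs @ ys \<in> lists (letters TG)" "xs @ zs \<in> lists (letters TG)"
    by (rule append_in_lists_conv[THEN iffD2, OF conjI[OF zs(1) assms(2)]],
        rule append_in_lists_conv[THEN iffD2, OF conjI[OF assms(1) zs(1)]])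
  have "wp (zs @ ys) = \<one>\<^bsub>P\<^esub>" 
    unfolding wp_append[OF zs(1) assms(2)] zs(2) by (rule l_inv[OF wp_carrier[OF assms(2)]])
  then have "amalgam_eq TG (zs @ ys) []" by (rule word_trivial[OF zl(1)])
  from amalgam_eq_context[OF this, of xs "[]"] assms have 1: "amalgam_eq TG (xs @ zs @ ys) xs" by simp
  have "wp (xs @ zs) = \<one>\<^bsub>P\<^esub>" 
    unfolding wp_append[OF assms(1) zs(1)] zs(2) e by (rule r_inv[OF wp_carrier[OF assms(2)]])
  then have "amalgam_eq TG (xs @ zs) []" by (rule word_trivial[OF zl(2)])
  from amalgam_eq_context[OF this, of "[]" ys] assms have 2: "amalgam_eq TG (xs @ zs @ ys) ys" by simp
  show "amalgam_eq TG xs ys" by (rule amalgam_eq.trans[OF amalgam_eq.sym[OF 1] 2])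
qed (rule amalgam_eq_wp)

lemma amalgam_class_eq:
  assumes "xs \<in> lists (letters TG)"
  shows "amalgam_class TG xs = {ys \<in> lists (letters TG). wp ys = wp xs}"
  unfolding amalgam_class_def using amalgam_eq_iff[OF assms] amalgam_eq_letters[OF TG] by fastforce

section \<open>The amalgam as a subgroup\<close>

definition amalgam_map :: "('v \<times> 'g) list set \<Rightarrow> 'a" where
  "amalgam_map X = wp (SOME xs. xs \<in> X)"

lemma amalgam_map_class: "xs \<in> lists (letters TG) \<Longrightarrow> amalgam_map (amalgam_class TG xs) = wp xs"
proof -
  assume xs: "xs \<in> lists (letters TG)"
  then have "xs \<in> amalgam_class TG xs" by (simp add: amalgam_class_eq)
  then have "(SOME ys. ys \<in> amalgam_class TG xs) \<in> amalgam_class TG xs" by (rule someI)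
  then show ?thesis unfolding amalgam_map_def using xs by (simp add: amalgam_class_eq)
qed

lemma amalgam_mult_class:
  assumes "xs \<in> lists (letters TG)" "ys \<in> lists (letters TG)"
  shows "amalgam_class TG xs \<otimes>\<^bsub>amalgam TG\<^esub> amalgam_class TG ys = amalgam_class TG (xs @ ys)"
proof -
  have eq: "amalgam_class TG (xs' @ ys') = amalgam_class TG (xs @ ys)"
    if "xs' \<in> amalgam_class TG xs" "ys' \<in> amalgam_class TG ys" for xs' ys'
  proof -
    have l: "xs' \<in> lists (letters TG)" "wp xs' = wp xs" "ys' \<in> lists (letters TG)" "wp ys' = wp ys"
      using that unfolding amalgam_class_eq[OF assms(1)] amalgam_class_eq[OF assms(2)] by blast+
    have "wp (xs' @ ys') = wp (xs @ ys)"
      unfolding wp_append[OF l(1,3)] wp_append[OF assms] l(2,4) ..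
    moreover have "xs' @ ys' \<in> lists (letters TG)" "xs @ ys \<in> lists (letters TG)"
      unfolding append_in_lists_conv using l assms by simp_all
    ultimately show ?thesis by (simp only: amalgam_class_eq)
  qed
  have mem: "xs \<in> amalgam_class TG xs" "ys \<in> amalgam_class TG ys" using assms by (simp_all add: amalgam_class_eq)
  have "(\<Union>xs'\<in>amalgam_class TG xs. \<Union>ys'\<in>amalgam_class TG ys. amalgam_class TG (xs' @ ys')) =
      (\<Union>xs'\<in>amalgam_class TG xs. \<Union>ys'\<in>amalgam_class TG ys. amalgam_class TG (xs @ ys))"
    by (intro SUP_cong HOL.refl eq)
  also have "\<dots> = amalgam_class TG (xs @ ys)" using mem by blast
  finally show ?thesis by (simp add: amalgam_def)
qed

lemma amalgam_iso: "amalgam_map \<in> iso (amalgam TG) (P\<lparr>carrier := \<Gamma>\<rparr>)"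
  unfolding iso_def
proof (intro CollectI conjI)
  have car: "carrier (amalgam TG) = amalgam_class TG ` lists (letters TG)" by (simp add: amalgam_def)
  show "amalgam_map \<in> hom (amalgam TG) (P\<lparr>carrier := \<Gamma>\<rparr>)"
    unfolding hom_def car
  proof (intro CollectI conjI ballI)
    show "amalgam_map \<in> amalgam_class TG ` lists (letters TG) \<rightarrow> carrier (P\<lparr>carrier := \<Gamma>\<rparr>)"
      by (intro funcsetI, elim imageE) (simp add: amalgam_map_class wp_\<Gamma>)
    fix X Y assume "X \<in> amalgam_class TG ` lists (letters TG)" "Y \<in> amalgam_class TG ` lists (letters TG)"
    then obtain xs ys where "xs \<in> lists (letters TG)" "X = amalgam_class TG xs" "ys \<in> lists (letters TG)" "Y = amalgam_class TG ys" by blast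
    then show "amalgam_map (X \<otimes>\<^bsub>amalgam TG\<^esub> Y) = amalgam_map X \<otimes>\<^bsub>P\<lparr>carrier := \<Gamma>\<rparr>\<^esub> amalgam_map Y"
      by (simp add: amalgam_mult_class amalgam_map_class wp_append)
  qed
  show "bij_betw amalgam_map (carrier (amalgam TG)) (carrier (P\<lparr>carrier := \<Gamma>\<rparr>))"
    unfolding bij_betw_def car
  proof (intro conjI)
    show "inj_on amalgam_map (amalgam_class TG ` lists (letters TG))"
    proof (rule inj_onI)
      fix X Y assume "X \<in> amalgam_class TG ` lists (letters TG)" "Y \<in> amalgam_class TG ` lists (letters TG)"
        and e: "amalgam_map X = amalgam_map Y"
      then obtain xs ys where xy: "xs \<in> lists (letters TG)" "X = amalgam_class TG xs"
        "ys \<in> lists (letters TG)" "Y = amalgam_class TG ys" by blast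
      then have "wp xs = wp ys" using e amalgam_map_class by simp
      then show "X = Y" using xy by (simp add: amalgam_class_eq)
    qed
    show "amalgam_map ` amalgam_class TG ` lists (letters TG) = carrier (P\<lparr>carrier := \<Gamma>\<rparr>)"
    proof (intro equalityI subsetI)
      fix \<gamma> assume "\<gamma> \<in> carrier (P\<lparr>carrier := \<Gamma>\<rparr>)"
      then obtain ws where "ws \<in> lists (letters TG)" "wp ws = \<gamma>"
        using word_exists[of \<gamma> "verts T"] by (auto simp: \<Gamma>_def)
      then show "\<gamma> \<in> amalgam_map ` amalgam_class TG ` lists (letters TG)"
        using amalgam_map_class by (intro image_eqI[of _ _ "amalgam_class TG ws"]) auto
    next
      fix \<gamma> assume "\<gamma> \<in> amalgam_map ` amalgam_class TG ` lists (letters TG)"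
      then obtain ws where "ws \<in> lists (letters TG)" "\<gamma> = wp ws" using amalgam_map_class by blast
      then show "\<gamma> \<in> carrier (P\<lparr>carrier := \<Gamma>\<rparr>)" using wp_\<Gamma> by simp
    qed
  qed
qed

lemma amalgam_map_letter:
  "v \<in> verts T \<Longrightarrow> g \<in> carrier (vgrp TG v) \<Longrightarrow> amalgam_map (amalgam_class TG [(v, g)]) = \<theta> v g"
  using \<theta>_carrier by (simp add: amalgam_map_class letters_def)

lemma translates_convex:
  assumes A: "t.convex A" and a: "a \<in> A"
  shows "convex (\<Union>\<gamma>\<in>generate P (\<Union>u\<in>A. \<G> u). (\<lambda>v. act \<gamma> (\<iota> v)) ` A)"
proof -
  define H where "H = generate P (\<Union>u\<in>A. \<G> u)"
  define Y where "Y = (\<Union>\<gamma>\<in>H. (\<lambda>v. act \<gamma> (\<iota> v)) ` A)"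
  have YI: "act \<gamma> (\<iota> v) \<in> Y" if "\<gamma> \<in> H" "v \<in> A" for \<gamma> v using that by (auto simp: Y_def)
  have YE: "\<exists>\<gamma> v. \<gamma> \<in> H \<and> v \<in> A \<and> x = act \<gamma> (\<iota> v)" if "x \<in> Y" for x using that by (auto simp: Y_def)
  have AT: "A \<subseteq> verts T" using A by (simp add: t.convex_def)
  have sub: "subgroup H P" unfolding H_def using AT by (intro generate_is_subgroup UN_least \<G>_carrier) blast
  then have Hc: "H \<subseteq> carrier P" by (rule subgroup.subset)
  have one: "\<iota> v \<in> Y" if "v \<in> A" for v
    using YI[OF subgroup.one_closed[OF sub] that] act_one[OF \<iota>_V] that AT by auto
  have transl: "act \<gamma> x \<in> Y" if gx: "\<gamma> \<in> H" "x \<in> Y" for \<gamma> x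
  proof -
    obtain \<delta> v where d: "\<delta> \<in> H" "v \<in> A" "x = act \<delta> (\<iota> v)" using YE[OF gx(2)] by blast
    then have "act \<gamma> x = act (\<gamma> \<otimes>\<^bsub>P\<^esub> \<delta>) (\<iota> v)" using gx(1) Hc AT \<iota>_V by (subst act_mult) auto
    moreover have "\<gamma> \<otimes>\<^bsub>P\<^esub> \<delta> \<in> H" using gx(1) d(1) unfolding H_def by (rule generate.eng)
    ultimately show ?thesis using YI d(2) by simp
  qed
  have base: "\<exists>xs. walk xs (\<iota> a) (\<iota> v) \<and> set xs \<subseteq> Y" if v: "v \<in> A" for v
  proof -
    obtain ps where ps: "t.walk ps a v" "set ps \<subseteq> A" using A a v unfolding t.convex_def by blast
    have "walk (map \<iota> ps) (\<iota> a) (\<iota> v)"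
      using ps(1) \<iota>_V \<iota>_adj unfolding t.walk_def walk_def
      by (auto simp: hd_map last_map successively_map intro: successively_mono)
    moreover have "set (map \<iota> ps) \<subseteq> Y" using one ps(2) by auto
    ultimately show ?thesis by blast
  qed
  have mv: "\<exists>xs. walk xs (act \<gamma> x) (act \<gamma> y) \<and> set xs \<subseteq> Y"
    if "\<gamma> \<in> H" "walk xs x y" "set xs \<subseteq> Y" for \<gamma> x y xs
  proof -
    have "walk (map (act \<gamma>) xs) (act \<gamma> x) (act \<gamma> y)" using walk_act that Hc by blast
    moreover have "set (map (act \<gamma>) xs) \<subseteq> Y" using transl that by auto
    ultimately show ?thesis by blast
  qed
  have comp: "\<exists>zs. walk zs x z \<and> set zs \<subseteq> Y"
    if "walk xs x y" "set xs \<subseteq> Y" "walk ys y z" "set ys \<subseteq> Y" for x y z xs ys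
  proof -
    have "set (tl ys) \<subseteq> Y" using that(4) list.set_sel(2)[of ys] walkD(6)[OF that(3)] by blast
    then show ?thesis using walk_append[OF that(1,3)] that(2) by (intro exI[of _ "xs @ tl ys"]) auto
  qed
  \<comment> \<open>Walk to the vertex \<open>\<iota> u\<close> fixed by \<open>g\<close>, then
    follow the image under \<open>g\<close> of the way back.\<close>
  have gen: "\<exists>xs. walk xs (\<iota> a) (act g (\<iota> a)) \<and> set xs \<subseteq> Y" if g: "g \<in> \<G> u" "u \<in> A" for g u
  proof -
    obtain xs where xs: "walk xs (\<iota> a) (\<iota> u)" "set xs \<subseteq> Y" using base g by blast
    have gH: "g \<in> H" unfolding H_def using g by (intro generate.incl) blast
    have "walk (rev xs) (\<iota> u) (\<iota> a)" "set (rev xs) \<subseteq> Y" using walk_rev xs by auto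
    from mv[OF gH this] obtain ys where "walk ys (act g (\<iota> u)) (act g (\<iota> a))" "set ys \<subseteq> Y" by blast
    moreover have "act g (\<iota> u) = \<iota> u" using vertex_fixes g AT by blast
    ultimately show ?thesis using comp[OF xs] by metis
  qed
  have reach: "\<exists>xs. walk xs (\<iota> a) (act \<gamma> (\<iota> a)) \<and> set xs \<subseteq> Y" if "\<gamma> \<in> H" for \<gamma>
    using that unfolding H_def
  proof induction
    case one
    then show ?case using base[OF a] act_one[OF \<iota>_V] a AT by force
  next
    case (incl h)
    then show ?case using gen by blast
  next
    case (inv h)
    then obtain u where u: "u \<in> A" "h \<in> \<G> u" by blast
    then have "inv\<^bsub>P\<^esub> h \<in> \<G> u" using \<G>_subgroup AT by (meson subgroup.m_inv_closed subsetD)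
    then show ?case using gen u by blast
  next
    case (eng h1 h2)
    obtain xs ys where xs: "walk xs (\<iota> a) (act h1 (\<iota> a))" "set xs \<subseteq> Y"
      and ys: "walk ys (\<iota> a) (act h2 (\<iota> a))" "set ys \<subseteq> Y" using eng.IH by blast
    obtain zs where "walk zs (act h1 (\<iota> a)) (act h1 (act h2 (\<iota> a)))" "set zs \<subseteq> Y"
      using mv[OF _ ys] eng.hyps(1) H_def by blast
    moreover have "act h1 (act h2 (\<iota> a)) = act (h1 \<otimes>\<^bsub>P\<^esub> h2) (\<iota> a)"
      using eng.hyps Hc[unfolded H_def] a AT \<iota>_V by (subst act_mult) auto
    ultimately show ?case using comp[OF xs] by metis
  qed
  have "convex Y"
  proof (rule convexI[of _ "\<iota> a"])
    show "Y \<subseteq> VX" using Hc AT act_V \<iota>_V YE by blast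
    show "\<iota> a \<in> Y" by (rule one[OF a])
    show "\<exists>xs. walk xs (\<iota> a) x \<and> set xs \<subseteq> Y" if x: "x \<in> Y" for x
    proof -
      obtain \<gamma> v where v: "\<gamma> \<in> H" "v \<in> A" "x = act \<gamma> (\<iota> v)" using YE[OF x] by blast
      obtain xs where xs: "walk xs (\<iota> a) (act \<gamma> (\<iota> a))" "set xs \<subseteq> Y" using reach v by blast
      obtain ys where ys: "walk ys (\<iota> a) (\<iota> v)" "set ys \<subseteq> Y" using base v by blast
      obtain zs where "walk zs (act \<gamma> (\<iota> a)) (act \<gamma> (\<iota> v))" "set zs \<subseteq> Y" using mv[OF v(1) ys] by blast
      then show ?thesis using comp[OF xs] v(3) by blast
    qed
  qed
  then show ?thesis by (simp only: Y_def H_def)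
qed

end

section \<open>Ends and subtrees of graphs\<close>

text \<open>Counting: conjugates of \<open>K\<close> are indexed by its cosets and share the
  identity. With index \<open>n\<close> they contain at most \<open>n * (card K - 1)\<close>
  nontrivial elements, that is \<open>card G - n\<close>, which is too few unless
  \<open>n = 1\<close>.\<close>

lemma conjugate_cover:
  assumes "group G" and K: "subgroup K G" and fin: "finite (carrier G)"
    and cover: "\<And>x. x \<in> carrier G \<Longrightarrow> \<exists>g\<in>carrier G. inv\<^bsub>G\<^esub> g \<otimes>\<^bsub>G\<^esub> x \<otimes>\<^bsub>G\<^esub> g \<in> K"
  shows "K = carrier G"
proof -
  interpret group G by fact
  have Kc: "K \<subseteq> carrier G" by (rule subgroup.subset[OF K])
  have one: "\<one>\<^bsub>G\<^esub> \<in> K" by (rule subgroup.one_closed[OF K])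
  define r where "r c = (SOME x. x \<in> c)" for c :: "'a set"
  define \<phi> where "\<phi> = (\<lambda>(c, k). inv\<^bsub>G\<^esub> (r c) \<otimes>\<^bsub>G\<^esub> k \<otimes>\<^bsub>G\<^esub> r c)"
  have sub: "carrier G - {\<one>\<^bsub>G\<^esub>} \<subseteq> \<phi> ` ((rcosets\<^bsub>G\<^esub> K) \<times> (K - {\<one>\<^bsub>G\<^esub>}))"
  proof
    fix x assume x: "x \<in> carrier G - {\<one>\<^bsub>G\<^esub>}"
    then obtain g where g: "g \<in> carrier G" "inv\<^bsub>G\<^esub> g \<otimes>\<^bsub>G\<^esub> x \<otimes>\<^bsub>G\<^esub> g \<in> K" using cover by blast
    define c where "c = K #>\<^bsub>G\<^esub> inv\<^bsub>G\<^esub> g"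
    have c: "c \<in> rcosets\<^bsub>G\<^esub> K" unfolding c_def RCOSETS_def using g by auto
    have "inv\<^bsub>G\<^esub> g \<in> c" unfolding c_def r_coset_def using one g by force
    then have "r c \<in> c" unfolding r_def by (rule someI)
    then obtain h where h: "h \<in> K" "r c = h \<otimes>\<^bsub>G\<^esub> inv\<^bsub>G\<^esub> g" unfolding c_def r_coset_def by blast
    have hc: "h \<in> carrier G" using h Kc by blast
    have rc: "r c \<in> carrier G" using h g hc by simp
    \<comment> \<open>The representative of the coset differs from \<open>inv g\<close> by a factor
      \<open>h\<close> in \<open>K\<close>, which turns the given conjugate into a
      \<open>K\<close>-conjugate of it, so it stays in \<open>K\<close>.\<close>
    define k where "k = r c \<otimes>\<^bsub>G\<^esub> x \<otimes>\<^bsub>G\<^esub> inv\<^bsub>G\<^esub> (r c)"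
    have "k = h \<otimes>\<^bsub>G\<^esub> (inv\<^bsub>G\<^esub> g \<otimes>\<^bsub>G\<^esub> x \<otimes>\<^bsub>G\<^esub> g) \<otimes>\<^bsub>G\<^esub> inv\<^bsub>G\<^esub> h"
      using g hc x by (simp add: k_def h(2) inv_mult_group m_assoc)
    then have kK: "k \<in> K" using h g K by (simp add: subgroup.m_closed subgroup.m_inv_closed)
    have xk: "x = inv\<^bsub>G\<^esub> (r c) \<otimes>\<^bsub>G\<^esub> k \<otimes>\<^bsub>G\<^esub> r c"
      using x rc by (simp add: k_def m_assoc inv_solve_left)
    have "k \<noteq> \<one>\<^bsub>G\<^esub>" using x xk rc by auto
    then show "x \<in> \<phi> ` ((rcosets\<^bsub>G\<^esub> K) \<times> (K - {\<one>\<^bsub>G\<^esub>}))"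
      using c kK xk by (intro image_eqI[of _ _ "(c, k)"]) (auto simp: \<phi>_def)
  qed
  have finK: "finite K" using Kc fin finite_subset by blast
  have finR: "finite (rcosets\<^bsub>G\<^esub> K)" using rcosets_subset_PowG[OF K] fin by (simp add: finite_subset)
  have lag: "card (rcosets\<^bsub>G\<^esub> K) * card K = card (carrier G)"
    using lagrange[OF K] by (simp add: order_def)
  have "card (carrier G - {\<one>\<^bsub>G\<^esub>}) \<le> card ((rcosets\<^bsub>G\<^esub> K) \<times> (K - {\<one>\<^bsub>G\<^esub>}))"
    using sub finR finK by (intro surj_card_le) auto
  then have "card (carrier G) - 1 \<le> card (rcosets\<^bsub>G\<^esub> K) * (card K - 1)"
    using one finK by (simp add: card_cartesian_product)
  moreover have "card (rcosets\<^bsub>G\<^esub> K) * (card K - 1) = card (carrier G) - card (rcosets\<^bsub>G\<^esub> K)"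
    by (simp add: diff_mult_distrib2 lag)
  moreover have "card (carrier G) > 0" using fin by (auto simp: card_gt_0_iff)
  moreover have "card (rcosets\<^bsub>G\<^esub> K) \<le> card (carrier G)" using lag one finK
    by (metis card_gt_0_iff empty_iff mult_le_mono2 nat_mult_1_right Suc_leI One_nat_def)
  ultimately have "card (rcosets\<^bsub>G\<^esub> K) \<le> 1" by linarith
  then have "card (carrier G) \<le> card K" using lag by (metis mult_le_mono1 nat_mult_1)
  then show ?thesis using Kc fin by (simp add: card_seteq)
qed

section \<open>Ends under injective maps of graphs\<close>

lemma end_rel_refl: "half_line G r \<Longrightarrow> (r, r) \<in> end_rel G"
  by (auto simp: end_rel_def)

lemma equiv_end_rel: "equiv (Collect (half_line G)) (end_rel G)"
proof (rule equivI)
  show "end_rel G \<subseteq> Collect (half_line G) \<times> Collect (half_line G)" by (auto simp: end_rel_def)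
  show "refl_on (Collect (half_line G)) (end_rel G)" by (auto simp: refl_on_def end_rel_def)
  show "sym (end_rel G)" by (rule symI) (auto simp: end_rel_def, metis)
  show "trans (end_rel G)"
  proof (rule transI)
    fix r s t assume "(r, s) \<in> end_rel G" "(s, t) \<in> end_rel G"
    then obtain a b c d where h: "half_line G r" "half_line G t" "\<forall>k. r (a + k) = s (b + k)" "\<forall>k. s (c + k) = t (d + k)"
      by (auto simp: end_rel_def)
    have "r (a + c + k) = t (d + b + k)" for k
    proof -
      have "r (a + (c + k)) = s (b + (c + k))" using h by blast
      also have "\<dots> = s (c + (b + k))" by (simp add: algebra_simps)
      also have "\<dots> = t (d + (b + k))" using h by blast
      finally show ?thesis by (simp add: add.assoc)
    qed
    then show "(r, t) \<in> end_rel G" using h unfolding end_rel_def by blast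
  qed
qed

text \<open>Injectivity on ends comes from injectivity on vertices; for surjectivity a tail of the
  given half-line lies in the image and lifts, since \<open>f\<close> reflects adjacency. The
  criterion serves both for the quotient of the limit tree and for the subtree of \<open>T\<close>
  isomorphic to it.\<close>

lemma ends_map_bij:
  assumes inj: "inj_on f (verts Q)"
    and hl: "\<And>r. half_line Q r \<Longrightarrow> half_line T (f \<circ> r)"
    and refl: "\<And>x y. x \<in> verts Q \<Longrightarrow> y \<in> verts Q \<Longrightarrow> adjacent T (f x) (f y) \<Longrightarrow> adjacent Q x y"
    and ev: "\<And>r. half_line T r \<Longrightarrow> \<exists>N. \<forall>n\<ge>N. r n \<in> f ` verts Q"
  shows "bij_betw (ends_map T f) (Ends Q) (Ends T)"
proof -
  note eqQ = equiv_end_rel[of Q] and eqT = equiv_end_rel[of T]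
  have comp: "(f \<circ> r, f \<circ> s) \<in> end_rel T" if rs: "(r, s) \<in> end_rel Q" for r s
  proof -
    obtain m n where "\<And>k. r (m + k) = s (n + k)" using rs unfolding end_rel_def by blast
    then have "\<And>k. (f \<circ> r) (m + k) = (f \<circ> s) (n + k)" by simp
    then show ?thesis using rs hl unfolding end_rel_def by blast
  qed
  have val: "ends_map T f (end_rel Q `` {r}) = end_rel T `` {f \<circ> r}" if r: "half_line Q r" for r
  proof (intro equalityI subsetI)
    fix t assume "t \<in> ends_map T f (end_rel Q `` {r})"
    then obtain s where s: "(r, s) \<in> end_rel Q" "(f \<circ> s, t) \<in> end_rel T" by (auto simp: ends_map_def)
    then show "t \<in> end_rel T `` {f \<circ> r}"
      using comp[OF s(1)] eqT by (auto simp: equiv_def dest: transD)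
  next
    fix t assume "t \<in> end_rel T `` {f \<circ> r}"
    then show "t \<in> ends_map T f (end_rel Q `` {r})" using end_rel_refl[OF r] by (auto simp: ends_map_def)
  qed
  show ?thesis
    unfolding bij_betw_def
  proof
    show "inj_on (ends_map T f) (Ends Q)"
  proof (rule inj_onI)
    fix X Y assume "X \<in> Ends Q" "Y \<in> Ends Q" and e: "ends_map T f X = ends_map T f Y"
    then obtain r s where rs: "half_line Q r" "X = end_rel Q `` {r}" "half_line Q s" "Y = end_rel Q `` {s}"
      by (auto simp: Ends_def quotient_def)
    then have "end_rel T `` {f \<circ> r} = end_rel T `` {f \<circ> s}" using e val by simp
    then have "(f \<circ> r, f \<circ> s) \<in> end_rel T" using eq_equiv_class[OF _ eqT] hl rs by blast
    then obtain m n where mn: "\<And>k. f (r (m + k)) = f (s (n + k))" by (auto simp: end_rel_def)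
    have "r (m + k) = s (n + k)" for k
      using inj_onD[OF inj mn[of k]] rs unfolding half_line_def by blast
    then have "(r, s) \<in> end_rel Q" using rs by (auto simp: end_rel_def)
    then show "X = Y" using rs equiv_class_eq[OF eqQ] by blast
  qed
  show "ends_map T f ` Ends Q = Ends T"
  proof (intro equalityI subsetI)
    fix Y assume "Y \<in> ends_map T f ` Ends Q"
    then obtain r where "half_line Q r" "Y = ends_map T f (end_rel Q `` {r})" by (auto simp: Ends_def quotient_def)
    then show "Y \<in> Ends T" using val hl by (auto simp: Ends_def quotient_def)
  next
    fix Y assume "Y \<in> Ends T"
    then obtain t where t: "half_line T t" "Y = end_rel T `` {t}" by (auto simp: Ends_def quotient_def)
    obtain N where N: "\<And>n. n \<ge> N \<Longrightarrow> t n \<in> f ` verts Q" using ev[OF t(1)] by blast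
    then have "\<forall>k. \<exists>x\<in>verts Q. t (N + k) = f x" using le_add1 by blast
    then obtain s where s: "\<And>k. s k \<in> verts Q" "\<And>k. t (N + k) = f (s k)" by metis
    have "half_line Q s"
      unfolding half_line_def
    proof (intro conjI allI)
      show "inj s"
      proof (rule injI)
        fix x y assume "s x = s y"
        then have "t (N + x) = t (N + y)" using s(2) by simp
        moreover have "inj t" using t(1) by (simp add: half_line_def)
        ultimately show "x = y" by (simp add: inj_eq)
      qed
      show "range s \<subseteq> verts Q" using s by blast
      have "adjacent T (t (N + k)) (t (N + Suc k))" for k using t(1) by (simp add: half_line_def)
      then show "adjacent Q (s k) (s (Suc k))" for k using refl s by metis
    qed
    moreover have "(f \<circ> s, t) \<in> end_rel T"
    proof -
      have "\<forall>k. (f \<circ> s) (0 + k) = t (N + k)" using s(2) by simp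
      then show ?thesis using hl[OF \<open>half_line Q s\<close>] t(1) unfolding end_rel_def by blast
    qed
    then have "end_rel T `` {f \<circ> s} = Y" using t(2) equiv_class_eq[OF eqT] by blast
    ultimately show "Y \<in> ends_map T f ` Ends Q"
      using val by (intro image_eqI[of _ _ "end_rel Q `` {s}"]) (auto simp: Ends_def quotient_def)
  qed
  qed
qed

section \<open>Subtrees and hulls\<close>

lemma subgraph_adjacent: "subgraph H G \<Longrightarrow> adjacent H x y \<Longrightarrow> adjacent G x y"
  unfolding subgraph_def adjacent_def by (metis subsetD)

text \<open>The geodesic of \<open>H\<close> between the two vertices is a geodesic of
  \<open>G\<close> too, hence equals the edge. Subtrees are therefore determined by their
  vertices.\<close>

lemma subtree_adjacent:
  assumes G: "tree G" and H: "subtree H G" and xy: "x \<in> verts H" "y \<in> verts H" "adjacent G x y"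
  shows "adjacent H x y"
proof -
  have HG: "subgraph H G" and tH: "tree H" using H by (auto simp: subtree_def)
  interpret g: simp_tree "verts G" "adjacent G" by (rule tree_simp_tree[OF G])
  interpret h: simp_tree "verts H" "adjacent H" by (rule tree_simp_tree[OF tH])
  obtain p where p: "h.geo p x y" using h.geo_exists xy by blast
  then have sp: "successively (adjacent H) p" "set p \<subseteq> verts H" "p \<noteq> []" "hd p = x" "last p = y" "nb p"
    by (auto simp: h.geo_def h.walk_def)
  have "successively (adjacent G) p" using sp(1) by (rule successively_mono) (rule subgraph_adjacent[OF HG])
  moreover have "verts H \<subseteq> verts G" using HG by (simp add: subgraph_def)
  ultimately have "g.geo p x y" using sp by (auto simp: g.geo_def g.walk_def)
  moreover have "g.geo [x, y] x y" using g.walk_pair[OF xy(3)] by (simp add: g.geo_def)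
  ultimately have "p = [x, y]" using g.geo_unique by blast
  then show ?thesis using sp(1) by simp
qed

lemma subgraph_circuit:
  assumes HG: "subgraph H G" and c: "circuit H vs es"
  shows "circuit G vs es"
proof -
  have "extr G (es ! i) = extr H (es ! i)" if "i < length vs" for i
    using HG c that unfolding subgraph_def circuit_def by (metis nth_mem subsetD)
  then show ?thesis using HG c unfolding subgraph_def circuit_def by auto
qed

lemma subtreeI:
  assumes "tree G" "subgraph H G" "verts H \<noteq> {}" "connected_graph H"
  shows "subtree H G"
  using assms subgraph_circuit[OF assms(2)] unfolding subtree_def tree_def
  by (auto simp: subgraph_def)

definition induced :: "('v, 'e) ugraph \<Rightarrow> 'v set \<Rightarrow> ('v, 'e) ugraph" where
  "induced G S = \<lparr>verts = S, edges = {e \<in> edges G. extr G e \<subseteq> S}, extr = extr G\<rparr>"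

lemma induced_subtree:
  assumes G: "tree G" and S: "simp_tree.convex (verts G) (adjacent G) S" "S \<noteq> {}"
  shows "subtree (induced G S) G"
proof (rule subtreeI[OF G])
  interpret g: simp_tree "verts G" "adjacent G" by (rule tree_simp_tree[OF G])
  have wf: "wf_graph G" using G by (simp add: tree_def)
  show "subgraph (induced G S) G"
    using wf S(1) by (auto simp: subgraph_def induced_def wf_graph_def g.convex_def)
  show "verts (induced G S) \<noteq> {}" using S by (simp add: induced_def)
  show "connected_graph (induced G S)"
    unfolding connected_graph_def
  proof (intro ballI)
    fix x y assume "x \<in> verts (induced G S)" "y \<in> verts (induced G S)"
    then obtain xs where xs: "g.walk xs x y" "set xs \<subseteq> S"
      using S(1) unfolding g.convex_def induced_def by fastforce
    have adj: "adjacent (induced G S) a b" if "a \<in> S" "b \<in> S" "adjacent G a b" for a b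
      using that by (auto simp: adjacent_def induced_def)
    have "(adjacent (induced G S))\<^sup>*\<^sup>* (hd xs) (last xs)"
      if "successively (adjacent G) xs" "set xs \<subseteq> S" "xs \<noteq> []" for xs
      using that
    proof (induction xs rule: induct_list012)
      case (3 a b xs)
      then have "adjacent (induced G S) a b" using adj by auto
      then show ?case using 3 by (auto intro: converse_rtranclp_into_rtranclp)
    qed auto
    then show "(adjacent (induced G S))\<^sup>*\<^sup>* x y" using xs by (auto simp: g.walk_def)
  qed
qed

lemma tree_hull_subgraph:
  assumes H: "subtree H G" and F: "\<And>S. S \<in> F \<Longrightarrow> subgraph S H"
  shows "subgraph (tree_hull G F) H"
proof -
  have HG: "extr H e = extr G e" if "e \<in> edges H" for e
    using H that by (auto simp: subtree_def subgraph_def)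
  have wf: "wf_graph (tree_hull G F)"
    unfolding wf_graph_def
  proof (intro ballI conjI)
    fix e assume e: "e \<in> edges (tree_hull G F)"
    have mem: "e \<in> edges H' \<and> extr H' e = extr G e \<and> extr H' e \<subseteq> verts H'"
      if H': "subtree H' G" "\<forall>S\<in>F. subgraph S H'" for H'
    proof -
      have "e \<in> edges H'" using e H' by (auto simp: tree_hull_def)
      moreover have "wf_graph H'" "\<And>e. e \<in> edges H' \<Longrightarrow> extr H' e = extr G e"
        using H'(1) by (auto simp: subtree_def subgraph_def)
      ultimately show ?thesis unfolding wf_graph_def by blast
    qed
    show "extr (tree_hull G F) e \<subseteq> verts (tree_hull G F)"
      using mem by (auto simp: tree_hull_def)
    have "e \<in> edges H" "extr H e = extr G e" using mem[OF H] F by auto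
    moreover have "wf_graph H" using H by (simp add: subtree_def subgraph_def)
    ultimately show "card (extr (tree_hull G F) e) \<in> {1, 2}" by (auto simp: tree_hull_def wf_graph_def)
  qed
  have "verts (tree_hull G F) \<subseteq> verts H" "edges (tree_hull G F) \<subseteq> edges H"
    using H F by (auto simp: tree_hull_def)
  moreover have "extr (tree_hull G F) e = extr H e" if "e \<in> edges H" for e
    using HG[OF that] by (simp add: tree_hull_def)
  ultimately show ?thesis using wf unfolding subgraph_def by blast
qed

lemma tree_hull_edges: "S \<in> F \<Longrightarrow> edges S \<subseteq> edges (tree_hull G F)"
  by (auto simp: tree_hull_def subgraph_def)

section \<open>Stars of vertices, and vertex groups along half-lines\<close>

context tree_of_groups_action
begin

text \<open>An irreducible word from \<open>v\<close> to \<open>w\<close> representing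
  \<open>\<gamma>\<close> traces the given edge, so it has two letters; the first one is the
  required \<open>g\<close>.\<close>

lemma star_reach:
  assumes v: "v \<in> verts T" and w: "w \<in> verts T" and \<gamma>: "\<gamma> \<in> \<Gamma>" and adj: "adj (\<iota> v) (act \<gamma> (\<iota> w))"
  shows "adjacent T v w \<and> (\<exists>g\<in>\<G> v. act \<gamma> (\<iota> w) = act g (\<iota> w))"
proof -
  obtain ws where ws: "ws \<in> lists (letters TG)" "wp ws = \<gamma>"
    using word_exists[OF \<gamma>[unfolded \<Gamma>_def] order_refl] by blast
  obtain ws1 where ws1: "wpath ws1" "amalgam_eq TG ws ws1" "fst (hd ws1) = v" "fst (last ws1) = w"
    using word_to_path[OF ws(1) v w] by blast
  obtain ws2 where ws2: "wpath ws2" "amalgam_eq TG ws1 ws2" "\<not> reducible ws2"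
    "fst (hd ws2) = v" "fst (last ws2) = w" using reduce[OF ws1(1)] ws1 by metis
  have wp2: "wp ws2 = \<gamma>" using amalgam_eq_wp[OF ws1(2)] amalgam_eq_wp[OF ws2(2)] ws(2) by simp
  have "geo (trace ws2) (\<iota> v) (act \<gamma> (\<iota> w))" using trace_geo[OF ws2(1,3)] ws2 wp2 by simp
  moreover have "geo [\<iota> v, act \<gamma> (\<iota> w)] (\<iota> v) (act \<gamma> (\<iota> w))" using walk_pair[OF adj] by (simp add: geo_def)
  ultimately have tr: "trace ws2 = [\<iota> v, act \<gamma> (\<iota> w)]" using geo_unique by blast
  then have "length ws2 = 2" by (metis trace_length length_Cons list.size(3) numeral_2_eq_2)
  then obtain x y where "ws2 = [x, y]" by (auto simp: length_Suc_conv numeral_2_eq_2)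
  then obtain g h where gh: "ws2 = [(v, g), (w, h)]" using ws2 by (cases x; cases y) auto
  then have "adjacent T v w" "g \<in> carrier (vgrp TG v)" using ws2(1,3) by (auto simp: wpath_def letters_def)
  moreover have "act \<gamma> (\<iota> w) = act (\<theta> v g) (\<iota> w)" using tr gh by simp
  ultimately show ?thesis by blast
qed

text \<open>Because the groups of the branch generate \<open>\<Gamma>\<close>, the translates of the
  branch form an invariant subtree. It does not contain \<open>\<iota> b\<close>, so
  \<open>\<iota> a\<close> is the only neighbour of \<open>\<iota> b\<close> in it, and an element
  fixing \<open>\<iota> b\<close> must fix \<open>\<iota> a\<close>.\<close>

lemma branch_decreasing:
  assumes ab: "adjacent T a b" and gen: "\<Gamma> = generate P (\<Union>u\<in>t.branch a b. \<G> u)"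
  shows "\<G> b \<subseteq> \<G> a"
proof
  fix \<gamma> assume \<gamma>: "\<gamma> \<in> \<G> b"
  have V: "a \<in> verts T" "b \<in> verts T" "a \<noteq> b" using t.adj_V t.adj_V2 t.adj_irrefl ab by blast+
  have B: "t.convex (t.branch a b)" "a \<in> t.branch a b" using t.branch_convex t.branch_self V by blast+
  define Y where "Y = (\<Union>\<gamma>\<in>\<Gamma>. (\<lambda>v. act \<gamma> (\<iota> v)) ` t.branch a b)"
  have Y: "convex Y" unfolding Y_def gen by (rule translates_convex[OF B])
  have inY: "act \<delta> (\<iota> a) \<in> Y" if "\<delta> \<in> \<Gamma>" for \<delta> using that B(2) by (auto simp: Y_def)
  have nY: "\<iota> b \<notin> Y"
  proof
    assume "\<iota> b \<in> Y"
    then obtain \<delta> u where "\<delta> \<in> \<Gamma>" "u \<in> t.branch a b" "act \<delta> (\<iota> u) = \<iota> b" by (auto simp: Y_def)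
    moreover have "u \<in> verts T" using \<open>u \<in> t.branch a b\<close> B(1) by (auto simp: t.convex_def)
    ultimately have "b \<in> t.branch a b" using stabilizer(1) V by blast
    then show False using t.branch_not by blast
  qed
  have \<gamma>\<Gamma>: "\<gamma> \<in> \<Gamma>" using \<gamma> \<G>_\<Gamma> V by blast
  have "adj (\<iota> b) (act \<gamma> (\<iota> a))"
    using act_adj[OF _ \<iota>_adj[OF t.adj_sym[OF ab]], of \<gamma>] vertex_fixes[OF V(2) \<gamma>] \<gamma>\<Gamma> \<Gamma>_carrier by auto
  moreover have "\<iota> a \<in> Y" using inY[OF subgroup.one_closed[OF \<Gamma>_subgroup]] act_one[OF \<iota>_V[OF V(1)]] by simp
  ultimately have "act \<gamma> (\<iota> a) = \<iota> a"
    using neighbour_unique[OF Y nY inY[OF \<gamma>\<Gamma>] _ _ \<iota>_adj[OF t.adj_sym[OF ab]]] by blast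
  then show "\<gamma> \<in> \<G> a" by (rule stabilizer(2)[OF \<gamma>\<Gamma> V(1) V(1)])
qed

lemma group_amalgam: "group (amalgam TG)"
proof (rule groupI)
  have car: "carrier (amalgam TG) = amalgam_class TG ` lists (letters TG)" by (simp add: amalgam_def)
  have one: "\<one>\<^bsub>amalgam TG\<^esub> = amalgam_class TG []" by (simp add: amalgam_def)
  show "\<one>\<^bsub>amalgam TG\<^esub> \<in> carrier (amalgam TG)" unfolding car one by blast
  fix X assume "X \<in> carrier (amalgam TG)"
  then obtain xs where xs: "xs \<in> lists (letters TG)" "X = amalgam_class TG xs" unfolding car by blast
  show "\<one>\<^bsub>amalgam TG\<^esub> \<otimes>\<^bsub>amalgam TG\<^esub> X = X"
    unfolding one xs(2) using amalgam_mult_class[of "[]" xs] xs(1) by simp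
  obtain ys where ys: "ys \<in> lists (letters TG)" "wp ys = inv\<^bsub>P\<^esub> (wp xs)" using word_inverse[OF xs(1)] by blast
  have l: "ys @ xs \<in> lists (letters TG)" unfolding append_in_lists_conv using xs ys by simp
  have "wp (ys @ xs) = wp []" unfolding wp_append[OF ys(1) xs(1)] ys(2) using wp_carrier[OF xs(1)] by simp
  then have "amalgam_class TG (ys @ xs) = amalgam_class TG []"
    using l by (simp only: amalgam_class_eq lists.Nil)
  then have "amalgam_class TG ys \<otimes>\<^bsub>amalgam TG\<^esub> X = \<one>\<^bsub>amalgam TG\<^esub>"
    unfolding one xs(2) using amalgam_mult_class[OF ys(1) xs(1)] by simp
  then show "\<exists>Y\<in>carrier (amalgam TG). Y \<otimes>\<^bsub>amalgam TG\<^esub> X = \<one>\<^bsub>amalgam TG\<^esub>"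
    unfolding car using ys(1) by blast
  fix Y assume "Y \<in> carrier (amalgam TG)"
  then obtain zs where zs: "zs \<in> lists (letters TG)" "Y = amalgam_class TG zs" unfolding car by blast
  have l2: "xs @ zs \<in> lists (letters TG)" unfolding append_in_lists_conv using xs zs by simp
  show "X \<otimes>\<^bsub>amalgam TG\<^esub> Y \<in> carrier (amalgam TG)"
    unfolding car xs(2) zs(2) amalgam_mult_class[OF xs(1) zs(1)] using l2 by blast
  fix Z assume "Z \<in> carrier (amalgam TG)"
  then obtain us where us: "us \<in> lists (letters TG)" "Z = amalgam_class TG us" unfolding car by blast
  have l3: "zs @ us \<in> lists (letters TG)" unfolding append_in_lists_conv using us zs by simp
  show "X \<otimes>\<^bsub>amalgam TG\<^esub> Y \<otimes>\<^bsub>amalgam TG\<^esub> Z = X \<otimes>\<^bsub>amalgam TG\<^esub> (Y \<otimes>\<^bsub>amalgam TG\<^esub> Z)"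
    unfolding xs(2) zs(2) us(2) amalgam_mult_class[OF xs(1) zs(1)] amalgam_mult_class[OF zs(1) us(1)]
      amalgam_mult_class[OF l2 us(1)] amalgam_mult_class[OF xs(1) l3] by simp
qed

lemma amalgam_map_hom: "group_hom (amalgam TG) P amalgam_map"
proof -
  have "amalgam_map \<in> hom (amalgam TG) P"
    using amalgam_iso \<Gamma>_carrier by (auto simp: iso_def hom_def)
  then show ?thesis using group_amalgam is_group by (simp add: group_hom_def group_hom_axioms_def)
qed

lemma amalgam_map_image: "amalgam_map ` carrier (amalgam TG) = \<Gamma>"
  using amalgam_iso by (simp add: iso_def bij_betw_def)

text \<open>Finitely many generators are values of finitely many words, in which only finitely many
  vertices occur.\<close>

lemma finite_support:
  assumes "finitely_generated (amalgam TG)"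
  shows "\<exists>S U. finite S \<and> S \<subseteq> \<Gamma> \<and> generate P S = \<Gamma> \<and>
    finite U \<and> U \<subseteq> verts T \<and> S \<subseteq> generate P (\<Union>u\<in>U. \<G> u)"
proof -
  obtain S where S: "finite S" "S \<subseteq> carrier (amalgam TG)" "generate (amalgam TG) S = carrier (amalgam TG)"
    using assms by (auto simp: finitely_generated_def)
  interpret h: group_hom "amalgam TG" P amalgam_map by (rule amalgam_map_hom)
  define S' where "S' = amalgam_map ` S"
  have gS: "generate P S' = \<Gamma>"
    unfolding S'_def using h.generate_img[OF S(2)] S(3) amalgam_map_image by simp
  have S'\<Gamma>: "S' \<subseteq> \<Gamma>" unfolding gS[symmetric] by (auto intro: generate.incl)
  have "\<exists>U. finite U \<and> U \<subseteq> verts T \<and> s \<in> generate P (\<Union>u\<in>U. \<G> u)" if "s \<in> S'" for s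
  proof -
    have "s \<in> \<Gamma>" using that S'\<Gamma> by blast
    then obtain ws where ws: "ws \<in> lists (letters TG)" "wp ws = s"
      using word_exists[OF _ order_refl] unfolding \<Gamma>_def by blast
    have "wp ws \<in> generate P (\<Union>u\<in>fst ` set ws. \<G> u)"
      if "ws \<in> lists (letters TG)" for ws :: "('v \<times> 'g) list"
      using that
    proof induction
      case Nil
      then show ?case by (simp add: generate.one)
    next
      case (Cons x ws)
      obtain v g where x: "x = (v, g)" by (cases x)
      have "\<theta> v g \<in> generate P (\<Union>u\<in>fst ` set (x # ws). \<G> u)"
        using Cons.hyps x by (intro generate.incl) (auto simp: letters_def)
      moreover have "wp ws \<in> generate P (\<Union>u\<in>fst ` set (x # ws). \<G> u)"
        using mono_generate[of "\<Union>u\<in>fst ` set ws. \<G> u" "\<Union>u\<in>fst ` set (x # ws). \<G> u"] Cons.IH by auto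
      ultimately show ?case using generate.eng x by simp
    qed
    moreover have "fst ` set ws \<subseteq> verts T" using ws(1) by (auto simp: letters_def in_lists_conv_set)
    ultimately show ?thesis using ws by (intro exI[of _ "fst ` set ws"]) auto
  qed
  then obtain U where U: "\<And>s. s \<in> S' \<Longrightarrow> finite (U s) \<and> U s \<subseteq> verts T \<and> s \<in> generate P (\<Union>u\<in>U s. \<G> u)"
    by metis
  have "S' \<subseteq> generate P (\<Union>u\<in>\<Union>(U ` S'). \<G> u)"
  proof
    fix s assume "s \<in> S'"
    then show "s \<in> generate P (\<Union>u\<in>\<Union>(U ` S'). \<G> u)"
      using U[of s] mono_generate[of "\<Union>u\<in>U s. \<G> u" "\<Union>u\<in>\<Union>(U ` S'). \<G> u"] by blast
  qed
  then show ?thesis using S(1) U gS S'\<Gamma> S'_def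
    by (intro exI[of _ S'] exI[of _ "\<Union>(U ` S')"]) auto
qed

text \<open>Every vertex lies behind \<open>r n\<close> for large \<open>n\<close>: a walk from
  \<open>r 0\<close> to it meets the half-line only finitely often. By \<open>finite_support\<close>
  it is enough that finitely many vertices do so.\<close>

lemma ray_generates:
  assumes fg: "finitely_generated (amalgam TG)" and r: "half_line T r"
  shows "\<exists>N. \<forall>n\<ge>N. \<Gamma> = generate P (\<Union>u\<in>t.branch (r n) (r (Suc n)). \<G> u)"
proof -
  obtain S U where SU: "generate P S = \<Gamma>" "finite U" "U \<subseteq> verts T" "S \<subseteq> generate P (\<Union>u\<in>U. \<G> u)"
    using finite_support[OF fg] by blast
  have rr: "inj r" "\<And>n. r n \<in> verts T" "\<And>n. adjacent T (r n) (r (Suc n))"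
    using r by (auto simp: half_line_def)
  have "\<exists>N. \<forall>n\<ge>N. u \<in> t.branch (r n) (r (Suc n))" if u: "u \<in> U" for u
  proof -
    obtain xs where xs: "t.walk xs (r 0) u" using t.walk_exists rr(2) u SU(3) by blast
    have "finite (r -` set xs)" using rr(1) by (intro finite_vimageI) auto
    then obtain N where N: "\<And>n. n \<in> r -` set xs \<Longrightarrow> n \<le> N" unfolding finite_nat_set_iff_bounded_le by blast
    have "u \<in> t.branch (r n) (r (Suc n))" if n: "n \<ge> N" for n
    proof (rule t.branchI)
      have "t.geo (map r [0..<Suc n]) (r 0) (r n)" using t.geo_ray[OF rr(1,3)] by blast
      then have "t.walk (rev (map r [0..<Suc n])) (r n) (r 0)" by (intro t.walk_rev t.geo_walk)
      then show "t.walk (rev (map r [0..<Suc n]) @ tl xs) (r n) u" by (rule t.walk_append[OF _ xs])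
      have "r (Suc n) \<notin> set xs" using N[of "Suc n"] n by auto
      then have "r (Suc n) \<notin> set (tl xs)" by (metis list.set_sel(2) tl_Nil)
      moreover have "r (Suc n) \<notin> r ` {0..<Suc n}" using rr(1) by (auto simp: inj_eq)
      ultimately show "r (Suc n) \<notin> set (rev (map r [0..<Suc n]) @ tl xs)" by (simp del: upt_Suc)
    qed
    then show ?thesis by blast
  qed
  then obtain N where N: "\<And>u n. u \<in> U \<Longrightarrow> n \<ge> N u \<Longrightarrow> u \<in> t.branch (r n) (r (Suc n))" by metis
  have "\<Gamma> = generate P (\<Union>u\<in>t.branch (r n) (r (Suc n)). \<G> u)" if n: "n \<ge> Max (insert 0 (N ` U))" for n
  proof
    let ?B = "t.branch (r n) (r (Suc n))"
    have BV: "?B \<subseteq> verts T" by (auto simp: t.branch_def dest: t.walkD(2))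
    have UB: "U \<subseteq> ?B"
    proof
      fix u assume u: "u \<in> U"
      then have "N u \<le> Max (insert 0 (N ` U))" using SU(2) by (intro Max_ge) auto
      then show "u \<in> ?B" using N[OF u, of n] n by linarith
    qed
    have "S \<subseteq> generate P (\<Union>u\<in>?B. \<G> u)"
      using SU(4) mono_generate[of "\<Union>u\<in>U. \<G> u" "\<Union>u\<in>?B. \<G> u"] UB by blast
    moreover have "subgroup (generate P (\<Union>u\<in>?B. \<G> u)) P"
      using BV by (intro generate_is_subgroup UN_least \<G>_carrier) blast
    ultimately show "\<Gamma> \<subseteq> generate P (\<Union>u\<in>?B. \<G> u)"
      unfolding SU(1)[symmetric] by (rule generate_subgroup_incl)
    show "generate P (\<Union>u\<in>?B. \<G> u) \<subseteq> \<Gamma>"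
      unfolding \<Gamma>_def by (rule mono_generate) (use BV in blast)
  qed
  then show ?thesis by blast
qed

text \<open>By \<open>branch_decreasing\<close> the vertex groups finally decrease; being finite,
  they are constant from the index on where their order is minimal.\<close>

lemma ray_constant:
  assumes fg: "finitely_generated (amalgam TG)" and r: "half_line T r"
  shows "\<exists>N. \<forall>n\<ge>N. \<Gamma> = generate P (\<Union>u\<in>t.branch (r n) (r (Suc n)). \<G> u) \<and> \<G> (r n) = \<G> (r N)"
proof -
  obtain N where N: "\<And>n. n \<ge> N \<Longrightarrow> \<Gamma> = generate P (\<Union>u\<in>t.branch (r n) (r (Suc n)). \<G> u)"
    using ray_generates assms by blast
  have rr: "\<And>n. r n \<in> verts T" "\<And>n. adjacent T (r n) (r (Suc n))" using r by (auto simp: half_line_def)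
  have dec: "\<G> (r (Suc n)) \<subseteq> \<G> (r n)" if "n \<ge> N" for n
    using branch_decreasing[OF rr(2) N[OF that]] .
  define M where "M = (ARG_MIN (\<lambda>n. card (\<G> (r n))) n. n \<ge> N)"
  have M: "M \<ge> N" "\<And>n. n \<ge> N \<Longrightarrow> card (\<G> (r M)) \<le> card (\<G> (r n))"
    unfolding M_def using arg_min_nat_lemma[of "\<lambda>n. n \<ge> N" N "\<lambda>n. card (\<G> (r n))"] by auto
  have sub: "\<G> (r n) \<subseteq> \<G> (r M)" if "n \<ge> M" for n
    using that
  proof (induction n rule: dec_induct)
    case (step n)
    then show ?case using dec[of n] M(1) by (meson order_trans)
  qed simp
  have const: "\<G> (r n) = \<G> (r M)" if n: "n \<ge> M" for n
    using card_seteq[OF _ sub[OF n] M(2)] vgrp_finite[OF rr(1)] n M(1) by simp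
  show ?thesis
  proof (intro exI[of _ M] allI impI conjI)
    fix n assume n: "n \<ge> M"
    then show "\<Gamma> = generate P (\<Union>u\<in>t.branch (r n) (r (Suc n)). \<G> u)" using N M(1) by (meson order_trans)
    show "\<G> (r n) = \<G> (r M)" by (rule const[OF n])
  qed
qed

text \<open>The translates of the branch form an invariant subtree \<open>Y\<close>, so
  \<open>\<gamma>\<close> fixes the geodesic from \<open>\<iota> u\<close> to its projection on
  \<open>Y\<close>. The geodesic from \<open>\<iota> u\<close> to \<open>\<iota> a\<close> runs
  through \<open>\<iota> b\<close>, and as \<open>\<iota> b\<close> is not in \<open>Y\<close>, it
  passes it before the projection.\<close>

lemma branch_complement_fixed:
  assumes ab: "adjacent T a b" and gen: "\<Gamma> = generate P (\<Union>u\<in>t.branch a b. \<G> u)"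
    and u: "u \<in> verts T" "u \<notin> t.branch a b" and \<gamma>: "\<gamma> \<in> \<G> u"
  shows "\<gamma> \<in> \<G> b"
proof -
  have V: "a \<in> verts T" "b \<in> verts T" "a \<noteq> b" using t.adj_V t.adj_V2 t.adj_irrefl ab by blast+
  have B: "t.convex (t.branch a b)" "a \<in> t.branch a b" using t.branch_convex t.branch_self V by blast+
  have BV: "t.branch a b \<subseteq> verts T" using B(1) by (auto simp: t.convex_def)
  define Y where "Y = (\<Union>\<gamma>\<in>\<Gamma>. (\<lambda>v. act \<gamma> (\<iota> v)) ` t.branch a b)"
  have Y: "convex Y" unfolding Y_def gen by (rule translates_convex[OF B])
  have \<gamma>\<Gamma>: "\<gamma> \<in> \<Gamma>" and \<gamma>P: "\<gamma> \<in> carrier P" using \<gamma> \<G>_\<Gamma> \<G>_carrier u by blast+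
  have tr: "act \<delta> x \<in> Y" if dx: "\<delta> \<in> \<Gamma>" "x \<in> Y" for \<delta> x
  proof -
    obtain \<epsilon> v where e: "\<epsilon> \<in> \<Gamma>" "v \<in> t.branch a b" "x = act \<epsilon> (\<iota> v)" using dx(2) by (auto simp: Y_def)
    have "act \<delta> x = act (\<delta> \<otimes>\<^bsub>P\<^esub> \<epsilon>) (\<iota> v)"
      using e dx(1) \<Gamma>_carrier BV \<iota>_V by (subst act_mult) auto
    moreover have "\<delta> \<otimes>\<^bsub>P\<^esub> \<epsilon> \<in> \<Gamma>" using dx(1) e(1) subgroup.m_closed[OF \<Gamma>_subgroup] by blast
    ultimately show ?thesis using e(2) by (auto simp: Y_def)
  qed
  have inv: "act \<gamma> x \<in> Y \<longleftrightarrow> x \<in> Y" if "x \<in> VX" for x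
    using tr[OF \<gamma>\<Gamma>] tr[OF subgroup.m_inv_closed[OF \<Gamma>_subgroup \<gamma>\<Gamma>], of "act \<gamma> x"] act_inv[OF \<gamma>P that] by auto
  have "act \<one>\<^bsub>P\<^esub> (\<iota> a) \<in> Y"
    using B(2) subgroup.one_closed[OF \<Gamma>_subgroup] unfolding Y_def by blast
  then have aY: "\<iota> a \<in> Y" using act_one[OF \<iota>_V[OF V(1)]] by simp
  have bY: "\<iota> b \<notin> Y"
  proof
    assume "\<iota> b \<in> Y"
    then obtain \<delta> c where "\<delta> \<in> \<Gamma>" "c \<in> t.branch a b" "act \<delta> (\<iota> c) = \<iota> b" by (auto simp: Y_def)
    then have "b \<in> t.branch a b" using stabilizer(1) V BV by blast
    then show False using t.branch_not by blast
  qed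
  have "\<exists>p y. gate Y p (\<iota> u) y \<and> act \<gamma> y = y \<and> (\<forall>z\<in>set p. act \<gamma> z = z)"
    using \<iota>_V[OF u(1)] vertex_fixes[OF u(1) \<gamma>] Y aY act_V[OF \<gamma>P] act_adj[OF \<gamma>P] act_inj[OF \<gamma>P] inv
    by (intro fixed_gate) auto
  then obtain p y where p: "gate Y p (\<iota> u) y" "\<And>z. z \<in> set p \<Longrightarrow> act \<gamma> z = z" by blast
  have yY: "y \<in> Y" using p(1) by (simp add: gate_def)
  then obtain s where s: "geo s y (\<iota> a)" using geo_exists Y aY unfolding convex_def by (meson subsetD)
  have sY: "set s \<subseteq> Y" using convex_geo[OF Y yY aY s] .
  have q: "geo (p @ tl s) (\<iota> u) (\<iota> a)" using gate_extend[OF p(1) Y aY s] .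
  obtain q' where q': "t.geo q' u a" using t.geo_exists u V by blast
  have "b \<in> set q'"
  proof (rule ccontr)
    assume "b \<notin> set q'"
    then have "u \<in> t.branch a b" using t.walk_rev[OF t.geo_walk[OF q']] by (intro t.branchI[of "rev q'"]) auto
    then show False using u by blast
  qed
  have "walk (map \<iota> q') (\<iota> u) (\<iota> a)"
    using t.geo_walk[OF q'] \<iota>_V \<iota>_adj unfolding t.walk_def walk_def
    by (auto simp: hd_map last_map successively_map intro: successively_mono)
  moreover have "nb (map \<iota> q')"
    using nb_map[of \<iota> q'] \<iota>_inj t.walkD(5)[OF t.geo_walk[OF q']] q' by (simp add: t.geo_def inj_on_subset)
  ultimately have "map \<iota> q' = p @ tl s" using geo_unique[OF _ q] by (simp add: geo_def)
  then have "\<iota> b \<in> set (p @ tl s)" using \<open>b \<in> set q'\<close> by (metis image_eqI set_map)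
  moreover have "\<iota> b \<notin> set (tl s)" using bY sY by (metis list.set_sel(2) subsetD tl_Nil)
  ultimately have "act \<gamma> (\<iota> b) = \<iota> b" using p(2) by auto
  then show ?thesis by (rule stabilizer(2)[OF \<gamma>\<Gamma> V(2) V(2)])
qed

end

section \<open>Admissible embeddings\<close>

lemma vert_stabilizer_iff: "g \<in> vert_stabilizer H x \<longleftrightarrow> g \<in> H \<and> act_vert g x = x"
  by (simp add: vert_stabilizer_def stabilizer_def sub_PGL2_def)

lemma vert_orbit_iff: "y \<in> vert_orbit H x \<longleftrightarrow> (\<exists>g\<in>H. y = act_vert g x)"
  by (auto simp: vert_orbit_def orbit_def sub_PGL2_def)

lemma edge_orbit_iff: "y \<in> edge_orbit H x \<longleftrightarrow> (\<exists>g\<in>H. y = act_edge g x)"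
  by (auto simp: edge_orbit_def orbit_def sub_PGL2_def)

context dvf
begin

lemma act_edge_mult:
  assumes "g \<in> carrier PGL2" "h \<in> carrier PGL2" "e \<subseteq> verts BT"
  shows "act_edge (g \<otimes>\<^bsub>PGL2\<^esub> h) e = act_edge g (act_edge h e)"
  unfolding act_edge_def image_image
  by (rule image_cong[OF HOL.refl]) (intro act_mult assms subsetD[OF assms(3)])

lemma act_edge_one:
  assumes "e \<subseteq> verts BT"
  shows "act_edge \<one>\<^bsub>PGL2\<^esub> e = e"
proof -
  have "act_edge \<one>\<^bsub>PGL2\<^esub> e = (\<lambda>x. x) ` e"
    unfolding act_edge_def by (rule image_cong[OF HOL.refl]) (intro act_one subsetD[OF assms])
  then show ?thesis by simp
qed

lemma edge_BT_verts: "e \<in> edges BT \<Longrightarrow> e \<subseteq> verts BT"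
  using wf_BT by (simp add: wf_graph_def)

lemma act_edge_edges: "g \<in> carrier PGL2 \<Longrightarrow> e \<in> edges BT \<Longrightarrow> act_edge g e \<in> edges BT"
proof -
  assume g: "g \<in> carrier PGL2" and e: "e \<in> edges BT"
  obtain A where A: "invertible A" "g = cls A" using g by (auto simp: carrier_PGL2)
  have "act_edge g e = mv A ` e"
    unfolding act_edge_def A(2) by (rule image_cong[OF HOL.refl]) (intro act_vert_cls subsetD[OF edge_BT_verts[OF e]])
  then show ?thesis using mv_edge[OF A(1) e] by simp
qed

lemma fixer_subgroup:
  assumes "x \<in> verts BT"
  shows "subgroup {g \<in> carrier PGL2. act_vert g x = x} PGL2"
proof -
  interpret P: group "PGL2 :: 'k pgl monoid" by (rule group_PGL2)
  show ?thesis
  proof (rule P.subgroupI)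
    show "{g \<in> carrier PGL2. act_vert g x = x} \<noteq> {}" using act_one[OF assms] P.one_closed by blast
    fix g assume g: "g \<in> {g \<in> carrier PGL2. act_vert g x = x}"
    then have "act_vert (inv\<^bsub>PGL2\<^esub> g) x = x" using act_inv(1)[of g x] assms by simp
    then show "inv\<^bsub>PGL2\<^esub> g \<in> {g \<in> carrier PGL2. act_vert g x = x}" using g by simp
  qed (use act_mult assms in auto)
qed

lemma orbit_eq:
  assumes H: "subgroup H PGL2" and g: "g \<in> H" and x: "x \<in> verts BT"
  shows "vert_orbit H (act_vert g x) = vert_orbit H x"
proof -
  interpret P: group "PGL2 :: 'k pgl monoid" by (rule group_PGL2)
  have gP: "\<And>h. h \<in> H \<Longrightarrow> h \<in> carrier PGL2" using subgroup.mem_carrier[OF H] .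
  have 1: "act_vert h (act_vert g x) = act_vert (h \<otimes>\<^bsub>PGL2\<^esub> g) x" if "h \<in> H" for h
    using act_mult gP that g x by simp
  have 2: "act_vert h x = act_vert (h \<otimes>\<^bsub>PGL2\<^esub> inv\<^bsub>PGL2\<^esub> g) (act_vert g x)" if "h \<in> H" for h
    using act_mult[of "h \<otimes>\<^bsub>PGL2\<^esub> inv\<^bsub>PGL2\<^esub> g" g x] gP[OF that] gP[OF g] x by (simp add: P.m_assoc)
  have "h \<otimes>\<^bsub>PGL2\<^esub> g \<in> H" "h \<otimes>\<^bsub>PGL2\<^esub> inv\<^bsub>PGL2\<^esub> g \<in> H" if "h \<in> H" for h
    using subgroup.m_closed[OF H] subgroup.m_inv_closed[OF H] g that by auto
  then show ?thesis using 1 2 unfolding set_eq_iff vert_orbit_iff by metis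
qed

lemma edge_orbit_eq:
  assumes H: "subgroup H PGL2" and g: "g \<in> H" and x: "x \<subseteq> verts BT"
  shows "edge_orbit H (act_edge g x) = edge_orbit H x"
proof -
  interpret P: group "PGL2 :: 'k pgl monoid" by (rule group_PGL2)
  have gP: "\<And>h. h \<in> H \<Longrightarrow> h \<in> carrier PGL2" using subgroup.mem_carrier[OF H] .
  have 1: "act_edge h (act_edge g x) = act_edge (h \<otimes>\<^bsub>PGL2\<^esub> g) x" if "h \<in> H" for h
    using act_edge_mult gP that g x by simp
  have 2: "act_edge h x = act_edge (h \<otimes>\<^bsub>PGL2\<^esub> inv\<^bsub>PGL2\<^esub> g) (act_edge g x)" if "h \<in> H" for h
    using act_edge_mult[of "h \<otimes>\<^bsub>PGL2\<^esub> inv\<^bsub>PGL2\<^esub> g" g x] gP[OF that] gP[OF g] x by (simp add: P.m_assoc)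
  have "h \<otimes>\<^bsub>PGL2\<^esub> g \<in> H" "h \<otimes>\<^bsub>PGL2\<^esub> inv\<^bsub>PGL2\<^esub> g \<in> H" if "h \<in> H" for h
    using subgroup.m_closed[OF H] subgroup.m_inv_closed[OF H] g that by auto
  then show ?thesis using 1 2 unfolding set_eq_iff edge_orbit_iff by metis
qed

end

text \<open>The assumption on fixed points is conditional on discreteness, as is the convention on
  the field. It becomes available through \<open>discrete\<close>, which is proved from the action
  on vertices alone.\<close>

locale admissible_tree = dvf nrm \<pi> for nrm :: "'k::field_char_0 \<Rightarrow> real" and \<pi> +
  fixes TG :: "('v, 'e, 'g, 'h) graph_of_groups" and \<iota>V :: "'v \<Rightarrow> 'k bt_vertex"
    and \<iota>E :: "'e \<Rightarrow> 'k bt_edge" and \<theta> :: "'v \<Rightarrow> 'g \<Rightarrow> 'k pgl"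
  assumes star: "star_admissible nrm TG" and adm: "admissible_embedding nrm TG \<iota>V \<iota>E \<theta>"
    and K_large: "\<lbrakk>discrete_subgroup nrm (generated_group TG \<theta>); g \<in> generated_group TG \<theta>;
        g \<noteq> \<one>\<^bsub>PGL2\<^esub>\<rbrakk> \<Longrightarrow> rational_fixed_points g"
begin

lemma TG: "tree_of_groups TG" and fg: "finitely_generated (amalgam TG)"
  using star by (auto simp: star_admissible_def)

lemma embedding: "graph_embedding (base TG) BT \<iota>V \<iota>E"
  using adm by (simp add: admissible_embedding_def)

lemma \<iota>E_eq: "e \<in> edges (base TG) \<Longrightarrow> \<iota>E e = \<iota>V ` extr (base TG) e"
  using embedding by (simp add: graph_embedding_def)

lemma \<iota>V_verts: "v \<in> verts (base TG) \<Longrightarrow> \<iota>V v \<in> verts BT"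
  and \<iota>E_edges: "e \<in> edges (base TG) \<Longrightarrow> \<iota>E e \<in> edges BT"
  and \<iota>V_inj: "inj_on \<iota>V (verts (base TG))" and \<iota>E_inj: "inj_on \<iota>E (edges (base TG))"
  using embedding by (auto simp: graph_embedding_def)

lemma tilde_v: "v \<in> verts (base TG) \<Longrightarrow> vert_tilde TG \<theta> (\<iota>V v) = vimg TG \<theta> v"
  and tilde_e: "e \<in> edges (base TG) \<Longrightarrow> v \<in> extr (base TG) e \<Longrightarrow>
      edge_tilde TG \<theta> (\<iota>E e) = \<theta> v ` einj TG e v ` carrier (egrp TG e)"
  and star_bij: "v \<in> verts (base TG) \<Longrightarrow> bij_betw (\<lambda>e. edge_orbit (vimg TG \<theta> v) (\<iota>E e)) (star (base TG) v)
          (edge_orbit (vimg TG \<theta> v) ` star (ambient_tree nrm TG \<theta>) (\<iota>V v))"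
  and compat: "compatible_embeddings TG \<theta>"
  using adm by (auto simp: admissible_embedding_def)

sublocale a: tree_of_groups_action "verts BT" "adjacent BT" PGL2 TG \<theta> act_vert \<iota>V
proof -
  interpret P: group "PGL2 :: 'k pgl monoid" by (rule group_PGL2)
  have wf: "wf_graph (base TG)" using TG by (simp add: tree_of_groups_def tree_def)
  have \<theta>m: "v \<in> verts (base TG) \<Longrightarrow> \<theta> v \<in> mon (vgrp TG v) PGL2" for v
    using compat by (simp add: compatible_embeddings_def)
  have sub: "subgroup (vimg TG \<theta> v) PGL2" if v: "v \<in> verts (base TG)" for v
  proof -
    have "group (vgrp TG v)" using TG v by (simp add: tree_of_groups_def)
    then interpret group_hom "vgrp TG v" PGL2 "\<theta> v"
      using \<theta>m[OF v] P.is_group by (auto simp: group_hom_def group_hom_axioms_def mon_def)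
    show ?thesis unfolding vimg_def by (rule img_is_subgroup)
  qed
  \<comment> \<open>By condition (iii) the group of \<open>v\<close> is generated by elements that
    fix \<open>\<iota>V v\<close>.\<close>
  have fixes': "act_vert g (\<iota>V v) = \<iota>V v" if v: "v \<in> verts (base TG)" and g: "g \<in> vimg TG \<theta> v" for v g
  proof -
    have "generate PGL2 (\<Union>u\<in>verts (base TG). vert_stabilizer (vimg TG \<theta> u) (\<iota>V v))
        \<subseteq> {g \<in> carrier PGL2. act_vert g (\<iota>V v) = \<iota>V v}"
    proof (rule P.generate_subgroup_incl[OF _ fixer_subgroup[OF \<iota>V_verts[OF v]]], rule UN_least, rule subsetI)
      fix u h assume "u \<in> verts (base TG)" "h \<in> vert_stabilizer (vimg TG \<theta> u) (\<iota>V v)"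
      then show "h \<in> {g \<in> carrier PGL2. act_vert g (\<iota>V v) = \<iota>V v}"
        using subgroup.mem_carrier[OF sub] by (simp add: vert_stabilizer_iff)
    qed
    then show ?thesis using g tilde_v[OF v] by (auto simp: vert_tilde_def)
  qed
  have edge': "\<iota>E e = {\<iota>V v, \<iota>V w}" if "e \<in> edges (base TG)" "extr (base TG) e = {v, w}" for e v w
    using \<iota>E_eq[OF that(1)] that(2) by simp
  show "tree_of_groups_action (verts BT) (adjacent BT) PGL2 TG \<theta> act_vert \<iota>V"
  proof (unfold_locales, goal_cases)
    case 1 show ?case by (rule TG)
  next
    case (2 g x) then show ?case by (rule act_verts)
  next
    case (3 g h x) then show ?case by (rule act_mult)
  next
    case (4 x) then show ?case by (rule act_one)
  next
    case (5 g x y) then show ?case by (rule act_adj)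
  next
    case (6 v) then show ?case by (rule \<theta>m)
  next
    case (7 e v w k) then show ?case using compat unfolding compatible_embeddings_def by blast
  next
    case (8 v) then show ?case by (rule \<iota>V_verts)
  next
    case (9 v w)
    then obtain e where e: "e \<in> edges (base TG)" "extr (base TG) e = {v, w}" by (auto simp: adjacent_def)
    then show ?case using \<iota>E_edges[OF e(1)] edge'[OF e] by (simp add: adjacent_BT_edge)
  next
    case 10 show ?case by (rule \<iota>V_inj)
  next
    case (11 v g) then show ?case using fixes' by (simp add: vimg_def)
  next
    \<comment> \<open>Injectivity in condition (v): the two edges lie in one orbit of the vertex
      group.\<close>
    case (12 v w u g)
    obtain e e' where e: "e \<in> edges (base TG)" "extr (base TG) e = {v, w}"
      and e': "e' \<in> edges (base TG)" "extr (base TG) e' = {v, u}" using 12 by (auto simp: adjacent_def)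
    have v: "v \<in> verts (base TG)" using e wf by (auto simp: wf_graph_def)
    have g: "g \<in> vimg TG \<theta> v" using 12 by (simp add: vimg_def)
    have "act_edge g (\<iota>E e) = \<iota>E e'"
      using edge'[OF e] edge'[OF e'] fixes'[OF v g] 12(4) by (simp add: act_edge_def)
    then have "edge_orbit (vimg TG \<theta> v) (\<iota>E e) = edge_orbit (vimg TG \<theta> v) (\<iota>E e')"
      using edge_orbit_eq[OF sub[OF v] g edge_BT_verts[OF \<iota>E_edges[OF e(1)]]] by simp
    then have "e = e'"
      using inj_onD[OF bij_betw_imp_inj_on[OF star_bij[OF v]], of e e'] e e' by (simp add: star_def)
    then show ?case using e e' by (auto simp: doubleton_eq_iff)
  next
    \<comment> \<open>Condition (iv): an element of the vertex group that fixes both extremities is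
      among the generators of \<open>edge_tilde\<close>.\<close>
    case (13 e v w g)
    have v: "v \<in> verts (base TG)" using 13 wf by (auto simp: wf_graph_def)
    have g: "g \<in> vimg TG \<theta> v" using 13 by (simp add: vimg_def)
    have "g \<in> edge_stabilizer (vimg TG \<theta> v) (\<iota>E e)"
      using edge'[OF 13(1,2)] fixes'[OF v g] 13(4) g by (simp add: edge_stabilizer_def)
    then have "g \<in> edge_tilde TG \<theta> (\<iota>E e)"
      unfolding edge_tilde_def using v by (intro generate.incl) blast
    then show ?case using tilde_e[OF 13(1), of v] 13(2) by simp
  qed
qed

abbreviation "\<Gamma> \<equiv> a.\<Gamma>"
abbreviation "T \<equiv> base TG"

lemma vimg_eq: "vimg TG \<theta> v = a.\<G> v"
  by (simp add: vimg_def)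

lemma generated_group_eq: "generated_group TG \<theta> = \<Gamma>"
  by (simp add: generated_group_def a.\<Gamma>_def vimg_def)

text \<open>The stabilizer of \<open>\<iota>V v\<close> in \<open>\<Gamma>\<close> is no larger than
  the finite group of \<open>v\<close>.\<close>

lemma discrete: "discrete_subgroup nrm \<Gamma>"
proof -
  obtain v where v: "v \<in> verts T" using a.tree_T by (auto simp: tree_def)
  have "{g \<in> \<Gamma>. act_vert g (\<iota>V v) = \<iota>V v} \<subseteq> a.\<G> v"
    using a.stabilizer(2)[OF _ v v] by blast
  moreover have "finite (a.\<G> v)" using a.vgrp_finite[OF v] by simp
  ultimately show ?thesis
    using discrete_subgroupI[OF a.\<Gamma>_subgroup \<iota>V_verts[OF v]] finite_subset by blast
qed

lemma rational: "g \<in> \<Gamma> \<Longrightarrow> g \<noteq> \<one>\<^bsub>PGL2\<^esub> \<Longrightarrow> rational_fixed_points g"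
  using K_large discrete by (simp add: generated_group_eq)

lemma fin_gen: "finitely_generated (sub_PGL2 \<Gamma>)"
proof -
  interpret H: group "PGL2\<lparr>carrier := \<Gamma>\<rparr>"
    using subgroup.subgroup_is_group[OF a.\<Gamma>_subgroup group_PGL2] .
  obtain S where S: "finite S" "S \<subseteq> \<Gamma>" "generate PGL2 S = \<Gamma>" using a.finite_support[OF fg] by blast
  then have "generate (PGL2\<lparr>carrier := \<Gamma>\<rparr>) S = \<Gamma>"
    using group.generate_consistent[OF group_PGL2 S(2) a.\<Gamma>_subgroup] by simp
  then show ?thesis using S by (auto simp: finitely_generated_def sub_PGL2_def)
qed

lemma amalgam_iso:
  "\<exists>f\<in>iso (amalgam TG) (sub_PGL2 \<Gamma>).
    \<forall>v\<in>verts T. \<forall>g\<in>carrier (vgrp TG v). f (amalgam_class TG [(v, g)]) = \<theta> v g"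
  using a.amalgam_iso a.amalgam_map_letter unfolding sub_PGL2_def by (intro bexI[of _ a.amalgam_map]) auto

end

section \<open>The tree of translates and its quotient\<close>

context admissible_tree
begin

definition VS :: "'k bt_vertex set" where
  "VS = (\<Union>\<gamma>\<in>\<Gamma>. (\<lambda>v. act_vert \<gamma> (\<iota>V v)) ` verts T)"

abbreviation T_star :: "'k bt_graph" where
  "T_star \<equiv> translates_graph nrm \<Gamma> T \<iota>V \<iota>E"

lemma \<Gamma>P: "g \<in> \<Gamma> \<Longrightarrow> g \<in> carrier PGL2"
  using a.\<Gamma>_carrier by blast

lemma \<Gamma>_mult: "g \<in> \<Gamma> \<Longrightarrow> h \<in> \<Gamma> \<Longrightarrow> g \<otimes>\<^bsub>PGL2\<^esub> h \<in> \<Gamma>"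
  by (rule subgroup.m_closed[OF a.\<Gamma>_subgroup])

lemma \<Gamma>_inv: "g \<in> \<Gamma> \<Longrightarrow> inv\<^bsub>PGL2\<^esub> g \<in> \<Gamma>"
  by (rule subgroup.m_inv_closed[OF a.\<Gamma>_subgroup])

lemma \<Gamma>_one: "\<one>\<^bsub>PGL2\<^esub> \<in> \<Gamma>"
  by (rule subgroup.one_closed[OF a.\<Gamma>_subgroup])

lemma VS_I: "g \<in> \<Gamma> \<Longrightarrow> v \<in> verts T \<Longrightarrow> act_vert g (\<iota>V v) \<in> VS"
  by (auto simp: VS_def)

lemma \<iota>_VS: "v \<in> verts T \<Longrightarrow> \<iota>V v \<in> VS"
  using VS_I[OF \<Gamma>_one, of v] act_one[OF \<iota>V_verts, of v] by simp

lemma T_nonempty: "verts T \<noteq> {}"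
  using a.tree_T by (simp add: tree_def)

lemma VS_nonempty: "VS \<noteq> {}"
  using T_nonempty \<iota>_VS by blast

lemma VS_convex: "bt.convex VS"
proof -
  have "a.t.convex (verts T)"
    unfolding a.t.convex_def using a.t.walk_exists a.t.walkD(5) by blast
  then show ?thesis
    using a.translates_convex[of "verts T"] T_nonempty unfolding VS_def a.\<Gamma>_def by blast
qed

lemma VS_verts: "VS \<subseteq> verts BT"
  using VS_convex by (simp add: bt.convex_def)

lemma VS_act: "g \<in> \<Gamma> \<Longrightarrow> x \<in> VS \<Longrightarrow> act_vert g x \<in> VS"
proof -
  assume g: "g \<in> \<Gamma>" and "x \<in> VS"
  then obtain h v where h: "h \<in> \<Gamma>" "v \<in> verts T" "x = act_vert h (\<iota>V v)" by (auto simp: VS_def)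
  then have "act_vert g x = act_vert (g \<otimes>\<^bsub>PGL2\<^esub> h) (\<iota>V v)"
    using act_mult g \<Gamma>P \<iota>V_verts by simp
  then show ?thesis using VS_I[OF \<Gamma>_mult[OF g h(1)] h(2)] by simp
qed

lemma VS_act_iff: "g \<in> \<Gamma> \<Longrightarrow> x \<in> verts BT \<Longrightarrow> act_vert g x \<in> VS \<longleftrightarrow> x \<in> VS"
  using VS_act[of g x] VS_act[OF \<Gamma>_inv, of g "act_vert g x"] act_inv(1)[of g x] \<Gamma>P by auto

lemma \<iota>E_extr: "e \<in> edges T \<Longrightarrow> extr T e = {v, w} \<Longrightarrow> \<iota>E e = {\<iota>V v, \<iota>V w}"
  using \<iota>E_eq by simp

text \<open>After moving \<open>x\<close> into \<open>\<iota>(T)\<close>, \<open>star_reach\<close>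
  shows that one further element of the vertex group brings \<open>y\<close> into
  \<open>\<iota>(T)\<close> as well. So an edge with both extremities in \<open>VS\<close> is a
  translate of an edge of \<open>\<iota>(T)\<close>, and \<open>T_star\<close> is a full
  subgraph.\<close>

lemma lift_adjacent:
  assumes xy: "x \<in> VS" "y \<in> VS" "adjacent BT x y"
  shows "\<exists>h\<in>\<Gamma>. \<exists>v w. adjacent T v w \<and> x = act_vert h (\<iota>V v) \<and> y = act_vert h (\<iota>V w)"
proof -
  obtain g v where g: "g \<in> \<Gamma>" "v \<in> verts T" "x = act_vert g (\<iota>V v)" using xy by (auto simp: VS_def)
  obtain h w where h: "h \<in> \<Gamma>" "w \<in> verts T" "y = act_vert h (\<iota>V w)" using xy by (auto simp: VS_def)
  have vw: "\<iota>V v \<in> verts BT" "\<iota>V w \<in> verts BT" using \<iota>V_verts g h by auto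
  let ?k = "inv\<^bsub>PGL2\<^esub> g \<otimes>\<^bsub>PGL2\<^esub> h"
  have k: "?k \<in> \<Gamma>" using \<Gamma>_mult \<Gamma>_inv g h by blast
  have "act_vert ?k (\<iota>V w) = act_vert (inv\<^bsub>PGL2\<^esub> g) y"
    using act_mult g h \<Gamma>P vw by simp
  moreover have "adjacent BT (act_vert (inv\<^bsub>PGL2\<^esub> g) x) (act_vert (inv\<^bsub>PGL2\<^esub> g) y)"
    using act_adj xy(3) g \<Gamma>P by simp
  ultimately have "adjacent BT (\<iota>V v) (act_vert ?k (\<iota>V w))"
    using act_inv(1) g \<Gamma>P vw by simp
  from a.star_reach[OF g(2) h(2) k this]
  obtain s where s: "adjacent T v w" "s \<in> a.\<G> v" "act_vert ?k (\<iota>V w) = act_vert s (\<iota>V w)" by blast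
  have s\<Gamma>: "s \<in> \<Gamma>" using s(2) a.\<G>_\<Gamma>[OF g(2)] by blast
  have "y = act_vert g (act_vert ?k (\<iota>V w))"
    using \<open>act_vert ?k (\<iota>V w) = act_vert (inv\<^bsub>PGL2\<^esub> g) y\<close> act_inv(2) g \<Gamma>P xy VS_verts by auto
  then have "y = act_vert (g \<otimes>\<^bsub>PGL2\<^esub> s) (\<iota>V w)" using s act_mult g s\<Gamma> \<Gamma>P vw by simp
  moreover have "x = act_vert (g \<otimes>\<^bsub>PGL2\<^esub> s) (\<iota>V v)"
    using a.vertex_fixes[OF g(2) s(2)] act_mult[OF \<Gamma>P[OF g(1)] \<Gamma>P[OF s\<Gamma>] vw(1)] g(3) by simp
  ultimately show ?thesis using \<Gamma>_mult[OF g(1) s\<Gamma>] s(1) by blast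
qed

lemma T_star_simps [simp]: "verts T_star = VS" "extr T_star = extr BT"
  by (simp_all add: translates_graph_def VS_def)

lemma T_star_edges: "edges T_star = {e \<in> edges BT. e \<subseteq> VS}"
proof (intro equalityI subsetI)
  fix e assume "e \<in> edges T_star"
  then obtain g d where g: "g \<in> \<Gamma>" "d \<in> edges T" "e = act_edge g (\<iota>E d)" by (auto simp: translates_graph_def)
  have "extr T d \<subseteq> verts T" using g(2) a.wf_T by (simp add: wf_graph_def)
  then have "e \<subseteq> VS" using g VS_I by (auto simp: \<iota>E_eq act_edge_def)
  then show "e \<in> {e \<in> edges BT. e \<subseteq> VS}" using act_edge_edges g \<Gamma>P \<iota>E_edges by simp
next
  fix e assume "e \<in> {e \<in> edges BT. e \<subseteq> VS}"
  then have e: "e \<in> edges BT" "e \<subseteq> VS" by auto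
  obtain y n where e2: "e = {bv y n, bv y (n + 1)}" using e by (auto simp: edges_BT)
  then have "adjacent BT (bv y n) (bv y (n + 1))" using e by (simp add: adjacent_BT_edge)
  then obtain h v w where h: "h \<in> \<Gamma>" "adjacent T v w" "bv y n = act_vert h (\<iota>V v)" "bv y (n + 1) = act_vert h (\<iota>V w)"
    using lift_adjacent[of "bv y n" "bv y (n + 1)"] e(2) e2 by auto
  obtain d where "d \<in> edges T" "extr T d = {v, w}" using h(2) by (auto simp: adjacent_def)
  then have "e = act_edge h (\<iota>E d)" using h e2 by (simp add: \<iota>E_extr act_edge_def)
  then show "e \<in> edges T_star" using h \<open>d \<in> edges T\<close> by (auto simp: translates_graph_def)
qed

lemma T_star_subtree: "subtree T_star BT"
proof -
  have "T_star = induced BT VS"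
    by (simp add: induced_def T_star_edges translates_graph_def VS_def[symmetric])
       (simp add: T_star_edges[unfolded translates_graph_def, simplified])
  then show ?thesis using induced_subtree[OF tree_BT VS_convex VS_nonempty] by simp
qed

text \<open>The inverse of the section: an orbit in \<open>VS\<close> meets
  \<open>\<iota>(T)\<close> in exactly one vertex, by \<open>stabilizer\<close>. As it refers only
  to the orbit, it applies to quotients of all invariant subgraphs.\<close>

definition \<Phi>V :: "'k bt_vertex set \<Rightarrow> 'v" where
  "\<Phi>V X = (THE v. v \<in> verts T \<and> \<iota>V v \<in> X)"

definition \<Phi>E :: "'k bt_edge set \<Rightarrow> 'e" where
  "\<Phi>E X = (THE e. e \<in> edges T \<and> \<iota>E e \<in> X)"

lemma orbit_self: "v \<in> verts T \<Longrightarrow> \<iota>V v \<in> vert_orbit \<Gamma> (\<iota>V v)"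
  unfolding vert_orbit_iff by (rule bexI[OF _ \<Gamma>_one]) (simp add: act_one \<iota>V_verts)

lemma edge_orbit_self: "e \<in> edges T \<Longrightarrow> \<iota>E e \<in> edge_orbit \<Gamma> (\<iota>E e)"
  unfolding edge_orbit_iff by (rule bexI[OF _ \<Gamma>_one]) (simp add: act_edge_one edge_BT_verts \<iota>E_edges)

lemma \<Phi>V_orbit: "v \<in> verts T \<Longrightarrow> \<Phi>V (vert_orbit \<Gamma> (\<iota>V v)) = v"
  unfolding \<Phi>V_def
  by (rule the_equality) (use orbit_self a.stabilizer(1) in \<open>auto simp: vert_orbit_iff\<close>)

text \<open>An element of \<open>\<Gamma>\<close> that carries a vertex of \<open>\<iota>(T)\<close>
  into \<open>\<iota>(T)\<close> leaves it in place, so both edges have the same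
  extremities.\<close>

lemma edge_translate_eq:
  assumes e: "e \<in> edges T" "d \<in> edges T" and g: "g \<in> \<Gamma>" and eq: "\<iota>E d = act_edge g (\<iota>E e)"
  shows "d = e"
proof -
  have V: "extr T e \<subseteq> verts T" "extr T d \<subseteq> verts T" using e a.wf_T by (simp_all add: wf_graph_def)
  have im: "\<iota>V ` extr T d = (\<lambda>v. act_vert g (\<iota>V v)) ` extr T e"
    using eq e by (simp add: \<iota>E_eq act_edge_def image_image)
  have "extr T d = extr T e"
  proof (intro equalityI subsetI)
    fix v assume v: "v \<in> extr T d"
    then obtain w where w: "w \<in> extr T e" "\<iota>V v = act_vert g (\<iota>V w)" using im by blast
    have "v = w" by (rule a.stabilizer(1)[OF g subsetD[OF V(2) v] subsetD[OF V(1) w(1)] w(2)[symmetric]])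
    then show "v \<in> extr T e" using w(1) by simp
  next
    fix w assume w: "w \<in> extr T e"
    have "act_vert g (\<iota>V w) \<in> \<iota>V ` extr T d" unfolding im by (rule imageI[OF w])
    then obtain v where v: "v \<in> extr T d" "\<iota>V v = act_vert g (\<iota>V w)" by (elim imageE) simp
    have "v = w" by (rule a.stabilizer(1)[OF g subsetD[OF V(2) v(1)] subsetD[OF V(1) w] v(2)[symmetric]])
    then show "w \<in> extr T d" using v(1) by simp
  qed
  then have "\<iota>E d = \<iota>E e" using e by (simp add: \<iota>E_eq)
  then show ?thesis using inj_onD[OF \<iota>E_inj] e by blast
qed

lemma \<Phi>E_orbit: "e \<in> edges T \<Longrightarrow> \<Phi>E (edge_orbit \<Gamma> (\<iota>E e)) = e"
  unfolding \<Phi>E_def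
  by (rule the_equality) (use edge_orbit_self edge_translate_eq in \<open>auto simp: edge_orbit_iff\<close>)

end

text \<open>Instantiated with the tree of translates and with the tree of the limit points, so that
  both quotients are identified with subgraphs of \<open>T\<close> by the same maps
  \<open>\<Phi>V\<close> and \<open>\<Phi>E\<close>.\<close>

locale invariant_subgraph = admissible_tree nrm \<pi> TG \<iota>V \<iota>E \<theta>
  for nrm :: "'k::field_char_0 \<Rightarrow> real" and \<pi> and TG :: "('v, 'e, 'g, 'h) graph_of_groups"
    and \<iota>V \<iota>E \<theta> +
  fixes S :: "'k bt_graph"
  assumes S_verts: "verts S \<subseteq> VS" and S_edges: "edges S \<subseteq> edges T_star"
    and S_edge_verts: "e \<in> edges S \<Longrightarrow> e \<subseteq> verts S" and S_extr: "e \<in> edges S \<Longrightarrow> extr S e = e"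
    and S_act: "g \<in> \<Gamma> \<Longrightarrow> x \<in> verts S \<Longrightarrow> act_vert g x \<in> verts S"
    and S_act_edge: "g \<in> \<Gamma> \<Longrightarrow> e \<in> edges S \<Longrightarrow> act_edge g e \<in> edges S"
begin

definition T' :: "('v, 'e) ugraph" where
  "T' = \<lparr>verts = {v \<in> verts T. \<iota>V v \<in> verts S}, edges = {e \<in> edges T. \<iota>E e \<in> edges S}, extr = extr T\<rparr>"

lemma quotient_verts: "verts (quotient_graph \<Gamma> S) = (\<lambda>v. vert_orbit \<Gamma> (\<iota>V v)) ` verts T'"
proof (intro equalityI subsetI)
  fix X assume "X \<in> verts (quotient_graph \<Gamma> S)"
  then obtain x where x: "x \<in> verts S" "X = vert_orbit \<Gamma> x" by (auto simp: quotient_graph_def)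
  then obtain g v where g: "g \<in> \<Gamma>" "v \<in> verts T" "x = act_vert g (\<iota>V v)" using S_verts by (auto simp: VS_def)
  then have "act_vert (inv\<^bsub>PGL2\<^esub> g) x = \<iota>V v" using act_inv(1) \<Gamma>P \<iota>V_verts by simp
  then have "\<iota>V v \<in> verts S" using S_act[OF \<Gamma>_inv[OF g(1)] x(1)] by (simp only:)
  moreover have "X = vert_orbit \<Gamma> (\<iota>V v)" using x g orbit_eq[OF a.\<Gamma>_subgroup g(1)] \<iota>V_verts by simp
  ultimately show "X \<in> (\<lambda>v. vert_orbit \<Gamma> (\<iota>V v)) ` verts T'" using g by (auto simp: T'_def)
qed (auto simp: quotient_graph_def T'_def)

lemma quotient_edges: "edges (quotient_graph \<Gamma> S) = (\<lambda>e. edge_orbit \<Gamma> (\<iota>E e)) ` edges T'"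
proof (intro equalityI subsetI)
  fix X assume "X \<in> edges (quotient_graph \<Gamma> S)"
  then obtain x where x: "x \<in> edges S" "X = edge_orbit \<Gamma> x" by (auto simp: quotient_graph_def)
  then obtain g e where g: "g \<in> \<Gamma>" "e \<in> edges T" "x = act_edge g (\<iota>E e)"
    using S_edges by (auto simp: translates_graph_def)
  have eV: "\<iota>E e \<subseteq> verts BT" using g \<iota>E_edges edge_BT_verts by blast
  have "act_edge (inv\<^bsub>PGL2\<^esub> g) x = \<iota>E e"
    using act_edge_mult[OF _ _ eV, of "inv\<^bsub>PGL2\<^esub> g" g] g \<Gamma>P[OF g(1)] act_edge_one[OF eV] a.l_inv by simp
  then have "\<iota>E e \<in> edges S" using S_act_edge \<Gamma>_inv g x by metis
  moreover have "X = edge_orbit \<Gamma> (\<iota>E e)" using x g edge_orbit_eq[OF a.\<Gamma>_subgroup g(1)] eV by simp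
  ultimately show "X \<in> (\<lambda>e. edge_orbit \<Gamma> (\<iota>E e)) ` edges T'" using g by (auto simp: T'_def)
qed (auto simp: quotient_graph_def T'_def)

text \<open>The extremities of an orbit of edges are defined as a union over the orbit; every edge
  in it contributes the same set of vertex orbits.\<close>

lemma quotient_extr:
  assumes e: "e \<in> edges T'"
  shows "extr (quotient_graph \<Gamma> S) (edge_orbit \<Gamma> (\<iota>E e)) = (\<lambda>v. vert_orbit \<Gamma> (\<iota>V v)) ` extr T e"
proof -
  have e': "e \<in> edges T" "\<iota>E e \<in> edges S" using e by (auto simp: T'_def)
  have V: "extr T e \<subseteq> verts T" using e' a.wf_T by (simp add: wf_graph_def)
  have "vert_orbit \<Gamma> ` extr S x = (\<lambda>v. vert_orbit \<Gamma> (\<iota>V v)) ` extr T e" if x: "x \<in> edge_orbit \<Gamma> (\<iota>E e)" for x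
  proof -
    obtain g where g: "g \<in> \<Gamma>" "x = act_edge g (\<iota>E e)" using x by (auto simp: edge_orbit_iff)
    have "extr S x = act_vert g ` \<iota>V ` extr T e"
      using S_extr S_act_edge g e' by (simp add: act_edge_def \<iota>E_eq)
    moreover have "vert_orbit \<Gamma> (act_vert g (\<iota>V v)) = vert_orbit \<Gamma> (\<iota>V v)" if "v \<in> extr T e" for v
      using orbit_eq[OF a.\<Gamma>_subgroup g(1)] \<iota>V_verts V that by blast
    ultimately show ?thesis by (simp add: image_image)
  qed
  then show ?thesis using edge_orbit_self[OF e'(1)] by (simp add: quotient_graph_def) blast
qed

lemma image_eq: "image_graph (quotient_graph \<Gamma> S) T \<Phi>V \<Phi>E = T'"
proof -
  have "\<Phi>V ` verts (quotient_graph \<Gamma> S) = verts T'"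
    unfolding quotient_verts image_image using \<Phi>V_orbit by (force simp: T'_def)
  moreover have "\<Phi>E ` edges (quotient_graph \<Gamma> S) = edges T'"
    unfolding quotient_edges image_image using \<Phi>E_orbit by (force simp: T'_def)
  ultimately show ?thesis by (simp add: image_graph_def T'_def)
qed

lemma T'_in: "v \<in> verts T' \<Longrightarrow> v \<in> verts T" "e \<in> edges T' \<Longrightarrow> e \<in> edges T" "extr T' = extr T"
  by (auto simp: T'_def)

lemma T'_extr: "e \<in> edges T' \<Longrightarrow> extr T e \<subseteq> verts T'"
  using S_edge_verts[of "\<iota>E e"] a.extr_verts[of e] by (auto simp: T'_def \<iota>E_eq image_subset_iff)

lemma quotient_iso: "graph_iso (quotient_graph \<Gamma> S) T' \<Phi>V \<Phi>E"
proof -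
  have "\<Phi>V (vert_orbit \<Gamma> (\<iota>V v)) = v" if "v \<in> verts T'" for v using \<Phi>V_orbit T'_in that by blast
  then have "bij_betw \<Phi>V (verts (quotient_graph \<Gamma> S)) (verts T')"
    unfolding quotient_verts by (intro bij_betwI[of _ _ _ "\<lambda>v. vert_orbit \<Gamma> (\<iota>V v)"]) auto
  moreover have "\<Phi>E (edge_orbit \<Gamma> (\<iota>E v)) = v" if "v \<in> edges T'" for v using \<Phi>E_orbit T'_in that by blast
  then have "bij_betw \<Phi>E (edges (quotient_graph \<Gamma> S)) (edges T')"
    unfolding quotient_edges by (intro bij_betwI[of _ _ _ "\<lambda>v. edge_orbit \<Gamma> (\<iota>E v)"]) auto
  moreover have "extr T' (\<Phi>E X) = \<Phi>V ` extr (quotient_graph \<Gamma> S) X" if X: "X \<in> edges (quotient_graph \<Gamma> S)" for X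
  proof -
    obtain e where e: "e \<in> edges T'" "X = edge_orbit \<Gamma> (\<iota>E e)" using X by (auto simp: quotient_edges)
    have "\<Phi>V ` extr (quotient_graph \<Gamma> S) X = (\<lambda>v. v) ` extr T e"
      unfolding e(2) quotient_extr[OF e(1)] image_image
      by (rule image_cong[OF HOL.refl]) (use T'_extr[OF e(1)] T'_in \<Phi>V_orbit in blast)
    then show ?thesis using e \<Phi>E_orbit T'_in by simp
  qed
  ultimately show ?thesis by (simp add: graph_iso_def)
qed

lemma quotient_embedding: "graph_embedding (quotient_graph \<Gamma> S) T \<Phi>V \<Phi>E"
  using quotient_iso T'_in by (auto simp: graph_iso_def graph_embedding_def bij_betw_def)

lemma section_T': "is_section \<Gamma> S T' \<Phi>V \<Phi>E \<iota>V \<iota>E"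
proof -
  have "graph_embedding T' S \<iota>V \<iota>E"
    using \<iota>V_inj \<iota>E_inj S_extr \<iota>E_eq by (auto simp: graph_embedding_def T'_def inj_on_def)
  then show ?thesis
    using quotient_iso \<Phi>V_orbit \<Phi>E_orbit T'_in by (simp add: is_section_def)
qed

end

section \<open>Sections, stabilizers and the induced tree of groups\<close>

context admissible_tree
begin

lemma T_star_invariant: "invariant_subgraph nrm \<pi> TG \<iota>V \<iota>E \<theta> T_star"
proof (unfold_locales, goal_cases)
  case (5 g x) then show ?case using VS_act by simp
next
  case (6 g e)
  then have "act_edge g e \<subseteq> VS" using VS_act by (auto simp: T_star_edges act_edge_def)
  then show ?case using 6 act_edge_edges \<Gamma>P by (simp add: T_star_edges)
qed (auto simp: T_star_edges)

lemma T_star_T': "invariant_subgraph.T' TG \<iota>V \<iota>E T_star = T"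
proof -
  have "\<iota>E e \<subseteq> VS" if e: "e \<in> edges T" for e
    using a.extr_verts[OF e] \<iota>_VS by (auto simp: \<iota>E_eq[OF e])
  then have "{e \<in> edges T. \<iota>E e \<in> edges T_star} = edges T" "{v \<in> verts T. \<iota>V v \<in> verts T_star} = verts T"
    using \<iota>E_edges \<iota>_VS unfolding T_star_edges by auto
  then show ?thesis by (simp add: invariant_subgraph.T'_def[OF T_star_invariant])
qed

lemma vert_stabilizer_eq: "v \<in> verts T \<Longrightarrow> vert_stabilizer \<Gamma> (\<iota>V v) = a.\<G> v"
proof (intro equalityI subsetI)
  assume v: "v \<in> verts T"
  fix g
  { assume "g \<in> vert_stabilizer \<Gamma> (\<iota>V v)"
    then have "g \<in> \<Gamma>" "act_vert g (\<iota>V v) = \<iota>V v" by (simp_all add: vert_stabilizer_iff)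
    then show "g \<in> a.\<G> v" by (intro a.stabilizer(2)[OF _ v v]) }
  { assume g: "g \<in> a.\<G> v"
    show "g \<in> vert_stabilizer \<Gamma> (\<iota>V v)"
      unfolding vert_stabilizer_iff using subsetD[OF a.\<G>_\<Gamma>[OF v] g] a.vertex_fixes[OF v g] by (rule conjI) }
qed

lemma extr_pair:
  assumes e: "e \<in> edges T" "v \<in> extr T e"
  shows "\<exists>w. extr T e = {v, w}"
proof -
  have "card (extr T e) = 1 \<or> card (extr T e) = 2" using e a.wf_T by (simp add: wf_graph_def)
  then obtain x y where "extr T e = {x, y}" by (metis card_1_singletonE card_2_iff insert_absorb2)
  then show ?thesis using e(2) by (cases "v = x") (simp_all add: insert_commute, blast+)
qed

lemma edge_stabilizer_eq:
  assumes e: "e \<in> edges T" "v \<in> extr T e"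
  shows "edge_stabilizer \<Gamma> (\<iota>E e) = \<theta> v ` einj TG e v ` carrier (egrp TG e)"
proof (intro equalityI subsetI)
  fix g assume g: "g \<in> edge_stabilizer \<Gamma> (\<iota>E e)"
  obtain w where w: "extr T e = {v, w}" using extr_pair[OF e] by (elim exE)
  have v: "v \<in> verts T" using a.extr_verts e by blast
  have "g \<in> \<Gamma>" "act_vert g (\<iota>V v) = \<iota>V v" "act_vert g (\<iota>V w) = \<iota>V w"
    using g \<iota>E_extr[OF e(1) w] by (auto simp: edge_stabilizer_def)
  then show "g \<in> \<theta> v ` einj TG e v ` carrier (egrp TG e)"
    using a.edge_group[OF e(1) w] a.stabilizer(2)[OF _ v v] by simp
next
  fix g assume "g \<in> \<theta> v ` einj TG e v ` carrier (egrp TG e)"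
  then obtain k where k: "k \<in> carrier (egrp TG e)" "g = \<theta> v (einj TG e v k)" by blast
  have *: "g \<in> a.\<G> w" if "w \<in> extr T e" for w
    using a.compat[OF e(1,2) that k(1)] k einj_closed[OF TG e(1) that k(1)] by auto
  then have "g \<in> \<Gamma>" using a.\<G>_\<Gamma> a.extr_verts e by blast
  moreover have "act_vert g (\<iota>V w) = \<iota>V w" if "w \<in> extr T e" for w
    by (rule a.vertex_fixes[OF a.extr_verts[OF e(1) that] *[OF that]])
  ultimately show "g \<in> edge_stabilizer \<Gamma> (\<iota>E e)" using e by (auto simp: edge_stabilizer_def \<iota>E_eq)
qed

lemma equal_groups: "equal_via \<theta> TG (induced_groups \<Gamma> T \<iota>V \<iota>E)"
proof -
  have "\<theta> v \<in> iso (vgrp TG v) (sub_PGL2 (vert_stabilizer \<Gamma> (\<iota>V v)))" if v: "v \<in> verts T" for v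
    using a.\<theta>_mon[OF v] by (auto simp: vert_stabilizer_eq[OF v] iso_def mon_def hom_def sub_PGL2_def bij_betw_def)
  moreover have "\<exists>f\<in>iso (egrp TG e) (sub_PGL2 (edge_stabilizer \<Gamma> (\<iota>E e))).
      \<forall>v\<in>extr T e. \<forall>h\<in>carrier (egrp TG e). \<theta> v (einj TG e v h) = f h" if e: "e \<in> edges T" for e
  proof -
    have "card (extr T e) \<in> {1, 2}" using e a.wf_T by (simp add: wf_graph_def)
    then obtain v where v: "v \<in> extr T e" by force
    have 1: "einj TG e v \<in> mon (egrp TG e) (vgrp TG v)" using TG e v by (simp add: tree_of_groups_def)
    have 2: "\<theta> v \<in> mon (vgrp TG v) PGL2" using a.\<theta>_mon a.extr_verts e v by blast
    have img: "(\<lambda>x. \<theta> v (einj TG e v x)) ` carrier (egrp TG e) = edge_stabilizer \<Gamma> (\<iota>E e)"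
      unfolding edge_stabilizer_eq[OF e v] by (simp add: image_image)
    have cl: "\<And>h. h \<in> carrier (egrp TG e) \<Longrightarrow> einj TG e v h \<in> carrier (vgrp TG v)"
      using 1 by (auto simp: mon_def hom_def)
    have "inj_on (\<lambda>x. \<theta> v (einj TG e v x)) (carrier (egrp TG e))"
      using 1 2 cl by (auto simp: mon_def inj_on_def)
    moreover have "(\<lambda>x. \<theta> v (einj TG e v x)) \<in> hom (egrp TG e) (sub_PGL2 (edge_stabilizer \<Gamma> (\<iota>E e)))"
      using 1 2 cl img by (auto simp: mon_def hom_def sub_PGL2_def)
    ultimately have "(\<lambda>x. \<theta> v (einj TG e v x)) \<in> iso (egrp TG e) (sub_PGL2 (edge_stabilizer \<Gamma> (\<iota>E e)))"
      using img by (simp add: iso_def bij_betw_def sub_PGL2_def)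
    then show ?thesis using a.compat[OF e v] by (intro bexI) auto
  qed
  ultimately show ?thesis by (simp add: equal_via_def induced_groups_def)
qed

end

lemma equal_via_restrict:
  assumes "equal_via \<theta> TG (induced_groups H (base TG) \<iota>V \<iota>E)"
    and "verts T' \<subseteq> verts (base TG)" "edges T' \<subseteq> edges (base TG)" "extr T' = extr (base TG)"
  shows "equal_via \<theta> (restrict_groups TG T') (induced_groups H T' \<iota>V \<iota>E)"
  using assms by (simp add: equal_via_def induced_groups_def restrict_groups_def subset_iff)

section \<open>Mirrors and axes\<close>

context dvf
begin

text \<open>Keeping the eigenbasis \<open>P\<close> with the element makes mirrors computable: the
  mirror is the line of \<open>axis P\<close>, and conjugation by \<open>D\<close> replaces
  \<open>P\<close> by \<open>D ** P\<close>.\<close>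

definition elliptic_frame :: "'k pgl \<Rightarrow> 'k^2^2 \<Rightarrow> bool" where
  "elliptic_frame g P \<longleftrightarrow> (\<exists>A a b. invertible A \<and> g = cls A \<and> invertible P \<and>
     A ** P = P ** M2 a 0 0 b \<and> a \<noteq> b \<and> nrm a = nrm b)"

definition axis_edges :: "'k^2^2 \<Rightarrow> 'k bt_edge set" where
  "axis_edges P = range (\<lambda>n. {mv P (bv 0 n), mv P (bv 0 (n + 1))})"

lemma elliptic_frame_exists:
  assumes "elliptic nrm g"
  shows "\<exists>P. elliptic_frame g P"
proof -
  obtain A where A: "invertible A" "g = cls A" using assms by (auto simp: elliptic_def carrier_PGL2)
  then have "elliptic nrm (cls A)" using assms by simp
  from ellipticD[OF this] show ?thesis unfolding elliptic_frame_def using A by metis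
qed

lemma elliptic_frame_elliptic: "elliptic_frame g P \<Longrightarrow> elliptic nrm g"
  unfolding elliptic_frame_def using ellipticI by blast

lemma elliptic_frame_fixed_points:
  assumes "elliptic_frame g P"
  shows "fixed_points g = {line (P *v e1), line (P *v e2)}"
proof -
  obtain A a b where A: "invertible A" "g = cls A" "invertible P"
     "A ** P = P ** M2 a 0 0 b" "a \<noteq> b" using assms by (auto simp: elliptic_frame_def)
  show ?thesis unfolding A(2)
    using fixed_points_diag[OF A(3-5)] diag_nonzero[OF A(1,3,4)] by simp
qed

lemma elliptic_frame_invertible: "elliptic_frame g P \<Longrightarrow> invertible P"
  by (auto simp: elliptic_frame_def)

lemma elliptic_frame_fixes:
  assumes "elliptic_frame g P" "x \<in> axis P"
  shows "act_vert g x = x"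
proof -
  obtain A a b where A: "invertible A" "g = cls A" "invertible P"
     "A ** P = P ** M2 a 0 0 b" "nrm a = nrm b" using assms by (auto simp: elliptic_frame_def)
  obtain n where n: "x = mv P (bv 0 n)" using assms by (auto simp: axis_def)
  have "mv A (mv P (bv 0 n)) = mv P (bv 0 (n + 0))"
    by (rule diag_axis[OF A(3,4) diag_nonzero[OF A(1,3,4)]]) (simp add: A(5))
  then show ?thesis unfolding n A(2) using A(3) by (simp add: act_vert_cls mv_verts)
qed

lemma elliptic_frame_conj:
  assumes P: "elliptic_frame g P" and D: "invertible D"
  shows "elliptic_frame (cls D \<otimes>\<^bsub>PGL2\<^esub> g \<otimes>\<^bsub>PGL2\<^esub> inv\<^bsub>PGL2\<^esub> (cls D)) (D ** P)"
proof -
  obtain A a b where A: "invertible A" "g = cls A" "invertible P"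
     "A ** P = P ** M2 a 0 0 b" "a \<noteq> b" "nrm a = nrm b" using P by (auto simp: elliptic_frame_def)
  obtain E where E: "D ** E = mat 1" "E ** D = mat 1" using D unfolding invertible_def by blast
  have Ei: "invertible E" using E unfolding invertible_def by blast
  have g: "cls D \<otimes>\<^bsub>PGL2\<^esub> g \<otimes>\<^bsub>PGL2\<^esub> inv\<^bsub>PGL2\<^esub> (cls D) = cls (D ** A ** E)"
    using A D Ei by (simp add: inv_cls[OF D E(1)] cls_mult invertible_mult2)
  have "(D ** A ** E) ** (D ** P) = D ** A ** (E ** D) ** P" by (simp add: matrix_mul_assoc)
  also have "\<dots> = D ** (A ** P)" by (simp add: E matrix_mul_assoc)
  also have "\<dots> = (D ** P) ** M2 a 0 0 b" by (simp add: A(4) matrix_mul_assoc)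
  finally have "(D ** A ** E) ** (D ** P) = (D ** P) ** M2 a 0 0 b" .
  moreover have "invertible (D ** A ** E)" "invertible (D ** P)" using A D Ei by (simp_all add: invertible_mult2)
  ultimately show ?thesis unfolding elliptic_frame_def g using A(5,6) by blast
qed

lemma axis_mult: "axis (D ** P) = mv D ` axis P"
  by (simp add: axis_def image_image mv_mult)

lemma axis_edges_mult: "axis_edges (D ** P) = (\<lambda>e. mv D ` e) ` axis_edges P"
  by (simp add: axis_edges_def image_image mv_mult)

lemma axis_edges_Union: "\<Union> (axis_edges P) = axis P"
  by (auto simp: axis_edges_def axis_def)

lemma axis_adjacent:
  assumes P: "invertible P" and adj: "adjacent BT x y" and xy: "x \<in> axis P" "y \<in> axis P"
  shows "{x, y} \<in> axis_edges P"
proof -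
  obtain m n where mn: "x = mv P (bv 0 m)" "y = mv P (bv 0 n)" using xy by (auto simp: axis_def)
  obtain E where E: "P ** E = mat 1" "E ** P = mat 1" using P unfolding invertible_def by blast
  have "invertible E" using E unfolding invertible_def by blast
  from mv_adj[OF this adj] have "adjacent BT (bv 0 m) (bv 0 n)"
    using mn mv_inverse[OF E(2)] by simp
  then obtain y' k where "{bv 0 m, bv 0 n} = {bv y' k, bv y' (k + 1)}" by (auto simp: adjacent_BT)
  then have "m = k \<and> n = k + 1 \<or> n = k \<and> m = k + 1" by (auto simp: doubleton_eq_iff bv_eq)
  then show ?thesis unfolding axis_edges_def mn by (auto simp: insert_commute)
qed

lemma axis_edges_adjacent: "invertible P \<Longrightarrow> {x, y} \<in> axis_edges P \<Longrightarrow> adjacent BT x y"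
  using mv_adj[OF _ adj_bv(1)] by (auto simp: axis_edges_def doubleton_eq_iff adjacent_commute)

lemma mirror_edges:
  assumes "elliptic_frame g P"
  shows "edges (mirror nrm g) = axis_edges P"
proof -
  have P: "invertible P" by (rule elliptic_frame_invertible[OF assms])
  have E: "edges (mirror nrm g) = {{c i, c (i + 1)} | c i z w.
      z \<in> {line (P *v e1), line (P *v e2)} \<and> w \<in> {line (P *v e1), line (P *v e2)} \<and> z \<noteq> w \<and> straight_line nrm c z w}"
    unfolding mirror_def tree_of_ends_def
    using elliptic_frame_elliptic[OF assms] elliptic_frame_fixed_points[OF assms] by simp
  show ?thesis
  proof (intro equalityI subsetI)
    fix e assume "e \<in> edges (mirror nrm g)"
    then obtain c i z w where e: "e = {c i, c (i + 1)}" and c: "straight_line nrm c z w"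
      and zw': "z \<in> {line (P *v e1), line (P *v e2)}" "w \<in> {line (P *v e1), line (P *v e2)}" "z \<noteq> w"
      unfolding E mem_Collect_eq by (elim exE conjE) simp
    have zw: "{z, w} = {line (P *v e1), line (P *v e2)}" using zw' by auto
    from e show "e \<in> axis_edges P"
      using axis_adjacent[OF P straight_line_adj[OF c] straight_line_axis[OF P c zw] straight_line_axis[OF P c zw]] by simp
  next
    fix e assume "e \<in> axis_edges P"
    then obtain n where "e = {mv P (bv 0 n), mv P (bv 0 (n + 1))}" by (auto simp: axis_edges_def)
    then show "e \<in> edges (mirror nrm g)"
      unfolding E mem_Collect_eq using straight_line_frame[OF P] frame_P1(3)[OF P]
      by (intro exI[of _ "\<lambda>n. mv P (bv 0 n)"] exI[of _ n] exI[of _ "line (P *v e1)"] exI[of _ "line (P *v e2)"]) simp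
  qed
qed

lemma conj_cancel:
  assumes "g \<in> carrier PGL2" "h \<in> carrier PGL2"
  shows "inv\<^bsub>PGL2\<^esub> h \<otimes>\<^bsub>PGL2\<^esub> (h \<otimes>\<^bsub>PGL2\<^esub> g \<otimes>\<^bsub>PGL2\<^esub> inv\<^bsub>PGL2\<^esub> h) \<otimes>\<^bsub>PGL2\<^esub> inv\<^bsub>PGL2\<^esub> (inv\<^bsub>PGL2\<^esub> h) = (g :: 'k pgl)"
proof -
  interpret P: group "PGL2 :: 'k pgl monoid" by (rule group_PGL2)
  have "inv\<^bsub>PGL2\<^esub> h \<otimes>\<^bsub>PGL2\<^esub> (h \<otimes>\<^bsub>PGL2\<^esub> g \<otimes>\<^bsub>PGL2\<^esub> inv\<^bsub>PGL2\<^esub> h) = g \<otimes>\<^bsub>PGL2\<^esub> inv\<^bsub>PGL2\<^esub> h"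
    using assms by (simp add: P.m_assoc[symmetric])
  then show ?thesis using assms by (simp add: P.m_assoc)
qed

lemma conj_one_iff:
  assumes "g \<in> carrier PGL2" "h \<in> carrier PGL2"
  shows "h \<otimes>\<^bsub>PGL2\<^esub> g \<otimes>\<^bsub>PGL2\<^esub> inv\<^bsub>PGL2\<^esub> h = \<one>\<^bsub>PGL2\<^esub> \<longleftrightarrow> g = (\<one>\<^bsub>PGL2\<^esub> :: 'k pgl)"
proof -
  interpret P: group "PGL2 :: 'k pgl monoid" by (rule group_PGL2)
  show ?thesis
  proof
    assume "h \<otimes>\<^bsub>PGL2\<^esub> g \<otimes>\<^bsub>PGL2\<^esub> inv\<^bsub>PGL2\<^esub> h = \<one>\<^bsub>PGL2\<^esub>"
    then have "g = inv\<^bsub>PGL2\<^esub> h \<otimes>\<^bsub>PGL2\<^esub> \<one>\<^bsub>PGL2\<^esub> \<otimes>\<^bsub>PGL2\<^esub> inv\<^bsub>PGL2\<^esub> (inv\<^bsub>PGL2\<^esub> h)"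
      using conj_cancel[OF assms] by simp
    then show "g = \<one>\<^bsub>PGL2\<^esub>" using assms by simp
  next
    assume "g = \<one>\<^bsub>PGL2\<^esub>"
    then show "h \<otimes>\<^bsub>PGL2\<^esub> g \<otimes>\<^bsub>PGL2\<^esub> inv\<^bsub>PGL2\<^esub> h = \<one>\<^bsub>PGL2\<^esub>" using assms by simp
  qed
qed

lemma conj_act:
  assumes "g \<in> carrier PGL2" "h \<in> carrier PGL2" "x \<in> verts BT"
  shows "act_vert (h \<otimes>\<^bsub>PGL2\<^esub> g \<otimes>\<^bsub>PGL2\<^esub> inv\<^bsub>PGL2\<^esub> h) (act_vert h x) = act_vert h (act_vert g x)"
proof -
  interpret P: group "PGL2 :: 'k pgl monoid" by (rule group_PGL2)
  show ?thesis using assms act_mult act_verts act_inv(1) by simp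
qed

end

section \<open>Mirrors and axes inside the tree of translates\<close>

context admissible_tree
begin

abbreviation cj :: "'k pgl \<Rightarrow> 'k pgl \<Rightarrow> 'k pgl" where
  "cj h g \<equiv> h \<otimes>\<^bsub>PGL2\<^esub> g \<otimes>\<^bsub>PGL2\<^esub> inv\<^bsub>PGL2\<^esub> h"

abbreviation "ambient \<equiv> ambient_tree nrm TG \<theta>"

lemma extr_ambient [simp]: "extr ambient = extr BT"
  by (simp add: ambient_tree_def tree_hull_def)

lemma mirror_ambient:
  assumes "v \<in> verts T" "g \<in> a.\<G> v" "g \<noteq> \<one>\<^bsub>PGL2\<^esub>"
  shows "edges (mirror nrm g) \<subseteq> edges ambient"
proof -
  have "edges (mirror nrm g) \<subseteq> edges (mirror_tree nrm (vimg TG \<theta> v))"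
    unfolding mirror_tree_def vimg_eq by (rule tree_hull_edges) (use assms in blast)
  also have "\<dots> \<subseteq> edges ambient"
    unfolding ambient_tree_def by (rule tree_hull_edges) (use assms in blast)
  finally show ?thesis .
qed

lemma cj_\<Gamma>: "g \<in> \<Gamma> \<Longrightarrow> h \<in> \<Gamma> \<Longrightarrow> cj h g \<in> \<Gamma>"
  by (simp add: \<Gamma>_mult \<Gamma>_inv)

lemma cj_\<G>:
  assumes "g \<in> \<Gamma>" "h \<in> \<Gamma>" "w \<in> verts T" "act_vert g (act_vert h (\<iota>V w)) = act_vert h (\<iota>V w)"
  shows "cj (inv\<^bsub>PGL2\<^esub> h) g \<in> a.\<G> w"
proof -
  have "act_vert (cj (inv\<^bsub>PGL2\<^esub> h) g) (\<iota>V w) = act_vert (cj (inv\<^bsub>PGL2\<^esub> h) g) (act_vert (inv\<^bsub>PGL2\<^esub> h) (act_vert h (\<iota>V w)))"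
    using assms \<Gamma>P \<iota>V_verts act_inv(1) by simp
  also have "\<dots> = act_vert (inv\<^bsub>PGL2\<^esub> h) (act_vert h (\<iota>V w))"
    using assms \<Gamma>P \<iota>V_verts act_verts by (subst conj_act) simp_all
  also have "\<dots> = \<iota>V w" using assms \<Gamma>P \<iota>V_verts act_inv(1) by simp
  finally show ?thesis by (intro a.stabilizer(2)[OF cj_\<Gamma>[OF assms(1) \<Gamma>_inv[OF assms(2)]] assms(3,3)])
qed

text \<open>Translated by the inverse of \<open>h\<close>, the edge lies on the mirror of an element
  of the group of \<open>w\<close> and emanates from \<open>\<iota>V w\<close>. It is thus in the
  star of the ambient tree, and surjectivity in condition (v) finds an edge of
  \<open>\<iota>(T)\<close> in its orbit.\<close>

lemma axis_step:
  assumes g: "g \<in> \<Gamma>" "g \<noteq> \<one>\<^bsub>PGL2\<^esub>" and P: "elliptic_frame g P" and yz: "{y, z} \<in> axis_edges P" and y: "y \<in> VS"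
  shows "z \<in> VS"
proof -
  obtain h w where h: "h \<in> \<Gamma>" "w \<in> verts T" "y = act_vert h (\<iota>V w)" using y by (auto simp: VS_def)
  have y_axis: "y \<in> axis P" using yz axis_edges_Union by blast
  let ?g = "cj (inv\<^bsub>PGL2\<^esub> h) g"
  have g\<G>: "?g \<in> a.\<G> w" using cj_\<G>[OF g(1) h(1,2)] elliptic_frame_fixes[OF P y_axis] h(3) by simp
  have g1: "?g \<noteq> \<one>\<^bsub>PGL2\<^esub>" using conj_one_iff[of g "inv\<^bsub>PGL2\<^esub> h"] g h \<Gamma>P by simp
  obtain H where H: "invertible H" "inv\<^bsub>PGL2\<^esub> h = cls H" using \<Gamma>P[OF \<Gamma>_inv[OF h(1)]] by (auto simp: carrier_PGL2)
  have zV: "z \<in> verts BT" "y \<in> verts BT"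
    using axis_edges_adjacent[OF elliptic_frame_invertible[OF P] yz] bt.adj_V bt.adj_V2 by auto
  have "mv H ` {y, z} \<in> axis_edges (H ** P)" using yz unfolding axis_edges_mult by blast
  then have "mv H ` {y, z} \<in> edges (mirror nrm ?g)"
    using mirror_edges[OF elliptic_frame_conj[OF P H(1)]] H(2) by simp
  moreover have "mv H y = \<iota>V w"
    using act_inv(1)[OF \<Gamma>P[OF h(1)] \<iota>V_verts[OF h(2)]] h(3) H(2) zV by (simp add: act_vert_cls)
  ultimately have "mv H ` {y, z} \<in> star ambient (\<iota>V w)"
    using mirror_ambient[OF h(2) g\<G> g1] by (auto simp: star_def)
  then have "edge_orbit (vimg TG \<theta> w) (mv H ` {y, z}) \<in> edge_orbit (vimg TG \<theta> w) ` star ambient (\<iota>V w)" by blast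
  then obtain e where e: "e \<in> star T w"
    "edge_orbit (vimg TG \<theta> w) (mv H ` {y, z}) = edge_orbit (vimg TG \<theta> w) (\<iota>E e)"
    using star_bij[OF h(2)] unfolding bij_betw_def by blast
  have "mv H ` {y, z} \<in> edge_orbit (vimg TG \<theta> w) (mv H ` {y, z})"
    unfolding edge_orbit_iff vimg_eq using mv_verts[OF H(1)] zV
    by (intro bexI[OF _ subgroup.one_closed[OF a.\<G>_subgroup[OF h(2)]]]) (simp add: act_edge_one)
  then have "mv H ` {y, z} \<in> edge_orbit (vimg TG \<theta> w) (\<iota>E e)" by (simp only: e(2))
  then obtain k where k: "k \<in> a.\<G> w" "mv H ` {y, z} = act_edge k (\<iota>E e)"
    unfolding edge_orbit_iff vimg_eq by (elim bexE)
  have "e \<in> edges T" using e(1) by (simp add: star_def)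
  then have "act_edge k (\<iota>E e) \<in> edges T_star"
    using subsetD[OF a.\<G>_\<Gamma>[OF h(2)] k(1)] by (auto simp: translates_graph_def)
  then have "act_vert (inv\<^bsub>PGL2\<^esub> h) z \<in> VS"
    using zV by (simp add: k(2)[symmetric] T_star_edges H(2) act_vert_cls)
  then show ?thesis using VS_act_iff[OF \<Gamma>_inv[OF h(1)] zV(1)] by simp
qed

lemma axis_in_VS:
  assumes g: "g \<in> \<Gamma>" "g \<noteq> \<one>\<^bsub>PGL2\<^esub>" and P: "elliptic_frame g P" and y: "y \<in> VS" "y \<in> axis P"
  shows "axis P \<subseteq> VS"
proof -
  let ?c = "\<lambda>n. mv P (bv 0 n)"
  obtain n where n: "y = ?c n" using y by (auto simp: axis_def)
  have E: "{?c m, ?c (m + 1)} \<in> axis_edges P" for m by (auto simp: axis_edges_def)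
  have "?c m \<in> VS" for m
  proof (induction m rule: int_induct[of _ n])
    case base then show ?case using y n by simp
  next
    case (step1 i) then show ?case using axis_step[OF g P E] by simp
  next
    case (step2 i)
    have "{?c i, ?c (i - 1)} \<in> axis_edges P" using E[of "i - 1"] by (simp add: insert_commute)
    then show ?case using axis_step[OF g P] step2 by blast
  qed
  then show ?thesis by (auto simp: axis_def)
qed

text \<open>Condition (ii) supplies a first edge, for a conjugate of \<open>g\<close>;
  \<open>axis_in_VS\<close> continues along its mirror in both directions, and conjugating back
  preserves \<open>VS\<close>.\<close>

lemma vertex_group_axis:
  assumes v: "v \<in> verts T" and g: "g \<in> a.\<G> v" "g \<noteq> \<one>\<^bsub>PGL2\<^esub>"
  shows "\<exists>P. elliptic_frame g P \<and> axis P \<subseteq> VS"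
proof -
  have g\<Gamma>: "g \<in> \<Gamma>" using g a.\<G>_\<Gamma>[OF v] by blast
  have "g \<in> vimg TG \<theta> v - {\<one>\<^bsub>PGL2\<^esub>}" using g by (simp add: vimg_eq)
  moreover have "\<forall>v\<in>verts T. \<forall>g\<in>vimg TG \<theta> v - {\<one>\<^bsub>PGL2\<^esub>}. \<exists>d\<in>\<Gamma>.
      edges (mirror nrm (cj d g)) \<inter> \<iota>E ` edges T \<noteq> {}"
    using adm by (simp add: admissible_embedding_def generated_group_eq)
  ultimately obtain d where d: "d \<in> \<Gamma>" "edges (mirror nrm (cj d g)) \<inter> \<iota>E ` edges T \<noteq> {}"
    using v by (elim ballE[of _ _ v] ballE[of _ _ g] bexE) simp_all
  \<comment> \<open>Since only elliptic elements have a mirror, condition (ii) also forces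
    \<open>g\<close> to be elliptic.\<close>
  have "edges (mirror nrm (cj d g)) = {}" if "\<not> elliptic nrm (cj d g)"
    using that by (simp add: mirror_def tree_of_ends_def)
  then have "elliptic nrm (cj d g)" using d by blast
  then obtain P where P: "elliptic_frame (cj d g) P" using elliptic_frame_exists by blast
  obtain e where e: "e \<in> edges T" "\<iota>E e \<in> axis_edges P" using d(2) mirror_edges[OF P] by blast
  then obtain y where "y \<in> \<iota>E e" "y \<in> axis P" unfolding axis_edges_Union[symmetric] axis_edges_def by blast
  moreover have "\<iota>E e \<subseteq> VS" using e a.extr_verts[OF e(1)] \<iota>_VS by (auto simp: \<iota>E_eq)
  ultimately have ax: "axis P \<subseteq> VS"
    using axis_in_VS[OF cj_\<Gamma>[OF g\<Gamma> d(1)] _ P] conj_one_iff[of g d] g(2) \<Gamma>P g\<Gamma> d(1) by blast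
  obtain D where D: "invertible D" "inv\<^bsub>PGL2\<^esub> d = cls D"
    using \<Gamma>P[OF \<Gamma>_inv[OF d(1)]] by (auto simp: carrier_PGL2)
  have "elliptic_frame g (D ** P)"
    using elliptic_frame_conj[OF P D(1)] conj_cancel[of g d] D(2) \<Gamma>P g\<Gamma> d(1) by simp
  moreover have "axis (D ** P) \<subseteq> VS"
  proof
    fix x assume "x \<in> axis (D ** P)"
    then obtain y where y: "y \<in> axis P" "x = mv D y" by (auto simp: axis_mult)
    then have "y \<in> VS" using ax by blast
    moreover have "x = act_vert (inv\<^bsub>PGL2\<^esub> d) y" using y D VS_verts \<open>y \<in> VS\<close> by (auto simp: act_vert_cls)
    ultimately show "x \<in> VS" using VS_act[OF \<Gamma>_inv[OF d(1)]] by simp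
  qed
  ultimately show ?thesis by blast
qed

text \<open>The projection of a fixed vertex to \<open>VS\<close> is fixed too, which places a
  conjugate of \<open>g\<close> in a vertex group. In particular \<open>\<Gamma>\<close> contains no
  nontrivial unipotent elements.\<close>

lemma fixing_axis:
  assumes g: "g \<in> \<Gamma>" "g \<noteq> \<one>\<^bsub>PGL2\<^esub>" and x: "x \<in> verts BT" "act_vert g x = x"
  shows "\<exists>P. elliptic_frame g P \<and> axis P \<subseteq> VS"
proof -
  have gP: "g \<in> carrier PGL2" using g \<Gamma>P by blast
  obtain y where y: "y \<in> VS" "act_vert g y = y"
    using bt.fixed_gate[OF x(1), of "act_vert g" VS] x(2) VS_convex VS_nonempty act_verts[OF gP] act_adj[OF gP]
      act_inj[OF gP] VS_act_iff[OF g(1)] unfolding bt.gate_def by blast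
  obtain h w where h: "h \<in> \<Gamma>" "w \<in> verts T" "y = act_vert h (\<iota>V w)" using y by (auto simp: VS_def)
  have "cj (inv\<^bsub>PGL2\<^esub> h) g \<in> a.\<G> w" using cj_\<G>[OF g(1) h(1,2)] y h by simp
  moreover have "cj (inv\<^bsub>PGL2\<^esub> h) g \<noteq> \<one>\<^bsub>PGL2\<^esub>" using conj_one_iff[of g "inv\<^bsub>PGL2\<^esub> h"] g h \<Gamma>P by simp
  ultimately obtain P where P: "elliptic_frame (cj (inv\<^bsub>PGL2\<^esub> h) g) P" "axis P \<subseteq> VS"
    using vertex_group_axis[OF h(2)] by blast
  obtain H where H: "invertible H" "h = cls H" using \<Gamma>P[OF h(1)] by (auto simp: carrier_PGL2)
  have "cj h (cj (inv\<^bsub>PGL2\<^esub> h) g) = g"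
    using conj_cancel[of g "inv\<^bsub>PGL2\<^esub> h"] gP \<Gamma>P[OF h(1)] by simp
  then have "elliptic_frame g (H ** P)" using elliptic_frame_conj[OF P(1) H(1)] H(2) by simp
  moreover have "axis (H ** P) \<subseteq> VS"
  proof
    fix x assume "x \<in> axis (H ** P)"
    then obtain y where y: "y \<in> axis P" "x = mv H y" by (auto simp: axis_mult)
    then have "y \<in> VS" using P(2) by blast
    moreover have "x = act_vert h y" using y H VS_verts \<open>y \<in> VS\<close> by (auto simp: act_vert_cls)
    ultimately show "x \<in> VS" using VS_act[OF h(1)] by simp
  qed
  ultimately show ?thesis by blast
qed

text \<open>\<open>axis_gate\<close> yields one vertex of the axis in \<open>VS\<close>. The element
  translates the axis by \<open>k\<close>, so every \<open>k\<close>-th vertex lies in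
  \<open>VS\<close>, and convexity gives the others.\<close>

lemma hyperbolic_axis:
  assumes g: "cls A \<in> \<Gamma>" and A: "invertible A" and P: "invertible P" "A ** P = P ** M2 a 0 0 b"
    and ab: "a \<noteq> 0" "b \<noteq> 0" "nrm a \<noteq> nrm b"
  shows "axis P \<subseteq> VS"
proof -
  let ?c = "\<lambda>n. mv P (bv 0 n)" and ?f = "act_vert (cls A)"
  have gP: "cls A \<in> carrier PGL2" using g \<Gamma>P by blast
  obtain k where "nrm (a / b) = q powi k" using nrm_value[of "a / b"] ab by auto
  then have k: "nrm a = nrm b * q powi k" using ab by (simp add: nrm_divide field_simps)
  then have k0: "k \<noteq> 0" using ab(3) by auto
  have f: "?f (?c n) = ?c (n + k)" for n
    using diag_axis[OF P ab(1,2) k] P(1) by (simp add: act_vert_cls mv_verts)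
  have cV: "?c n \<in> verts BT" for n using mv_verts[OF P(1)] by simp
  have aV: "axis P \<subseteq> verts BT" using cV by (auto simp: axis_def)
  have inj: "?c m = ?c n \<longleftrightarrow> m = n" for m n using inj_mv[OF P(1)] by (simp add: inj_eq bv_eq)
  have fC: "?f x \<in> axis P \<longleftrightarrow> x \<in> axis P" if x: "x \<in> verts BT" for x
  proof
    assume "?f x \<in> axis P"
    then obtain n where "?f x = ?c n" by (auto simp: axis_def)
    then have "?f x = ?f (?c (n - k))" by (simp add: f)
    then have "x = ?c (n - k)" using inj_onD[OF act_inj[OF gP]] x cV by blast
    then show "x \<in> axis P" by (simp add: axis_def)
  next
    assume "x \<in> axis P" then show "?f x \<in> axis P" by (auto simp: axis_def f)
  qed
  obtain x where x: "x \<in> VS" using VS_nonempty by blast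
  have "axis P \<noteq> {}" by (simp add: axis_def)
  then obtain p c where pc: "bt.gate (axis P) p x c" using bt.gate_exists[OF _ aV] x VS_verts by blast
  then obtain n where n: "c = ?c n" by (auto simp: bt.gate_def axis_def)
  have "c \<in> VS"
    by (rule bt.axis_gate[OF VS_convex axis_convex[OF P(1)] x pc, of ?f])
      (use act_verts[OF gP] act_adj[OF gP] act_inj[OF gP] fC VS_act[OF g x] f inj n k0 in auto)
  then have c0: "?c n \<in> VS" using n by simp
  have shift: "?c (m + k) \<in> VS \<longleftrightarrow> ?c m \<in> VS" for m using VS_act_iff[OF g cV, of m] by (simp add: f)
  have all: "?c (n + k * j) \<in> VS" for j
  proof (induction j rule: int_induct[of _ 0])
    case base then show ?case using c0 by simp
  next
    case (step1 i) then show ?case using shift[of "n + k * i"] by (simp add: algebra_simps)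
  next
    case (step2 i) then show ?case using shift[of "n + k * (i - 1)"] by (simp add: algebra_simps)
  qed
  \<comment> \<open>As \<open>k\<close> may be negative, the factor \<open>sgn k\<close> makes sure
    that the two translates enclose \<open>m\<close> in the right order.\<close>
  have "?c m \<in> VS" for m
  proof (rule line_between[of ?c VS "n + k * (- sgn k * \<bar>m - n\<bar>)" "n + k * (sgn k * \<bar>m - n\<bar>)"])
    show "inj ?c" using inj by (auto simp: inj_def)
    show "adjacent BT (?c i) (?c (i + 1))" for i using mv_adj[OF P(1) adj_bv(1)] .
    have 1: "\<bar>m - n\<bar> \<le> \<bar>k\<bar> * \<bar>m - n\<bar>" using mult_right_mono[of 1 "\<bar>k\<bar>" "\<bar>m - n\<bar>"] k0 by simp
    have "k * (sgn k * \<bar>m - n\<bar>) = \<bar>k\<bar> * \<bar>m - n\<bar>" "k * (- sgn k * \<bar>m - n\<bar>) = - (\<bar>k\<bar> * \<bar>m - n\<bar>)"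
      by (simp_all add: abs_sgn mult.assoc)
    then show "n + k * (- sgn k * \<bar>m - n\<bar>) \<le> m" "m \<le> n + k * (sgn k * \<bar>m - n\<bar>)"
      using 1 by linarith+
    show "?c (n + k * (- sgn k * \<bar>m - n\<bar>)) \<in> VS" "?c (n + k * (sgn k * \<bar>m - n\<bar>)) \<in> VS" by (rule all)+
  qed (rule VS_convex)
  then show ?thesis by (auto simp: axis_def)
qed

lemma fixed_point_end:
  assumes g: "g \<in> \<Gamma>" "g \<noteq> \<one>\<^bsub>PGL2\<^esub>" and z: "z \<in> fixed_points g"
  shows "end_of VS z"
proof -
  obtain A where A: "invertible A" "g = cls A" using \<Gamma>P[OF g(1)] by (auto simp: carrier_PGL2)
  have *: "end_of VS z" if P: "invertible P" "axis P \<subseteq> VS" and F: "fixed_points g = {line (P *v e1), line (P *v e2)}" for P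
    using straight_line_ends[OF straight_line_frame[OF P(1)], of VS] P(2) z F by (auto simp: axis_def)
  have "rational_fixed_points (cls A)" using rational[OF g] A by simp
  from rational_cases[OF A(1) this] show ?thesis
  proof (elim disjE bexE exE conjE)
    fix x assume "x \<in> verts BT" "mv A x = x"
    then have "act_vert g x = x" by (simp add: A act_vert_cls)
    then obtain P where "elliptic_frame g P" "axis P \<subseteq> VS" using fixing_axis[OF g] \<open>x \<in> verts BT\<close> by blast
    then show ?thesis by (intro *[OF elliptic_frame_invertible _ elliptic_frame_fixed_points])
  next
    fix P a b assume P: "invertible P" "A ** P = P ** M2 a 0 0 b" "nrm a \<noteq> nrm b" "a \<noteq> 0" "b \<noteq> 0"
    have 1: "axis P \<subseteq> VS" using hyperbolic_axis[OF _ A(1) P(1,2,4,5,3)] g A by simp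
    have 2: "fixed_points g = {line (P *v e1), line (P *v e2)}"
      unfolding A(2) by (rule fixed_points_diag[OF P(1,2) _ P(4,5)]) (use P(3) in auto)
    show ?thesis by (rule *[OF P(1) 1 2])
  qed
qed

end

section \<open>The tree of the limit points\<close>

lemma subtree_convex:
  assumes G: "tree G" and H: "subtree H G"
  shows "simp_tree.convex (verts G) (adjacent G) (verts H)"
proof -
  interpret g: simp_tree "verts G" "adjacent G" by (rule tree_simp_tree[OF G])
  have "tree H" "subgraph H G" using H by (auto simp: subtree_def)
  interpret h: simp_tree "verts H" "adjacent H" by (rule tree_simp_tree[OF \<open>tree H\<close>])
  have V: "verts H \<subseteq> verts G" using \<open>subgraph H G\<close> by (simp add: subgraph_def)
  have "\<exists>xs. g.walk xs x y \<and> set xs \<subseteq> verts H" if xy: "x \<in> verts H" "y \<in> verts H" for x y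
  proof -
    obtain xs where xs: "h.walk xs x y" using h.walk_exists[OF xy] by blast
    then have s: "set xs \<subseteq> verts H" by (rule h.walkD(5))
    have "successively (adjacent G) xs"
      by (rule successively_mono[of "adjacent H"])
        (use xs subgraph_adjacent[OF \<open>subgraph H G\<close>] in \<open>auto simp: h.walk_def\<close>)
    then have "g.walk xs x y" using xs s V by (auto simp: h.walk_def g.walk_def)
    then show ?thesis using s by blast
  qed
  then show ?thesis using V by (simp add: g.convex_def)
qed

context dvf
begin

lemma tree_of_ends_subgraph:
  assumes X: "X \<subseteq> P1" and S: "bt.convex S" "\<And>z. z \<in> X \<Longrightarrow> end_of S z"
  shows "subgraph (tree_of_ends nrm X) (induced BT S)"
proof -
  have in_S: "c i \<in> S" if "z \<in> X" "w \<in> X" "straight_line nrm c z w" for c i z w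
    using line_in[OF S(1) _ _ S(2) S(2) that(3)] that X by blast
  have E: "{c i, c (i + 1)} \<in> edges BT" if "straight_line nrm c z w" for c i z w
    using straight_line_adj[OF that] by (simp add: adjacent_BT_edge)
  have 1: "verts (tree_of_ends nrm X) \<subseteq> S" using in_S by (auto simp: tree_of_ends_def)
  have 2: "edges (tree_of_ends nrm X) \<subseteq> edges BT" using E by (auto simp: tree_of_ends_def)
  have 3: "e \<subseteq> verts (tree_of_ends nrm X)" if "e \<in> edges (tree_of_ends nrm X)" for e
    using that by (auto simp: tree_of_ends_def)
  have "card e = 1 \<or> card e = 2" if "e \<in> edges (tree_of_ends nrm X)" for e
    using subsetD[OF 2 that] wf_BT by (simp add: wf_graph_def)
  then have "wf_graph (tree_of_ends nrm X)" using 3 by (simp add: wf_graph_def) (simp add: tree_of_ends_def)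
  moreover have "extr (tree_of_ends nrm X) = id" by (simp add: tree_of_ends_def)
  ultimately show ?thesis using 1 2 3 by (simp add: subgraph_def induced_def) blast
qed

lemma tree_of_ends_line:
  "z \<in> X \<Longrightarrow> w \<in> X \<Longrightarrow> z \<noteq> w \<Longrightarrow> straight_line nrm c z w \<Longrightarrow> c i \<in> verts (tree_of_ends nrm X)"
  by (auto simp: tree_of_ends_def)

lemma end_of_verts: "z \<in> P1 \<Longrightarrow> end_of (verts BT) z"
proof -
  assume "z \<in> P1"
  then obtain P where P: "invertible P" "z = line (P *v e1)" using P1_frame1 by blast
  have "range (\<lambda>n. mv P (bv 0 n)) \<subseteq> verts BT" using mv_verts[OF P(1)] by auto
  then show ?thesis using straight_line_ends(1)[OF straight_line_frame[OF P(1)]] P(2) by blast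
qed

text \<open>Two lines with a common end share a vertex, by \<open>half_line_to_tail\<close>.
  Arbitrary lines are connected through a third line that has an end in common with each.\<close>

lemma tree_of_ends_subtree:
  assumes X: "X \<subseteq> P1" and zw: "z \<in> X" "w \<in> X" "z \<noteq> w"
  shows "subtree (tree_of_ends nrm X) BT"
proof (rule subtreeI[OF tree_BT])
  let ?G = "tree_of_ends nrm X"
  have "bt.convex (verts BT)" unfolding bt.convex_def using bt.walk_exists bt.walkD(5) by blast
  then have "subgraph ?G (induced BT (verts BT))"
    using tree_of_ends_subgraph[OF X] end_of_verts X by blast
  then show "subgraph ?G BT" by (auto simp: subgraph_def induced_def)
  obtain c0 where "straight_line nrm c0 z w" using line_exists[of z w] zw X by blast
  then show "verts ?G \<noteq> {}" using tree_of_ends_line zw by blast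
  have con: "(adjacent ?G)\<^sup>*\<^sup>* (c i) (c j)"
    if c: "straight_line nrm c z w" "z \<in> X" "w \<in> X" "z \<noteq> w" for c z w i j
  proof -
    have adj: "adjacent ?G (c k) (c (k + 1))" for k
      using c by (auto simp: adjacent_def tree_of_ends_def)
    show ?thesis
    proof (induction j rule: int_induct[of _ i])
      case (step1 k) then show ?case using adj by (meson rtranclp.rtrancl_into_rtrancl)
    next
      case (step2 k)
      have "adjacent ?G (c k) (c (k - 1))" using adj[of "k - 1"] adjacent_commute by fastforce
      then show ?case using step2 by (meson rtranclp.rtrancl_into_rtrancl)
    qed simp
  qed
  have share: "(adjacent ?G)\<^sup>*\<^sup>* (c i) (d j)"
    if c: "straight_line nrm c z w" "z \<in> X" "w \<in> X" "z \<noteq> w"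
      and d: "straight_line nrm d z w'" "w' \<in> X" "z \<noteq> w'" for c d z w w' i j
  proof -
    have "half_line_to nrm (\<lambda>n. c (- int n)) z" "half_line_to nrm (\<lambda>n. d (- int n)) z"
      using c d by (auto simp: straight_line_def)
    from half_line_to_tail[OF subsetD[OF X c(2)] this]
    obtain a b where "\<forall>k. c (- int (a + k)) = d (- int (b + k))" by (elim exE)
    from spec[OF this, of 0] have "c (- int a) = d (- int b)" by simp
    then show ?thesis
      using rtranclp_trans[OF con[OF c, of i "- int a"]] con[OF d(1) c(2) d(2,3), of "- int b" j] by simp
  qed
  show "connected_graph ?G"
    unfolding connected_graph_def
  proof (intro ballI)
    fix x y assume xy: "x \<in> verts ?G" "y \<in> verts ?G"
    have on_line: "\<exists>c i z w. x = c i \<and> z \<in> X \<and> w \<in> X \<and> z \<noteq> w \<and> straight_line nrm c z w"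
      if "x \<in> verts ?G" for x using that by (simp add: tree_of_ends_def)
    obtain c i z w where c: "x = c i" "z \<in> X" "w \<in> X" "z \<noteq> w" "straight_line nrm c z w"
      using on_line[OF xy(1)] by (elim exE conjE)
    obtain d j z' w' where d: "y = d j" "z' \<in> X" "w' \<in> X" "z' \<noteq> w'" "straight_line nrm d z' w'"
      using on_line[OF xy(2)] by (elim exE conjE)
    have c': "straight_line nrm (\<lambda>i. c (- i)) w z" by (rule straight_line_commute[OF c(5)])
    show "(adjacent ?G)\<^sup>*\<^sup>* x y"
    proof (cases "w = z'")
      case True
      then show ?thesis using share[OF c'(1) c(3,2) c(4)[symmetric], of d w' "- i" j] d c(1) by simp
    next
      case False
      then obtain f where f: "straight_line nrm f w z'" using line_exists[of w z'] c d X by blast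
      have 1: "(adjacent ?G)\<^sup>*\<^sup>* x (f 0)"
        using share[OF c'(1) c(3,2) c(4)[symmetric] f d(2) False, of "- i" 0] c(1) by simp
      have "(adjacent ?G)\<^sup>*\<^sup>* (f 0) y"
        using share[OF straight_line_commute[OF f] d(2) c(3) False[symmetric] d(5,3,4), of 0 j] d(1) by simp
      with 1 show ?thesis by (rule rtranclp_trans)
    qed
  qed
qed

end

section \<open>The limit points of the group and their tree\<close>

context admissible_tree
begin

lemma T_star_induced: "T_star = induced BT VS"
  using T_star_simps T_star_edges by (simp add: induced_def translates_graph_def)

lemma mirror_subgraph:
  assumes P: "elliptic_frame g P" and S: "bt.convex S" "axis P \<subseteq> S"
  shows "subgraph (mirror nrm g) (induced BT S)"
proof -
  have "end_of S (line (P *v e1))" "end_of S (line (P *v e2))"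
    using straight_line_ends[OF straight_line_frame[OF elliptic_frame_invertible[OF P]]] S(2)
    by (auto simp: axis_def)
  then show ?thesis unfolding mirror_def
    using elliptic_frame_elliptic[OF P] frame_P1[OF elliptic_frame_invertible[OF P]]
    by (intro tree_of_ends_subgraph[OF _ S(1)]) (auto simp: elliptic_frame_fixed_points[OF P])
qed

text \<open>This is how condition (i) is used: a candidate set \<open>S\<close> is tested on axes
  only, and minimality of the hulls together with (i) puts \<open>\<iota>(T)\<close> inside
  it.\<close>

lemma ambient_minimal:
  assumes S: "bt.convex S" "S \<noteq> {}"
    and ax: "\<And>u g P. u \<in> verts T \<Longrightarrow> g \<in> a.\<G> u \<Longrightarrow> g \<noteq> \<one>\<^bsub>PGL2\<^esub> \<Longrightarrow> elliptic_frame g P \<Longrightarrow> axis P \<subseteq> S"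
    and v: "v \<in> verts T"
  shows "\<iota>V v \<in> S"
proof -
  have sub: "subtree (induced BT S) BT" by (rule induced_subtree[OF tree_BT S])
  have "subgraph (mirror_tree nrm (vimg TG \<theta> u)) (induced BT S)" if u: "u \<in> verts T" for u
    unfolding mirror_tree_def
  proof (rule tree_hull_subgraph[OF sub], elim imageE, hypsubst)
    fix g assume "g \<in> vimg TG \<theta> u - {\<one>\<^bsub>PGL2\<^esub>}"
    then have g: "g \<in> a.\<G> u" "g \<noteq> \<one>\<^bsub>PGL2\<^esub>" by (auto simp: vimg_eq)
    obtain P where "elliptic_frame g P" using vertex_group_axis[OF u g] by blast
    then show "subgraph (mirror nrm g) (induced BT S)" using mirror_subgraph S(1) ax[OF u g] by blast
  qed
  then have "subgraph ambient (induced BT S)"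
    unfolding ambient_tree_def by (intro tree_hull_subgraph[OF sub]) blast
  then have "verts ambient \<subseteq> S" by (simp add: subgraph_def induced_def)
  moreover have "subgraph (image_graph T BT \<iota>V \<iota>E) ambient" using adm by (simp add: admissible_embedding_def)
  then have "\<iota>V ` verts T \<subseteq> verts ambient" by (simp add: subgraph_def image_graph_def)
  ultimately show ?thesis using v by blast
qed

abbreviation "F \<equiv> (\<Union>g\<in>\<Gamma> - {\<one>\<^bsub>PGL2\<^esub>}. fixed_points g)"
abbreviation "L \<equiv> P1_topology nrm closure_of F"
abbreviation "LT \<equiv> limit_tree nrm \<Gamma>"

lemma F_P1: "F \<subseteq> P1"
  by (auto simp: fixed_points_def)

lemma L_P1: "L \<subseteq> P1"
  using closure_of_subset_topspace[of "P1_topology nrm" F] by (simp add: topspace_P1)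

lemma F_L: "F \<subseteq> L"
  using closure_of_subset[of F "P1_topology nrm"] F_P1 by (simp add: topspace_P1)

lemma L_end: "z \<in> L \<Longrightarrow> end_of VS z"
  by (rule closure_end[OF VS_convex VS_nonempty F_P1]) (use fixed_point_end in auto)

lemma limit_subgraph: "subgraph LT T_star"
  unfolding T_star_induced limit_tree_def by (rule tree_of_ends_subgraph[OF L_P1 VS_convex L_end])

text \<open>Without nontrivial elements there would be no mirrors, and the ambient tree would lie in
  every one-vertex subtree, hence be empty, against (i).\<close>

lemma nontrivial: "\<exists>v\<in>verts T. \<exists>g\<in>a.\<G> v. g \<noteq> \<one>\<^bsub>PGL2\<^esub>"
proof (rule ccontr)
  assume neg: "\<not> ?thesis"
  obtain v where v: "v \<in> verts T" using T_nonempty by blast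
  have "\<iota>V v \<in> {x}" if x: "x \<in> verts BT" for x
  proof (rule ambient_minimal[OF _ _ _ v])
    show "bt.convex {x}" using bt.walk_single[OF x] x by (auto simp: bt.convex_def)
  qed (use neg in auto)
  from this[of "bv 0 0"] this[of "bv 0 1"] have "bv 0 0 = (bv 0 1 :: 'k bt_vertex)" by simp
  then show False by (simp add: bv_eq)
qed

lemma frame_L:
  assumes "g \<in> \<Gamma>" "g \<noteq> \<one>\<^bsub>PGL2\<^esub>" "elliptic_frame g P"
  shows "line (P *v e1) \<in> L" "line (P *v e2) \<in> L" "axis P \<subseteq> verts LT"
proof -
  have F: "line (P *v e1) \<in> F" "line (P *v e2) \<in> F"
    using assms(1,2) elliptic_frame_fixed_points[OF assms(3)] by auto
  show L: "line (P *v e1) \<in> L" "line (P *v e2) \<in> L" using subsetD[OF F_L F(1)] subsetD[OF F_L F(2)] .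
  have P: "invertible P" by (rule elliptic_frame_invertible[OF assms(3)])
  show "axis P \<subseteq> verts LT"
    unfolding limit_tree_def axis_def
    using tree_of_ends_line[OF L frame_P1(3)[OF P] straight_line_frame[OF P]] by auto
qed

text \<open>A nontrivial element of a vertex group is elliptic and contributes two limit points, so
  the family of lines is not empty.\<close>

lemma limit_subtree: "subtree LT BT"
proof -
  obtain v g where g: "v \<in> verts T" "g \<in> a.\<G> v" "g \<noteq> \<one>\<^bsub>PGL2\<^esub>" using nontrivial by blast
  have "g \<in> \<Gamma>" by (rule subsetD[OF a.\<G>_\<Gamma>[OF g(1)] g(2)])
  moreover obtain P where P: "elliptic_frame g P" using vertex_group_axis[OF g] by blast
  ultimately show ?thesis unfolding limit_tree_def
    using tree_of_ends_subtree[OF L_P1 frame_L(1,2) frame_P1(3)[OF elliptic_frame_invertible[OF P]]] g(3) P by blast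
qed

lemma limit_convex: "bt.convex (verts LT)" and limit_nonempty: "verts LT \<noteq> {}"
  and limit_VS: "verts LT \<subseteq> VS"
  using subtree_convex[OF tree_BT limit_subtree] limit_subtree limit_subgraph
  by (auto simp: subtree_def tree_def subgraph_def)

lemma F_act:
  assumes h: "cls H \<in> \<Gamma>" "invertible H"
  shows "(`) ((*v) H) ` F \<subseteq> F"
proof (intro subsetI, elim imageE UN_E, hypsubst)
  fix g z assume g: "g \<in> \<Gamma> - {\<one>\<^bsub>PGL2\<^esub>}" and z: "z \<in> fixed_points g"
  have gP: "g \<in> carrier PGL2" using g \<Gamma>P by blast
  obtain A where A: "invertible A" "g = cls A" using gP by (auto simp: carrier_PGL2)
  obtain x where x: "x \<noteq> 0" "z = line x" using z by (auto simp: fixed_points_def P1_def)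
  have fx: "line (A *v x) = line x" using z by (simp add: fixed_points_def A x act_line_cls)
  obtain E where E: "H ** E = mat 1" "E ** H = mat 1" using h(2) unfolding invertible_def by blast
  have Ei: "invertible E" using E unfolding invertible_def by blast
  have cj: "cj (cls H) g = cls (H ** A ** E)"
    using A h(2) Ei by (simp add: inv_cls[OF h(2) E(1)] cls_mult invertible_mult2)
  have "(H ** A ** E) *v (H *v x) = (H ** A ** (E ** H)) *v x"
    by (simp add: matrix_mul_assoc matrix_vector_mul_assoc)
  also have "\<dots> = H *v (A *v x)" by (simp add: E matrix_vector_mul_assoc)
  finally have "line ((H ** A ** E) *v (H *v x)) = (*v) H ` line x"
    using image_line[of H "A *v x"] fx by simp
  then have "act_line (cj (cls H) g) ((*v) H ` z) = (*v) H ` z"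
    by (simp add: cj x image_line act_line_cls)
  moreover have "(*v) H ` z \<in> P1" using x h(2) by (simp add: image_line P1_line matvec_zero_iff)
  ultimately have "(*v) H ` z \<in> fixed_points (cj (cls H) g)" by (simp add: fixed_points_def)
  moreover have "cj (cls H) g \<in> \<Gamma> - {\<one>\<^bsub>PGL2\<^esub>}"
    using cj_\<Gamma> g h conj_one_iff[OF gP, of "cls H"] by simp
  ultimately show "(*v) H ` z \<in> F" by blast
qed

lemma L_act:
  assumes "cls H \<in> \<Gamma>" "invertible H" "z \<in> L"
  shows "(*v) H ` z \<in> L"
  using subsetD[OF closure_of_mono[OF F_act[OF assms(1,2)]] closure_act[OF assms(2) F_P1 assms(3)]] .

lemma limit_line_act:
  assumes g: "g \<in> \<Gamma>" and c: "z \<in> L" "w \<in> L" "z \<noteq> w" "straight_line nrm c z w"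
  shows "\<exists>z'\<in>L. \<exists>w'\<in>L. z' \<noteq> w' \<and> straight_line nrm (act_vert g \<circ> c) z' w'"
proof -
  obtain H where H: "invertible H" "g = cls H" using \<Gamma>P[OF g] by (auto simp: carrier_PGL2)
  have cV: "c i \<in> verts BT" for i using straight_line_adj[OF c(4)] bt.adj_V by blast
  have "act_vert g \<circ> c = mv H \<circ> c" using cV by (auto simp: H act_vert_cls)
  then have 1: "straight_line nrm (act_vert g \<circ> c) ((*v) H ` z) ((*v) H ` w)"
    using straight_line_mv[OF H(1) c(4)] by simp
  have 2: "(*v) H ` z \<noteq> (*v) H ` w" using c(3) invertible_inj[OF H(1)] by (simp add: inj_image_eq_iff)
  have h: "cls H \<in> \<Gamma>" using g H(2) by simp
  show ?thesis
    by (rule bexI[OF _ L_act[OF h H(1) c(1)]], rule bexI[OF _ L_act[OF h H(1) c(2)]], rule conjI[OF 2 1])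
qed

lemma limit_invariant: "invariant_subgraph nrm \<pi> TG \<iota>V \<iota>E \<theta> LT"
proof (unfold_locales, goal_cases)
  case 1 show ?case using limit_VS .
next
  case 2 show ?case using limit_subgraph by (simp add: subgraph_def)
next
  case (3 e) then show ?case by (auto simp: limit_tree_def tree_of_ends_def)
next
  case (4 e) then show ?case by (simp add: limit_tree_def tree_of_ends_def)
next
  case (5 g x)
  then obtain c i z w where c: "x = c i" "z \<in> L" "w \<in> L" "z \<noteq> w" "straight_line nrm c z w"
    unfolding limit_tree_def tree_of_ends_def ugraph.simps mem_Collect_eq by (elim exE conjE)
  obtain z' w' where z': "z' \<in> L" "w' \<in> L" "z' \<noteq> w'" "straight_line nrm (act_vert g \<circ> c) z' w'"
    using limit_line_act[OF 5(1) c(2-5)] by blast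
  show ?case using tree_of_ends_line[OF z', of i] c(1) by (simp add: limit_tree_def)
next
  case (6 g e)
  then obtain c i z w where c: "e = {c i, c (i + 1)}" "z \<in> L" "w \<in> L" "z \<noteq> w" "straight_line nrm c z w"
    unfolding limit_tree_def tree_of_ends_def ugraph.simps mem_Collect_eq by (elim exE conjE)
  obtain z' w' where z': "z' \<in> L" "w' \<in> L" "z' \<noteq> w'" "straight_line nrm (act_vert g \<circ> c) z' w'"
    using limit_line_act[OF 6(1) c(2-5)] by blast
  have "act_edge g e = {(act_vert g \<circ> c) i, (act_vert g \<circ> c) (i + 1)}" by (simp add: c(1) act_edge_def)
  then show ?case using z' unfolding limit_tree_def tree_of_ends_def ugraph.simps by blast
qed

abbreviation "T' \<equiv> invariant_subgraph.T' TG \<iota>V \<iota>E LT"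

text \<open>An edge of \<open>\<iota>(T)\<close> belongs to the limit tree as soon as its
  extremities do, by \<open>subtree_adjacent\<close>; this makes \<open>T'\<close> a full subgraph
  of \<open>T\<close>.\<close>

lemma T'_eq: "verts T' = {v \<in> verts T. \<iota>V v \<in> verts LT}" "T' = induced T (verts T')"
proof -
  show V: "verts T' = {v \<in> verts T. \<iota>V v \<in> verts LT}"
    by (simp add: invariant_subgraph.T'_def[OF limit_invariant])
  have "\<iota>E e \<in> edges LT \<longleftrightarrow> extr T e \<subseteq> verts T'" if e: "e \<in> edges T" for e
  proof
    assume "\<iota>E e \<in> edges LT"
    then have "\<iota>E e \<subseteq> verts LT" by (rule invariant_subgraph.S_edge_verts[OF limit_invariant])
    then show "extr T e \<subseteq> verts T'" using a.extr_verts[OF e] by (auto simp: V \<iota>E_eq[OF e])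
  next
    assume sub: "extr T e \<subseteq> verts T'"
    have "card (extr T e) = 1 \<or> card (extr T e) = 2" using e a.wf_T by (simp add: wf_graph_def)
    then obtain v where v: "v \<in> extr T e" by fastforce
    then obtain w where w: "extr T e = {v, w}" using extr_pair[OF e] by blast
    have "adjacent T v w" using e w by (auto simp: adjacent_def)
    then have "adjacent LT (\<iota>V v) (\<iota>V w)"
      using sub w V by (intro subtree_adjacent[OF tree_BT limit_subtree] a.\<iota>_adj) auto
    then obtain d where "d \<in> edges LT" "extr LT d = {\<iota>V v, \<iota>V w}" by (auto simp: adjacent_def)
    then show "\<iota>E e \<in> edges LT" using \<iota>E_extr[OF e w] by (simp add: limit_tree_def tree_of_ends_def)
  qed
  then show "T' = induced T (verts T')"
    unfolding invariant_subgraph.T'_def[OF limit_invariant] induced_def by auto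
qed

lemma T'_convex: "a.t.convex (verts T')" and T'_nonempty: "verts T' \<noteq> {}"
proof -
  have "\<exists>xs. a.t.walk xs v w \<and> set xs \<subseteq> verts T'" if vw: "v \<in> verts T'" "w \<in> verts T'" for v w
  proof -
    obtain p where p: "a.t.geo p v w" using a.t.geo_exists vw T'_eq(1) by blast
    have pT: "set p \<subseteq> verts T" "a.t.walk p v w" "nb p"
      using p a.t.walkD(5) by (auto simp: a.t.geo_def)
    have "successively (adjacent BT) (map \<iota>V p)"
      unfolding successively_map by (rule successively_mono[of "adjacent T"])
        (use pT a.\<iota>_adj in \<open>auto simp: a.t.walk_def\<close>)
    moreover have "nb (map \<iota>V p)" using pT nb_map[OF inj_on_subset[OF \<iota>V_inj pT(1)]] by simp
    ultimately have "bt.geo (map \<iota>V p) (\<iota>V v) (\<iota>V w)"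
      using pT \<iota>V_verts by (auto simp: bt.geo_def bt.walk_def a.t.walk_def hd_map last_map)
    from bt.convex_geo[OF limit_convex _ _ this] have "set p \<subseteq> verts T'"
      using vw pT(1) by (auto simp: T'_eq(1))
    then show ?thesis using pT by blast
  qed
  then show "a.t.convex (verts T')" unfolding a.t.convex_def using T'_eq(1) by blast
  obtain x where x: "x \<in> verts LT" using limit_nonempty by blast
  then obtain g v where g: "g \<in> \<Gamma>" "v \<in> verts T" "x = act_vert g (\<iota>V v)" using limit_VS by (auto simp: VS_def)
  have "act_vert (inv\<^bsub>PGL2\<^esub> g) x = \<iota>V v" using g act_inv(1) \<Gamma>P \<iota>V_verts by simp
  then have "\<iota>V v \<in> verts LT" using invariant_subgraph.S_act[OF limit_invariant \<Gamma>_inv[OF g(1)] x] by simp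
  then show "verts T' \<noteq> {}" using g(2) by (auto simp: T'_eq(1))
qed

lemma T'_subtree: "subtree T' T"
  using induced_subtree[OF a.tree_T T'_convex T'_nonempty] by (simp only: T'_eq(2)[symmetric])

text \<open>Along the half-line the vertex group is finally constant. A nontrivial element of it
  confines the half-line to a neighbourhood of bounded width of its mirror. If the constant group is
  trivial, the subtree on one side of an edge of the half-line contains all mirrors but not all of
  \<open>\<iota>(T)\<close>.\<close>

lemma ray_eventually_limit:
  assumes r: "half_line T r"
  shows "\<exists>N. \<forall>n\<ge>N. r n \<in> verts T'"
proof -
  have rT: "inj r" "\<And>n. r n \<in> verts T" "\<And>n. adjacent T (r n) (r (Suc n))" using r by (auto simp: half_line_def)
  obtain N where N0: "\<forall>n\<ge>N. \<Gamma> = generate PGL2 (\<Union>u\<in>a.t.branch (r n) (r (Suc n)). a.\<G> u) \<and> a.\<G> (r n) = a.\<G> (r N)"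
    using a.ray_constant[OF fg r] by (elim exE)
  note N = conjunct1[OF mp[OF spec[OF N0]]] conjunct2[OF mp[OF spec[OF N0]]]
  show ?thesis
  proof (cases "\<exists>g\<in>a.\<G> (r N). g \<noteq> \<one>\<^bsub>PGL2\<^esub>")
    case True
    then obtain g where g: "g \<in> a.\<G> (r N)" "g \<noteq> \<one>\<^bsub>PGL2\<^esub>" by blast
    have g\<Gamma>: "g \<in> \<Gamma>" by (rule subsetD[OF a.\<G>_\<Gamma>[OF rT(2)] g(1)])
    obtain P where P: "elliptic_frame g P" using vertex_group_axis[OF rT(2) g] by blast
    obtain A a b where A: "invertible A" "g = cls A" "invertible P"
     "A ** P = P ** M2 a 0 0 b" "a \<noteq> b" "nrm a = nrm b" using P by (auto simp: elliptic_frame_def)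
    obtain k where k: "\<And>x. x \<in> verts BT \<Longrightarrow> mv A x = x \<Longrightarrow> \<exists>p y. bt.geo p x y \<and> y \<in> axis P \<and> length p \<le> k"
      using elliptic_tube[OF A(4,3) diag_nonzero[OF A(1,3,4)] A(5,6)] by blast
    \<comment> \<open>From index \<open>N\<close> on the half-line is fixed by \<open>g\<close>, so
      \<open>elliptic_tube\<close> bounds its distance from the axis and
      \<open>bt.ray_eventually_in\<close> applies.\<close>
    let ?s = "\<lambda>n. \<iota>V (r (N + n))"
    have "\<exists>M. \<forall>n\<ge>M. ?s n \<in> axis P"
    proof (rule bt.ray_eventually_in[OF _ _ axis_convex[OF A(3)]])
      show "inj ?s"
      proof (rule injI)
        fix m n assume "?s m = ?s n"
        then have "r (N + m) = r (N + n)" by (rule inj_onD[OF \<iota>V_inj _ rT(2) rT(2)])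
        then have "N + m = N + n" by (rule injD[OF rT(1)])
        then show "m = n" by simp
      qed
      show "adjacent BT (?s n) (?s (Suc n))" for n using a.\<iota>_adj[OF rT(3)] by simp
      show "\<exists>p y. bt.geo p (?s n) y \<and> y \<in> axis P \<and> length p \<le> k" for n
      proof (rule k[OF \<iota>V_verts[OF rT(2)]])
        have "g \<in> a.\<G> (r (N + n))" using N(2)[of "N + n"] g(1) by simp
        then have "act_vert g (?s n) = ?s n" by (rule a.vertex_fixes[OF rT(2)])
        then show "mv A (?s n) = ?s n" by (simp add: A(2) act_vert_cls \<iota>V_verts rT(2))
      qed
    qed
    then obtain M where M: "\<And>n. n \<ge> M \<Longrightarrow> ?s n \<in> axis P" by blast
    have "r n \<in> verts T'" if n: "n \<ge> N + M" for n
      using M[of "n - N"] frame_L(3)[OF g\<Gamma> g(2) P] rT(2) n by (auto simp: T'_eq(1))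
    then show ?thesis by blast
  next
    case False
    let ?a = "r N" and ?b = "r (Suc N)"
    have triv: "g = \<one>\<^bsub>PGL2\<^esub>" if "g \<in> a.\<G> ?b" for g using False N(2)[of "Suc N"] that by auto
    \<comment> \<open>The side of \<open>\<iota>V ?a\<close> will be shown to contain every mirror,
      hence all of \<open>\<iota>(T)\<close> by \<open>ambient_minimal\<close>, although it does not
      contain \<open>\<iota>V ?b\<close>.\<close>
    let ?D = "bt.branch (\<iota>V ?a) (\<iota>V ?b)"
    have ab: "\<iota>V ?a \<noteq> \<iota>V ?b" using a.\<iota>_adj[OF rT(3)[of N]] bt.adj_irrefl by metis
    have aV: "\<iota>V ?a \<in> verts BT" using \<iota>V_verts rT(2) .
    have "\<iota>V ?b \<in> ?D"
    proof (rule ambient_minimal[OF bt.branch_convex[OF aV ab]])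
      show "?D \<noteq> {}" unfolding ex_in_conv[symmetric] by (rule exI, rule bt.branch_self[OF aV ab])
      show "?b \<in> verts T" by (rule rT(2))
      fix u g P assume u: "u \<in> verts T" and g: "g \<in> a.\<G> u" "g \<noteq> \<one>\<^bsub>PGL2\<^esub>" and P: "elliptic_frame g P"
      have gP: "g \<in> carrier PGL2" by (rule subsetD[OF a.\<G>_carrier[OF u] g(1)])
      have "u \<in> a.t.branch ?a ?b"
      proof (rule ccontr)
        assume "u \<notin> a.t.branch ?a ?b"
        then have "g \<in> a.\<G> ?b"
          by (rule a.branch_complement_fixed[OF rT(3) N(1)[OF order_refl] u _ g(1)])
        then show False using triv g(2) by blast
      qed
      then obtain p where p: "a.t.walk p ?a u" "?b \<notin> set p" by (auto simp: a.t.branch_def)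
      have pT: "set p \<subseteq> verts T" using a.t.walkD(5)[OF p(1)] .
      have "successively (adjacent BT) (map \<iota>V p)"
        unfolding successively_map by (rule successively_mono[of "adjacent T"])
          (use p a.\<iota>_adj in \<open>auto simp: a.t.walk_def\<close>)
      then have w: "bt.walk (map \<iota>V p) (\<iota>V ?a) (\<iota>V u)"
        using p pT \<iota>V_verts by (auto simp: bt.walk_def a.t.walk_def hd_map last_map)
      have bp: "\<iota>V ?b \<notin> set (map \<iota>V p)"
        using p(2) pT inj_onD[OF \<iota>V_inj _ rT(2)[of "Suc N"]] by fastforce
      \<comment> \<open>Go from \<open>\<iota>V ?a\<close> to \<open>\<iota>V u\<close> and on to
        \<open>x\<close>. The first part avoids \<open>\<iota>V ?b\<close> because \<open>u\<close>
        lies in the branch of \<open>?a\<close>, the second because \<open>g\<close> fixes it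
        pointwise but does not fix \<open>\<iota>V ?b\<close>.\<close>
      show "axis P \<subseteq> ?D"
      proof
        fix x assume x: "x \<in> axis P"
        have xV: "x \<in> verts BT" using x mv_verts[OF elliptic_frame_invertible[OF P]] by (auto simp: axis_def)
        obtain s where s: "bt.geo s (\<iota>V u) x" using bt.geo_exists[OF \<iota>V_verts[OF u] xV] by blast
        have "act_vert g z = z" if "z \<in> set s" for z
          by (rule bt.geo_fixed[OF s a.vertex_fixes[OF u g(1)] elliptic_frame_fixes[OF P x]
            act_verts[OF gP] act_adj[OF gP] act_inj[OF gP] that])
        moreover have "act_vert g (\<iota>V ?b) \<noteq> \<iota>V ?b"
        proof
          assume "act_vert g (\<iota>V ?b) = \<iota>V ?b"
          then have "g \<in> a.\<G> ?b" by (rule a.stabilizer(2)[OF subsetD[OF a.\<G>_\<Gamma>[OF u] g(1)] rT(2) rT(2)])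
          then show False using triv g(2) by blast
        qed
        ultimately have "\<iota>V ?b \<notin> set s" by metis
        moreover have "set (tl s) \<subseteq> set s" by (cases s) auto
        ultimately show "x \<in> ?D" using bt.branchI[OF bt.walk_append[OF w bt.geo_walk[OF s]]] bp by auto
      qed
    qed
    then show ?thesis using bt.branch_not by blast
  qed
qed

lemma ends_quotient: "bij_betw (ends_map T \<Phi>V) (Ends (quotient_graph \<Gamma> LT)) (Ends T)"
proof (rule ends_map_bij)
  note i = limit_invariant
  let ?Q = "quotient_graph \<Gamma> LT"
  have iso: "graph_iso ?Q T' \<Phi>V \<Phi>E" by (rule invariant_subgraph.quotient_iso[OF i])
  then show inj: "inj_on \<Phi>V (verts ?Q)" by (simp add: graph_iso_def bij_betw_def)
  have im: "\<Phi>V ` verts ?Q = verts T'" using iso by (simp add: graph_iso_def bij_betw_def)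
  have extr: "extr T' = extr T" by (rule invariant_subgraph.T'_in(3)[OF i])
  show "half_line T (\<Phi>V \<circ> r)" if r: "half_line ?Q r" for r
  proof -
    have rV: "r n \<in> verts ?Q" for n using r by (auto simp: half_line_def)
    have "adjacent T (\<Phi>V x) (\<Phi>V y)" if xy: "adjacent ?Q x y" for x y
    proof -
      obtain X where X: "X \<in> edges ?Q" "extr ?Q X = {x, y}" using xy by (auto simp: adjacent_def)
      have "\<Phi>E X \<in> edges T'" using iso X by (auto simp: graph_iso_def bij_betw_def)
      then have "\<Phi>E X \<in> edges T" by (rule invariant_subgraph.T'_in(2)[OF i])
      moreover have "extr T (\<Phi>E X) = {\<Phi>V x, \<Phi>V y}" using iso X extr by (simp add: graph_iso_def)
      ultimately show ?thesis by (auto simp: adjacent_def)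
    qed
    moreover have "\<Phi>V (r n) \<in> verts T" for n using im rV[of n] T'_eq(1) by blast
    moreover have "inj (\<Phi>V \<circ> r)" using r rV inj by (auto simp: half_line_def inj_def inj_on_def)
    ultimately show ?thesis using r by (auto simp: half_line_def)
  qed
  show "adjacent ?Q x y" if xy: "x \<in> verts ?Q" "y \<in> verts ?Q" "adjacent T (\<Phi>V x) (\<Phi>V y)" for x y
  proof -
    obtain e where e: "e \<in> edges T" "extr T e = {\<Phi>V x, \<Phi>V y}" using xy by (auto simp: adjacent_def)
    have "{\<Phi>V x, \<Phi>V y} \<subseteq> verts T'" using im xy by blast
    then have "e \<in> edges (induced T (verts T'))" using e by (simp add: induced_def)
    then have eT': "e \<in> edges T'" by (simp only: T'_eq(2)[symmetric])
    have self: "vert_orbit \<Gamma> (\<iota>V (\<Phi>V z)) = z" if z: "z \<in> verts ?Q" for z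
    proof -
      obtain v where "v \<in> verts T'" "z = vert_orbit \<Gamma> (\<iota>V v)"
        using z invariant_subgraph.quotient_verts[OF i] by auto
      then show ?thesis using \<Phi>V_orbit T'_eq(1) by auto
    qed
    have "extr ?Q (edge_orbit \<Gamma> (\<iota>E e)) = {x, y}"
      using invariant_subgraph.quotient_extr[OF i eT'] e(2) self xy by simp
    moreover have "edge_orbit \<Gamma> (\<iota>E e) \<in> edges ?Q" using eT' invariant_subgraph.quotient_edges[OF i] by blast
    ultimately show ?thesis by (auto simp: adjacent_def)
  qed
  show "\<exists>N. \<forall>n\<ge>N. r n \<in> \<Phi>V ` verts ?Q" if "half_line T r" for r
    using ray_eventually_limit[OF that] im by simp
qed

lemma ends_T': "bij_betw (ends_map T id) (Ends T') (Ends T)"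
proof (rule ends_map_bij)
  have sub: "subgraph T' T" using T'_subtree by (simp add: subtree_def)
  show "half_line T (id \<circ> r)" if "half_line T' r" for r
    using that subgraph_adjacent[OF sub] sub by (auto simp: half_line_def subgraph_def)
  show "adjacent T' x y" if "x \<in> verts T'" "y \<in> verts T'" "adjacent T (id x) (id y)" for x y
    using subtree_adjacent[OF a.tree_T T'_subtree] that by simp
  show "\<exists>N. \<forall>n\<ge>N. r n \<in> id ` verts T'" if "half_line T r" for r
    using ray_eventually_limit[OF that] by simp
qed simp

end

section \<open>The contraction\<close>

context admissible_tree
begin

definition over :: "'v \<Rightarrow> 'k bt_vertex \<Rightarrow> bool" where
  "over v x \<longleftrightarrow> (\<exists>h\<in>\<Gamma>. x = act_vert h (\<iota>V v))"

lemma over_unique: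
  assumes v: "v \<in> verts T" and w: "w \<in> verts T" and g: "g \<in> \<Gamma>" and h: "h \<in> \<Gamma>"
    and eq: "act_vert g (\<iota>V v) = act_vert h (\<iota>V w)"
  shows "v = w" "inv\<^bsub>PGL2\<^esub> g \<otimes>\<^bsub>PGL2\<^esub> h \<in> a.\<G> v"
proof -
  have k: "inv\<^bsub>PGL2\<^esub> g \<otimes>\<^bsub>PGL2\<^esub> h \<in> \<Gamma>" by (rule \<Gamma>_mult[OF \<Gamma>_inv[OF g] h])
  have "act_vert (inv\<^bsub>PGL2\<^esub> g \<otimes>\<^bsub>PGL2\<^esub> h) (\<iota>V w) = act_vert (inv\<^bsub>PGL2\<^esub> g) (act_vert g (\<iota>V v))"
    using act_mult[OF a.inv_closed[OF \<Gamma>P[OF g]] \<Gamma>P[OF h] \<iota>V_verts[OF w]] eq by simp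
  also have "\<dots> = \<iota>V v" by (rule act_inv(1)[OF \<Gamma>P[OF g] \<iota>V_verts[OF v]])
  finally have e: "act_vert (inv\<^bsub>PGL2\<^esub> g \<otimes>\<^bsub>PGL2\<^esub> h) (\<iota>V w) = \<iota>V v" .
  show "v = w" by (rule a.stabilizer(1)[OF k v w e])
  show "inv\<^bsub>PGL2\<^esub> g \<otimes>\<^bsub>PGL2\<^esub> h \<in> a.\<G> v" by (rule a.stabilizer(2)[OF k v w e])
qed

text \<open>The star of a translate of \<open>\<iota>V v\<close> in \<open>VS\<close> is swept out
  by the group of \<open>v\<close> from the edges of \<open>T\<close> at \<open>v\<close>.\<close>

lemma over_neighbour:
  assumes h: "h \<in> \<Gamma>" and v: "v \<in> verts T" and y: "y \<in> VS" and adj: "adjacent BT (act_vert h (\<iota>V v)) y"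
  shows "\<exists>c. adjacent T v c \<and> (\<exists>g\<in>a.\<G> v. y = act_vert h (act_vert g (\<iota>V c)))"
proof -
  obtain k v' c where k: "k \<in> \<Gamma>" "adjacent T v' c" "act_vert h (\<iota>V v) = act_vert k (\<iota>V v')"
    "y = act_vert k (\<iota>V c)" using lift_adjacent[OF VS_I[OF h v] y adj] by (elim bexE exE conjE)
  have v': "v' \<in> verts T" "c \<in> verts T" using k(2) adjacent_verts[OF a.wf_T] by blast+
  have eq: "v = v'" by (rule over_unique(1)[OF v v'(1) h k(1,3)])
  let ?g = "inv\<^bsub>PGL2\<^esub> h \<otimes>\<^bsub>PGL2\<^esub> k"
  have g: "?g \<in> a.\<G> v" by (rule over_unique(2)[OF v v'(1) h k(1,3)])
  have "h \<otimes>\<^bsub>PGL2\<^esub> ?g = k" using h k(1) \<Gamma>P by (simp add: a.m_assoc[symmetric])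
  then have "y = act_vert h (act_vert ?g (\<iota>V c))"
    using act_mult[OF \<Gamma>P[OF h] \<Gamma>P[OF \<Gamma>_mult[OF \<Gamma>_inv[OF h] k(1)]] \<iota>V_verts[OF v'(2)]] k(4) by simp
  then show ?thesis using g k(2) eq by blast
qed

text \<open>Orients the edges outside \<open>T'\<close> towards it, expressed without distances: no
  vertex of \<open>T'\<close> lies behind \<open>v\<close>.\<close>

definition toward :: "'v \<Rightarrow> 'v \<Rightarrow> bool" where
  "toward v w \<longleftrightarrow> adjacent T v w \<and> a.t.branch v w \<inter> verts T' = {}"

lemma toward_verts: "toward v w \<Longrightarrow> v \<in> verts T \<and> w \<in> verts T \<and> v \<notin> verts T'"
  using adjacent_verts[OF a.wf_T, of v w] a.t.branch_self[of v w] a.t.adj_irrefl[of v]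
  by (cases "v = w") (auto simp: toward_def)

lemma toward_step: "toward v w \<Longrightarrow> adjacent T v c \<Longrightarrow> c \<noteq> w \<Longrightarrow> toward c v"
  using a.t.branch_mono[of c v w] a.t.adj_sym[of v c] unfolding toward_def by blast

definition toward_rel :: "(('v \<times> 'v) \<times> ('v \<times> 'v)) set" where
  "toward_rel = {((c, v), (v', w)). v' = v \<and> toward c v \<and> toward v w \<and> c \<noteq> w}"

text \<open>Smaller pairs are farther from \<open>T'\<close>, so the distance gives no induction. An
  infinite descent runs away from \<open>T'\<close> without backtracking; it is a half-line of
  \<open>T\<close> outside \<open>T'\<close>, which \<open>ray_eventually_limit\<close>
  forbids.\<close>

lemma wf_toward: "wf toward_rel"
  unfolding wf_iff_no_infinite_down_chain
proof
  assume "\<exists>f. \<forall>i. (f (Suc i), f i) \<in> toward_rel"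
  then obtain f where f: "\<And>i. (f (Suc i), f i) \<in> toward_rel" by blast
  define r where "r n = snd (f n)" for n
  have fst: "fst (f n) = r (Suc n)" and tow: "toward (r (Suc n)) (r n)"
    and ne: "r (Suc (Suc n)) \<noteq> r n" for n
    using f[of n] f[of "Suc n"]
    by (cases "f n"; cases "f (Suc n)"; cases "f (Suc (Suc n))"; simp add: toward_rel_def r_def)+
  have adj: "adjacent T (r n) (r (Suc n))" for n
    using tow[of n] a.t.adj_sym by (simp add: toward_def)
  have dist: "distinct (map r [0..<k])" for k
  proof (rule a.t.nb_walk_distinct)
    show "successively (adjacent T) (map r [0..<k])"
      using adj by (simp add: successively_conv_nth)
    show "nb (map r [0..<k])" using ne[symmetric] by (simp add: nb_conv_nth)
  qed
  have "inj r"
  proof (rule injI)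
    fix m n assume eq: "r m = r n"
    have inj: "inj_on r (set [0..<Suc (m + n)])" using dist[of "Suc (m + n)"] unfolding distinct_map by (rule conjunct2)
    show "m = n" by (rule inj_onD[OF inj eq]) (simp_all del: upt_Suc)
  qed
  moreover have "r n \<in> verts T" for n using tow[of n] toward_verts by blast
  ultimately have "half_line T r" using adj by (auto simp: half_line_def)
  then obtain N where "\<And>n. n \<ge> N \<Longrightarrow> r n \<in> verts T'" using ray_eventually_limit by blast
  then have "r (Suc N) \<in> verts T'" by simp
  then show False using tow[of N] toward_verts by blast
qed

lemma limit_over: "h \<in> \<Gamma> \<Longrightarrow> v \<in> verts T \<Longrightarrow> act_vert h (\<iota>V v) \<in> verts LT \<Longrightarrow> v \<in> verts T'"
  using invariant_subgraph.S_act[OF limit_invariant \<Gamma>_inv, of h "act_vert h (\<iota>V v)"]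
    act_inv(1)[OF \<Gamma>P \<iota>V_verts, of h v] by (simp add: T'_eq(1))

text \<open>
  By the second statement a geodesic that enters the part lying over the branch of \<open>v\<close> never returns
  to the tree of \<open>\<Gamma>\<close>.  The two statements need each other: a geodesic from \<open>\<iota>V v\<close> to a mirror cannot
  start towards an earlier vertex, hence it starts over \<open>w\<close>, and the resulting inclusion of the
  groups implies that \<open>\<iota>V v\<close> has just one neighbour over \<open>w\<close>.
\<close>

lemma toward_decreasing:
  assumes "toward v w"
  shows "a.\<G> v \<subseteq> a.\<G> w \<and>
    (\<forall>x y xs. successively (adjacent BT) (x # y # xs) \<and> nb (x # y # xs) \<and> set (x # y # xs) \<subseteq> VS \<and>
       over w x \<and> over v y \<longrightarrow> last (y # xs) \<notin> verts LT)"
  using assms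
proof (induction "(v, w)" arbitrary: v w rule: wf_induct_rule[OF wf_toward])
  case (1 v w)
  have vT: "v \<in> verts T" "w \<in> verts T" "v \<notin> verts T'" using toward_verts[OF 1(2)] by blast+
  have vw: "adjacent T v w" using 1(2) by (simp add: toward_def)
  \<comment> \<open>Every neighbour of \<open>v\<close> other than \<open>w\<close> points to
    \<open>v\<close>, so the induction hypothesis confines geodesics that step from over
    \<open>v\<close> to over such a neighbour.\<close>
  have IH: "last (y # xs) \<notin> verts LT" if c: "adjacent T v c" "c \<noteq> w"
    and x: "successively (adjacent BT) (x # y # xs)" "nb (x # y # xs)" "set (x # y # xs) \<subseteq> VS" "over v x" "over c y"
    for c x y xs
  proof -
    have t: "toward c v" by (rule toward_step[OF 1(2) c])
    have "((c, v), (v, w)) \<in> toward_rel" using t 1(2) c(2) by (simp add: toward_rel_def)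
    from conjunct2[OF 1(1)[OF this t]] show ?thesis using x by blast
  qed
  interpret Gv: group "PGL2\<lparr>carrier := a.\<G> v\<rparr>"
    by (rule subgroup.subgroup_is_group[OF a.\<G>_subgroup[OF vT(1)] group_PGL2])
  \<comment> \<open>The geodesic from \<open>\<iota>V v\<close> to the mirror of
    \<open>\<gamma>\<close> is fixed by \<open>\<gamma>\<close> and ends in the limit tree. By
    \<open>IH\<close> its first step goes to a translate of \<open>\<iota>V w\<close> by some
    \<open>g\<close> in the group of \<open>v\<close>, so the conjugate of \<open>\<gamma>\<close>
    by the inverse of \<open>g\<close> fixes \<open>\<iota>V w\<close>.\<close>
  have conj: "\<exists>g\<in>a.\<G> v. cj (inv\<^bsub>PGL2\<^esub> g) \<gamma> \<in> a.\<G> w" if \<gamma>: "\<gamma> \<in> a.\<G> v" for \<gamma>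
  proof (cases "\<gamma> = \<one>\<^bsub>PGL2\<^esub>")
    case True
    have "cj (inv\<^bsub>PGL2\<^esub> \<one>\<^bsub>PGL2\<^esub>) \<gamma> = \<one>\<^bsub>PGL2\<^esub>" using True by simp
    then show ?thesis using subgroup.one_closed[OF a.\<G>_subgroup[OF vT(1)]] subgroup.one_closed[OF a.\<G>_subgroup[OF vT(2)]]
      by (intro bexI[of _ "\<one>\<^bsub>PGL2\<^esub>"]) simp_all
  next
    case False
    have \<gamma>\<Gamma>: "\<gamma> \<in> \<Gamma>" by (rule subsetD[OF a.\<G>_\<Gamma>[OF vT(1)] \<gamma>])
    have \<gamma>P: "\<gamma> \<in> carrier PGL2" by (rule \<Gamma>P[OF \<gamma>\<Gamma>])
    obtain P where P: "elliptic_frame \<gamma> P" using vertex_group_axis[OF vT(1) \<gamma> False] by blast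
    obtain y where y: "y \<in> axis P" by (auto simp: axis_def)
    have yL: "y \<in> verts LT" by (rule subsetD[OF frame_L(3)[OF \<gamma>\<Gamma> False P] y])
    have yVS: "y \<in> VS" by (rule subsetD[OF limit_VS yL])
    obtain p where p: "bt.geo p (\<iota>V v) y" using bt.geo_exists[OF \<iota>V_verts[OF vT(1)] subsetD[OF VS_verts yVS]] by blast
    have pfix: "act_vert \<gamma> z = z" if "z \<in> set p" for z
      by (rule bt.geo_fixed[OF p a.vertex_fixes[OF vT(1) \<gamma>] elliptic_frame_fixes[OF P y]
            act_verts[OF \<gamma>P] act_adj[OF \<gamma>P] act_inj[OF \<gamma>P] that])
    have pVS: "set p \<subseteq> VS" by (rule bt.convex_geo[OF VS_convex \<iota>_VS[OF vT(1)] yVS p])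
    have "\<iota>V v \<noteq> y" using yL vT by (auto simp: T'_eq(1))
    then obtain x1 xs where pc: "p = \<iota>V v # x1 # xs"
      using p by (cases p; cases "tl p") (auto simp: bt.geo_def bt.walk_def)
    have px: "successively (adjacent BT) (\<iota>V v # x1 # xs)" "nb (\<iota>V v # x1 # xs)" "last (x1 # xs) = y"
      using p unfolding pc by (auto simp: bt.geo_def bt.walk_def)
    have one: "act_vert \<one>\<^bsub>PGL2\<^esub> (\<iota>V v) = \<iota>V v" by (rule act_one[OF \<iota>V_verts[OF vT(1)]])
    have x1: "x1 \<in> VS" "adjacent BT (\<iota>V v) x1" using pVS pc px by auto
    then have "adjacent BT (act_vert \<one>\<^bsub>PGL2\<^esub> (\<iota>V v)) x1" using one by simp
    from over_neighbour[OF \<Gamma>_one vT(1) x1(1) this]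
    obtain c g where c: "adjacent T v c" and g: "g \<in> a.\<G> v" and x1g: "x1 = act_vert \<one>\<^bsub>PGL2\<^esub> (act_vert g (\<iota>V c))"
      by (elim exE conjE bexE)
    have cT: "c \<in> verts T" using c adjacent_verts[OF a.wf_T] by blast
    have g\<Gamma>: "g \<in> \<Gamma>" by (rule subsetD[OF a.\<G>_\<Gamma>[OF vT(1)] g])
    have x1e: "x1 = act_vert g (\<iota>V c)"
      using x1g act_one[OF act_verts[OF \<Gamma>P[OF g\<Gamma>] \<iota>V_verts[OF cT]]] by simp
    have "over v (\<iota>V v)" unfolding over_def by (rule bexI[OF _ \<Gamma>_one]) (rule one[symmetric])
    moreover have "over c x1" unfolding over_def by (intro bexI[of _ g] x1e g\<Gamma>)
    ultimately have "c = w" using IH[OF c _ px(1,2) pVS[unfolded pc]] px(3) yL by blast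
    moreover have "act_vert \<gamma> (act_vert g (\<iota>V c)) = act_vert g (\<iota>V c)"
      using pfix[of x1] pc x1e by simp
    ultimately have "cj (inv\<^bsub>PGL2\<^esub> g) \<gamma> \<in> a.\<G> w" using cj_\<G>[OF \<gamma>\<Gamma> g\<Gamma> vT(2)] by simp
    then show ?thesis using g by blast
  qed
  have inv: "inv\<^bsub>PGL2\<lparr>carrier := a.\<G> v\<rparr>\<^esub> g = inv\<^bsub>PGL2\<^esub> g" if "g \<in> a.\<G> v" for g
    using a.m_inv_consistent[OF a.\<G>_subgroup[OF vT(1)] that] .
  have "a.\<G> v \<inter> a.\<G> w = carrier (PGL2\<lparr>carrier := a.\<G> v\<rparr>)"
  proof (rule conjugate_cover)
    show "group (PGL2\<lparr>carrier := a.\<G> v\<rparr>)" by (rule Gv.is_group)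
    show "finite (carrier (PGL2\<lparr>carrier := a.\<G> v\<rparr>))" using a.vgrp_finite[OF vT(1)] by simp
    have sub: "subgroup (a.\<G> v \<inter> a.\<G> w) PGL2"
      by (rule a.subgroups_Inter_pair[OF a.\<G>_subgroup[OF vT(1)] a.\<G>_subgroup[OF vT(2)]])
    show "subgroup (a.\<G> v \<inter> a.\<G> w) (PGL2\<lparr>carrier := a.\<G> v\<rparr>)"
      using a.subgroup_incl[OF sub a.\<G>_subgroup[OF vT(1)]] by simp
    fix \<gamma> assume "\<gamma> \<in> carrier (PGL2\<lparr>carrier := a.\<G> v\<rparr>)"
    then have \<gamma>: "\<gamma> \<in> a.\<G> v" by simp
    from conj[OF this] obtain g where g: "g \<in> a.\<G> v" "cj (inv\<^bsub>PGL2\<^esub> g) \<gamma> \<in> a.\<G> w" by (elim bexE)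
    have gP: "g \<in> carrier PGL2" by (rule subsetD[OF a.\<G>_carrier[OF vT(1)] g(1)])
    have "inv\<^bsub>PGL2\<^esub> g \<otimes>\<^bsub>PGL2\<^esub> \<gamma> \<otimes>\<^bsub>PGL2\<^esub> g \<in> a.\<G> w" using g(2) gP by simp
    moreover have "inv\<^bsub>PGL2\<^esub> g \<otimes>\<^bsub>PGL2\<^esub> \<gamma> \<otimes>\<^bsub>PGL2\<^esub> g \<in> a.\<G> v"
      using subgroup.m_closed[OF a.\<G>_subgroup[OF vT(1)]] subgroup.m_inv_closed[OF a.\<G>_subgroup[OF vT(1)]] \<gamma> g(1) by simp
    ultimately show "\<exists>g\<in>carrier (PGL2\<lparr>carrier := a.\<G> v\<rparr>).
        inv\<^bsub>PGL2\<lparr>carrier := a.\<G> v\<rparr>\<^esub> g \<otimes>\<^bsub>PGL2\<lparr>carrier := a.\<G> v\<rparr>\<^esub> \<gamma> \<otimes>\<^bsub>PGL2\<lparr>carrier := a.\<G> v\<rparr>\<^esub> g \<in> a.\<G> v \<inter> a.\<G> w"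
      using inv[OF g(1)] g(1) by (intro bexI[of _ g]) simp_all
  qed
  then have incl: "a.\<G> v \<subseteq> a.\<G> w" by auto
  \<comment> \<open>By \<open>incl\<close> the group of \<open>v\<close> fixes
    \<open>\<iota>V w\<close>, so \<open>y\<close> has a single neighbour over \<open>w\<close>,
    namely \<open>x\<close>. A geodesic coming from \<open>x\<close> therefore continues over a
    neighbour of \<open>v\<close> other than \<open>w\<close>, where \<open>IH\<close> takes
    over.\<close>
  have "last (y # xs) \<notin> verts LT"
    if x: "successively (adjacent BT) (x # y # xs)" "nb (x # y # xs)" "set (x # y # xs) \<subseteq> VS" "over w x" "over v y"
    for x y xs
  proof -
    obtain h where h: "h \<in> \<Gamma>" "y = act_vert h (\<iota>V v)" using x(5) by (auto simp: over_def)
    show ?thesis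
    proof (cases xs)
      case Nil
      then show ?thesis using limit_over[OF h(1) vT(1)] h(2) vT(3) by auto
    next
      case (Cons z zs)
      have fixw: "act_vert g (\<iota>V w) = \<iota>V w" if "g \<in> a.\<G> v" for g
        by (rule a.vertex_fixes[OF vT(2) subsetD[OF incl that]])
      have xV: "x \<in> VS" "adjacent BT (act_vert h (\<iota>V v)) x" using x h bt.adj_sym by auto
      from over_neighbour[OF h(1) vT(1) xV]
      obtain c0 g0 where c0: "adjacent T v c0" and g0: "g0 \<in> a.\<G> v" and x0: "x = act_vert h (act_vert g0 (\<iota>V c0))"
        by (elim exE conjE bexE)
      have zV: "z \<in> VS" "adjacent BT (act_vert h (\<iota>V v)) z" using x h Cons by auto
      from over_neighbour[OF h(1) vT(1) zV]
      obtain c g where c: "adjacent T v c" and g: "g \<in> a.\<G> v" and z: "z = act_vert h (act_vert g (\<iota>V c))"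
        by (elim exE conjE bexE)
      have cT: "c0 \<in> verts T" "c \<in> verts T" using c c0 adjacent_verts[OF a.wf_T] by blast+
      have g\<Gamma>: "g0 \<in> \<Gamma>" "g \<in> \<Gamma>" using subsetD[OF a.\<G>_\<Gamma>[OF vT(1)]] g g0 by blast+
      have x0': "x = act_vert (h \<otimes>\<^bsub>PGL2\<^esub> g0) (\<iota>V c0)" "z = act_vert (h \<otimes>\<^bsub>PGL2\<^esub> g) (\<iota>V c)"
        using act_mult[OF \<Gamma>P[OF h(1)] \<Gamma>P[OF g\<Gamma>(1)] \<iota>V_verts[OF cT(1)]]
          act_mult[OF \<Gamma>P[OF h(1)] \<Gamma>P[OF g\<Gamma>(2)] \<iota>V_verts[OF cT(2)]] x0 z by simp_all
      obtain k where k: "k \<in> \<Gamma>" "x = act_vert k (\<iota>V w)" using x(4) by (auto simp: over_def)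
      have "w = c0"
        by (rule over_unique(1)[OF vT(2) cT(1) k(1) \<Gamma>_mult[OF h(1) g\<Gamma>(1)]]) (use k(2) x0'(1) in simp)
      then have xw: "x = act_vert h (\<iota>V w)" using x0 fixw[OF g0] by simp
      have "c \<noteq> w"
      proof
        assume "c = w"
        then have "z = x" using z fixw[OF g] xw by simp
        then show False using x(2) Cons by simp
      qed
      moreover have "over c z" unfolding over_def by (intro bexI[of _ "h \<otimes>\<^bsub>PGL2\<^esub> g"] x0'(2) \<Gamma>_mult h(1) g\<Gamma>(2))
      moreover have "successively (adjacent BT) (y # z # zs)" "nb (y # z # zs)" "set (y # z # zs) \<subseteq> VS"
        using x(1-3) Cons by auto
      ultimately have "last (z # zs) \<notin> verts LT" using IH[OF c] x(5) by blast
      then show ?thesis using Cons by simp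
    qed
  qed
  then show ?case using incl by blast
qed

text \<open>A shortest path meets \<open>T'\<close> only in its last vertex, so its tails are gates.
  A vertex of \<open>T'\<close> behind \<open>p ! i\<close> would have its geodesic from
  \<open>p ! i\<close> start with such a tail and hence pass through
  \<open>p ! Suc i\<close>.\<close>

lemma path_toward:
  assumes p: "vpath T p" "last p \<in> verts T'"
    and min: "\<And>q. vpath T q \<Longrightarrow> hd q = hd p \<Longrightarrow> last q \<in> verts T' \<Longrightarrow> length p \<le> length q"
    and i: "Suc i < length p"
  shows "toward (p ! i) (p ! Suc i)"
proof -
  have walkd: "a.t.walk (drop i p) (p ! i) (last p)"
    using p(1) i set_drop_subset[of i p] successively_append_iff[of "adjacent T" "take i p" "drop i p"]
    by (auto simp: a.t.walk_def vpath_def hd_drop_conv_nth)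
  have geo: "a.t.geo (drop i p) (p ! i) (last p)"
    using walkd p(1) nb_distinct[of "drop i p"] by (simp add: a.t.geo_def vpath_def)
  have out: "p ! j \<notin> verts T'" if "Suc j < length p" for j
  proof
    assume "p ! j \<in> verts T'"
    have 1: "vpath T (take (Suc j) p)"
      using p(1) that set_take_subset[of "Suc j" p]
        successively_append_iff[of "adjacent T" "take (Suc j) p" "drop (Suc j) p"]
      by (auto simp: vpath_def)
    have 2: "hd (take (Suc j) p) = hd p" by simp
    have "last (take (Suc j) p) = p ! j" using that by (simp add: take_Suc_conv_app_nth)
    then have "length p \<le> length (take (Suc j) p)" using min[OF 1 2] \<open>p ! j \<in> verts T'\<close> by simp
    then show False using that by simp
  qed
  have "set (butlast (drop i p)) \<inter> verts T' = {}"
    using out by (auto simp: in_set_conv_nth nth_butlast)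
  then have gate: "a.t.gate (verts T') (drop i p) (p ! i) (last p)"
    using geo p(2) by (simp add: a.t.gate_def)
  have "x \<notin> verts T'" if x: "x \<in> a.t.branch (p ! i) (p ! Suc i)" for x
  proof
    assume xT: "x \<in> verts T'"
    obtain w where w: "a.t.walk w (p ! i) x" "p ! Suc i \<notin> set w" using x by (auto simp: a.t.branch_def)
    obtain q where q: "a.t.geo q (p ! i) x" using a.t.geo_exists[OF a.t.walkD(1,2)[OF w(1)]] by blast
    obtain r where "q = drop i p @ r" using a.t.gate_prefix[OF gate T'_convex xT q] by blast
    moreover have "p ! Suc i \<in> set (drop i p)" using i by (auto simp: in_set_conv_nth intro!: exI[of _ 1])
    ultimately show False using a.t.geo_subset_walk[OF q w(1)] w(2) by auto
  qed
  moreover have "adjacent T (p ! i) (p ! Suc i)"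
    using p(1) i by (auto simp: vpath_def successively_conv_nth)
  ultimately show ?thesis by (auto simp: toward_def)
qed

section \<open>Comparison of vertex groups inside the amalgams\<close>

lemma amalgam_vgrp_mono:
  assumes v: "v \<in> verts T" and w: "w \<in> verts T" and sub: "a.\<G> v \<subseteq> a.\<G> w"
  shows "amalgam_vgrp TG v \<subseteq> amalgam_vgrp TG w"
proof
  fix X assume "X \<in> amalgam_vgrp TG v"
  then obtain g where g: "g \<in> carrier (vgrp TG v)" "X = amalgam_class TG [(v, g)]" by (auto simp: amalgam_vgrp_def)
  have "\<theta> v g \<in> a.\<G> w" using sub g(1) by blast
  then obtain k where k: "k \<in> carrier (vgrp TG w)" "\<theta> v g = \<theta> w k" by (elim imageE)
  have l: "[(v, g)] \<in> lists (letters TG)" "[(w, k)] \<in> lists (letters TG)"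
    using v w g(1) k(1) by (auto simp: letters_def)
  have "amalgam_class TG [(v, g)] = amalgam_class TG [(w, k)]"
    unfolding a.amalgam_class_eq[OF l(1)] a.amalgam_class_eq[OF l(2)] by (simp add: k(2))
  then show "X \<in> amalgam_vgrp TG w" using g(2) k(1) by (auto simp: amalgam_vgrp_def)
qed

text \<open>By the inclusion \<open>g\<close> fixes both extremities of the edge between
  \<open>v\<close> and \<open>w\<close>, so it lies in the edge group. As the edge homomorphisms are
  inclusions, a single edge relation identifies the letters \<open>(v, g)\<close> and
  \<open>(w, g)\<close>.\<close>

lemma amalgam_vgrp_induced_mono:
  assumes vw: "adjacent T v w" and sub: "a.\<G> v \<subseteq> a.\<G> w"
  shows "amalgam_vgrp (induced_groups \<Gamma> T \<iota>V \<iota>E) v \<subseteq> amalgam_vgrp (induced_groups \<Gamma> T \<iota>V \<iota>E) w"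
proof
  let ?G = "induced_groups \<Gamma> T \<iota>V \<iota>E"
  have vT: "v \<in> verts T" "w \<in> verts T" using vw adjacent_verts[OF a.wf_T] by blast+
  have carr: "carrier (vgrp ?G u) = a.\<G> u" if "u \<in> verts T" for u
    using vert_stabilizer_eq[OF that] by (simp add: induced_groups_def sub_PGL2_def)
  fix X assume "X \<in> amalgam_vgrp ?G v"
  then obtain g where g: "g \<in> a.\<G> v" "X = amalgam_class ?G [(v, g)]"
    unfolding amalgam_vgrp_def carr[OF vT(1)] by (rule imageE) (rule that)
  have gw: "g \<in> a.\<G> w" by (rule subsetD[OF sub g(1)])
  obtain e where e: "e \<in> edges T" "extr T e = {v, w}" using vw by (auto simp: adjacent_def)
  have "g \<in> edge_stabilizer \<Gamma> (\<iota>E e)"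
    using \<iota>E_extr[OF e] subsetD[OF a.\<G>_\<Gamma>[OF vT(1)] g(1)] a.vertex_fixes[OF vT(1) g(1)] a.vertex_fixes[OF vT(2) gw]
    by (simp add: edge_stabilizer_def)
  then have "amalgam_eq ?G ([] @ [(v, einj ?G e v g)] @ []) ([] @ [(w, einj ?G e w g)] @ [])"
    using e by (intro amalgam_eq.edge) (auto simp: induced_groups_def sub_PGL2_def)
  then have eq: "amalgam_eq ?G [(v, g)] [(w, g)]" by (simp add: induced_groups_def)
  have "amalgam_class ?G [(v, g)] = amalgam_class ?G [(w, g)]"
    unfolding amalgam_class_def using amalgam_eq.trans[OF eq] amalgam_eq.trans[OF amalgam_eq.sym[OF eq]] by blast
  then show "X \<in> amalgam_vgrp ?G w" unfolding amalgam_vgrp_def carr[OF vT(2)] using g(2) gw by blast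
qed

lemma equal_groups_T': "equal_via \<theta> (restrict_groups TG T') (induced_groups \<Gamma> T' \<iota>V \<iota>E)"
  using invariant_subgraph.T'_in[OF limit_invariant]
  by (intro equal_via_restrict[OF equal_groups] subsetI)

lemma contraction_TG: "contraction (restrict_groups TG T') TG"
  unfolding contraction_def
proof (intro conjI allI impI)
  show "subtree (base (restrict_groups TG T')) T" using T'_subtree by (simp add: restrict_groups_def)
  show "bij_betw (ends_map T id) (Ends (base (restrict_groups TG T'))) (Ends T)"
    using ends_T' by (simp add: restrict_groups_def)
  fix p i
  assume p: "vpath T p \<and> hd p \<notin> verts (base (restrict_groups TG T')) \<and> last p \<in> verts (base (restrict_groups TG T')) \<and>
        (\<forall>q. vpath T q \<and> hd q = hd p \<and> last q \<in> verts (base (restrict_groups TG T')) \<longrightarrow> length p \<le> length q)"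
    and i: "Suc i < length p"
  have t: "toward (p ! i) (p ! Suc i)"
    by (rule path_toward[OF _ _ _ i]) (use p in \<open>simp_all add: restrict_groups_def\<close>)
  show "amalgam_vgrp TG (p ! i) \<subseteq> amalgam_vgrp TG (p ! Suc i)"
    using amalgam_vgrp_mono toward_verts[OF t] conjunct1[OF toward_decreasing[OF t]] by blast
qed (simp add: restrict_groups_def)

lemma contraction_induced:
  "contraction (induced_groups \<Gamma> T' \<iota>V \<iota>E) (induced_groups \<Gamma> T \<iota>V \<iota>E)"
  unfolding contraction_def
proof (intro conjI allI impI)
  let ?G = "induced_groups \<Gamma> T \<iota>V \<iota>E" and ?G' = "induced_groups \<Gamma> T' \<iota>V \<iota>E"
  have b: "base ?G = T" "base ?G' = T'" by (simp_all add: induced_groups_def)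
  show "?G' = restrict_groups ?G (base ?G')" by (simp add: induced_groups_def restrict_groups_def)
  show "subtree (base ?G') (base ?G)" using T'_subtree by (simp add: b)
  show "bij_betw (ends_map (base ?G) id) (Ends (base ?G')) (Ends (base ?G))" using ends_T' by (simp add: b)
  fix p i
  assume p: "vpath (base ?G) p \<and> hd p \<notin> verts (base ?G') \<and> last p \<in> verts (base ?G') \<and>
        (\<forall>q. vpath (base ?G) q \<and> hd q = hd p \<and> last q \<in> verts (base ?G') \<longrightarrow> length p \<le> length q)"
    and i: "Suc i < length p"
  have t: "toward (p ! i) (p ! Suc i)"
    by (rule path_toward[OF _ _ _ i]) (use p in \<open>simp_all add: b\<close>)
  show "amalgam_vgrp ?G (p ! i) \<subseteq> amalgam_vgrp ?G (p ! Suc i)"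
    using amalgam_vgrp_induced_mono[OF _ conjunct1[OF toward_decreasing[OF t]]] t by (simp add: toward_def)
qed

end

theorem theorem3p6:
  fixes p :: nat
    and nrm :: "'k::field_char_0 \<Rightarrow> real"
    and TG :: "('v, 'e, 'g, 'h) graph_of_groups"
    and \<iota>V :: "'v \<Rightarrow> 'k bt_vertex"
    and \<iota>E :: "'e \<Rightarrow> 'k bt_edge"
    and \<theta> :: "'v \<Rightarrow> 'g \<Rightarrow> 'k pgl"
    and T :: "('v, 'e) ugraph"
    and \<Gamma> :: "'k pgl set"
    and T_star :: "'k bt_graph"
  defines "T \<equiv> base TG"
    and "\<Gamma> \<equiv> generated_group TG \<theta>"
    and "T_star \<equiv> translates_graph nrm \<Gamma> T \<iota>V \<iota>E"
  assumes K: "finite_extension_of_Qp p nrm"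
    and K_large: "\<And>H g. \<lbrakk>H = \<Gamma> \<or> (\<exists>v\<in>verts T. H = vimg TG \<theta> v); discrete_subgroup nrm H;
        g \<in> H; g \<noteq> \<one>\<^bsub>PGL2\<^esub>\<rbrakk> \<Longrightarrow> rational_fixed_points g"
    and "star_admissible nrm TG"
    and "admissible_embedding nrm TG \<iota>V \<iota>E \<theta>"
  shows
    \<comment> \<open>(1)\<close>
    "finitely_generated (sub_PGL2 \<Gamma>) \<and> discrete_subgroup nrm \<Gamma> \<and>
     (\<exists>f\<in>iso (amalgam TG) (sub_PGL2 \<Gamma>).
        \<forall>v\<in>verts T. \<forall>g\<in>carrier (vgrp TG v). f (amalgam_class TG [(v, g)]) = \<theta> v g) \<and>
     (\<exists>\<Phi>V \<Phi>E.
     \<comment> \<open>(2)\<close>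
     subtree T_star (BT_tree nrm) \<and>
     graph_iso (quotient_graph \<Gamma> T_star) T \<Phi>V \<Phi>E \<and>
     \<comment> \<open>(3)\<close>
     is_section \<Gamma> T_star T \<Phi>V \<Phi>E \<iota>V \<iota>E \<and>
     equal_via \<theta> TG (induced_groups \<Gamma> T \<iota>V \<iota>E) \<and>
     \<comment> \<open>the inclusion of the tree of \<open>\<Gamma>\<close>, and the induced inclusion of quotients\<close>
     subgraph (limit_tree nrm \<Gamma>) T_star \<and>
     graph_embedding (quotient_graph \<Gamma> (limit_tree nrm \<Gamma>)) T \<Phi>V \<Phi>E \<and>
     \<comment> \<open>(4)\<close>
     bij_betw (ends_map T \<Phi>V) (Ends (quotient_graph \<Gamma> (limit_tree nrm \<Gamma>))) (Ends T) \<and>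
     (let T' = image_graph (quotient_graph \<Gamma> (limit_tree nrm \<Gamma>)) T \<Phi>V \<Phi>E in
        \<comment> \<open>(5)\<close>
        is_section \<Gamma> (limit_tree nrm \<Gamma>) T' \<Phi>V \<Phi>E \<iota>V \<iota>E \<and>
        induced_groups \<Gamma> T' \<iota>V \<iota>E = restrict_groups (induced_groups \<Gamma> T \<iota>V \<iota>E) T' \<and>
        equal_via \<theta> (restrict_groups TG T') (induced_groups \<Gamma> T' \<iota>V \<iota>E) \<and>
        \<comment> \<open>(6)\<close>
        contraction (induced_groups \<Gamma> T' \<iota>V \<iota>E) (induced_groups \<Gamma> T \<iota>V \<iota>E) \<and>
        contraction (restrict_groups TG T') TG))"
proof -
  obtain \<pi> where \<pi>: "dvf nrm \<pi>" using dvf_exists[OF K] by blast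
  have adm: "admissible_tree nrm \<pi> TG \<iota>V \<iota>E \<theta>"
  proof (rule admissible_tree.intro[OF \<pi>], rule admissible_tree_axioms.intro)
    fix g assume "discrete_subgroup nrm (generated_group TG \<theta>)" "g \<in> generated_group TG \<theta>" "g \<noteq> \<one>\<^bsub>PGL2\<^esub>"
    then show "rational_fixed_points g" by (rule K_large[unfolded \<Gamma>_def, OF disjI1[OF HOL.refl]])
  qed (rule assms(6,7))+
  note i = admissible_tree.limit_invariant[OF adm] and s = admissible_tree.T_star_invariant[OF adm]
  note \<Gamma>_eq = admissible_tree.generated_group_eq[OF adm, folded \<Gamma>_def, symmetric]
  note fold = \<Gamma>_eq T_def[symmetric]
  \<comment> \<open>The subtree of \<open>T\<close> below the limit tree; \<open>image\<close>
    identifies it with the image of the quotient that occurs in the statement.\<close>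
  let ?T' = "invariant_subgraph.T' TG \<iota>V \<iota>E (limit_tree nrm \<Gamma>)"
  note star_T' = admissible_tree.T_star_T'[OF adm, unfolded fold]
  note image = invariant_subgraph.image_eq[OF i, unfolded fold]
  have "induced_groups \<Gamma> ?T' \<iota>V \<iota>E = restrict_groups (induced_groups \<Gamma> T \<iota>V \<iota>E) ?T'"
    by (simp add: induced_groups_def restrict_groups_def)
  moreover note admissible_tree.fin_gen[OF adm, unfolded fold] admissible_tree.discrete[OF adm, unfolded fold]
    admissible_tree.amalgam_iso[OF adm, unfolded fold] admissible_tree.T_star_subtree[OF adm, unfolded fold]
    invariant_subgraph.quotient_iso[OF s, unfolded fold star_T']
    invariant_subgraph.section_T'[OF s, unfolded fold star_T']
    admissible_tree.equal_groups[OF adm, unfolded fold] admissible_tree.limit_subgraph[OF adm, unfolded fold]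
    invariant_subgraph.quotient_embedding[OF i, unfolded fold]
    admissible_tree.ends_quotient[OF adm, unfolded fold]
    invariant_subgraph.section_T'[OF i, unfolded fold]
    admissible_tree.equal_groups_T'[OF adm, unfolded fold]
    admissible_tree.contraction_induced[OF adm, unfolded fold]
    admissible_tree.contraction_TG[OF adm, unfolded fold]
  ultimately show ?thesis
    unfolding T_star_def
    by (intro conjI exI[of _ "admissible_tree.\<Phi>V TG \<iota>V"] exI[of _ "admissible_tree.\<Phi>E TG \<iota>E"])
      (simp_all add: image)
qed

end
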